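(* Let $p$ be a prime, $K$ an algebraically closed field of characteristic $p$, and $n\ge d=p^m$ with $m\ge 1$. Then the representation ring $r(KZ_n/J^d)$ is isomorphic to the quotient ring $\mathbb Z[y,z,w_1,\dots,w_{m-1}]/I$, where $I$ is the ideal generated by the polynomials $g_0,g_1,\dots,g_m$ defined in the context; the isomorphism is induced by the ring epimorphism $$\phi:\mathbb Z[y,z,w_1,\dots,w_{m-1}]\to r(KZ_n/J^d)$$ with $\phi(1)=[M(1,\overline 0)]$, $\phi(y)=[M(1,\overline 1)]$, $\phi(z)=[M(2,\overline 0)]$ and $\phi(w_l)=[M(p^l+1,\overline 0)]$ for $1\le l\le m-1$.
   Context: $Z_n$ is the oriented cycle with vertices $v_{\overline 0},\dots,v_{\overline{n-1}}$ (indexed by $\mathbb Z/n\mathbb Z$) and arrows $\alpha_{\overline i}:v_{\overline i}\to v_{\overline{i+1}}$; $KZ_n$ is its path algebra, with paths composed from right to left, and $J$ is the ideal generated by all arrows. $H=KZ_n/J^d$ is a cocommutative Hopf algebra with (induced) structure $\Delta(v_h)=\sum_{g_1+g_2=h}v_{g_1}\otimes v_{g_2}$, $\Delta(\alpha_h)=\sum_{g_1+g_2=h}(\alpha_{g_1}\otimes v_{g_2}+v_{g_1}\otimes\alpha_{g_2})$, $\varepsilon(v_h)=\delta_{h,\overline 0}$, $\varepsilon(\alpha_h)=0$, $S(v_h)=v_{-h}$, $S(\alpha_h)=-\alpha_{-h-\overline 1}$. Modules are finitely generated left modules; $V\otimes W=V\otimes_KW$ with $H$ acting through $\Delta$. $P_{\overline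 j}=Hv_{\overline j}$ and $M(i,\overline j)=P_{\overline j}/{\rm rad}^iP_{\overline j}$ for $1\le i\le d$, $\overline j\in\mathbb Z/n\mathbb Z$; these are all the indecomposable $H$-modules up to isomorphism. The representation ring $r(H)$ is the abelian group generated by isomorphism classes of $H$-modules modulo $[V]+[W]=[V\oplus W]$, with multiplication $[V][W]=[V\otimes W]$ and identity $[M(1,\overline 0)]$. The polynomials $f_{u,\overline r}$. For $1\le u\le d$ define $f_{u,\overline 0}\in\mathbb Z[y,z,w_1,\dots,w_{m-1}]$ recursively: $f_{1,\overline 0}=1$, $f_{2,\overline 0}=z$, $f_{p^l+1,\overline 0}=w_l$ for $1\le l\le m-1$; if $u\ge 3$ and $u-1$ is not a power of $p$, choose $w$ with $1\le w\le u-2$ and $\binom{u-1}{w}\ne 0$ in $K$ (such $w$ exists); then $M(u-w,\overline 0)\otimes M(w+1,\overline 0)\cong M(u,\overline 0)\oplus\bigoplus_{s=2}^{t}M(i_s,\overline{j_s})$ with $1\le i_s,j_s\le u-2$, and $f_{u,\overline 0}=f_{u-w,\overline 0}f_{w+1,\overline 0}-\sum_{s=2}^{t}y^{j_s}f_{i_s,\overline 0}$. Put $f_{u,\overline r}=y^rf_{u,\overline 0}$ for $0\le r\le n-1$. (The choices of $w$ are fixed once and for all; $\phi(f_{u,\overline r})=[M(u,\overline r)]$.) The polynomials $g_0,\dots,g_m$. Let $a_1=1$, $a_2=z$, $a_k=za_{k-1}-ya_{k-2}$ for $k\ge 3$. Put $g_0=y^n-1$ and $g_1=(z-y-1)a_p$.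 For $1\le l\le m-1$ put $q=p^l$, $h_1=w_l$, $$h_{k+1}=w_lh_k-f_{(k+1)q-1,\overline 1}-\sum_{j=2}^{q-1}f_{kq,\overline j}-f_{(k-1)q+1,\overline q}\qquad(1\le k\le p-2),$$ and $$g_{l+1}=w_lh_{p-1}-f_{pq,\overline 0}-f_{pq,\overline 1}-\sum_{j=2}^{q-1}f_{(p-1)q,\overline j}-f_{(p-2)q+1,\overline q}.$$ (These encode, for $k=1,\dots,p-1$, the decompositions of $M(q+1,\overline 0)\otimes M(kq+1,\overline 0)$.) *)

theory Defs
  imports
    "HOL-Computational_Algebra.Polynomial"
    "HOL-Computational_Algebra.Primes"
    "HOL-Library.Poly_Mapping"
    "HOL-Algebra.Module"
    "HOL-Algebra.QuotRing"
    "HOL-Algebra.Ideal_Product"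
    "HOL-Algebra.Generated_Groups"
begin

section \<open>Left modules over a not necessarily commutative ring\<close>

text \<open>
  The library locale \<^locale>\<open>module\<close> requires a commutative ring. We keep its record type
  (the multiplicative fields of the record are irrelevant) and its axioms.
\<close>

locale left_module = R?: ring R + M?: abelian_group M
  for R :: "('r, 'y) ring_scheme" (structure) and M :: "('r, 'v, 'z) module_scheme" (structure) +
  assumes smult_closed:
      "\<lbrakk>a \<in> carrier R; x \<in> carrier M\<rbrakk> \<Longrightarrow> a \<odot>\<^bsub>M\<^esub> x \<in> carrier M"
    and smult_l_distr:
      "\<lbrakk>a \<in> carrier R; b \<in> carrier R; x \<in> carrier M\<rbrakk> \<Longrightarrow>
        (a \<oplus>\<^bsub>R\<^esub> b) \<odot>\<^bsub>M\<^esub> x = a \<odot>\<^bsub>M\<^esub> x \<oplus>\<^bsub>M\<^esub> b \<odot>\<^bsub>M\<^esub> x"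
    and smult_r_distr:
      "\<lbrakk>a \<in> carrier R; x \<in> carrier M; y \<in> carrier M\<rbrakk> \<Longrightarrow>
        a \<odot>\<^bsub>M\<^esub> (x \<oplus>\<^bsub>M\<^esub> y) = a \<odot>\<^bsub>M\<^esub> x \<oplus>\<^bsub>M\<^esub> a \<odot>\<^bsub>M\<^esub> y"
    and smult_assoc1:
      "\<lbrakk>a \<in> carrier R; b \<in> carrier R; x \<in> carrier M\<rbrakk> \<Longrightarrow>
        (a \<otimes>\<^bsub>R\<^esub> b) \<odot>\<^bsub>M\<^esub> x = a \<odot>\<^bsub>M\<^esub> (b \<odot>\<^bsub>M\<^esub> x)"
    and smult_one: "x \<in> carrier M \<Longrightarrow> \<one>\<^bsub>R\<^esub> \<odot>\<^bsub>M\<^esub> x = x"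

definition fin_gen_module :: "('r, 'y) ring_scheme \<Rightarrow> ('r, 'v) module \<Rightarrow> bool" where
  "fin_gen_module R M \<longleftrightarrow> left_module R M \<and>
     (\<exists>S. finite S \<and> S \<subseteq> carrier M \<and>
        (\<forall>N. submodule N R M \<and> S \<subseteq> N \<longrightarrow> N = carrier M))"

definition module_isomorphic ::
    "('r, 'y) ring_scheme \<Rightarrow> ('r, 'v) module \<Rightarrow> ('r, 'u) module \<Rightarrow> bool" where
  "module_isomorphic R M N \<longleftrightarrow>
     (\<exists>f. bij_betw f (carrier M) (carrier N) \<and>
        (\<forall>x\<in>carrier M. \<forall>y\<in>carrier M. f (x \<oplus>\<^bsub>M\<^esub> y) = f x \<oplus>\<^bsub>N\<^esub> f y) \<and>
        (\<forall>a\<in>carrier R. \<forall>x\<in>carrier M. f (a \<odot>\<^bsub>M\<^esub> x) = a \<odot>\<^bsub>N\<^esub> f x))"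

definition regular_module :: "('r, 'y) ring_scheme \<Rightarrow> ('r, 'r) module" where
  "regular_module R =
     \<lparr>carrier = carrier R, mult = mult R, one = one R, zero = zero R, add = add R,
      smult = mult R\<rparr>"

definition quotient_module :: "('r, 'v) module \<Rightarrow> 'v set \<Rightarrow> ('r, 'v set) module" where
  "quotient_module M N =
     \<lparr>carrier = a_rcosets\<^bsub>M\<^esub> N, mult = undefined, one = undefined, zero = N, add = set_add M,
      smult = (\<lambda>a X. \<Union>x\<in>X. N +>\<^bsub>M\<^esub> (a \<odot>\<^bsub>M\<^esub> x))\<rparr>"

definition direct_sum2 ::
    "('r, 'v) module \<Rightarrow> ('r, 'u) module \<Rightarrow> ('r, 'v \<times> 'u) module" where
  "direct_sum2 M N =
     \<lparr>carrier = carrier M \<times> carrier N, mult = undefined, one = undefined,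
      zero = (\<zero>\<^bsub>M\<^esub>, \<zero>\<^bsub>N\<^esub>),
      add = (\<lambda>(x, y) (x', y'). (x \<oplus>\<^bsub>M\<^esub> x', y \<oplus>\<^bsub>N\<^esub> y')),
      smult = (\<lambda>a (x, y). (a \<odot>\<^bsub>M\<^esub> x, a \<odot>\<^bsub>N\<^esub> y))\<rparr>"

text \<open>Intended for finite index sets only.\<close>

definition direct_sum ::
    "'i set \<Rightarrow> ('i \<Rightarrow> ('r, 'v) module) \<Rightarrow> ('r, 'i \<Rightarrow> 'v) module" where
  "direct_sum I M =
     \<lparr>carrier = (\<Pi>\<^sub>E i\<in>I. carrier (M i)), mult = undefined, one = undefined,
      zero = (\<lambda>i\<in>I. \<zero>\<^bsub>M i\<^esub>),
      add = (\<lambda>x y. \<lambda>i\<in>I. x i \<oplus>\<^bsub>M i\<^esub> y i),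
      smult = (\<lambda>a x. \<lambda>i\<in>I. a \<odot>\<^bsub>M i\<^esub> x i)\<rparr>"

definition maximal_submodule ::
    "('r, 'y) ring_scheme \<Rightarrow> ('r, 'v) module \<Rightarrow> 'v set \<Rightarrow> bool" where
  "maximal_submodule R M N \<longleftrightarrow> submodule N R M \<and> N \<noteq> carrier M \<and>
     (\<forall>N'. submodule N' R M \<and> N \<subseteq> N' \<longrightarrow> N' = N \<or> N' = carrier M)"

definition module_radical :: "('r, 'y) ring_scheme \<Rightarrow> ('r, 'v) module \<Rightarrow> 'v set" where
  "module_radical R M = {x \<in> carrier M. \<forall>N. maximal_submodule R M N \<longrightarrow> x \<in> N}"

primrec radical_power ::
    "('r, 'y) ring_scheme \<Rightarrow> ('r, 'v) module \<Rightarrow> nat \<Rightarrow> 'v set" where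
  "radical_power R M 0 = carrier M"
| "radical_power R M (Suc i) = module_radical R (M\<lparr>carrier := radical_power R M i\<rparr>)"


section \<open>The algebra \<open>KZ\<^sub>n/J\<^sup>d\<close> and its comultiplication\<close>

text \<open>
  The pair \<open>(i, k)\<close> with \<open>i < n\<close> stands for the unique path of length \<open>k\<close> in the oriented cycle
  \<open>Z\<^sub>n\<close> that starts at the vertex \<open>i\<close>; it ends at the vertex \<open>(i + k) mod n\<close>. Thus
  \<open>v\<^sub>i = (i, 0)\<close> and \<open>\<alpha>\<^sub>i = (i, 1)\<close>. In the composite of \<open>x\<close> and \<open>y\<close> the path \<open>y\<close> is run first.
\<close>

type_synonym path = "nat \<times> nat"

definition path_comp :: "nat \<Rightarrow> path \<Rightarrow> path \<Rightarrow> path option" where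
  "path_comp n x y =
     (if fst x = (fst y + snd y) mod n then Some (fst y, snd y + snd x) else None)"

definition path_comp2 :: "nat \<Rightarrow> path \<times> path \<Rightarrow> path \<times> path \<Rightarrow> (path \<times> path) option" where
  "path_comp2 n x y =
     (case (path_comp n (fst x) (fst y), path_comp n (snd x) (snd y)) of
        (Some a, Some b) \<Rightarrow> Some (a, b)
      | _ \<Rightarrow> None)"

text \<open>
  Bilinear extension of a partial multiplication of basis elements (undefined products are \<open>0\<close>).
  With \<open>path_comp n\<close> this is the product of \<open>KZ\<^sub>n\<close>, with \<open>path_comp2 n\<close> it is the product of
  \<open>KZ\<^sub>n \<otimes> KZ\<^sub>n\<close>, where the pair \<open>(x, y)\<close> of paths stands for \<open>x \<otimes> y\<close>. (The product \<open>*\<close> of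
  the type of finitely supported functions is a different one and is not used for \<open>KZ\<^sub>n\<close>.)
\<close>

definition basis_mult ::
    "('b \<Rightarrow> 'b \<Rightarrow> 'b option) \<Rightarrow> ('b \<Rightarrow>\<^sub>0 'k::comm_ring_1) \<Rightarrow> ('b \<Rightarrow>\<^sub>0 'k) \<Rightarrow> ('b \<Rightarrow>\<^sub>0 'k)" where
  "basis_mult m f g =
     (\<Sum>x\<in>Poly_Mapping.keys f. \<Sum>y\<in>Poly_Mapping.keys g.
        case m x y of
          None \<Rightarrow> 0
        | Some z \<Rightarrow> Poly_Mapping.single z (Poly_Mapping.lookup f x * Poly_Mapping.lookup g y))"

definition path_algebra :: "nat \<Rightarrow> (path \<Rightarrow>\<^sub>0 'k::comm_ring_1) ring" where
  "path_algebra n =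
     \<lparr>carrier = {f. Poly_Mapping.keys f \<subseteq> {..<n} \<times> UNIV},
      mult = basis_mult (path_comp n),
      one = (\<Sum>i<n. Poly_Mapping.single (i, 0) 1),
      zero = 0,
      add = (+)\<rparr>"

definition arrow_ideal :: "nat \<Rightarrow> (path \<Rightarrow>\<^sub>0 'k::comm_ring_1) set" where
  "arrow_ideal n = Idl\<^bsub>path_algebra n\<^esub> {Poly_Mapping.single (i, 1) 1 |i. i < n}"

primrec ideal_power :: "('a, 'b) ring_scheme \<Rightarrow> 'a set \<Rightarrow> nat \<Rightarrow> 'a set" where
  "ideal_power R I 0 = carrier R"
| "ideal_power R I (Suc k) = ideal_prod R (ideal_power R I k) I"

abbreviation trunc_ideal :: "nat \<Rightarrow> nat \<Rightarrow> (path \<Rightarrow>\<^sub>0 'k::comm_ring_1) set" where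
  "trunc_ideal n d \<equiv> ideal_power (path_algebra n) (arrow_ideal n) d"

definition trunc_algebra :: "nat \<Rightarrow> nat \<Rightarrow> (path \<Rightarrow>\<^sub>0 'k::comm_ring_1) set ring" where
  "trunc_algebra n d = path_algebra n Quot trunc_ideal n d"

definition trunc_class :: "nat \<Rightarrow> nat \<Rightarrow> (path \<Rightarrow>\<^sub>0 'k::comm_ring_1) \<Rightarrow> (path \<Rightarrow>\<^sub>0 'k) set" where
  "trunc_class n d a = trunc_ideal n d +>\<^bsub>path_algebra n\<^esub> a"

definition comult_vertex :: "nat \<Rightarrow> nat \<Rightarrow> (path \<times> path \<Rightarrow>\<^sub>0 'k::comm_ring_1)" where
  "comult_vertex n h =
     (\<Sum>(g\<^sub>1, g\<^sub>2) \<in> {(g\<^sub>1, g\<^sub>2). g\<^sub>1 < n \<and> g\<^sub>2 < n \<and> (g\<^sub>1 + g\<^sub>2) mod n = h}.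
        Poly_Mapping.single ((g\<^sub>1, 0), (g\<^sub>2, 0)) 1)"

definition comult_arrow :: "nat \<Rightarrow> nat \<Rightarrow> (path \<times> path \<Rightarrow>\<^sub>0 'k::comm_ring_1)" where
  "comult_arrow n h =
     (\<Sum>(g\<^sub>1, g\<^sub>2) \<in> {(g\<^sub>1, g\<^sub>2). g\<^sub>1 < n \<and> g\<^sub>2 < n \<and> (g\<^sub>1 + g\<^sub>2) mod n = h}.
        Poly_Mapping.single ((g\<^sub>1, 1), (g\<^sub>2, 0)) 1 + Poly_Mapping.single ((g\<^sub>1, 0), (g\<^sub>2, 1)) 1)"

text \<open>
  \<open>\<Delta>\<close> is the algebra homomorphism \<open>KZ\<^sub>n \<rightarrow> KZ\<^sub>n \<otimes> KZ\<^sub>n\<close> with these values on vertices and arrows;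
  on the path \<open>\<alpha>\<^bsub>i+k\<^esub> \<dots> \<alpha>\<^bsub>i+1\<^esub> \<alpha>\<^sub>i\<close> of length \<open>k + 1\<close> it is computed by splitting off the last arrow.
\<close>

primrec comult_path :: "nat \<Rightarrow> nat \<Rightarrow> nat \<Rightarrow> (path \<times> path \<Rightarrow>\<^sub>0 'k::comm_ring_1)" where
  "comult_path n i 0 = comult_vertex n i"
| "comult_path n i (Suc k) =
     basis_mult (path_comp2 n) (comult_arrow n ((i + k) mod n)) (comult_path n i k)"

definition comult :: "nat \<Rightarrow> (path \<Rightarrow>\<^sub>0 'k::comm_ring_1) \<Rightarrow> (path \<times> path \<Rightarrow>\<^sub>0 'k)" where
  "comult n a =
     (\<Sum>(i, k) \<in> Poly_Mapping.keys a.
        Poly_Mapping.map ((*) (Poly_Mapping.lookup a (i, k))) (comult_path n i k))"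


section \<open>Tensor products of modules over \<open>KZ\<^sub>n/J\<^sup>d\<close>\<close>

definition scalar :: "nat \<Rightarrow> nat \<Rightarrow> 'k::comm_ring_1 \<Rightarrow> (path \<Rightarrow>\<^sub>0 'k) set" where
  "scalar n d c = trunc_class n d (\<Sum>i<n. Poly_Mapping.single (i, 0) c)"

definition free_space :: "'a set \<Rightarrow> ('a \<Rightarrow>\<^sub>0 'k::comm_ring_1) ring" where
  "free_space A =
     \<lparr>carrier = {x. Poly_Mapping.keys x \<subseteq> A}, mult = undefined, one = undefined,
      zero = 0, add = (+)\<rparr>"

text \<open>
  \<open>V \<otimes>\<^sub>K W\<close> is the \<open>K\<close>-vector space with basis \<open>V \<times> W\<close> modulo the subspace spanned by the
  bilinearity relations. As all scalar multiples of the relations are listed, that subspace is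
  the additive subgroup they generate.
\<close>

definition tensor_relations ::
    "nat \<Rightarrow> nat \<Rightarrow> ((path \<Rightarrow>\<^sub>0 'k::comm_ring_1) set, 'v) module \<Rightarrow> ((path \<Rightarrow>\<^sub>0 'k) set, 'u) module \<Rightarrow>
      ('v \<times> 'u \<Rightarrow>\<^sub>0 'k) set" where
  "tensor_relations n d V W =
     {Poly_Mapping.single (x \<oplus>\<^bsub>V\<^esub> x', y) a - Poly_Mapping.single (x, y) a
        - Poly_Mapping.single (x', y) a
      |x x' y a. x \<in> carrier V \<and> x' \<in> carrier V \<and> y \<in> carrier W} \<union>
     {Poly_Mapping.single (x, y \<oplus>\<^bsub>W\<^esub> y') a - Poly_Mapping.single (x, y) a
        - Poly_Mapping.single (x, y') a
      |x y y' a. x \<in> carrier V \<and> y \<in> carrier W \<and> y' \<in> carrier W} \<union>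
     {Poly_Mapping.single (scalar n d c \<odot>\<^bsub>V\<^esub> x, y) a - Poly_Mapping.single (x, y) (a * c)
      |x y a c. x \<in> carrier V \<and> y \<in> carrier W} \<union>
     {Poly_Mapping.single (x, scalar n d c \<odot>\<^bsub>W\<^esub> y) a - Poly_Mapping.single (x, y) (a * c)
      |x y a c. x \<in> carrier V \<and> y \<in> carrier W}"

definition tensor_subspace ::
    "nat \<Rightarrow> nat \<Rightarrow> ((path \<Rightarrow>\<^sub>0 'k::comm_ring_1) set, 'v) module \<Rightarrow> ((path \<Rightarrow>\<^sub>0 'k) set, 'u) module \<Rightarrow>
      ('v \<times> 'u \<Rightarrow>\<^sub>0 'k) set" where
  "tensor_subspace n d V W =
     generate (add_monoid (free_space (carrier V \<times> carrier W))) (tensor_relations n d V W)"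

text \<open>The action of \<open>\<Delta>(a)\<close> on representatives, for \<open>a\<close> in \<open>KZ\<^sub>n\<close>.\<close>

definition diagonal_action ::
    "nat \<Rightarrow> nat \<Rightarrow> ((path \<Rightarrow>\<^sub>0 'k::comm_ring_1) set, 'v) module \<Rightarrow> ((path \<Rightarrow>\<^sub>0 'k) set, 'u) module \<Rightarrow>
      (path \<Rightarrow>\<^sub>0 'k) \<Rightarrow> ('v \<times> 'u \<Rightarrow>\<^sub>0 'k) \<Rightarrow> ('v \<times> 'u \<Rightarrow>\<^sub>0 'k)" where
  "diagonal_action n d V W a t =
     (\<Sum>(b\<^sub>1, b\<^sub>2) \<in> Poly_Mapping.keys (comult n a). \<Sum>(x, y) \<in> Poly_Mapping.keys t.
        Poly_Mapping.single
          (trunc_class n d (Poly_Mapping.single b\<^sub>1 1) \<odot>\<^bsub>V\<^esub> x,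
           trunc_class n d (Poly_Mapping.single b\<^sub>2 1) \<odot>\<^bsub>W\<^esub> y)
          (Poly_Mapping.lookup (comult n a) (b\<^sub>1, b\<^sub>2) * Poly_Mapping.lookup t (x, y)))"

definition tensor_module ::
    "nat \<Rightarrow> nat \<Rightarrow> ((path \<Rightarrow>\<^sub>0 'k::comm_ring_1) set, 'v) module \<Rightarrow> ((path \<Rightarrow>\<^sub>0 'k) set, 'u) module \<Rightarrow>
      ((path \<Rightarrow>\<^sub>0 'k) set, ('v \<times> 'u \<Rightarrow>\<^sub>0 'k) set) module" where
  "tensor_module n d V W =
     (let F = free_space (carrier V \<times> carrier W); N = tensor_subspace n d V W in
      \<lparr>carrier = a_rcosets\<^bsub>F\<^esub> N, mult = undefined, one = undefined, zero = N, add = set_add F,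
       smult = (\<lambda>h X. \<Union>a\<in>h. \<Union>t\<in>X. N +>\<^bsub>F\<^esub> diagonal_action n d V W a t)\<rparr>)"


section \<open>The modules \<open>M(i, j)\<close>\<close>

definition proj_module ::
    "nat \<Rightarrow> nat \<Rightarrow> nat \<Rightarrow> ((path \<Rightarrow>\<^sub>0 'k::comm_ring_1) set, (path \<Rightarrow>\<^sub>0 'k) set) module" where
  "proj_module n d j =
     (regular_module (trunc_algebra n d))
       \<lparr>carrier := {h \<otimes>\<^bsub>trunc_algebra n d\<^esub> trunc_class n d (Poly_Mapping.single (j, 0) 1)
                    |h. h \<in> carrier (trunc_algebra n d)}\<rparr>"

definition indec_module ::
    "nat \<Rightarrow> nat \<Rightarrow> nat \<Rightarrow> nat \<Rightarrow>
      ((path \<Rightarrow>\<^sub>0 'k::comm_ring_1) set, (path \<Rightarrow>\<^sub>0 'k) set set) module" where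
  "indec_module n d i j =
     quotient_module (proj_module n d j)
       (radical_power (trunc_algebra n d) (proj_module n d j) i)"


section \<open>The representation ring\<close>

text \<open>
  A finitely generated module is finite-dimensional over \<open>K\<close>, so it has an isomorphic copy whose
  elements are of type \<open>nat \<Rightarrow> 'k\<close>. The isomorphism class of an arbitrary module is represented by
  the set of these copies; the type serves as a universe only, its own operations play no role.
\<close>

type_synonym 'k umodule = "((path \<Rightarrow>\<^sub>0 'k) set, nat \<Rightarrow> 'k) module"

definition iso_class ::
    "nat \<Rightarrow> nat \<Rightarrow> ((path \<Rightarrow>\<^sub>0 'k::comm_ring_1) set, 'v) module \<Rightarrow> 'k umodule set" where
  "iso_class n d V =
     {U. fin_gen_module (trunc_algebra n d) U \<and> module_isomorphic (trunc_algebra n d) U V}"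

definition iso_classes :: "nat \<Rightarrow> nat \<Rightarrow> ('k::comm_ring_1) umodule set set" where
  "iso_classes n d =
     {iso_class n d V |V :: 'k umodule. fin_gen_module (trunc_algebra n d) V}"

definition tensor_class ::
    "nat \<Rightarrow> nat \<Rightarrow> ('k::comm_ring_1) umodule set \<Rightarrow> 'k umodule set \<Rightarrow> 'k umodule set" where
  "tensor_class n d A B = (\<Union>V\<in>A. \<Union>W\<in>B. iso_class n d (tensor_module n d V W))"

definition free_rep_ring :: "nat \<Rightarrow> nat \<Rightarrow> (('k::comm_ring_1) umodule set \<Rightarrow>\<^sub>0 int) ring" where
  "free_rep_ring n d =
     \<lparr>carrier = {c. Poly_Mapping.keys c \<subseteq> iso_classes n d},
      mult = basis_mult (\<lambda>A B. Some (tensor_class n d A B)),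
      one = Poly_Mapping.single (iso_class n d (indec_module n d 1 0)) 1,
      zero = 0,
      add = (+)\<rparr>"

definition rep_relations :: "nat \<Rightarrow> nat \<Rightarrow> (('k::comm_ring_1) umodule set \<Rightarrow>\<^sub>0 int) set" where
  "rep_relations n d =
     generate (add_monoid (free_rep_ring n d))
       {Poly_Mapping.single (iso_class n d V) 1 + Poly_Mapping.single (iso_class n d W) 1
          - Poly_Mapping.single (iso_class n d (direct_sum2 V W)) 1
        |(V :: 'k umodule) (W :: 'k umodule).
           fin_gen_module (trunc_algebra n d) V \<and> fin_gen_module (trunc_algebra n d) W}"

definition rep_ring ::
    "nat \<Rightarrow> nat \<Rightarrow> (('k::comm_ring_1) umodule set \<Rightarrow>\<^sub>0 int) set ring" where
  "rep_ring n d = free_rep_ring n d Quot rep_relations n d"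

text \<open>The element \<open>[V]\<close> of the representation ring.\<close>

definition rep_class ::
    "nat \<Rightarrow> nat \<Rightarrow> ((path \<Rightarrow>\<^sub>0 'k::comm_ring_1) set, 'v) module \<Rightarrow>
      ('k umodule set \<Rightarrow>\<^sub>0 int) set" where
  "rep_class n d V =
     rep_relations n d +>\<^bsub>free_rep_ring n d\<^esub> Poly_Mapping.single (iso_class n d V) 1"


section \<open>Polynomials\<close>

text \<open>
  Polynomials with integer coefficients in the indeterminates \<open>x\<^sub>0, x\<^sub>1, \<dots>\<close>, as finitely supported
  functions on monomials, with the library's ring operations. We use
  \<open>y = x\<^sub>0\<close>, \<open>z = x\<^sub>1\<close> and \<open>w\<^sub>l = x\<^bsub>l+1\<^esub>\<close>, so \<open>\<int>[y, z, w\<^sub>1, \<dots>, w\<^bsub>m-1\<^esub>]\<close> consists of the polynomials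
  in which only \<open>x\<^sub>0, \<dots>, x\<^sub>m\<close> occur.
\<close>

type_synonym zpoly = "(nat \<Rightarrow>\<^sub>0 nat) \<Rightarrow>\<^sub>0 int"

definition indet :: "nat \<Rightarrow> zpoly" where
  "indet i = Poly_Mapping.single (Poly_Mapping.single i 1) 1"

definition varY :: zpoly where "varY = indet 0"
definition varZ :: zpoly where "varZ = indet 1"
definition varW :: "nat \<Rightarrow> zpoly" where "varW l = indet (l + 1)"

definition zpoly_ring :: "nat \<Rightarrow> zpoly ring" where
  "zpoly_ring m =
     \<lparr>carrier = {P. \<forall>\<mu>\<in>Poly_Mapping.keys P. Poly_Mapping.keys \<mu> \<subseteq> {..m}},
      mult = (*), one = 1, zero = 0, add = (+)\<rparr>"

text \<open>
  The function \<open>w\<close> records, for every \<open>u \<in> {3..p\<^sup>m}\<close> such that \<open>u - 1\<close> is not a power of \<open>p\<close>, the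
  number \<open>w\<close> chosen in the recursive definition of \<open>f\<^bsub>u,0\<^esub>\<close>.
\<close>

definition recursive_index :: "nat \<Rightarrow> nat \<Rightarrow> nat \<Rightarrow> bool" where
  "recursive_index p m u \<longleftrightarrow> 3 \<le> u \<and> u \<le> p ^ m \<and> (\<nexists>l. u - 1 = p ^ l)"

definition admissible_choice ::
    "'k::comm_ring_1 itself \<Rightarrow> nat \<Rightarrow> nat \<Rightarrow> (nat \<Rightarrow> nat) \<Rightarrow> bool" where
  "admissible_choice _ p m w \<longleftrightarrow>
     (\<forall>u. recursive_index p m u \<longrightarrow>
        1 \<le> w u \<and> w u \<le> u - 2 \<and> (of_nat ((u - 1) choose (w u)) :: 'k) \<noteq> 0)"

text \<open>
  \<open>f\<close> is the family \<open>u \<mapsto> f\<^bsub>u,0\<^esub>\<close> (only \<open>1 \<le> u \<le> p\<^sup>m\<close> matters) obtained from the choice \<open>w\<close>.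
  The list \<open>L\<close> contains the pairs \<open>(i\<^sub>s, j\<^sub>s)\<close> for \<open>2 \<le> s \<le> t\<close>.
\<close>

definition f_family ::
    "'k::comm_ring_1 itself \<Rightarrow> nat \<Rightarrow> nat \<Rightarrow> nat \<Rightarrow> (nat \<Rightarrow> nat) \<Rightarrow> (nat \<Rightarrow> zpoly) \<Rightarrow> bool" where
  "f_family _ n p m w f \<longleftrightarrow>
     f 1 = 1 \<and> f 2 = varZ \<and> (\<forall>l\<in>{1..m - 1}. f (p ^ l + 1) = varW l) \<and>
     (\<forall>u. recursive_index p m u \<longrightarrow>
        (\<exists>L :: (nat \<times> nat) list.
           (\<forall>(i, j)\<in>set L. 1 \<le> i \<and> i \<le> u - 2 \<and> 1 \<le> j \<and> j \<le> u - 2) \<and>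
           module_isomorphic (trunc_algebra n (p ^ m))
             (tensor_module n (p ^ m)
                (indec_module n (p ^ m) (u - w u) 0 ::
                   ((path \<Rightarrow>\<^sub>0 'k) set, (path \<Rightarrow>\<^sub>0 'k) set set) module)
                (indec_module n (p ^ m) (w u + 1) 0))
             (direct_sum2 (indec_module n (p ^ m) u 0)
                (direct_sum {..<length L}
                   (\<lambda>s. indec_module n (p ^ m) (fst (L ! s)) (snd (L ! s))))) \<and>
           f u = f (u - w u) * f (w u + 1) - (\<Sum>(i, j)\<leftarrow>L. varY ^ j * f i)))"

definition f_shift :: "(nat \<Rightarrow> zpoly) \<Rightarrow> nat \<Rightarrow> nat \<Rightarrow> zpoly" where
  "f_shift f u r = varY ^ r * f u"

text \<open>The values of \<open>a_poly\<close> and \<open>h_poly\<close> at \<open>0\<close> are arbitrary.\<close>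

fun a_poly :: "nat \<Rightarrow> zpoly" where
  "a_poly 0 = 0"
| "a_poly (Suc 0) = 1"
| "a_poly (Suc (Suc 0)) = varZ"
| "a_poly (Suc (Suc (Suc k))) = varZ * a_poly (Suc (Suc k)) - varY * a_poly (Suc k)"

fun h_poly :: "nat \<Rightarrow> (nat \<Rightarrow> zpoly) \<Rightarrow> nat \<Rightarrow> nat \<Rightarrow> zpoly" where
  "h_poly p f l 0 = 0"
| "h_poly p f l (Suc 0) = varW l"
| "h_poly p f l (Suc (Suc k')) =
     (let q = p ^ l; k = Suc k' in
      varW l * h_poly p f l (Suc k') - f_shift f ((k + 1) * q - 1) 1
        - (\<Sum>j = 2..q - 1. f_shift f (k * q) j) - f_shift f ((k - 1) * q + 1) q)"

fun g_poly :: "nat \<Rightarrow> nat \<Rightarrow> (nat \<Rightarrow> zpoly) \<Rightarrow> nat \<Rightarrow> zpoly" where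
  "g_poly n p f 0 = varY ^ n - 1"
| "g_poly n p f (Suc 0) = (varZ - varY - 1) * a_poly p"
| "g_poly n p f (Suc (Suc l')) =
     (let l = Suc l'; q = p ^ l in
      varW l * h_poly p f l (p - 1) - f_shift f (p * q) 0 - f_shift f (p * q) 1
        - (\<Sum>j = 2..q - 1. f_shift f ((p - 1) * q) j) - f_shift f ((p - 2) * q + 1) q)"

definition rep_ideal :: "nat \<Rightarrow> nat \<Rightarrow> nat \<Rightarrow> (nat \<Rightarrow> zpoly) \<Rightarrow> zpoly set" where
  "rep_ideal n p m f = Idl\<^bsub>zpoly_ring m\<^esub> (g_poly n p f ` {0..m})"

definition rep_epimorphism ::
    "nat \<Rightarrow> nat \<Rightarrow> nat \<Rightarrow> (zpoly \<Rightarrow> (('k::comm_ring_1) umodule set \<Rightarrow>\<^sub>0 int) set) \<Rightarrow> bool" where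
  "rep_epimorphism n p m \<phi> \<longleftrightarrow>
     (let d = p ^ m in
      ring_hom_ring (zpoly_ring m) (rep_ring n d) \<phi> \<and>
      \<phi> ` carrier (zpoly_ring m) = carrier (rep_ring n d) \<and>
      \<phi> 1 = rep_class n d (indec_module n d 1 0) \<and>
      \<phi> varY = rep_class n d (indec_module n d 1 1) \<and>
      \<phi> varZ = rep_class n d (indec_module n d 2 0) \<and>
      (\<forall>l\<in>{1..m - 1}. \<phi> (varW l) = rep_class n d (indec_module n d (p ^ l + 1) 0)))"

end

theory Submission
 imports Defs "HOL-Combinatorics.List_Permutation" "HOL-Library.Nat_Bijection"
begin

text \<open>A module over \<open>KZ\<^sub>n/J\<^sup>d\<close> is a vector space graded by \<open>\<int>/n\<int>\<close> with an operator \<open>X\<close> that raises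
degrees by \<open>1\<close> and satisfies \<open>X\<^sup>d = 0\<close>: the vertices act as the projections to the homogeneous
components, and \<open>X\<close> is the action of the sum of all arrows. The module \<open>M(i, j)\<close> is a single Jordan
block of length \<open>i\<close> whose generator has degree \<open>j\<close>. Since \<open>n \<ge> d\<close>, distinct basis vectors of a block
have distinct degrees, and every finitely generated module is a direct sum of such blocks
(\<open>block_decomposition\<close>) with multiplicities that depend on the module only
(\<open>block_decomposition_unique\<close>). Hence the representation ring is free abelian on the \<open>nd\<close> classes
\<open>[M(i, j)]\<close>; the map \<open>\<Gamma>\<close> below takes coordinates in this basis, and every statement about modules up to
isomorphism becomes an equation between integer vectors.

The comultiplication makes \<open>X\<close> act on \<open>V \<otimes> W\<close> as \<open>X \<otimes> 1 + 1 \<otimes> X\<close> and adds degrees. Its \<open>d\<close>-th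
power vanishes again because \<open>d\<close> is a power of the characteristic \<open>p\<close>. In particular
\<open>M(i, 0) \<otimes> M(j, 0)\<close> is \<open>K[a, b]/(a\<^sup>i, b\<^sup>j)\<close> with \<open>X\<close> acting as multiplication by \<open>x = a + b\<close>. Two kinds
of decompositions are needed. If \<open>i + j - 1 = u \<le> d\<close> and the binomial coefficient of \<open>u - 1\<close> over \<open>i - 1\<close> is
not zero in \<open>K\<close>, then \<open>1\<close> generates a block of the maximal length \<open>u\<close>, and all other blocks lie
strictly inside (\<open>tensor_top_summand\<close>); this gives sense to the recursion for the polynomials
\<open>f\<^bsub>u,0\<^esub>\<close>. The products with \<open>M(2, 0)\<close> and with \<open>M(p\<^sup>l + 1, 0)\<close> are decomposed completely by
explicit homogeneous generators (\<open>product_two\<close>, \<open>product_decomposition\<close> and their counterparts for the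
last factor); the relations between \<open>a\<close> and \<open>x\<close> used there come from
\<open>(x - a)\<^sup>q = x\<^sup>q - a\<^sup>q\<close> for \<open>q = p\<^sup>l\<close>.

A homomorphism \<open>\<phi>\<close> with the prescribed values sends \<open>f\<^bsub>u,r\<^esub>\<close> to \<open>[M(u, r)]\<close>, so it is surjective, and the
decompositions say that it kills all \<open>g\<^sub>i\<close>. That the kernel is not larger follows by counting. Give \<open>y\<close>
weight \<open>0\<close>, \<open>z\<close> weight \<open>1\<close> and \<open>w\<^sub>l\<close> weight \<open>p\<^sup>l\<close>. Then \<open>f\<^bsub>u,0\<^esub>\<close> has weight at most \<open>u - 1\<close>, so \<open>g\<^sub>1\<close> is
\<open>z\<^sup>p\<close> and \<open>g\<^bsub>l+1\<^esub>\<close> is \<open>w\<^sub>l\<^sup>p\<close> up to terms of smaller weight. Modulo \<open>y\<^sup>n - 1\<close> and these polynomials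
everything reduces to the \<open>n p\<^sup>m\<close> monomials with exponent less than \<open>n\<close> in \<open>y\<close> and less than \<open>p\<close> in the other
indeterminates (\<open>reduction\<close>). Their images span a lattice of the same rank \<open>n p\<^sup>m = nd\<close>, so they are
independent (\<open>spanning_family_independent\<close>), and no further relation is possible (\<open>kernel_eq\<close>).\<close>

type_synonym 'k trunc = "(path \<Rightarrow>\<^sub>0 'k) set"
abbreviation (input) "KZ \<equiv> path_algebra"
abbreviation (input) "KZJ \<equiv> trunc_algebra"
abbreviation keys :: "('b \<Rightarrow>\<^sub>0 'k::zero) => 'b set" where "keys \<equiv> Poly_Mapping.keys"
abbreviation lookup :: "('b \<Rightarrow>\<^sub>0 'k::zero) => 'b => 'k" where "lookup \<equiv> Poly_Mapping.lookup"
abbreviation single :: "'b => 'k::zero => ('b \<Rightarrow>\<^sub>0 'k)" where "single \<equiv> Poly_Mapping.single"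

section \<open>Bilinear extensions of partial multiplications\<close>

lemma sum_single_lookup:
 fixes f :: "'b \<Rightarrow>\<^sub>0 'k::comm_monoid_add"
 assumes "finite A" "keys f \<subseteq> A"
 shows "(\<Sum>x\<in>A. single x (lookup f x)) = f"
proof (rule poly_mapping_eqI)
 fix k
 have "lookup (\<Sum>x\<in>A. single x (lookup f x)) k = (\<Sum>x\<in>A. if x = k then lookup f x else 0)"
  by (simp add: lookup_sum lookup_single when_def)
 also have "... = lookup f k"
  using assms by (auto simp: in_keys_iff)
 finally show "lookup (\<Sum>x\<in>A. single x (lookup f x)) k = lookup f k" .
qed

lemma poly_mapping_span_induct [consumes 1, case_names zero single add]:
 fixes f :: "'b \<Rightarrow>\<^sub>0 'k::comm_monoid_add"
 assumes "keys f \<subseteq> B"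
  and "P 0"
  and "\<And>x a. x \<in> B ==> P (single x a)"
  and "\<And>f g. keys f \<subseteq> B ==> keys g \<subseteq> B ==> P f ==> P g ==> P (f + g)"
 shows "P f"
proof -
 have "finite A ==> A \<subseteq> B ==>
   P (\<Sum>x\<in>A. single x (lookup f x)) \<and> keys (\<Sum>x\<in>A. single x (lookup f x)) \<subseteq> B" for A
 proof (induction A rule: finite_induct)
  case empty then show ?case using assms(2) by simp
 next
  case (insert x A)
  have "keys (single x (lookup f x)) \<subseteq> B" using insert by auto
  moreover have "keys (single x (lookup f x) + (\<Sum>x\<in>A. single x (lookup f x))) \<subseteq> B"
   using calculation insert Poly_Mapping.keys_add[of "single x (lookup f x)" "\<Sum>x\<in>A. single x (lookup f x)"]
   by auto
  ultimately show ?case using insert assms(3,4) by simp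
 qed
 from this[of "keys f"] show ?thesis using assms(1) sum_single_lookup[of "keys f" f] by simp
qed

lemma sum_keys_add:
 assumes "\<And>x. h x 0 = 0" "\<And>x a b. h x (a + b) = h x a + h x b"
 shows "(\<Sum>x\<in>keys (f + g). h x (lookup (f + g) x))
  = (\<Sum>x\<in>keys f. h x (lookup f x)) + (\<Sum>x\<in>keys g. h x (lookup g x))"
 by (rule setsum_keys_plus_distrib) (use assms in auto)

lemma sum_keys_single:
 assumes "\<And>x. h x 0 = 0"
 shows "(\<Sum>x\<in>keys (single y a). h x (lookup (single y a) x)) = h y a"
 using assms by (cases "a = 0") auto

lemma sum_keys_superset:
 assumes "\<And>x. h x 0 = 0" "finite A" "keys f \<subseteq> A"
 shows "(\<Sum>x\<in>keys f. h x (lookup f x)) = (\<Sum>x\<in>A. h x (lookup f x))"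
 using assms by (intro sum.mono_neutral_left) (auto simp: in_keys_iff)

context
 fixes m :: "'b => 'b => 'b option"
begin

lemma basis_mult_add_left:
 "basis_mult m (f + g) h = basis_mult m f h + basis_mult m g (h :: 'b \<Rightarrow>\<^sub>0 'k::comm_ring_1)"
proof -
 define k where "k x a = (\<Sum>y\<in>keys h. case m x y of None => 0 | Some z => single z (a * lookup h y))" for x a
 have "k x 0 = 0" "k x (a + b) = k x a + k x b" for x a b
  unfolding k_def sum.distrib[symmetric]
  by (auto simp: distrib_right single_add split: option.splits intro!: sum.neutral sum.cong)
 from sum_keys_add[of k, OF this] show ?thesis by (simp add: basis_mult_def k_def)
qed

lemma basis_mult_add_right:
 "basis_mult m h (f + g) = basis_mult m h f + basis_mult m h (g :: 'b \<Rightarrow>\<^sub>0 'k::comm_ring_1)"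
proof -
 have "(\<Sum>y\<in>keys (f + g). case m x y of None => 0 | Some z => single z (lookup h x * lookup (f + g) y))
   = (\<Sum>y\<in>keys f. case m x y of None => 0 | Some z => single z (lookup h x * lookup f y))
   + (\<Sum>y\<in>keys g. case m x y of None => 0 | Some z => single z (lookup h x * lookup g y))" for x
  by (rule sum_keys_add) (auto simp: algebra_simps single_add split: option.splits)
 then show ?thesis unfolding basis_mult_def by (simp add: sum.distrib)
qed

lemma basis_mult_zero [simp]: "basis_mult m 0 h = 0" "basis_mult m h 0 = 0"
 by (simp_all add: basis_mult_def)

lemma basis_mult_single:
 "basis_mult m (single x a) (single y b)
  = (case m x y of None => 0 | Some z => single z (a * b :: 'k::comm_ring_1))"
 by (cases "a = 0"; cases "b = 0") (auto simp: basis_mult_def split: option.splits)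

lemma basis_mult_sum_left:
 "basis_mult m (sum f A) (h :: 'b \<Rightarrow>\<^sub>0 'k::comm_ring_1) = (\<Sum>i\<in>A. basis_mult m (f i) h)"
 by (induction A rule: infinite_finite_induct) (auto simp: basis_mult_add_left)

lemma basis_mult_sum_right:
 "basis_mult m (h :: 'b \<Rightarrow>\<^sub>0 'k::comm_ring_1) (sum f A) = (\<Sum>i\<in>A. basis_mult m h (f i))"
 by (induction A rule: infinite_finite_induct) (auto simp: basis_mult_add_right)

lemma keys_basis_mult:
 "keys (basis_mult m f (g :: 'b \<Rightarrow>\<^sub>0 'k::comm_ring_1))
  \<subseteq> {z. \<exists>x\<in>keys f. \<exists>y\<in>keys g. m x y = Some z}"
proof
 fix z assume z: "z \<in> keys (basis_mult m f g)"
 show "z \<in> {z. \<exists>x\<in>keys f. \<exists>y\<in>keys g. m x y = Some z}"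
 proof (rule ccontr)
  assume "\<not> ?thesis"
  then have "lookup (basis_mult m f g) z = 0"
   by (auto simp: basis_mult_def lookup_sum lookup_single when_def split: option.splits intro!: sum.neutral)
  with z show False by (simp add: in_keys_iff)
 qed
qed

end

text \<open>The set \<open>B\<close> plays the role of the morphisms of a category with finitely many objects, with the
identities \<open>E\<close>. This covers both multiplications in use: path algebras, whose objects are the vertices,
and the monoid ring of isomorphism classes, with a single object.\<close>

locale based_algebra =
 fixes B :: "'b set" and m :: "'b => 'b => 'b option" and E :: "'b set"
 assumes m_closed: "x \<in> B ==> y \<in> B ==> m x y = Some z ==> z \<in> B"
  and m_assoc: "x \<in> B ==> y \<in> B ==> z \<in> B ==>
   Option.bind (m x y) (%u. m u z) = Option.bind (m y z) (%u. m x u)"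
  and E: "finite E" "E \<subseteq> B"
  and unit_left: "x \<in> B ==> \<exists>e\<in>E. m e x = Some x \<and> (\<forall>e'\<in>E. e' \<noteq> e --> m e' x = None)"
  and unit_right: "x \<in> B ==> \<exists>e\<in>E. m x e = Some x \<and> (\<forall>e'\<in>E. e' \<noteq> e --> m x e' = None)"
begin

definition alg :: "('b \<Rightarrow>\<^sub>0 'k::comm_ring_1) ring" where
 "alg = \<lparr>carrier = {f. keys f \<subseteq> B}, mult = basis_mult m, one = (\<Sum>e\<in>E. single e 1),
   zero = 0, add = (+)\<rparr>"

lemma basis_mult_closed:
 "keys f \<subseteq> B ==> keys g \<subseteq> B ==> keys (basis_mult m f (g :: 'b \<Rightarrow>\<^sub>0 'k::comm_ring_1)) \<subseteq> B"
 using keys_basis_mult[of m f g] m_closed by blast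

lemma basis_mult_assoc:
 fixes f g h :: "'b \<Rightarrow>\<^sub>0 'k::comm_ring_1"
 assumes "keys f \<subseteq> B" "keys g \<subseteq> B" "keys h \<subseteq> B"
 shows "basis_mult m (basis_mult m f g) h = basis_mult m f (basis_mult m g h)"
 using assms(1)
proof (induction f rule: poly_mapping_span_induct)
 case (single x a)
 note x = this
 show ?case using assms(2)
 proof (induction g rule: poly_mapping_span_induct)
  case (single y b)
  note y = this
  show ?case using assms(3)
  proof (induction h rule: poly_mapping_span_induct)
   case (single z c)
   show ?case using m_assoc[OF x y single]
    by (auto simp: basis_mult_single mult.assoc split: option.splits)
  qed (auto simp: basis_mult_add_right)
 qed (auto simp: basis_mult_add_left basis_mult_add_right)
qed (auto simp: basis_mult_add_left)

lemma basis_mult_unit_left: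
 fixes f :: "'b \<Rightarrow>\<^sub>0 'k::comm_ring_1"
 assumes "keys f \<subseteq> B" shows "basis_mult m (\<Sum>e\<in>E. single e 1) f = f"
 using assms
proof (induction f rule: poly_mapping_span_induct)
 case (single x a)
 obtain e where e: "e \<in> E" "m e x = Some x" "\<forall>e'\<in>E. e' \<noteq> e --> m e' x = None"
  using unit_left[OF single] by blast
 have "basis_mult m (\<Sum>e\<in>E. single e 1) (single x a)
   = (\<Sum>e'\<in>E. if e' = e then single x a else 0)"
  unfolding basis_mult_sum_left basis_mult_single using e by (intro sum.cong) auto
 then show ?case using e E by simp
qed (auto simp: basis_mult_add_right)

lemma basis_mult_unit_right:
 fixes f :: "'b \<Rightarrow>\<^sub>0 'k::comm_ring_1"
 assumes "keys f \<subseteq> B" shows "basis_mult m f (\<Sum>e\<in>E. single e 1) = f"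
 using assms
proof (induction f rule: poly_mapping_span_induct)
 case (single x a)
 obtain e where e: "e \<in> E" "m x e = Some x" "\<forall>e'\<in>E. e' \<noteq> e --> m x e' = None"
  using unit_right[OF single] by blast
 have "basis_mult m (single x a) (\<Sum>e\<in>E. single e 1)
   = (\<Sum>e'\<in>E. if e' = e then single x a else 0)"
  unfolding basis_mult_sum_right basis_mult_single using e by (intro sum.cong) auto
 then show ?case using e E by simp
qed (auto simp: basis_mult_add_left)

lemma keys_unit: "keys (\<Sum>e\<in>E. single e (1::'k::comm_ring_1)) \<subseteq> B"
 using E keys_sum[of "%e. single e (1::'k)" E] by auto

lemma ring_alg: "ring (alg :: ('b \<Rightarrow>\<^sub>0 'k::comm_ring_1) ring)"
proof (rule ringI)
 show "abelian_group (alg :: ('b \<Rightarrow>\<^sub>0 'k) ring)"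
 proof (rule abelian_groupI)
  fix x :: "'b \<Rightarrow>\<^sub>0 'k" assume "x \<in> carrier alg"
  then show "\<exists>y\<in>carrier alg. y \<oplus>\<^bsub>alg\<^esub> x = \<zero>\<^bsub>alg\<^esub>"
   by (intro bexI[of _ "- x"]) (auto simp: alg_def)
 qed (auto simp: alg_def add.assoc add.commute dest!: subsetD[OF keys_add])
 show "monoid (alg :: ('b \<Rightarrow>\<^sub>0 'k) ring)"
 proof (rule monoidI)
  fix x y :: "'b \<Rightarrow>\<^sub>0 'k" assume "x \<in> carrier alg" "y \<in> carrier alg"
  then show "x \<otimes>\<^bsub>alg\<^esub> y \<in> carrier alg"
   using basis_mult_closed[of x y] by (simp add: alg_def)
 next
  show "\<one>\<^bsub>alg :: ('b \<Rightarrow>\<^sub>0 'k) ring\<^esub> \<in> carrier alg" using keys_unit by (simp add: alg_def)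
 qed (simp_all add: alg_def basis_mult_assoc basis_mult_unit_left basis_mult_unit_right)
qed (auto simp: alg_def basis_mult_add_left basis_mult_add_right)

end

subsection \<open>Matrix representations\<close>

definition mat_ext :: "('b => 'i => 'i => 'k::comm_ring_1) => ('b \<Rightarrow>\<^sub>0 'k) => 'i => 'i => 'k" where
 "mat_ext \<rho> a b b' = (\<Sum>x\<in>keys a. lookup a x * \<rho> x b b')"

lemma mat_ext_add: "mat_ext \<rho> (a + a') b b' = mat_ext \<rho> a b b' + mat_ext \<rho> a' b b'"
 unfolding mat_ext_def by (rule sum_keys_add) (auto simp: algebra_simps)

lemma mat_ext_single [simp]: "mat_ext \<rho> (single x c) b b' = c * \<rho> x b b'"
 unfolding mat_ext_def by (rule sum_keys_single) auto

lemma mat_ext_zero [simp]: "mat_ext \<rho> 0 b b' = 0"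
 by (simp add: mat_ext_def)

lemma mat_ext_sum: "mat_ext \<rho> (sum f A) b b' = (\<Sum>i\<in>A. mat_ext \<rho> (f i) b b')"
 by (induction A rule: infinite_finite_induct) (auto simp: mat_ext_add)

lemma mat_ext_scale: "mat_ext \<rho> (Poly_Mapping.map ((*) c) a) b b' = c * mat_ext \<rho> a b b'"
proof -
 have "keys (Poly_Mapping.map ((*) c) a) \<subseteq> keys a"
  by (auto simp: in_keys_iff Poly_Mapping.map.rep_eq when_def)
 then have "mat_ext \<rho> (Poly_Mapping.map ((*) c) a) b b'
   = (\<Sum>x\<in>keys a. lookup (Poly_Mapping.map ((*) c) a) x * \<rho> x b b')"
  unfolding mat_ext_def by (intro sum_keys_superset) auto
 also have "... = c * mat_ext \<rho> a b b'"
  unfolding mat_ext_def sum_distrib_left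
  by (intro sum.cong) (auto simp: Poly_Mapping.map.rep_eq in_keys_iff mult.assoc)
 finally show ?thesis .
qed

text \<open>A representation has to be checked on products of basis elements only.\<close>

lemma mat_ext_mult:
 assumes "keys f \<subseteq> B" "keys g \<subseteq> B"
  and rep: "\<And>x y. x \<in> B ==> y \<in> B ==>
   (\<Sum>c\<in>I. \<rho> x b c * \<rho> y c b') = (case m x y of None => 0 | Some z => \<rho> z b b')"
 shows "mat_ext \<rho> (basis_mult m f g) b b' = (\<Sum>c\<in>I. mat_ext \<rho> f b c * mat_ext \<rho> g c b')"
 using assms(1)
proof (induction f rule: poly_mapping_span_induct)
 case (single x a)
 note x = this
 show ?case using assms(2)
 proof (induction g rule: poly_mapping_span_induct)
  case (single y c)
  have "(\<Sum>i\<in>I. a * \<rho> x b i * (c * \<rho> y i b')) = a * c * (\<Sum>i\<in>I. \<rho> x b i * \<rho> y i b')"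
   by (simp add: sum_distrib_left algebra_simps)
  then show ?case using rep[OF x single]
   by (auto simp: basis_mult_single split: option.splits)
 qed (auto simp: basis_mult_add_right mat_ext_add algebra_simps sum.distrib)
qed (auto simp: basis_mult_add_left mat_ext_add algebra_simps sum.distrib)

section \<open>The truncated path algebra\<close>

lemma path_based_algebra: "based_algebra ({..<n} \<times> UNIV) (path_comp n) ((%i. (i, 0)) ` {..<n})"
proof
 fix x assume x: "x \<in> {..<n} \<times> (UNIV :: nat set)"
 show "\<exists>e\<in>(%i. (i, 0)) ` {..<n}. path_comp n e x = Some x \<and>
   (\<forall>e'\<in>(%i. (i, 0)) ` {..<n}. e' \<noteq> e --> path_comp n e' x = None)"
  using x by (intro bexI[of _ "((fst x + snd x) mod n, 0)"]) (auto simp: path_comp_def)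
 show "\<exists>e\<in>(%i. (i, 0)) ` {..<n}. path_comp n x e = Some x \<and>
   (\<forall>e'\<in>(%i. (i, 0)) ` {..<n}. e' \<noteq> e --> path_comp n x e' = None)"
  using x by (intro bexI[of _ "(fst x, 0)"]) (auto simp: path_comp_def)
next
 fix x y z :: path
 show "Option.bind (path_comp n x y) (%u. path_comp n u z)
   = Option.bind (path_comp n y z) (%u. path_comp n x u)"
  by (cases "fst y = (fst z + snd z) mod n")
    (simp_all add: path_comp_def mod_add_left_eq add.assoc)
qed (auto simp: path_comp_def split: if_splits)

lemma path_algebra_alg:
 "KZ n = based_algebra.alg ({..<n} \<times> UNIV) (path_comp n) ((%i. (i, 0)) ` {..<n})"
 unfolding path_algebra_def based_algebra.alg_def[OF path_based_algebra]
 by (simp add: sum.reindex inj_on_def)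

lemma ring_path_algebra: "ring (KZ n)"
 unfolding path_algebra_alg by (rule based_algebra.ring_alg[OF path_based_algebra])

lemma path_algebra_sel [simp]:
 "carrier (KZ n) = {f. keys f \<subseteq> {..<n} \<times> UNIV}"
 "mult (KZ n) = basis_mult (path_comp n)"
 "zero (KZ n) = 0"
 "add (KZ n) = (+)"
 "one (KZ n) = (\<Sum>i<n. single (i, 0) 1)"
 by (simp_all add: path_algebra_def)

lemma uminus_path_algebra:
 assumes "f \<in> carrier (KZ n)" shows "\<ominus>\<^bsub>KZ n\<^esub> f = - f"
proof -
 interpret ring "KZ n" by (rule ring_path_algebra)
 show ?thesis using assms by (intro minus_equality) auto
qed

text \<open>The power \<open>J\<^sup>d\<close> is spanned by the paths of length at least \<open>d\<close>: such a path is a product of \<open>d\<close> paths of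
positive length, and conversely lengths add in products.\<close>

lemma trunc_ideal_eq:
 "trunc_ideal n d = {f :: path \<Rightarrow>\<^sub>0 'k::comm_ring_1. keys f \<subseteq> {..<n} \<times> {d..}}"
proof -
 interpret ring "KZ n :: (path \<Rightarrow>\<^sub>0 'k) ring" by (rule ring_path_algebra)
 define T where "T k = {f :: path \<Rightarrow>\<^sub>0 'k. keys f \<subseteq> {..<n} \<times> {k..}}" for k
 have keys_prod: "keys (basis_mult (path_comp n) f g) \<subseteq> {..<n} \<times> {k + l..}"
  if "keys f \<subseteq> {..<n} \<times> {k..}" "keys g \<subseteq> {..<n} \<times> {l..}" for k l and f g :: "path \<Rightarrow>\<^sub>0 'k"
 proof -
  have "k + l \<le> snd z \<and> fst z < n"
   if z: "x \<in> keys f" "y \<in> keys g" "path_comp n x y = Some z" for x y z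
  proof -
   have "fst y < n" "k \<le> snd x" "l \<le> snd y"
    using z \<open>keys f \<subseteq> _\<close> \<open>keys g \<subseteq> _\<close> by force+
   then show ?thesis using z(3) by (auto simp: path_comp_def split: if_splits)
  qed
  then show ?thesis using keys_basis_mult[of "path_comp n" f g] by force
 qed
 have split: "single (i, Suc k) a = basis_mult (path_comp n) (single ((i + 1) mod n, k) a) (single (i, 1) 1)"
  for i k and a :: 'k
  by (auto simp: basis_mult_single path_comp_def)
 have idealT: "ideal (T k) (KZ n)" for k
 proof (rule idealI)
  show "ring (KZ n :: (path \<Rightarrow>\<^sub>0 'k) ring)" by (rule ring_path_algebra)
  show "subgroup (T k) (add_monoid (KZ n))"
  proof (rule group.subgroupI)
   show "group (add_monoid (KZ n :: (path \<Rightarrow>\<^sub>0 'k) ring))" by (rule a_group)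
   show "T k \<subseteq> carrier (add_monoid (KZ n))" by (auto simp: T_def)
   show "T k \<noteq> {}" by (auto simp: T_def intro: exI[of _ 0])
   show "inv\<^bsub>add_monoid (KZ n)\<^esub> a \<in> T k" if "a \<in> T k" for a
   proof -
    have "\<ominus>\<^bsub>KZ n\<^esub> a = - a"
     using that by (intro uminus_path_algebra) (auto simp: T_def)
    then show ?thesis using that unfolding a_inv_def[symmetric] by (simp add: T_def)
   qed
   show "a \<otimes>\<^bsub>add_monoid (KZ n)\<^esub> b \<in> T k" if "a \<in> T k" "b \<in> T k" for a b
    using that keys_add[of a b] by (auto simp: T_def)
  qed
  fix a x :: "path \<Rightarrow>\<^sub>0 'k" assume "a \<in> T k" "x \<in> carrier (KZ n)"
  then show "x \<otimes>\<^bsub>KZ n\<^esub> a \<in> T k" "a \<otimes>\<^bsub>KZ n\<^esub> x \<in> T k"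
   using keys_prod[of x 0 a k] keys_prod[of a k x 0] by (auto simp: T_def)
 qed
 have arrow: "arrow_ideal n = T 1"
 proof
  show "arrow_ideal n \<subseteq> T 1"
   unfolding arrow_ideal_def by (rule genideal_minimal[OF idealT]) (auto simp: T_def)
  show "T 1 \<subseteq> arrow_ideal n"
  proof
   fix f assume "f \<in> T 1"
   have I: "ideal (arrow_ideal n :: 'k trunc) (KZ n)"
    unfolding arrow_ideal_def by (rule genideal_ideal) auto
   from \<open>f \<in> T 1\<close> have "keys f \<subseteq> {..<n} \<times> {1..}" by (simp add: T_def)
   then show "f \<in> arrow_ideal n"
   proof (induction f rule: poly_mapping_span_induct)
    case zero then show ?case
     using additive_subgroup.zero_closed[OF ideal.axioms(1)[OF I]] by simp
   next
    case (single x a)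
    then obtain i k where x: "x = (i, Suc k)" "i < n" by (cases x, cases "snd x") auto
    have "single (i, 1) (1::'k) \<in> arrow_ideal n"
     unfolding arrow_ideal_def
     by (rule subsetD[OF genideal_self]) (use x in auto)
    from ideal.I_l_closed[OF I this, of "single ((i + 1) mod n, k) a"]
    show ?case using x split[of i k a] by auto
   next
    case (add f g)
    then show ?case using additive_subgroup.a_closed[OF ideal.axioms(1)[OF I]] by simp
   qed
  qed
 qed
 have "trunc_ideal n k = T k" for k
 proof (induction k)
  case 0 show ?case by (auto simp: T_def)
 next
  case (Suc k)
  have "ideal_prod (KZ n) (T k) (T 1) = T (Suc k)"
  proof (intro equalityI subsetI)
   fix f assume "f \<in> ideal_prod (KZ n) (T k) (T 1)"
   then show "f \<in> T (Suc k)"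
   proof induction
    case (prod i j) then show ?case using keys_prod[of i k j 1] by (auto simp: T_def)
   next
    case (sum s1 s2) then show ?case using keys_add[of s1 s2] by (auto simp: T_def)
   qed
  next
   fix f assume "f \<in> T (Suc k)"
   then have "keys f \<subseteq> {..<n} \<times> {Suc k..}" by (simp add: T_def)
   then show "f \<in> ideal_prod (KZ n) (T k) (T 1)"
   proof (induction f rule: poly_mapping_span_induct)
    case zero
    show ?case using ideal_prod.prod[of 0 "T k" 0 "T 1" "KZ n"] by (simp add: T_def)
   next
    case (single x a)
    then obtain i l where x: "x = (i, Suc l)" "i < n" "k \<le> l" by (cases x, cases "snd x") auto
    have "single ((i + 1) mod n, l) a \<otimes>\<^bsub>KZ n\<^esub> single (i, 1) 1
      \<in> ideal_prod (KZ n) (T k) (T 1)"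
     by (rule ideal_prod.prod) (use x in \<open>auto simp: T_def\<close>)
    then show ?case using split[of i l a] x by simp
   next
    case (add f g)
    from ideal_prod.sum[OF add(3,4)] show ?case by simp
   qed
  qed
  then show ?case using Suc arrow by simp
 qed
 then show ?thesis by (simp add: T_def)
qed

lemma ideal_trunc_ideal: "ideal (trunc_ideal n d) (KZ n :: (path \<Rightarrow>\<^sub>0 'k::comm_ring_1) ring)"
proof -
 interpret ring "KZ n :: (path \<Rightarrow>\<^sub>0 'k) ring" by (rule ring_path_algebra)
 have "ideal (arrow_ideal n :: 'k trunc) (KZ n)"
  unfolding arrow_ideal_def by (rule genideal_ideal) auto
 then show ?thesis
  by (induction d) (simp_all add: oneideal ideal_prod_is_ideal del: path_algebra_sel)
qed

lemma ring_trunc_algebra: "ring (KZJ n d)"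
 unfolding trunc_algebra_def by (rule ideal.quotient_is_ring[OF ideal_trunc_ideal])

lemma trunc_class_ring_hom: "trunc_class n d \<in> ring_hom (KZ n) (KZJ n d)"
 unfolding trunc_algebra_def trunc_class_def by (rule ideal.rcos_ring_hom[OF ideal_trunc_ideal])

lemma carrier_trunc_algebra:
 "carrier (KZJ n d) = trunc_class n d ` carrier (KZ n)"
 unfolding trunc_algebra_def FactRing_def A_RCOSETS_def' trunc_class_def by auto

lemma trunc_class_closed [simp, intro]:
 "a \<in> carrier (KZ n) ==> trunc_class n d a \<in> carrier (KZJ n d)"
 by (auto simp: carrier_trunc_algebra)

lemma mem_trunc_class:
 assumes "a \<in> carrier (KZ n)"
 shows "b \<in> trunc_class n d a \<longleftrightarrow>
   keys b \<subseteq> {..<n} \<times> UNIV \<and> (\<forall>x\<in>keys (b - a). d \<le> snd x)"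
proof -
 have "b \<in> trunc_class n d a \<longleftrightarrow> (\<exists>h. keys h \<subseteq> {..<n} \<times> {d..} \<and> b = h + a)"
  by (auto simp: trunc_class_def a_r_coset_def' trunc_ideal_eq)
 also have "... \<longleftrightarrow> keys (b - a) \<subseteq> {..<n} \<times> {d..}"
  by (auto intro: exI[of _ "b - a"])
 also have "... \<longleftrightarrow> keys b \<subseteq> {..<n} \<times> UNIV \<and> (\<forall>x\<in>keys (b - a). d \<le> snd x)"
 proof
  assume l: "keys (b - a) \<subseteq> {..<n} \<times> {d..}"
  have "keys b \<subseteq> keys (b - a) \<union> keys a" using keys_add[of "b - a" a] by simp
  with l assms show "keys b \<subseteq> {..<n} \<times> UNIV \<and> (\<forall>x\<in>keys (b - a). d \<le> snd x)" by force
 next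
  assume r: "keys b \<subseteq> {..<n} \<times> UNIV \<and> (\<forall>x\<in>keys (b - a). d \<le> snd x)"
  have "keys (b - a) \<subseteq> keys b \<union> keys a" by (rule keys_diff)
  with r assms show "keys (b - a) \<subseteq> {..<n} \<times> {d..}" by force
 qed
 finally show ?thesis .
qed

lemma trunc_class_self: "a \<in> carrier (KZ n) ==> a \<in> trunc_class n d a"
 by (simp add: mem_trunc_class)

lemma trunc_class_eqI:
 assumes "b \<in> trunc_class n d a" "a \<in> carrier (KZ n)"
 shows "trunc_class n d b = trunc_class n d a"
proof -
 interpret ideal "trunc_ideal n d" "KZ n" by (rule ideal_trunc_ideal)
 from a_repr_independence'[OF assms[unfolded trunc_class_def]]
 show ?thesis unfolding trunc_class_def ..
qed

section \<open>Modules over the truncated path algebra as graded matrices\<close>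

text \<open>A basis with degrees and the matrix of the operator \<open>X\<close>. The path of length \<open>k\<close> with start \<open>i\<close> acts as the
projection to degree \<open>i\<close> followed by \<open>X\<^sup>k\<close>.\<close>

record ('i, 'k) gdata =
 idx :: "'i set"
 deg :: "'i => nat"
 mat :: "'i => 'i => 'k"

type_synonym 'k gdata2 = "(nat \<times> nat, 'k) gdata"

primrec pow_mat :: "('i, 'k::field) gdata => nat => 'i => 'i => 'k" where
 "pow_mat C 0 = (%b b'. of_bool (b = b'))"
| "pow_mat C (Suc k) = (%b b'. \<Sum>c\<in>idx C. mat C b c * pow_mat C k c b')"

text \<open>The last two conditions say that \<open>X\<close> has degree \<open>1\<close> and that \<open>X\<^sup>d = 0\<close>, so that paths of length \<open>d\<close> act
as zero and the action of \<open>KZ\<^sub>n\<close> descends to the quotient by \<open>J\<^sup>d\<close>.\<close>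

definition gvalid :: "nat => nat => ('i, 'k::field) gdata => bool" where
 "gvalid n d C \<longleftrightarrow> finite (idx C) \<and> (\<forall>b\<in>idx C. deg C b < n) \<and>
   (\<forall>b\<in>idx C. \<forall>b'\<in>idx C. mat C b b' \<noteq> 0 --> deg C b = (deg C b' + 1) mod n) \<and>
   (\<forall>b\<in>idx C. \<forall>b'\<in>idx C. pow_mat C d b b' = 0)"

definition path_mat :: "('i, 'k::field) gdata => path => 'i => 'i => 'k" where
 "path_mat C x b b' = pow_mat C (snd x) b b' * of_bool (deg C b' = fst x)"

definition cact :: "('i, 'k::field) gdata => (path \<Rightarrow>\<^sub>0 'k) => ('i => 'k) => ('i => 'k)" where
 "cact C a v = (%b. if b \<in> idx C then \<Sum>b'\<in>idx C. mat_ext (path_mat C) a b b' * v b' else 0)"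

definition gspace :: "('i, 'k::field) gdata => ('i => 'k) set" where
 "gspace C = {v. \<forall>b. b \<notin> idx C --> v b = 0}"

text \<open>Elements of \<open>KZ\<^sub>n/J\<^sup>d\<close> are cosets and act through an arbitrary representative; the choice is immaterial
by \<open>cact_trunc\<close>.\<close>

definition gmod :: "('i, 'k::field) gdata => ('k trunc, 'i => 'k) module" where
 "gmod C = \<lparr>carrier = gspace C, mult = undefined, one = undefined, zero = (%_. 0),
   add = (%v w b. v b + w b), smult = (%h. cact C (SOME a. a \<in> h))\<rparr>"

lemma gmod_sel [simp]:
 "carrier (gmod C) = gspace C" "zero (gmod C) = (%_. 0)" "add (gmod C) = (%v w b. v b + w b)"
 by (simp_all add: gmod_def)

lemma gspaceD: "v \<in> gspace C ==> b \<notin> idx C ==> v b = 0"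
 by (simp add: gspace_def)

lemma gspace_zero [simp]: "(%_. 0) \<in> gspace C"
 and gspace_add [intro]: "v \<in> gspace C ==> w \<in> gspace C ==> (%b. v b + w b) \<in> gspace C"
 and gspace_scale [intro]: "v \<in> gspace C ==> (%b. c * v b) \<in> gspace C"
 and gspace_cact [simp, intro]: "cact C a v \<in> gspace C"
 by (auto simp: gspace_def cact_def)

lemma gspace_sum: "(\<And>i. i \<in> A ==> f i \<in> gspace C) ==> (%b. \<Sum>i\<in>A. f i b) \<in> gspace C"
 by (auto simp: gspace_def intro!: sum.neutral)

lemma cact_add_right: "cact C a (%b. v b + w b) = (%b. cact C a v b + cact C a w b)"
 by (auto simp: cact_def fun_eq_iff algebra_simps sum.distrib)

lemma cact_add_left: "cact C (a + a') v = (%b. cact C a v b + cact C a' v b)"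
 by (auto simp: cact_def fun_eq_iff algebra_simps mat_ext_add sum.distrib)

lemma gvalid_finite: "gvalid n d C ==> finite (idx C)"
 and gvalid_deg: "gvalid n d C ==> b \<in> idx C ==> deg C b < n"
 and gvalid_mat: "gvalid n d C ==> b \<in> idx C ==> b' \<in> idx C ==> mat C b b' \<noteq> 0
   ==> deg C b = (deg C b' + 1) mod n"
 and gvalid_pow: "gvalid n d C ==> b \<in> idx C ==> b' \<in> idx C ==> pow_mat C d b b' = 0"
 by (auto simp: gvalid_def)

lemma pow_mat_add:
 assumes "finite (idx C)" "b \<in> idx C"
 shows "(\<Sum>c\<in>idx C. pow_mat C k b c * pow_mat C l c b') = pow_mat C (k + l) b b'"
 using assms(2)
proof (induction k arbitrary: b)
 case 0
 have "(\<Sum>c\<in>idx C. of_bool (b = c) * pow_mat C l c b') = (\<Sum>c\<in>idx C. if c = b then pow_mat C l c b' else 0)"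
  by (intro sum.cong) auto
 then show ?case using assms(1) 0 by simp
next
 case (Suc k)
 have "(\<Sum>c\<in>idx C. pow_mat C (Suc k) b c * pow_mat C l c b')
   = (\<Sum>c\<in>idx C. \<Sum>e\<in>idx C. mat C b e * (pow_mat C k e c * pow_mat C l c b'))"
  by (simp add: sum_distrib_right mult.assoc)
 also have "... = (\<Sum>e\<in>idx C. mat C b e * (\<Sum>c\<in>idx C. pow_mat C k e c * pow_mat C l c b'))"
  by (subst sum.swap) (simp add: sum_distrib_left)
 also have "... = pow_mat C (Suc k + l) b b'"
  using Suc.IH by (simp cong: sum.cong)
 finally show ?case .
qed

lemma pow_mat_ge:
 assumes "gvalid n d C" "b \<in> idx C" "b' \<in> idx C" "d \<le> k"
 shows "pow_mat C k b b' = 0"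
proof -
 have "pow_mat C k b b' = (\<Sum>c\<in>idx C. pow_mat C d b c * pow_mat C (k - d) c b')"
  using pow_mat_add[OF gvalid_finite[OF assms(1)] assms(2), of d "k - d" b'] assms(4) by simp
 also have "... = 0" using gvalid_pow[OF assms(1,2)] by (auto intro: sum.neutral)
 finally show ?thesis .
qed

lemma pow_mat_deg:
 assumes "gvalid n d C" "b \<in> idx C" "b' \<in> idx C" "pow_mat C k b b' \<noteq> 0"
 shows "deg C b = (deg C b' + k) mod n"
 using assms(2,4)
proof (induction k arbitrary: b)
 case 0
 then show ?case using gvalid_deg[OF assms(1)] by (auto split: if_splits)
next
 case (Suc k)
 from Suc.prems(2) obtain c where c: "c \<in> idx C" "mat C b c \<noteq> 0" "pow_mat C k c b' \<noteq> 0"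
  by (auto elim!: sum.not_neutral_contains_not_neutral)
 from gvalid_mat[OF assms(1) Suc.prems(1) c(1,2)] Suc.IH[OF c(1,3)]
 show ?case by (simp add: mod_Suc_eq)
qed

lemma path_mat_mult:
 assumes C: "gvalid n d C" "b \<in> idx C" "b' \<in> idx C"
  and x: "x \<in> {..<n} \<times> UNIV" "y \<in> {..<n} \<times> UNIV"
 shows "(\<Sum>c\<in>idx C. path_mat C x b c * path_mat C y c b')
  = (case path_comp n x y of None => 0 | Some z => path_mat C z b b')"
proof -
 have z: "pow_mat C (snd y) c b' = 0"
  if "c \<in> idx C" "deg C b' = fst y" "deg C c \<noteq> (fst y + snd y) mod n" for c
  using pow_mat_deg[OF C(1) that(1) C(3)] that by metis
 have "(\<Sum>c\<in>idx C. path_mat C x b c * path_mat C y c b')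
  = (\<Sum>c\<in>idx C. of_bool (deg C b' = fst y \<and> fst x = (fst y + snd y) mod n)
     * (pow_mat C (snd x) b c * pow_mat C (snd y) c b'))"
  by (intro sum.cong refl) (use z in \<open>auto simp: path_mat_def\<close>)
 also have "... = of_bool (deg C b' = fst y \<and> fst x = (fst y + snd y) mod n)
   * pow_mat C (snd x + snd y) b b'"
  unfolding sum_distrib_left[symmetric] using pow_mat_add[OF gvalid_finite[OF C(1)] C(2)] by simp
 also have "... = (case path_comp n x y of None => 0 | Some z => path_mat C z b b')"
  by (auto simp: path_comp_def path_mat_def add.commute)
 finally show ?thesis .
qed

lemma cact_mult:
 assumes C: "gvalid n d C" and a: "a \<in> carrier (KZ n)" "a' \<in> carrier (KZ n)"
 shows "cact C (a \<otimes>\<^bsub>KZ n\<^esub> a') v = cact C a (cact C a' v)"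
proof
 fix b
 show "cact C (a \<otimes>\<^bsub>KZ n\<^esub> a') v b = cact C a (cact C a' v) b"
 proof (cases "b \<in> idx C")
  case True
  have "cact C (a \<otimes>\<^bsub>KZ n\<^esub> a') v b = (\<Sum>b'\<in>idx C. (\<Sum>c\<in>idx C.
    mat_ext (path_mat C) a b c * mat_ext (path_mat C) a' c b') * v b')"
   using True a unfolding cact_def path_algebra_sel
   by (auto intro!: sum.cong arg_cong2[of _ _ _ _ "(*)"]
     mat_ext_mult[where B = "{..<n} \<times> UNIV"] path_mat_mult[OF C])
  also have "... = (\<Sum>c\<in>idx C. \<Sum>b'\<in>idx C.
    mat_ext (path_mat C) a b c * (mat_ext (path_mat C) a' c b' * v b'))"
   unfolding sum_distrib_right by (subst sum.swap) (simp add: mult.assoc)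
  also have "... = cact C a (cact C a' v) b"
   using True by (simp add: cact_def sum_distrib_left)
  finally show ?thesis .
 qed (auto simp: cact_def)
qed

lemma cact_vertices:
 assumes C: "gvalid n d C" and v: "v \<in> gspace C"
 shows "cact C (\<Sum>i<n. single (i, 0) c) v = (%b. c * v b)"
proof
 fix b
 show "cact C (\<Sum>i<n. single (i, 0) c) v b = c * v b"
 proof (cases "b \<in> idx C")
  case True
  have "cact C (\<Sum>i<n. single (i, 0) c) v b
    = (\<Sum>b'\<in>idx C. (\<Sum>i<n. if i = deg C b' then c * of_bool (b = b') else 0) * v b')"
   using True unfolding cact_def mat_ext_sum
   by (auto simp: path_mat_def intro!: sum.cong)
  also have "... = (\<Sum>b'\<in>idx C. if b' = b then c * v b else 0)"
   by (intro sum.cong) (use gvalid_deg[OF C] in auto)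
  also have "... = c * v b" using True gvalid_finite[OF C] by simp
  finally show ?thesis .
 qed (use v in \<open>auto simp: cact_def gspace_def\<close>)
qed

lemma cact_single:
 "cact C (single (i, k) c) v = (%b. if b \<in> idx C then
   c * (\<Sum>b' | b' \<in> idx C \<and> deg C b' = i. pow_mat C k b b' * v b') else 0)"
 if "finite (idx C)"
proof
 fix b
 have "(\<Sum>b'\<in>idx C. c * path_mat C (i, k) b b' * v b')
  = (\<Sum>b' | b' \<in> idx C \<and> deg C b' = i. c * (pow_mat C k b b' * v b'))"
  using that by (intro sum.mono_neutral_cong_right) (auto simp: path_mat_def)
 then show "cact C (single (i, k) c) v b = (if b \<in> idx C then
   c * (\<Sum>b' | b' \<in> idx C \<and> deg C b' = i. pow_mat C k b b' * v b') else 0)"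
  by (simp add: cact_def sum_distrib_left)
qed

lemma cact_trunc:
 assumes C: "gvalid n d C" and a: "a \<in> carrier (KZ n)" "a' \<in> trunc_class n d a"
 shows "cact C a' v = cact C a v"
proof -
 have "mat_ext (path_mat C) (a' - a) b b' = 0" if "b \<in> idx C" "b' \<in> idx C" for b b'
  using a that unfolding mat_ext_def
  by (intro sum.neutral ballI) (auto simp: mem_trunc_class path_mat_def pow_mat_ge[OF C])
 then have "mat_ext (path_mat C) a' b b' = mat_ext (path_mat C) a b b'"
  if "b \<in> idx C" "b' \<in> idx C" for b b'
  using that mat_ext_add[of "path_mat C" "a' - a" a] by simp
 then show ?thesis by (auto simp: cact_def fun_eq_iff)
qed

lemma gmod_smult:
 assumes C: "gvalid n d C" and a: "a \<in> carrier (KZ n)"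
 shows "trunc_class n d a \<odot>\<^bsub>gmod C\<^esub> v = cact C a v"
proof -
 have "(SOME a'. a' \<in> trunc_class n d a) \<in> trunc_class n d a"
  using trunc_class_self[OF a] by (rule someI)
 then show ?thesis using cact_trunc[OF C a] by (simp add: gmod_def)
qed

lemma trunc_algebra_cases:
 assumes "h \<in> carrier (KZJ n d)"
 obtains a where "a \<in> carrier (KZ n)" "h = trunc_class n d a"
 using assms by (auto simp: carrier_trunc_algebra simp del: path_algebra_sel)

lemma trunc_class_add:
 "a \<in> carrier (KZ n) ==> b \<in> carrier (KZ n) ==>
  trunc_class n d (a + b) = trunc_class n d a \<oplus>\<^bsub>KZJ n d\<^esub> trunc_class n d b"
 using ring_hom_add[OF trunc_class_ring_hom, of a n b d] by simp

lemma trunc_class_mult: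
 "a \<in> carrier (KZ n) ==> b \<in> carrier (KZ n) ==>
  trunc_class n d (basis_mult (path_comp n) a b)
   = trunc_class n d a \<otimes>\<^bsub>KZJ n d\<^esub> trunc_class n d b"
 using ring_hom_mult[OF trunc_class_ring_hom, of a n b d] by simp

lemma trunc_class_one:
 "trunc_class n d (\<Sum>i<n. single (i, 0) 1) = \<one>\<^bsub>KZJ n d\<^esub>"
 using ring_hom_one[OF trunc_class_ring_hom, of n d] by simp

lemma unit_closed: "(\<Sum>i<n. single (i, 0) c) \<in> carrier (KZ n)"
proof -
 have "keys (\<Sum>i<n. single (i, 0::nat) c) \<subseteq> (\<Union>i<n. keys (single (i, 0::nat) c))" by (rule keys_sum)
 then show ?thesis by (auto split: if_splits)
qed

lemma path_algebra_add_closed [simp]: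
 "keys a \<subseteq> B ==> keys b \<subseteq> B ==> keys (a + b) \<subseteq> B"
 using keys_add[of a b] by blast

lemma path_algebra_mult_closed:
 "a \<in> carrier (KZ n) ==> b \<in> carrier (KZ n) ==>
  basis_mult (path_comp n) a b \<in> carrier (KZ n)"
 using ring.ring_simprules(5)[OF ring_path_algebra] by (metis path_algebra_sel(2))

lemma left_module_gmod:
 assumes C: "gvalid n d (C :: ('i, 'k::field) gdata)"
 shows "left_module (KZJ n d) (gmod C)"
proof (intro left_module.intro ring_trunc_algebra left_module_axioms.intro)
 show "abelian_group (gmod C)"
 proof (rule abelian_groupI)
  fix x assume "x \<in> carrier (gmod C)"
  then show "\<exists>y\<in>carrier (gmod C). y \<oplus>\<^bsub>gmod C\<^esub> x = \<zero>\<^bsub>gmod C\<^esub>"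
   by (intro bexI[of _ "%b. - x b"]) (auto simp: gspace_def)
 qed (auto simp: gspace_def add.assoc add.commute)
next
 fix h :: "'k trunc" and x assume "h \<in> carrier (KZJ n d)" "x \<in> carrier (gmod C)"
 then show "h \<odot>\<^bsub>gmod C\<^esub> x \<in> carrier (gmod C)"
  by (auto elim!: trunc_algebra_cases simp: gmod_smult[OF C])
next
 fix h h' :: "'k trunc" and x assume h: "h \<in> carrier (KZJ n d)" "h' \<in> carrier (KZJ n d)"
  and x: "x \<in> carrier (gmod C)"
 from h(1) obtain a where a: "a \<in> carrier (KZ n)" "h = trunc_class n d a"
  by (rule trunc_algebra_cases)
 from h(2) obtain a' where a': "a' \<in> carrier (KZ n)" "h' = trunc_class n d a'"
  by (rule trunc_algebra_cases)
 have "a + a' \<in> carrier (KZ n)" using a(1) a'(1) by simp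
 then show "(h \<oplus>\<^bsub>KZJ n d\<^esub> h') \<odot>\<^bsub>gmod C\<^esub> x = h \<odot>\<^bsub>gmod C\<^esub> x \<oplus>\<^bsub>gmod C\<^esub> h' \<odot>\<^bsub>gmod C\<^esub> x"
  using a a' by (simp add: trunc_class_add[symmetric] gmod_smult[OF C] cact_add_left)
 show "(h \<otimes>\<^bsub>KZJ n d\<^esub> h') \<odot>\<^bsub>gmod C\<^esub> x = h \<odot>\<^bsub>gmod C\<^esub> (h' \<odot>\<^bsub>gmod C\<^esub> x)"
  unfolding a(2) a'(2) trunc_class_mult[OF a(1) a'(1), symmetric]
  using gmod_smult[OF C] a(1) a'(1) path_algebra_mult_closed[OF a(1) a'(1)]
   cact_mult[OF C a(1) a'(1)] by simp
next
 fix h :: "'k trunc" and x y assume "h \<in> carrier (KZJ n d)" "x \<in> carrier (gmod C)" "y \<in> carrier (gmod C)"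
 then show "h \<odot>\<^bsub>gmod C\<^esub> (x \<oplus>\<^bsub>gmod C\<^esub> y) = h \<odot>\<^bsub>gmod C\<^esub> x \<oplus>\<^bsub>gmod C\<^esub> h \<odot>\<^bsub>gmod C\<^esub> y"
  by (auto elim!: trunc_algebra_cases simp: gmod_smult[OF C] cact_add_right)
next
 fix x assume "x \<in> carrier (gmod C)"
 then show "\<one>\<^bsub>KZJ n d\<^esub> \<odot>\<^bsub>gmod C\<^esub> x = x"
  unfolding trunc_class_one[symmetric] using cact_vertices[OF C, of x 1] gmod_smult[OF C unit_closed[of 1]]
  by simp
qed

section \<open>Homomorphisms\<close>

definition mod_hom :: "('r, 'y) ring_scheme => ('r, 'v) module => ('r, 'u) module => ('v => 'u) => bool" where
 "mod_hom R M N f \<longleftrightarrow> f ` carrier M \<subseteq> carrier N \<and>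
    (\<forall>x\<in>carrier M. \<forall>y\<in>carrier M. f (x \<oplus>\<^bsub>M\<^esub> y) = f x \<oplus>\<^bsub>N\<^esub> f y) \<and>
    (\<forall>a\<in>carrier R. \<forall>x\<in>carrier M. f (a \<odot>\<^bsub>M\<^esub> x) = a \<odot>\<^bsub>N\<^esub> f x)"

lemma mod_homI:
 assumes "\<And>x. x \<in> carrier M ==> f x \<in> carrier N"
  and "\<And>x y. x \<in> carrier M ==> y \<in> carrier M ==> f (x \<oplus>\<^bsub>M\<^esub> y) = f x \<oplus>\<^bsub>N\<^esub> f y"
  and "\<And>a x. a \<in> carrier R ==> x \<in> carrier M ==> f (a \<odot>\<^bsub>M\<^esub> x) = a \<odot>\<^bsub>N\<^esub> f x"
 shows "mod_hom R M N f"
 using assms by (auto simp: mod_hom_def)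

lemma mod_homD:
 assumes "mod_hom R M N f"
 shows "\<And>x. x \<in> carrier M ==> f x \<in> carrier N"
  and "\<And>x y. x \<in> carrier M ==> y \<in> carrier M ==> f (x \<oplus>\<^bsub>M\<^esub> y) = f x \<oplus>\<^bsub>N\<^esub> f y"
  and "\<And>a x. a \<in> carrier R ==> x \<in> carrier M ==> f (a \<odot>\<^bsub>M\<^esub> x) = a \<odot>\<^bsub>N\<^esub> f x"
 using assms by (auto simp: mod_hom_def)

lemma mod_hom_comp:
 "mod_hom R M N f ==> mod_hom R N P g ==> mod_hom R M P (%x. g (f x))"
 by (simp add: mod_hom_def image_subset_iff)

lemma mod_hom_zero:
 assumes "mod_hom R M N f" "left_module R M" "left_module R N"
 shows "f \<zero>\<^bsub>M\<^esub> = \<zero>\<^bsub>N\<^esub>"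
proof -
 interpret M: left_module R M by fact
 interpret N: left_module R N by fact
 have "f \<zero>\<^bsub>M\<^esub> \<in> carrier N" using assms(1) by (simp add: mod_hom_def image_subset_iff)
 moreover have "f \<zero>\<^bsub>M\<^esub> \<oplus>\<^bsub>N\<^esub> f \<zero>\<^bsub>M\<^esub> = f \<zero>\<^bsub>M\<^esub>"
  using mod_homD(2)[OF assms(1), of "\<zero>\<^bsub>M\<^esub>" "\<zero>\<^bsub>M\<^esub>"] by simp
 ultimately show ?thesis using N.add.l_cancel_one by blast
qed

lemma module_isomorphic_alt:
 "module_isomorphic R M N \<longleftrightarrow> (\<exists>f. bij_betw f (carrier M) (carrier N) \<and> mod_hom R M N f)"
 by (auto simp: module_isomorphic_def mod_hom_def bij_betw_def)

lemma module_isomorphic_refl: "module_isomorphic R M M"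
 by (auto simp: module_isomorphic_def intro!: exI[of _ id])

lemma module_isomorphic_trans:
 assumes "module_isomorphic R M N" "module_isomorphic R N P"
 shows "module_isomorphic R M P"
 using assms unfolding module_isomorphic_alt
 by (meson bij_betw_trans[unfolded comp_def] mod_hom_comp)

lemma mod_hom_inv:
 assumes "left_module R M" "bij_betw f (carrier M) (carrier N)" "mod_hom R M N f"
 shows "mod_hom R N M (inv_into (carrier M) f)"
proof -
 interpret M: left_module R M by fact
 have f: "inj_on f (carrier M)" "f ` carrier M = carrier N" using assms(2) by (auto simp: bij_betw_def)
 let ?g = "inv_into (carrier M) f"
 have g: "?g y \<in> carrier M" "f (?g y) = y" if "y \<in> carrier N" for y
  using that f by (auto simp: f_inv_into_f inv_into_into)
 have gf: "?g (f x) = x" if "x \<in> carrier M" for x using that f(1) by simp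
 show ?thesis
 proof (rule mod_homI)
  fix x y assume xy: "x \<in> carrier N" "y \<in> carrier N"
  have "?g (x \<oplus>\<^bsub>N\<^esub> y) = ?g (f (?g x \<oplus>\<^bsub>M\<^esub> ?g y))"
   using xy g mod_homD(2)[OF assms(3)] by simp
  then show "?g (x \<oplus>\<^bsub>N\<^esub> y) = ?g x \<oplus>\<^bsub>M\<^esub> ?g y" using xy g gf by simp
 next
  fix a x assume ax: "a \<in> carrier R" "x \<in> carrier N"
  have "?g (a \<odot>\<^bsub>N\<^esub> x) = ?g (f (a \<odot>\<^bsub>M\<^esub> ?g x))"
   using ax g mod_homD(3)[OF assms(3)] by simp
  then show "?g (a \<odot>\<^bsub>N\<^esub> x) = a \<odot>\<^bsub>M\<^esub> ?g x" using ax g gf M.smult_closed by simp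
 qed (use g in auto)
qed

lemma module_isomorphic_sym:
 assumes "left_module R M" "module_isomorphic R M N"
 shows "module_isomorphic R N M"
 using assms mod_hom_inv bij_betw_inv_into unfolding module_isomorphic_alt by blast

lemma left_module_transport:
 assumes N: "left_module R N" and f: "bij_betw f (carrier M) (carrier N)" "mod_hom R M N f"
  and closed: "\<And>x y. x \<in> carrier M ==> y \<in> carrier M ==> x \<oplus>\<^bsub>M\<^esub> y \<in> carrier M"
   "\<And>a x. a \<in> carrier R ==> x \<in> carrier M ==> a \<odot>\<^bsub>M\<^esub> x \<in> carrier M"
  and zero: "\<zero>\<^bsub>M\<^esub> \<in> carrier M" "f \<zero>\<^bsub>M\<^esub> = \<zero>\<^bsub>N\<^esub>"
 shows "left_module R M"
proof -
 interpret N: left_module R N by fact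
 have inj: "x = y" if "f x = f y" "x \<in> carrier M" "y \<in> carrier M" for x y
  using that f(1) by (auto simp: bij_betw_def inj_on_def)
 have fc: "f x \<in> carrier N" if "x \<in> carrier M" for x
  using that f(1) by (auto simp: bij_betw_def)
 note [simp] = mod_homD(2,3)[OF f(2)] closed zero fc N.smult_closed
 show ?thesis
 proof (intro left_module.intro left_module_axioms.intro abelian_groupI)
  show "ring R" by (rule N.ring_axioms)
  fix x assume x: "x \<in> carrier M"
  show "\<exists>y\<in>carrier M. y \<oplus>\<^bsub>M\<^esub> x = \<zero>\<^bsub>M\<^esub>"
  proof -
   obtain y where y: "y \<in> carrier M" "f y = \<ominus>\<^bsub>N\<^esub> f x"
    using f(1) x fc N.a_inv_closed unfolding bij_betw_def by (metis imageE)
   then have "y \<oplus>\<^bsub>M\<^esub> x = \<zero>\<^bsub>M\<^esub>" using x by (intro inj) (auto simp: N.l_neg)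
   with y show ?thesis by blast
  qed
 qed (auto intro!: inj simp: N.smult_l_distr N.smult_r_distr N.smult_assoc1 N.smult_one
    N.add.m_assoc N.add.m_comm N.add.m_lcomm N.R.ring_simprules)
qed

lemma submodule_kernel:
 assumes f: "mod_hom R M N f" and M: "left_module R M" and N: "left_module R N"
 shows "submodule {x \<in> carrier M. f x = \<zero>\<^bsub>N\<^esub>} R M"
proof -
 interpret M: left_module R M by fact
 interpret N: left_module R N by fact
 show ?thesis
 proof (intro submodule.intro submodule_axioms.intro M.add.subgroupI)
  fix a assume a: "a \<in> {x \<in> carrier M. f x = \<zero>\<^bsub>N\<^esub>}"
  have "f (\<ominus>\<^bsub>M\<^esub> a) \<oplus>\<^bsub>N\<^esub> f a = \<zero>\<^bsub>N\<^esub>"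
   using a mod_homD(2)[OF f, of "\<ominus>\<^bsub>M\<^esub> a" a] mod_hom_zero[OF f M N] by (simp add: M.l_neg)
  then show "\<ominus>\<^bsub>M\<^esub> a \<in> {x \<in> carrier M. f x = \<zero>\<^bsub>N\<^esub>}"
   using a mod_homD(1)[OF f, of "\<ominus>\<^bsub>M\<^esub> a"] by simp
 next
  fix a x assume "a \<in> carrier R" "x \<in> {x \<in> carrier M. f x = \<zero>\<^bsub>N\<^esub>}"
  moreover have "a \<odot>\<^bsub>N\<^esub> \<zero>\<^bsub>N\<^esub> = \<zero>\<^bsub>N\<^esub>" if "a \<in> carrier R" for a
   using that N.smult_r_distr[of a "\<zero>\<^bsub>N\<^esub>" "\<zero>\<^bsub>N\<^esub>"] N.smult_closed[of a "\<zero>\<^bsub>N\<^esub>"]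
   by (metis N.add.l_cancel_one N.zero_closed N.l_zero)
  ultimately show "a \<odot>\<^bsub>M\<^esub> x \<in> {x \<in> carrier M. f x = \<zero>\<^bsub>N\<^esub>}"
   using mod_homD(3)[OF f] M.smult_closed by simp
 qed (use mod_hom_zero[OF f M N] mod_homD(2)[OF f] in auto)
qed

lemma submodule_image:
 assumes f: "mod_hom R M N f" and M: "left_module R M" and N: "left_module R N"
 shows "submodule (f ` carrier M) R N"
proof -
 interpret M: left_module R M by fact
 interpret N: left_module R N by fact
 have fc: "f x \<in> carrier N" if "x \<in> carrier M" for x using that by (rule mod_homD(1)[OF f])
 show ?thesis
 proof (intro submodule.intro submodule_axioms.intro N.add.subgroupI)
  fix a assume "a \<in> f ` carrier M"
  then obtain x where x: "x \<in> carrier M" "a = f x" by blast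
  have "f (\<ominus>\<^bsub>M\<^esub> x) \<oplus>\<^bsub>N\<^esub> f x = \<zero>\<^bsub>N\<^esub>"
   using x mod_homD(2)[OF f, of "\<ominus>\<^bsub>M\<^esub> x" x] mod_hom_zero[OF f M N] by (simp add: M.l_neg)
  then have "f (\<ominus>\<^bsub>M\<^esub> x) = \<ominus>\<^bsub>N\<^esub> a" using x fc by (simp add: N.minus_equality)
  then show "\<ominus>\<^bsub>N\<^esub> a \<in> f ` carrier M" using x by (auto intro: image_eqI[of _ _ "\<ominus>\<^bsub>M\<^esub> x"])
 next
  fix a b assume "a \<in> f ` carrier M" "b \<in> f ` carrier M"
  then obtain x y where "x \<in> carrier M" "y \<in> carrier M" "a = f x" "b = f y" by blast
  then show "a \<oplus>\<^bsub>N\<^esub> b \<in> f ` carrier M"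
   using mod_homD(2)[OF f, of x y] by (intro image_eqI[of _ _ "x \<oplus>\<^bsub>M\<^esub> y"]) auto
 next
  fix a x assume "a \<in> carrier R" "x \<in> f ` carrier M"
  moreover from this obtain y where "y \<in> carrier M" "x = f y" by blast
  ultimately show "a \<odot>\<^bsub>N\<^esub> x \<in> f ` carrier M"
   using mod_homD(3)[OF f, of a y] M.smult_closed by (intro image_eqI[of _ _ "a \<odot>\<^bsub>M\<^esub> y"]) auto
 qed (use fc M.zero_closed in auto)
qed

text \<open>Paths are products of arrows, so the algebra is generated by the arrows and the scalar multiples of
the vertices, and linearity over these suffices.\<close>

lemma trunc_algebra_hom_criterion:
 fixes V :: "('k::field trunc, 'v) module" and W :: "('k trunc, 'u) module"
 assumes V: "left_module (KZJ n d) V" and W: "left_module (KZJ n d) W"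
  and f: "\<And>x. x \<in> carrier V ==> f x \<in> carrier W"
  and f_add: "\<And>x y. x \<in> carrier V ==> y \<in> carrier V ==> f (x \<oplus>\<^bsub>V\<^esub> y) = f x \<oplus>\<^bsub>W\<^esub> f y"
  and vertex: "\<And>i c x. i < n ==> x \<in> carrier V ==>
   f (trunc_class n d (single (i, 0) c) \<odot>\<^bsub>V\<^esub> x) = trunc_class n d (single (i, 0) c) \<odot>\<^bsub>W\<^esub> f x"
  and arrow: "\<And>i x. i < n ==> x \<in> carrier V ==>
   f (trunc_class n d (single (i, 1) 1) \<odot>\<^bsub>V\<^esub> x) = trunc_class n d (single (i, 1) 1) \<odot>\<^bsub>W\<^esub> f x"
 shows "mod_hom (KZJ n d) V W f"
proof -
 interpret V: left_module "KZJ n d" V by fact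
 interpret W: left_module "KZJ n d" W by fact
 have path: "f (trunc_class n d (single (i, k) c) \<odot>\<^bsub>V\<^esub> x) = trunc_class n d (single (i, k) c) \<odot>\<^bsub>W\<^esub> f x"
  if "i < n" "x \<in> carrier V" for i k c x
 proof (induction k)
  case 0 then show ?case using vertex that by simp
 next
  case (Suc k)
  let ?a = "single ((i + k) mod n, 1) 1" and ?b = "single (i, k) c"
  have ab: "?a \<in> carrier (KZ n)" "?b \<in> carrier (KZ n)" using that(1) by auto
  have "single (i, Suc k) c = basis_mult (path_comp n) ?a ?b"
   by (simp add: basis_mult_single path_comp_def)
  then have eq: "trunc_class n d (single (i, Suc k) c)
    = trunc_class n d ?a \<otimes>\<^bsub>KZJ n d\<^esub> trunc_class n d ?b"
   using trunc_class_mult[OF ab, of d] by simp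
  have "f (trunc_class n d (single (i, Suc k) c) \<odot>\<^bsub>V\<^esub> x)
    = f (trunc_class n d ?a \<odot>\<^bsub>V\<^esub> (trunc_class n d ?b \<odot>\<^bsub>V\<^esub> x))"
   unfolding eq using that(2) ab by (subst V.smult_assoc1) (auto simp del: path_algebra_sel)
  also have "... = trunc_class n d ?a \<odot>\<^bsub>W\<^esub> (trunc_class n d ?b \<odot>\<^bsub>W\<^esub> f x)"
   using that ab arrow[of "(i + k) mod n"] Suc V.smult_closed by (simp del: path_algebra_sel)
  also have "... = trunc_class n d (single (i, Suc k) c) \<odot>\<^bsub>W\<^esub> f x"
   unfolding eq using that(2) ab f by (subst W.smult_assoc1) (auto simp del: path_algebra_sel)
  finally show ?case .
 qed
 show ?thesis
 proof (rule mod_homI)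
  fix h :: "'k trunc" and x assume h: "h \<in> carrier (KZJ n d)" and x: "x \<in> carrier V"
  from h obtain a where a: "a \<in> carrier (KZ n)" "h = trunc_class n d a"
   by (rule trunc_algebra_cases)
  from a(1) have "keys a \<subseteq> {..<n} \<times> UNIV" by simp
  then have "f (trunc_class n d a \<odot>\<^bsub>V\<^esub> x) = trunc_class n d a \<odot>\<^bsub>W\<^esub> f x"
  proof (induction a rule: poly_mapping_span_induct)
   case zero
   show ?case
   proof (cases "n = 0")
    case True
    have "trunc_class n d (0 :: path \<Rightarrow>\<^sub>0 'k) = \<one>\<^bsub>KZJ n d\<^esub>"
     using trunc_class_one[of n d, where ?'a = 'k] True by simp
    then show ?thesis using x f by (simp add: V.smult_one W.smult_one)
   next
    case False
    then show ?thesis using vertex[of 0 x 0] x by simp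
   qed
  next
   case (single y c) then show ?case using path x by auto
  next
   case (add a b)
   have ab: "a \<in> carrier (KZ n)" "b \<in> carrier (KZ n)" using add by auto
   then have T: "trunc_class n d a \<in> carrier (KZJ n d)" "trunc_class n d b \<in> carrier (KZJ n d)"
    by blast+
   show ?case unfolding trunc_class_add[OF ab]
    using T x f add(3,4) by (simp add: V.smult_l_distr W.smult_l_distr f_add V.smult_closed)
  qed
  then show "f (h \<odot>\<^bsub>V\<^esub> x) = h \<odot>\<^bsub>W\<^esub> f x" by (simp add: a(2))
 qed (use f f_add in auto)
qed

section \<open>Constructions on graded matrices\<close>

definition realizes ::
 "nat => nat => ('k::field trunc, 'v) module => ('i, 'k) gdata => bool" where
 "realizes n d V C \<longleftrightarrow> left_module (KZJ n d) V \<and> gvalid n d C \<and>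
   module_isomorphic (KZJ n d) V (gmod C)"

lemma realizesD:
 assumes "realizes n d V C"
 shows "left_module (KZJ n d) V" "gvalid n d C"
  "module_isomorphic (KZJ n d) V (gmod C)"
 using assms by (auto simp: realizes_def)

lemma realizes_gmod: "gvalid n d C ==> realizes n d (gmod C) C"
 by (simp add: realizes_def left_module_gmod module_isomorphic_refl)

lemma realizes_iso:
 assumes "realizes n d V C" "realizes n d W C"
 shows "module_isomorphic (KZJ n d) V W"
 using assms module_isomorphic_trans module_isomorphic_sym unfolding realizes_def by blast

lemma realizes_trans:
 assumes "realizes n d V C" "gvalid n d D" "module_isomorphic (KZJ n d) (gmod C) (gmod D)"
 shows "realizes n d V D"
 using assms module_isomorphic_trans unfolding realizes_def by blast

lemma gmod_homI:
 fixes C :: "('i, 'k::field) gdata"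
 assumes C: "gvalid n d C" and D: "gvalid n d D"
  and "\<And>v. v \<in> gspace C ==> f v \<in> gspace D"
  and "\<And>v w. v \<in> gspace C ==> w \<in> gspace C ==> f (%b. v b + w b) = (%b. f v b + f w b)"
  and "\<And>a v. a \<in> carrier (KZ n) ==> v \<in> gspace C ==> f (cact C a v) = cact D a (f v)"
 shows "mod_hom (KZJ n d) (gmod C) (gmod D) f"
proof (rule mod_homI)
 fix h :: "'k trunc" and v assume "h \<in> carrier (KZJ n d)" "v \<in> carrier (gmod C)"
 then show "f (h \<odot>\<^bsub>gmod C\<^esub> v) = h \<odot>\<^bsub>gmod D\<^esub> f v"
  using assms by (auto elim!: trunc_algebra_cases simp: gmod_smult[OF C] gmod_smult[OF D] simp del: path_algebra_sel)
qed (use assms in auto)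

text \<open>The action of a vertex and the action of the sum of all arrows; together they determine the module
structure.\<close>

definition gproj :: "('i, 'k::field) gdata => nat => ('i => 'k) => ('i => 'k)" where
 "gproj C i v = (%b. if b \<in> idx C \<and> deg C b = i then v b else 0)"

definition gX :: "('i, 'k::field) gdata => ('i => 'k) => ('i => 'k)" where
 "gX C v = (%b. if b \<in> idx C then \<Sum>b'\<in>idx C. mat C b b' * v b' else 0)"

lemma gproj_gspace [simp, intro]: "gproj C i v \<in> gspace C"
 and gX_gspace [simp, intro]: "gX C v \<in> gspace C"
 by (auto simp: gproj_def gX_def gspace_def)

lemma gX_add: "gX C (%b. v b + w b) = (%b. gX C v b + gX C w b)"
 by (auto simp: gX_def fun_eq_iff algebra_simps sum.distrib)

lemma gX_scale: "gX C (%b. c * v b) = (%b. c * gX C v b)"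
 by (auto simp: gX_def fun_eq_iff sum_distrib_left algebra_simps)

lemma gX_funpow_gspace [simp]: "v \<in> gspace C ==> (gX C ^^ k) v \<in> gspace C"
 by (cases k) auto

lemma gX_funpow_scale: "(gX C ^^ k) (%b. c * v b) = (%b. c * (gX C ^^ k) v b)"
 by (induction k) (auto simp: gX_scale)

lemma gX_funpow_zero [simp]: "(gX C ^^ k) (%b. 0) = (%b. 0)"
 using gX_funpow_scale[of k C 0 "%_. 0"] by simp

lemma gX_funpow:
 assumes "finite (idx C)" "v \<in> gspace C" "b \<in> idx C"
 shows "(gX C ^^ k) v b = (\<Sum>b'\<in>idx C. pow_mat C k b b' * v b')"
 using assms(3)
proof (induction k arbitrary: b)
 case 0
 have "(\<Sum>b'\<in>idx C. of_bool (b = b') * v b') = (\<Sum>b'\<in>idx C. if b' = b then v b else 0)"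
  by (intro sum.cong) auto
 then show ?case using assms(1) 0 by simp
next
 case (Suc k)
 have "(gX C ^^ Suc k) v b = (\<Sum>c\<in>idx C. mat C b c * (gX C ^^ k) v c)"
  using Suc.prems by (simp add: gX_def[of C "(gX C ^^ k) v"])
 also have "... = (\<Sum>c\<in>idx C. mat C b c * (\<Sum>b'\<in>idx C. pow_mat C k c b' * v b'))"
  using Suc.IH by simp
 also have "... = (\<Sum>b'\<in>idx C. \<Sum>c\<in>idx C. mat C b c * (pow_mat C k c b' * v b'))"
  unfolding sum_distrib_left by (rule sum.swap)
 finally show ?case by (simp add: sum_distrib_right mult.assoc)
qed

lemma cact_path:
 assumes C: "gvalid n d C"
 shows "cact C (single (i, k) c) v = (%b. c * (gX C ^^ k) (gproj C i v) b)"
proof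
 fix b
 note fin = gvalid_finite[OF C]
 show "cact C (single (i, k) c) v b = c * (gX C ^^ k) (gproj C i v) b"
 proof (cases "b \<in> idx C")
  case True
  have "(gX C ^^ k) (gproj C i v) b = (\<Sum>b'\<in>idx C. pow_mat C k b b' * gproj C i v b')"
   by (rule gX_funpow[OF fin _ True]) simp
  also have "... = (\<Sum>b' | b' \<in> idx C \<and> deg C b' = i. pow_mat C k b b' * v b')"
   using fin by (intro sum.mono_neutral_cong_right) (auto simp: gproj_def)
  finally show ?thesis using True by (simp add: cact_single[OF fin])
 next
  case False
  then show ?thesis by (simp add: cact_single[OF fin] gspaceD[OF gX_funpow_gspace[OF gproj_gspace]])
 qed
qed

lemma gmod_lin_homI:
 fixes C :: "('i, 'k::field) gdata"
 assumes C: "gvalid n d C" and D: "gvalid n d D"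
  and f: "\<And>v. v \<in> gspace C ==> f v \<in> gspace D"
  and add: "\<And>v w. v \<in> gspace C ==> w \<in> gspace C ==> f (%b. v b + w b) = (%b. f v b + f w b)"
  and scale: "\<And>c v. v \<in> gspace C ==> f (%b. c * v b) = (%b. c * f v b)"
  and X: "\<And>v. v \<in> gspace C ==> f (gX C v) = gX D (f v)"
  and proj: "\<And>i v. v \<in> gspace C ==> f (gproj C i v) = gproj D i (f v)"
 shows "mod_hom (KZJ n d) (gmod C) (gmod D) f"
proof (rule trunc_algebra_hom_criterion[OF left_module_gmod[OF C] left_module_gmod[OF D]])
 fix i and c :: 'k and x assume i: "i < n" and x: "x \<in> carrier (gmod C)"
 have s: "single (i, 0) c \<in> carrier (KZ n)" "single (i, 1) (1 :: 'k) \<in> carrier (KZ n)"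
  using i by auto
 show "f (trunc_class n d (single (i, 0) c) \<odot>\<^bsub>gmod C\<^esub> x) = trunc_class n d (single (i, 0) c) \<odot>\<^bsub>gmod D\<^esub> f x"
  unfolding gmod_smult[OF C s(1)] gmod_smult[OF D s(1)]
  using x proj scale by (simp add: cact_path[OF C] cact_path[OF D])
next
 fix i x assume i: "i < n" and x: "x \<in> carrier (gmod C)"
 have s: "single (i, 1) (1 :: 'k) \<in> carrier (KZ n)"
  using i by auto
 show "f (trunc_class n d (single (i, 1) 1) \<odot>\<^bsub>gmod C\<^esub> x) = trunc_class n d (single (i, 1) 1) \<odot>\<^bsub>gmod D\<^esub> f x"
  unfolding gmod_smult[OF C s] gmod_smult[OF D s]
  using x proj X by (simp add: cact_path[OF C] cact_path[OF D])
qed (use f add in auto)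

subsection \<open>Relabelling\<close>

definition gdata_iso :: "('i => 'j) => ('i, 'k) gdata => ('j, 'k) gdata => bool" where
 "gdata_iso h C D \<longleftrightarrow> bij_betw h (idx C) (idx D) \<and> (\<forall>b\<in>idx C. deg D (h b) = deg C b) \<and>
   (\<forall>b\<in>idx C. \<forall>b'\<in>idx C. mat D (h b) (h b') = mat C b b')"

lemma pow_mat_iso:
 assumes "gdata_iso h C D" "b \<in> idx C" "b' \<in> idx C"
 shows "pow_mat D k (h b) (h b') = pow_mat C k b b'"
 using assms(2)
proof (induction k arbitrary: b)
 case 0
 then show ?case using assms by (auto simp: gdata_iso_def bij_betw_def inj_on_def)
next
 case (Suc k)
 have h: "bij_betw h (idx C) (idx D)" using assms(1) by (simp add: gdata_iso_def)
 show ?case using Suc assms(1)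
  by (simp add: sum.reindex_bij_betw[OF h, symmetric] gdata_iso_def)
qed

lemma gvalid_iso:
 assumes "gdata_iso h C D" "gvalid n d C" shows "gvalid n d D"
proof -
 have h: "idx D = h ` idx C" using assms(1) by (simp add: gdata_iso_def bij_betw_def)
 show ?thesis unfolding gvalid_def h
  using assms by (auto simp: gvalid_def pow_mat_iso[OF assms(1)] gdata_iso_def)
qed

lemma gmod_iso:
 assumes h: "gdata_iso h C D" and C: "gvalid n d C"
 shows "module_isomorphic (KZJ n d) (gmod C) (gmod D)"
proof -
 note D = gvalid_iso[OF h C]
 have bij: "bij_betw h (idx C) (idx D)" using h by (simp add: gdata_iso_def)
 have hD: "h b \<in> idx D" if "b \<in> idx C" for b using bij that by (auto simp: bij_betw_def)
 define f where "f w = (%b. if b \<in> idx C then w (h b) else 0)" for w :: "'b => 'c"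
 have "mod_hom (KZJ n d) (gmod D) (gmod C) f"
 proof (rule gmod_homI[OF D C])
  fix a :: "path \<Rightarrow>\<^sub>0 'c" and v :: "'b => 'c"
  show "f (cact D a v) = cact C a (f v)"
  proof
   fix b
   have "mat_ext (path_mat D) a (h b) (h b') = mat_ext (path_mat C) a b b'"
    if "b \<in> idx C" "b' \<in> idx C" for b'
    using that h by (simp add: mat_ext_def path_mat_def pow_mat_iso[OF h] gdata_iso_def)
   then show "f (cact D a v) b = cact C a (f v) b"
    using hD by (simp add: f_def cact_def sum.reindex_bij_betw[OF bij, symmetric] cong: sum.cong)
  qed
 qed (auto simp: f_def gspace_def)
 moreover have "bij_betw f (gspace D) (gspace C)"
 proof (rule bij_betwI[where g = "%v c. if c \<in> idx D then v (inv_into (idx C) h c) else 0"])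
  show "f (%c. if c \<in> idx D then v (inv_into (idx C) h c) else 0) = v" if "v \<in> gspace C" for v
   using that bij hD by (auto simp: f_def fun_eq_iff gspace_def bij_betw_def)
  show "(%c. if c \<in> idx D then f w (inv_into (idx C) h c) else 0) = w" if "w \<in> gspace D" for w
   using that bij bij_betw_inv_into[OF bij]
   by (auto simp: f_def fun_eq_iff gspace_def bij_betw_def f_inv_into_f inv_into_into)
 qed (auto simp: f_def gspace_def)
 ultimately have "module_isomorphic (KZJ n d) (gmod D) (gmod C)"
  unfolding module_isomorphic_alt by auto
 then show ?thesis by (rule module_isomorphic_sym[OF left_module_gmod[OF D]])
qed

lemma realizes_reindex:
 assumes "gdata_iso h C D" "realizes n d V C" shows "realizes n d V D"
 using assms gmod_iso gvalid_iso realizes_trans realizesD(2) by blast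

subsection \<open>Direct sums\<close>

definition dsum :: "('i, 'k::field) gdata => ('j, 'k) gdata => ('i + 'j, 'k) gdata" where
 "dsum C D = \<lparr>idx = idx C <+> idx D, deg = case_sum (deg C) (deg D),
   mat = (%x y. case x of Inl b => (case y of Inl b' => mat C b b' | Inr c' => 0)
    | Inr c => (case y of Inl b' => 0 | Inr c' => mat D c c'))\<rparr>"

lemma dsum_sel [simp]:
 "idx (dsum C D) = idx C <+> idx D" "deg (dsum C D) (Inl b) = deg C b" "deg (dsum C D) (Inr c) = deg D c"
 "mat (dsum C D) (Inl b) (Inl b') = mat C b b'" "mat (dsum C D) (Inr c) (Inr c') = mat D c c'"
 "mat (dsum C D) (Inl b) (Inr c') = 0" "mat (dsum C D) (Inr c) (Inl b') = 0"
 by (simp_all add: dsum_def)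

lemma pow_mat_dsum:
 assumes "finite (idx C)" "finite (idx D)"
 shows "pow_mat (dsum C D) k x y = (case x of Inl b => (case y of Inl b' => pow_mat C k b b' | Inr c' => 0)
    | Inr c => (case y of Inl b' => 0 | Inr c' => pow_mat D k c c'))"
proof (induction k arbitrary: x y)
 case 0 show ?case by (auto split: sum.splits)
next
 case (Suc k)
 show ?case by (cases x; cases y) (simp_all add: Suc sum.Plus assms)
qed

lemma gvalid_dsum: "gvalid n d C ==> gvalid n d D ==> gvalid n d (dsum C D)"
 unfolding gvalid_def by (auto simp: pow_mat_dsum)

lemma cact_dsum:
 assumes "finite (idx C)" "finite (idx D)"
 shows "cact (dsum C D) a (case_sum v w) = case_sum (cact C a v) (cact D a w)"
proof
 fix x
 have "mat_ext (path_mat (dsum C D)) a (Inl b) (Inl b') = mat_ext (path_mat C) a b b'"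
  "mat_ext (path_mat (dsum C D)) a (Inr c) (Inr c') = mat_ext (path_mat D) a c c'"
  "mat_ext (path_mat (dsum C D)) a (Inl b) (Inr c') = 0"
  "mat_ext (path_mat (dsum C D)) a (Inr c) (Inl b') = 0" for b b' c c'
  by (simp_all add: mat_ext_def path_mat_def pow_mat_dsum assms)
 then show "cact (dsum C D) a (case_sum v w) x = case_sum (cact C a v) (cact D a w) x"
  by (cases x) (auto simp: cact_def sum.Plus assms)
qed

lemma realizes_direct_sum2:
 fixes C :: "('i, 'k::field) gdata"
 assumes V: "realizes n d V C" and W: "realizes n d W D"
 shows "realizes n d (direct_sum2 V W) (dsum C D)"
proof -
 note C = realizesD(2)[OF V] and D = realizesD(2)[OF W]
 note CD = gvalid_dsum[OF C D]
 note fin = gvalid_finite[OF C] gvalid_finite[OF D]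
 interpret V: left_module "KZJ n d" V by (rule realizesD(1)[OF V])
 interpret W: left_module "KZJ n d" W by (rule realizesD(1)[OF W])
 obtain f where f: "bij_betw f (carrier V) (gspace C)" "mod_hom (KZJ n d) V (gmod C) f"
  using realizesD(3)[OF V] by (auto simp: module_isomorphic_alt)
 obtain g where g: "bij_betw g (carrier W) (gspace D)" "mod_hom (KZJ n d) W (gmod D) g"
  using realizesD(3)[OF W] by (auto simp: module_isomorphic_alt)
 define F where "F = (%(x, y). case_sum (f x) (g y))"
 have bij: "bij_betw F (carrier (direct_sum2 V W)) (carrier (gmod (dsum C D)))"
 proof (rule bij_betwI')
  fix x y assume "x \<in> carrier (direct_sum2 V W)" "y \<in> carrier (direct_sum2 V W)"
  then show "(F x = F y) = (x = y)"
   using f(1) g(1) by (auto simp: F_def direct_sum2_def bij_betw_def inj_on_def fun_eq_iff split: sum.splits)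
 next
  fix x assume "x \<in> carrier (direct_sum2 V W)"
  then show "F x \<in> carrier (gmod (dsum C D))"
   using gspaceD[of "f (fst x)" C] gspaceD[of "g (snd x)" D] mod_homD(1)[OF f(2)] mod_homD(1)[OF g(2)]
   by (force simp: F_def direct_sum2_def gspace_def[of "dsum C D"] split: sum.splits)
 next
  fix u assume u: "u \<in> carrier (gmod (dsum C D))"
  have "(%b. u (Inl b)) \<in> gspace C" "(%b. u (Inr b)) \<in> gspace D" using u by (auto simp: gspace_def)
  then have "(%b. u (Inl b)) \<in> f ` carrier V" "(%b. u (Inr b)) \<in> g ` carrier W"
   using f(1) g(1) by (simp_all add: bij_betw_def)
  then obtain x y where "x \<in> carrier V" "(%b. u (Inl b)) = f x" "y \<in> carrier W" "(%b. u (Inr b)) = g y"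
   by (elim imageE)
  then show "\<exists>x\<in>carrier (direct_sum2 V W). u = F x"
   by (intro bexI[of _ "(x, y)"] ext) (auto simp: F_def direct_sum2_def dest: fun_cong split: sum.splits)
 qed
 have hom: "mod_hom (KZJ n d) (direct_sum2 V W) (gmod (dsum C D)) F"
 proof (rule mod_homI)
  fix x y assume "x \<in> carrier (direct_sum2 V W)" "y \<in> carrier (direct_sum2 V W)"
  then show "F (x \<oplus>\<^bsub>direct_sum2 V W\<^esub> y) = F x \<oplus>\<^bsub>gmod (dsum C D)\<^esub> F y"
   using mod_homD(2)[OF f(2)] mod_homD(2)[OF g(2)]
   by (auto simp: F_def direct_sum2_def fun_eq_iff split: sum.splits)
 next
  fix h :: "'k trunc" and x assume h: "h \<in> carrier (KZJ n d)" and x: "x \<in> carrier (direct_sum2 V W)"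
  from h obtain a where a: "a \<in> carrier (KZ n)" "h = trunc_class n d a"
   by (rule trunc_algebra_cases)
  show "F (h \<odot>\<^bsub>direct_sum2 V W\<^esub> x) = h \<odot>\<^bsub>gmod (dsum C D)\<^esub> F x"
   using x h mod_homD(3)[OF f(2)] mod_homD(3)[OF g(2)]
   by (auto simp: F_def direct_sum2_def a(2) gmod_smult[OF C a(1)] gmod_smult[OF D a(1)]
      gmod_smult[OF CD a(1)] cact_dsum[OF fin])
 qed (use bij in \<open>auto simp: bij_betw_def\<close>)
 have "left_module (KZJ n d) (direct_sum2 V W)"
 proof (rule left_module_transport[OF left_module_gmod[OF CD] bij hom])
  show "F \<zero>\<^bsub>direct_sum2 V W\<^esub> = \<zero>\<^bsub>gmod (dsum C D)\<^esub>"
   using mod_hom_zero[OF f(2) realizesD(1)[OF V] left_module_gmod[OF C]]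
    mod_hom_zero[OF g(2) realizesD(1)[OF W] left_module_gmod[OF D]]
   by (auto simp: F_def direct_sum2_def fun_eq_iff split: sum.splits)
 qed (auto simp: direct_sum2_def V.smult_closed W.smult_closed)
 with CD bij hom show ?thesis by (auto simp: realizes_def module_isomorphic_alt)
qed

definition famsum :: "nat => (nat => ('i, 'k::field) gdata) => (nat \<times> 'i, 'k) gdata" where
 "famsum N C = \<lparr>idx = Sigma {..<N} (%s. idx (C s)), deg = (%x. deg (C (fst x)) (snd x)),
   mat = (%x y. if fst x = fst y then mat (C (fst x)) (snd x) (snd y) else 0)\<rparr>"

lemma famsum_sel [simp]:
 "idx (famsum N C) = Sigma {..<N} (%s. idx (C s))" "deg (famsum N C) (s, b) = deg (C s) b"
 "mat (famsum N C) (s, b) (s', b') = (if s = s' then mat (C s) b b' else 0)"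
 by (simp_all add: famsum_def)

lemma sum_famsum:
 fixes N :: nat
 assumes "\<And>s. s < N ==> finite (idx (C s))" "s < N" "\<And>s' b. s' < N ==> s' \<noteq> s ==> F (s', b) = 0"
 shows "(\<Sum>x\<in>Sigma {..<N} (%s. idx (C s)). F x) = (\<Sum>b\<in>idx (C s). F (s, b) :: 'k::field)"
proof -
 have "(\<Sum>x\<in>Sigma {..<N} (%s. idx (C s)). F x) = (\<Sum>s'<N. \<Sum>b\<in>idx (C s'). F (s', b))"
  using assms(1) by (subst sum.Sigma) auto
 also have "... = (\<Sum>s'<N. if s' = s then \<Sum>b\<in>idx (C s). F (s, b) else 0)"
  using assms(3) by (intro sum.cong) (auto intro: sum.neutral)
 finally show ?thesis using assms(2) by simp
qed

lemma pow_mat_famsum: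
 assumes "\<And>s. s < N ==> finite (idx (C s))" "s < N"
 shows "pow_mat (famsum N C) k (s, b) (s', b') = (if s = s' then pow_mat (C s) k b b' else 0)"
proof (induction k arbitrary: b)
 case 0 show ?case by simp
next
 case (Suc k)
 have "pow_mat (famsum N C) (Suc k) (s, b) (s', b')
   = (\<Sum>x\<in>Sigma {..<N} (%s. idx (C s)). mat (famsum N C) (s, b) x * pow_mat (famsum N C) k x (s', b'))"
  by simp
 also have "... = (\<Sum>c\<in>idx (C s). mat (famsum N C) (s, b) (s, c) * pow_mat (famsum N C) k (s, c) (s', b'))"
  by (rule sum_famsum[OF assms]) auto
 finally show ?case by (simp add: Suc)
qed

lemma gvalid_famsum:
 assumes "\<And>s. s < N ==> gvalid n d (C s)"
 shows "gvalid n d (famsum N C)"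
 unfolding gvalid_def
proof (intro conjI ballI impI)
 have fin: "finite (idx (C s))" if "s < N" for s using assms[OF that] by (rule gvalid_finite)
 then show "finite (idx (famsum N C))" by auto
 fix x assume x: "x \<in> idx (famsum N C)"
 obtain s b where sb: "x = (s, b)" "s < N" "b \<in> idx (C s)" using x by auto
 then show "deg (famsum N C) x < n" using gvalid_deg[OF assms] by auto
 fix y assume y: "y \<in> idx (famsum N C)"
 then obtain s' b' where sb': "y = (s', b')" "s' < N" "b' \<in> idx (C s')" by auto
 show "pow_mat (famsum N C) d x y = 0"
  using sb sb' gvalid_pow[OF assms] by (auto simp: pow_mat_famsum fin)
 assume "mat (famsum N C) x y \<noteq> 0"
 then show "deg (famsum N C) x = (deg (famsum N C) y + 1) mod n"
  using sb sb' gvalid_mat[OF assms] by (auto split: if_splits)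
qed

lemma cact_famsum:
 assumes fin: "\<And>s. s < N ==> finite (idx (C s))"
 shows "cact (famsum N C) a v (s, b) = (if s < N then cact (C s) a (%b. v (s, b)) b else 0)"
proof (cases "s < N \<and> b \<in> idx (C s)")
 case True
 have m: "mat_ext (path_mat (famsum N C)) a (s, b) (s', b')
   = (if s = s' then mat_ext (path_mat (C s)) a b b' else 0)" for s' b'
  using True by (simp add: mat_ext_def path_mat_def pow_mat_famsum fin)
 have "cact (famsum N C) a v (s, b) = (\<Sum>x\<in>Sigma {..<N} (%s. idx (C s)).
   mat_ext (path_mat (famsum N C)) a (s, b) x * v x)"
  using True by (simp add: cact_def)
 also have "... = (\<Sum>b'\<in>idx (C s). mat_ext (path_mat (famsum N C)) a (s, b) (s, b') * v (s, b'))"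
  by (rule sum_famsum) (use True fin m in auto)
 finally show ?thesis using True m by (simp add: cact_def)
qed (auto simp: cact_def)

lemma realizes_direct_sum:
 fixes C :: "nat => ('i, 'k::field) gdata"
 assumes V: "\<And>s. s < N ==> realizes n d (V s) (C s)"
 shows "realizes n d (direct_sum {..<N} V) (famsum N C)"
proof -
 note C = realizesD(2)[OF V]
 note CD = gvalid_famsum[OF C]
 have fin: "finite (idx (C s))" if "s < N" for s by (rule gvalid_finite[OF C[OF that]])
 have "\<forall>s. \<exists>f. s < N --> bij_betw f (carrier (V s)) (gspace (C s)) \<and> mod_hom (KZJ n d) (V s) (gmod (C s)) f"
  using realizesD(3)[OF V] by (auto simp: module_isomorphic_alt)
 then obtain f where f: "\<And>s. s < N ==> bij_betw (f s) (carrier (V s)) (gspace (C s))"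
   "\<And>s. s < N ==> mod_hom (KZJ n d) (V s) (gmod (C s)) (f s)"
  by metis
 define F where "F x = (%(s, b). if s < N then f s (x s) b else 0)" for x
 let ?S = "direct_sum {..<N} V"
 have bij: "bij_betw F (carrier ?S) (carrier (gmod (famsum N C)))"
 proof (rule bij_betwI')
  fix x y assume x: "x \<in> carrier ?S" and y: "y \<in> carrier ?S"
  show "(F x = F y) = (x = y)"
  proof
   assume eq: "F x = F y"
   have "x s = y s" if s: "s < N" for s
   proof -
    have "f s (x s) = f s (y s)"
     using fun_cong[OF eq, of "(s, _)"] s by (auto simp: F_def fun_eq_iff)
    then show ?thesis using f(1)[OF s] x y s by (auto simp: bij_betw_def inj_on_def direct_sum_def)
   qed
   then show "x = y" using x y by (auto simp: direct_sum_def intro: PiE_ext)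
  qed simp
 next
  fix x assume "x \<in> carrier ?S"
  then show "F x \<in> carrier (gmod (famsum N C))"
   using mod_homD(1)[OF f(2)] by (fastforce simp: F_def direct_sum_def gspace_def PiE_iff)
 next
  fix u assume u: "u \<in> carrier (gmod (famsum N C))"
  have "\<forall>s. \<exists>x. s < N --> x \<in> carrier (V s) \<and> f s x = (%b. u (s, b))"
  proof (intro allI)
   fix s show "\<exists>x. s < N --> x \<in> carrier (V s) \<and> f s x = (%b. u (s, b))"
   proof (cases "s < N")
    case True
    have "(%b. u (s, b)) \<in> gspace (C s)" using u True by (auto simp: gspace_def)
    then have "(%b. u (s, b)) \<in> f s ` carrier (V s)"
     using f(1)[OF True] by (simp add: bij_betw_def)
    then show ?thesis by (elim imageE) (intro exI, auto)
   qed auto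
  qed
  then obtain x where x: "\<And>s. s < N ==> x s \<in> carrier (V s) \<and> f s (x s) = (%b. u (s, b))" by metis
  show "\<exists>x\<in>carrier ?S. u = F x"
   using x u by (intro bexI[of _ "restrict x {..<N}"]) (auto simp: F_def direct_sum_def fun_eq_iff gspace_def)
 qed
 have hom: "mod_hom (KZJ n d) ?S (gmod (famsum N C)) F"
 proof (rule mod_homI)
  fix x y assume "x \<in> carrier ?S" "y \<in> carrier ?S"
  then show "F (x \<oplus>\<^bsub>?S\<^esub> y) = F x \<oplus>\<^bsub>gmod (famsum N C)\<^esub> F y"
   using mod_homD(2)[OF f(2)] by (auto simp: F_def direct_sum_def fun_eq_iff PiE_iff)
 next
  fix h :: "'k trunc" and x assume h: "h \<in> carrier (KZJ n d)" and x: "x \<in> carrier ?S"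
  from h obtain a where a: "a \<in> carrier (KZ n)" "h = trunc_class n d a"
   by (rule trunc_algebra_cases)
  show "F (h \<odot>\<^bsub>?S\<^esub> x) = h \<odot>\<^bsub>gmod (famsum N C)\<^esub> F x"
  proof
   fix y show "F (h \<odot>\<^bsub>?S\<^esub> x) y = (h \<odot>\<^bsub>gmod (famsum N C)\<^esub> F x) y"
   proof (cases y)
    case (Pair s b)
    have "f s (h \<odot>\<^bsub>V s\<^esub> x s) = cact (C s) a (f s (x s))" if "s < N"
     using mod_homD(3)[OF f(2)[OF that] h] x that gmod_smult[OF C[OF that] a(1)] a(2)
     by (auto simp: direct_sum_def PiE_iff)
    then show ?thesis
     using a(2) gmod_smult[OF CD a(1), where v = "F x"]
     by (simp add: Pair cact_famsum[OF fin], simp add: F_def direct_sum_def)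
   qed
  qed
 qed (use bij in \<open>auto simp: bij_betw_def\<close>)
 have "left_module (KZJ n d) ?S"
 proof (rule left_module_transport[OF left_module_gmod[OF CD] bij hom])
  show "F \<zero>\<^bsub>?S\<^esub> = \<zero>\<^bsub>gmod (famsum N C)\<^esub>"
   using mod_hom_zero[OF f(2) realizesD(1)[OF V] left_module_gmod[OF C]]
   by (auto simp: F_def direct_sum_def fun_eq_iff)
 next
  fix x y assume xy: "x \<in> carrier ?S" "y \<in> carrier ?S"
  have "x s \<oplus>\<^bsub>V s\<^esub> y s \<in> carrier (V s)" if "s < N" for s
  proof -
   interpret V: left_module "KZJ n d" "V s" by (rule realizesD(1)[OF V[OF that]])
   show ?thesis using xy that by (auto simp: direct_sum_def PiE_iff)
  qed
  then show "x \<oplus>\<^bsub>?S\<^esub> y \<in> carrier ?S" by (auto simp: direct_sum_def)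
 next
  fix a :: "'k trunc" and x assume ax: "a \<in> carrier (KZJ n d)" "x \<in> carrier ?S"
  have "a \<odot>\<^bsub>V s\<^esub> x s \<in> carrier (V s)" if "s < N" for s
   using left_module.smult_closed[OF realizesD(1)[OF V[OF that]]] ax that by (auto simp: direct_sum_def PiE_iff)
  then show "a \<odot>\<^bsub>?S\<^esub> x \<in> carrier ?S" by (auto simp: direct_sum_def)
 next
  have "\<zero>\<^bsub>V s\<^esub> \<in> carrier (V s)" if "s < N" for s
  proof -
   interpret V: left_module "KZJ n d" "V s" by (rule realizesD(1)[OF V[OF that]])
   show ?thesis by simp
  qed
  then show "\<zero>\<^bsub>?S\<^esub> \<in> carrier ?S" by (auto simp: direct_sum_def)
 qed
 with CD bij hom show ?thesis by (auto simp: realizes_def module_isomorphic_alt)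
qed

subsection \<open>Jordan blocks\<close>

text \<open>The graded matrix of \<open>M(l, j)\<close> for \<open>x = (l, j)\<close>: the basis vector \<open>s\<close> is \<open>X\<^sup>s\<close> applied to a generator of
degree \<open>j\<close>. A standard module is a finite sum of blocks; its basis vector \<open>(t, s)\<close> is the vector \<open>s\<close> of
the block number \<open>t\<close>.\<close>

definition block :: "nat => nat \<times> nat => (nat, 'k::field) gdata" where
 "block n x = \<lparr>idx = {..<fst x}, deg = (%s. (snd x + s) mod n), mat = (%s s'. of_bool (s = Suc s'))\<rparr>"

lemma block_sel [simp]:
 "idx (block n x) = {..<fst x}" "deg (block n x) s = (snd x + s) mod n"
 "mat (block n x) s s' = of_bool (s = Suc s')"
 by (simp_all add: block_def)

lemma pow_mat_block: "s < fst x ==> pow_mat (block n x :: (nat, 'k::field) gdata) k s s' = of_bool (s = s' + k)"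
proof (induction k arbitrary: s)
 case (Suc k)
 have "pow_mat (block n x :: (nat, 'k) gdata) (Suc k) s s' = (\<Sum>c<fst x. of_bool (s = Suc c) * of_bool (c = s' + k))"
  unfolding pow_mat.simps block_sel using Suc.IH by (intro sum.cong refl) auto
 also have "... = (\<Sum>c<fst x. if c = s' + k then of_bool (s = Suc (s' + k)) else 0)"
  by (intro sum.cong) auto
 finally show ?case using Suc.prems by auto
qed auto

lemma gvalid_block: "0 < n ==> fst x \<le> d ==> gvalid n d (block n x)"
 by (auto simp: gvalid_def pow_mat_block mod_Suc_eq split: if_splits)

definition std :: "nat => (nat \<times> nat) list => 'k::field gdata2" where
 "std n L = famsum (length L) (%t. block n (L ! t))"

lemma std_sel [simp]:
 "idx (std n L) = Sigma {..<length L} (%t. {..<fst (L ! t)})"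
 "deg (std n L) (t, s) = (snd (L ! t) + s) mod n"
 "mat (std n L) (t, s) (t', s') = of_bool (t = t' \<and> s = Suc s')"
 by (simp_all add: std_def)

lemma pow_mat_std:
 "(t, s) \<in> idx (std n L) ==> pow_mat (std n L) k (t, s) (t', s') = of_bool (t = t' \<and> s = s' + k)"
 by (auto simp: std_def pow_mat_famsum pow_mat_block)

lemma gvalid_std:
 assumes "0 < n" "\<And>x. x \<in> set L ==> fst x \<le> d" shows "gvalid n d (std n L)"
 unfolding std_def by (rule gvalid_famsum, rule gvalid_block) (use assms in auto)

lemma gdata_iso_std_append:
 "gdata_iso (case_sum id (%(t, s). (length L + t, s))) (dsum (std n L) (std n L')) (std n (L @ L'))"
 unfolding gdata_iso_def
proof (intro conjI ballI)
 show "bij_betw (case_sum id (%(t, s). (length L + t, s)))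
   (idx (dsum (std n L) (std n L'))) (idx (std n (L @ L')))"
  by (rule bij_betwI[where g = "%(t, s). if t < length L then Inl (t, s) else Inr (t - length L, s)"])
    (auto simp: nth_append split: if_splits)
qed (auto simp: nth_append)

lemma gdata_iso_std_singleton: "gdata_iso (%s. (0, s)) (block n x) (std n [x])"
 by (auto simp: gdata_iso_def bij_betw_def inj_on_def)

lemma gdata_iso_std_mset:
 assumes "mset L = mset L'"
 shows "\<exists>h. gdata_iso h (std n L :: 'k::field gdata2) (std n L')"
proof -
 obtain f where f: "bij_betw f {..<length L} {..<length L'}" "\<And>i. i < length L ==> L ! i = L' ! f i"
  using permutation_Ex_bij[OF assms] by blast
 have inj: "f t = f t' \<longleftrightarrow> t = t'" if "t < length L" "t' < length L" for t t'
  using f(1) that by (auto simp: bij_betw_def inj_on_def)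
 have "bij_betw (%(t, s). (f t, s)) (idx (std n L :: 'k gdata2)) (idx (std n L' :: 'k gdata2))"
  unfolding bij_betw_def
 proof
  show "inj_on (%(t, s). (f t, s)) (idx (std n L))" using inj by (auto simp: inj_on_def)
  show "(%(t, s). (f t, s)) ` idx (std n L) = idx (std n L')"
  proof (intro equalityI subsetI)
   fix x assume "x \<in> (%(t, s). (f t, s)) ` idx (std n L)"
   then show "x \<in> idx (std n L')" using f by (auto simp: bij_betw_def)
  next
   fix x assume x: "x \<in> idx (std n L')"
   then obtain t s where ts: "x = (t, s)" "t < length L'" "s < fst (L' ! t)" by auto
   then obtain t' where "t' < length L" "f t' = t" using f(1) unfolding bij_betw_def by (metis imageE lessThan_iff)
   then show "x \<in> (%(t, s). (f t, s)) ` idx (std n L)"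
    using ts f(2) by (intro image_eqI[of _ _ "(t', s)"]) auto
  qed
 qed
 then have "gdata_iso (%(t, s). (f t, s)) (std n L :: 'k gdata2) (std n L')"
  using inj f(2) by (auto simp: gdata_iso_def)
 then show ?thesis by (intro exI[of _ "%(t, s). (f t, s)"])
qed

subsection \<open>Tensor products\<close>

text \<open>The operator of a tensor product is \<open>X \<otimes> 1 + 1 \<otimes> X\<close>.\<close>

definition tdata :: "nat => ('i, 'k::field) gdata => ('j, 'k) gdata => ('i \<times> 'j, 'k) gdata" where
 "tdata n C D = \<lparr>idx = idx C \<times> idx D, deg = (%x. (deg C (fst x) + deg D (snd x)) mod n),
   mat = (%x y. mat C (fst x) (fst y) * of_bool (snd x = snd y)
    + of_bool (fst x = fst y) * mat D (snd x) (snd y))\<rparr>"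

lemma tdata_sel [simp]:
 "idx (tdata n C D) = idx C \<times> idx D" "deg (tdata n C D) (b, c) = (deg C b + deg D c) mod n"
 "mat (tdata n C D) (b, c) (b', c') = mat C b b' * of_bool (c = c') + of_bool (b = b') * mat D c c'"
 by (simp_all add: tdata_def)

lemma binomial_step:
 fixes A B :: "nat => 'k::field"
 shows "(\<Sum>j\<le>k. of_nat (k choose j) * (A (Suc j) * B (k - j) + A j * B (Suc (k - j))))
  = (\<Sum>j\<le>Suc k. of_nat (Suc k choose j) * (A j * B (Suc k - j)))"
proof -
 have "(\<Sum>j\<le>Suc k. of_nat (Suc k choose j) * (A j * B (Suc k - j)))
  = A 0 * B (Suc k) + (\<Sum>j\<le>k. of_nat (k choose j) * (A (Suc j) * B (k - j)))
   + (\<Sum>j\<le>k. of_nat (k choose Suc j) * (A (Suc j) * B (k - j)))"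
  by (subst sum.atMost_Suc_shift) (simp add: sum.distrib algebra_simps)
 also have "(\<Sum>j\<le>k. of_nat (k choose Suc j) * (A (Suc j) * B (k - j)))
   = (\<Sum>j<k. of_nat (k choose Suc j) * (A (Suc j) * B (k - j)))"
  by (simp add: lessThan_Suc_atMost[symmetric] binomial_eq_0)
 also have "A 0 * B (Suc k) + (\<Sum>j\<le>k. of_nat (k choose j) * (A (Suc j) * B (k - j)))
   + (\<Sum>j<k. of_nat (k choose Suc j) * (A (Suc j) * B (k - j)))
   = (\<Sum>j\<le>k. of_nat (k choose j) * (A (Suc j) * B (k - j)))
   + (\<Sum>j\<le>k. of_nat (k choose j) * (A j * B (Suc (k - j))))"
 proof -
  have "(\<Sum>j\<le>k. of_nat (k choose j) * (A j * B (Suc (k - j))))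
    = A 0 * B (Suc k) + (\<Sum>j<k. of_nat (k choose Suc j) * (A (Suc j) * B (Suc (k - Suc j))))"
   by (subst sum.atMost_shift) simp
  also have "(\<Sum>j<k. of_nat (k choose Suc j) * (A (Suc j) * B (Suc (k - Suc j))))
    = (\<Sum>j<k. of_nat (k choose Suc j) * (A (Suc j) * B (k - j)))"
   by (intro sum.cong) (auto simp: Suc_diff_Suc)
  finally show ?thesis by simp
 qed
 finally show ?thesis by (simp add: sum.distrib algebra_simps)
qed

lemma pow_mat_tdata:
 assumes fin: "finite (idx C)" "finite (idx D)" and "b \<in> idx C" "c \<in> idx D"
 shows "pow_mat (tdata n C D) k (b, c) (b', c')
   = (\<Sum>j\<le>k. of_nat (k choose j) * (pow_mat C j b b' * pow_mat D (k - j) c c'))"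
 using assms(3,4)
proof (induction k arbitrary: b c)
 case 0 show ?case by simp
next
 case (Suc k)
 let ?P = "pow_mat (tdata n C D) k"
 have "pow_mat (tdata n C D) (Suc k) (b, c) (b', c')
  = (\<Sum>e\<in>idx C. \<Sum>f\<in>idx D. (if f = c then mat C b e * ?P (e, c) (b', c') else 0)
    + (if e = b then mat D c f * ?P (b, f) (b', c') else 0))"
 proof -
  have "pow_mat (tdata n C D) (Suc k) (b, c) (b', c')
   = (\<Sum>e\<in>idx C. \<Sum>f\<in>idx D. mat (tdata n C D) (b, c) (e, f) * ?P (e, f) (b', c'))"
   by (simp add: sum.cartesian_product split_def del: tdata_sel(3))
  then show ?thesis by (auto simp: algebra_simps intro!: sum.cong)
 qed
 also have "... = (\<Sum>e\<in>idx C. mat C b e * ?P (e, c) (b', c')) + (\<Sum>f\<in>idx D. mat D c f * ?P (b, f) (b', c'))"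
 proof -
  have "(\<Sum>e\<in>idx C. \<Sum>f\<in>idx D. if e = b then mat D c f * ?P (b, f) (b', c') else 0)
    = (\<Sum>e\<in>idx C. if e = b then \<Sum>f\<in>idx D. mat D c f * ?P (b, f) (b', c') else 0)"
   by (intro sum.cong) auto
  then show ?thesis using fin Suc.prems by (simp add: sum.distrib)
 qed
 also have "(\<Sum>e\<in>idx C. mat C b e * ?P (e, c) (b', c'))
   = (\<Sum>j\<le>k. of_nat (k choose j) * (pow_mat C (Suc j) b b' * pow_mat D (k - j) c c'))"
 proof -
  have "(\<Sum>e\<in>idx C. mat C b e * ?P (e, c) (b', c')) = (\<Sum>e\<in>idx C. \<Sum>j\<le>k. mat C b e *
    (of_nat (k choose j) * (pow_mat C j e b' * pow_mat D (k - j) c c')))"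
   using Suc by (intro sum.cong) (auto simp: sum_distrib_left)
  then show ?thesis by (subst (asm) sum.swap) (simp add: sum_distrib_left sum_distrib_right algebra_simps)
 qed
 also have "(\<Sum>f\<in>idx D. mat D c f * ?P (b, f) (b', c'))
   = (\<Sum>j\<le>k. of_nat (k choose j) * (pow_mat C j b b' * pow_mat D (Suc (k - j)) c c'))"
 proof -
  have "(\<Sum>f\<in>idx D. mat D c f * ?P (b, f) (b', c')) = (\<Sum>f\<in>idx D. \<Sum>j\<le>k. mat D c f *
    (of_nat (k choose j) * (pow_mat C j b b' * pow_mat D (k - j) f c')))"
   using Suc by (intro sum.cong) (auto simp: sum_distrib_left)
  then show ?thesis by (subst (asm) sum.swap) (simp add: sum_distrib_left sum_distrib_right algebra_simps)
 qed
 finally show ?case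
  using binomial_step[of k "%j. pow_mat C j b b'" "%j. pow_mat D j c c'"]
  by (simp only: sum.distrib[symmetric] distrib_left[symmetric])
qed

lemma prime_dvd_binomial_prime_power:
 assumes "prime p" "0 < j" "j < p ^ m" shows "p dvd (p ^ m choose j)"
proof (rule ccontr)
 assume "\<not> p dvd (p ^ m choose j)"
 then have "coprime (p ^ m) (p ^ m choose j)" using assms(1) by (simp add: prime_imp_coprime coprime_power_left_iff)
 moreover have "p ^ m dvd j * (p ^ m choose j)"
  using binomial_absorption[of "j - 1" "p ^ m"] assms(2) by (metis Suc_pred' dvd_triv_left)
 ultimately have "p ^ m dvd j" by (simp add: coprime_dvd_mult_left_iff)
 then show False using assms(2,3) by (auto dest: dvd_imp_le)
qed

text \<open>The \<open>d\<close>-th power of \<open>X \<otimes> 1 + 1 \<otimes> X\<close> is given by the binomial formula. The inner binomial coefficients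
of \<open>d = p\<^sup>m\<close> vanish in \<open>K\<close>, and the outer terms contain \<open>X\<^sup>d = 0\<close>.\<close>

lemma gvalid_tdata:
 assumes p: "prime p" "CHAR('k::field) = p" and d: "d = p ^ m"
  and C: "gvalid n d (C :: ('i, 'k) gdata)" and D: "gvalid n d (D :: ('j, 'k) gdata)" and n: "0 < n"
 shows "gvalid n d (tdata n C D)"
 unfolding gvalid_def
proof (intro conjI ballI impI)
 note fin = gvalid_finite[OF C] gvalid_finite[OF D]
 show "finite (idx (tdata n C D))" using fin by simp
 fix x assume x: "x \<in> idx (tdata n C D)"
 then obtain b c where bc: "x = (b, c)" "b \<in> idx C" "c \<in> idx D" by auto
 then show "deg (tdata n C D) x < n" using n by simp
 fix y assume y: "y \<in> idx (tdata n C D)"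
 then obtain b' c' where bc': "y = (b', c')" "b' \<in> idx C" "c' \<in> idx D" by auto
 show "pow_mat (tdata n C D) d x y = 0"
  unfolding bc(1) bc'(1) pow_mat_tdata[OF fin bc(2,3)]
 proof (intro sum.neutral ballI)
  fix j assume j: "j \<in> {..d}"
  consider "j = 0" | "j = d" | "0 < j" "j < d" using j by force
  then show "of_nat (d choose j) * (pow_mat C j b b' * pow_mat D (d - j) c c') = 0"
  proof cases
   case 1 then show ?thesis using gvalid_pow[OF D bc(3) bc'(3)] by simp
  next
   case 2 then show ?thesis using gvalid_pow[OF C bc(2) bc'(2)] by simp
  next
   case 3
   then have "p dvd (d choose j)" using prime_dvd_binomial_prime_power[OF p(1)] d by simp
   then have "of_nat (d choose j) = (0::'k)" using p(2) by (simp add: of_nat_eq_0_iff_char_dvd)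
   then show ?thesis by simp
  qed
 qed
 assume "mat (tdata n C D) x y \<noteq> 0"
 then have "mat C b b' \<noteq> 0 \<and> c = c' \<or> b = b' \<and> mat D c c' \<noteq> 0"
  using bc bc' by (auto split: if_splits)
 then show "deg (tdata n C D) x = (deg (tdata n C D) y + 1) mod n"
  using gvalid_mat[OF C bc(2) bc'(2)] gvalid_mat[OF D bc(3) bc'(3)] bc bc'
  by (auto simp: mod_add_left_eq mod_add_right_eq mod_Suc_eq)
qed

lemma gdata_iso_tdata_commute: "gdata_iso prod.swap (tdata n C D) (tdata n D C)"
 by (auto simp: gdata_iso_def bij_betw_def inj_on_def add.commute mult.commute image_iff)

lemma gdata_iso_tdata_assoc:
 "gdata_iso (%((b, c), e). (b, (c, e))) (tdata n (tdata n B C) D) (tdata n B (tdata n C D))"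
 by (auto simp: gdata_iso_def bij_betw_def inj_on_def image_iff mod_add_left_eq mod_add_right_eq
   add.assoc algebra_simps)

lemma gdata_iso_tdata_dsum:
 "gdata_iso (%(x, e). case x of Inl b => Inl (b, e) | Inr c => Inr (c, e))
   (tdata n (dsum B C) D) (dsum (tdata n B D) (tdata n C D))" (is "gdata_iso ?h ?C ?D")
proof -
 have "bij_betw ?h (idx ?C) (idx ?D)"
  by (rule bij_betwI[where g = "case_sum (%(b, e). (Inl b, e)) (%(c, e). (Inr c, e))"]) auto
 then show ?thesis by (auto simp: gdata_iso_def split: sum.splits)
qed

lemma gdata_iso_tdata_shift:
 "gdata_iso snd (tdata n (block n (1, r)) (block n (u, s))) (block n (u, (r + s) mod n))"
 by (auto simp: gdata_iso_def bij_betw_def inj_on_def image_iff mod_add_left_eq mod_add_right_eq add.assoc)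

section \<open>Decomposition into Jordan blocks\<close>

definition gunit :: "'i => 'i => 'k::field" where
 "gunit b = (%c. of_bool (c = b))"

lemma gunit_gspace [simp]: "b \<in> idx C ==> gunit b \<in> gspace C"
 by (auto simp: gunit_def gspace_def)

text \<open>Linear maps on coordinate vectors are compared on unit vectors.\<close>

lemma gspace_induct [consumes 2, case_names zero unit add]:
 assumes "finite (idx C)" "v \<in> gspace C"
  and "P (%_. 0)"
  and "\<And>b c. b \<in> idx C ==> P (%x. c * gunit b x)"
  and "\<And>v w. v \<in> gspace C ==> w \<in> gspace C ==> P v ==> P w ==> P (%b. v b + w b)"
 shows "P v"
proof -
 have "P (%x. if x \<in> A then v x else 0) \<and> (%x. if x \<in> A then v x else 0) \<in> gspace C"
  if "finite A" "A \<subseteq> idx C" for A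
  using that
 proof (induction A rule: finite_induct)
  case (insert b A)
  have eq: "(%x. if x \<in> insert b A then v x else 0)
    = (%x. v b * gunit b x + (if x \<in> A then v x else 0))"
   using insert(2) by (auto simp: fun_eq_iff gunit_def)
  have "(%x. v b * gunit b x) \<in> gspace C" using insert.prems by (auto intro: gspace_scale)
  then show ?case unfolding eq using insert assms(4)[of b "v b"] assms(5) by auto
 qed (use assms(3) in auto)
 moreover have "(%x. if x \<in> idx C then v x else 0) = v"
  using assms(2) by (auto simp: gspace_def fun_eq_iff)
 ultimately show ?thesis using assms(1) by fastforce
qed

lemma gunit_expansion:
 assumes "finite (idx C)" "v \<in> gspace C"
 shows "(%x. \<Sum>b\<in>idx C. v b * gunit b x) = v"
proof
 fix x
 have "(\<Sum>b\<in>idx C. v b * gunit b x) = (\<Sum>b\<in>idx C. if b = x then v x else 0)"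
  by (intro sum.cong) (auto simp: gunit_def)
 also have "... = v x" using assms by (auto simp: gspace_def)
 finally show "(\<Sum>b\<in>idx C. v b * gunit b x) = v x" .
qed

lemma cact_paths:
 assumes C: "gvalid n d C" and v: "v \<in> gspace C"
 shows "cact C (\<Sum>i<n. single (i, k) c) v = (%b. c * (gX C ^^ k) v b)"
proof
 fix b
 show "cact C (\<Sum>i<n. single (i, k) c) v b = c * (gX C ^^ k) v b"
 proof (cases "b \<in> idx C")
  case True
  have "mat_ext (path_mat C) (\<Sum>i<n. single (i, k) c) b b' = c * pow_mat C k b b'" if "b' \<in> idx C" for b'
  proof -
   have "mat_ext (path_mat C) (\<Sum>i<n. single (i, k) c) b b'
     = (\<Sum>i<n. if i = deg C b' then c * pow_mat C k b b' else 0)"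
    unfolding mat_ext_sum by (intro sum.cong) (auto simp: path_mat_def)
   then show ?thesis using gvalid_deg[OF C that] by simp
  qed
  then have "cact C (\<Sum>i<n. single (i, k) c) v b = (\<Sum>b'\<in>idx C. c * (pow_mat C k b b' * v b'))"
   using True by (simp add: cact_def mult.assoc)
  then show ?thesis
   by (simp only: gX_funpow[OF gvalid_finite[OF C] v True] sum_distrib_left)
 qed (simp add: cact_def gspaceD[OF gX_funpow_gspace[OF v]])
qed

lemma paths_closed: "(\<Sum>i<n. single (i, k) c) \<in> carrier (KZ n)"
proof -
 have "keys (\<Sum>i<n. single (i, k::nat) c) \<subseteq> (\<Union>i<n. keys (single (i, k::nat) c))" by (rule keys_sum)
 then show ?thesis by (auto split: if_splits)
qed

lemma smult_paths:
 assumes C: "gvalid n d C" and v: "v \<in> gspace C"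
 shows "trunc_class n d (\<Sum>i<n. single (i, k) c) \<odot>\<^bsub>gmod C\<^esub> v = (%b. c * (gX C ^^ k) v b)"
 using gmod_smult[OF C paths_closed] cact_paths[OF C v] by simp

lemma smult_vertex:
 assumes C: "gvalid n d C" and i: "i < n"
 shows "trunc_class n d (single (i, 0) 1) \<odot>\<^bsub>gmod C\<^esub> v = gproj C i v"
proof -
 have "single (i, 0) 1 \<in> carrier (KZ n)" using i by simp
 then show ?thesis using gmod_smult[OF C] cact_path[OF C, of i 0 1 v] by simp
qed

context
 fixes n d and C :: "('i, 'k::field) gdata" and D :: "('j, 'k) gdata" and f
 assumes C: "gvalid n d C" and D: "gvalid n d D"
  and f: "mod_hom (KZJ n d) (gmod C) (gmod D) f"
begin

lemma gmod_hom_gspace: "v \<in> gspace C ==> f v \<in> gspace D"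
 using mod_homD(1)[OF f] by simp

lemma gmod_hom_add:
 "v \<in> gspace C ==> w \<in> gspace C ==> f (%b. v b + w b) = (%b. f v b + f w b)"
 using mod_homD(2)[OF f] by simp

lemma gmod_hom_scale_X:
 assumes v: "v \<in> gspace C" shows "f (%b. c * (gX C ^^ k) v b) = (%b. c * (gX D ^^ k) (f v) b)"
 using mod_homD(3)[OF f, of "trunc_class n d (\<Sum>i<n. single (i, k) c)" v] v
  smult_paths[OF C v] smult_paths[OF D gmod_hom_gspace[OF v]] trunc_class_closed[OF paths_closed[of k c n]]
 by simp

lemma gmod_hom_scale: "v \<in> gspace C ==> f (%b. c * v b) = (%b. c * f v b)"
 using gmod_hom_scale_X[of v c 0] by simp

lemma gmod_hom_X: "v \<in> gspace C ==> f ((gX C ^^ k) v) = (gX D ^^ k) (f v)"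
 using gmod_hom_scale_X[of v 1 k] by simp

lemma gmod_hom_proj: "i < n ==> v \<in> gspace C ==> f (gproj C i v) = gproj D i (f v)"
 using mod_homD(3)[OF f, of "trunc_class n d (single (i, 0) 1)" v]
 by (simp add: smult_vertex[OF C] smult_vertex[OF D] trunc_class_closed)

lemma gmod_hom_zero: "f (%_. 0) = (%_. 0)"
 using gmod_hom_scale[of "%_. 0" 0] by simp

lemma gmod_hom_expansion:
 assumes v: "v \<in> gspace C"
 shows "f v = (%x. \<Sum>b\<in>idx C. v b * f (gunit b) x)"
proof -
 have fin: "finite (idx C)" by (rule gvalid_finite[OF C])
 have "f (%x. \<Sum>b\<in>A. v b * gunit b x) = (%x. \<Sum>b\<in>A. v b * f (gunit b) x)"
  if "finite A" "A \<subseteq> idx C" for A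
  using that
 proof (induction A rule: finite_induct)
  case (insert b A)
  have "(%x. \<Sum>b\<in>A. v b * gunit b x) \<in> gspace C" "(%x. v b * gunit b x) \<in> gspace C"
   using insert.prems by (auto intro!: gspace_sum gspace_scale)
  from gmod_hom_add[OF this(2,1)] show ?case
   using insert gmod_hom_scale[of "gunit b" "v b"] by (simp add: fun_eq_iff)
 qed (use gmod_hom_zero in auto)
 from this[OF fin order_refl] show ?thesis using gunit_expansion[OF fin v] by simp
qed

end

lemma gX_funpow_std:
 assumes v: "v \<in> gspace (std n L)"
 shows "(gX (std n L) ^^ k) v (t, s)
  = (if t < length L \<and> s < fst (L ! t) \<and> k \<le> s then v (t, s - k) else (0::'k::field))"
proof (cases "t < length L \<and> s < fst (L ! t)")
 case True
 let ?C = "std n L :: 'k gdata2"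
 have fin: "finite (idx ?C)" by simp
 have tr: "(t, s) \<in> idx ?C" using True by simp
 have mem: "(t, s - k) \<in> idx ?C" using tr by auto
 have "pow_mat ?C k (t, s) b' * v b' = (if b' = (t, s - k) then if k \<le> s then v (t, s - k) else 0 else 0)" for b'
  by (cases b') (auto simp: pow_mat_std[OF tr])
 then have "(gX ?C ^^ k) v (t, s) = (\<Sum>b'\<in>idx ?C. if b' = (t, s - k) then if k \<le> s then v (t, s - k) else 0 else 0)"
  using gX_funpow[OF fin v tr, of k] by simp
 also have "... = (if k \<le> s then v (t, s - k) else 0)"
  using mem fin by (simp only: sum.delta if_True)
 finally show ?thesis using True by simp
next
 case False
 then show ?thesis using gspaceD[OF gX_funpow_gspace[OF v], of "(t, s)"] by auto
qed

subsection \<open>Finite generation\<close>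

lemma smult_zero_right:
 assumes "left_module R V" "a \<in> carrier R" shows "a \<odot>\<^bsub>V\<^esub> \<zero>\<^bsub>V\<^esub> = \<zero>\<^bsub>V\<^esub>"
proof -
 interpret V: left_module R V by fact
 show ?thesis using V.smult_r_distr[of a "\<zero>\<^bsub>V\<^esub>" "\<zero>\<^bsub>V\<^esub>"] V.smult_closed[of a "\<zero>\<^bsub>V\<^esub>"] assms(2)
  by (metis V.add.l_cancel_one V.zero_closed V.l_zero)
qed

lemma fin_gen_gmod_image:
 assumes C: "gvalid n d C" and V: "left_module (KZJ n d) V"
  and f: "mod_hom (KZJ n d) (gmod C) V f" "f ` gspace C = carrier V"
 shows "fin_gen_module (KZJ n d) V"
 unfolding fin_gen_module_def
proof (intro conjI V exI[of _ "f ` gunit ` idx C"] allI impI)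
 show "finite (f ` gunit ` idx C)" using gvalid_finite[OF C] by simp
 show "f ` gunit ` idx C \<subseteq> carrier V" using mod_homD(1)[OF f(1)] by auto
 fix N assume N: "submodule N (KZJ n d) V \<and> f ` gunit ` idx C \<subseteq> N"
 interpret V: left_module "KZJ n d" V by fact
 interpret N: submodule N "KZJ n d" V using N by simp
 have "f v \<in> N" if "v \<in> gspace C" for v
  using gvalid_finite[OF C] that
 proof (induction v rule: gspace_induct)
  case zero
  show ?case using mod_hom_zero[OF f(1) left_module_gmod[OF C] V] N.one_closed by simp
 next
  case (unit b c)
  have "f (%x. c * gunit b x) = trunc_class n d (\<Sum>i<n. single (i, 0) c) \<odot>\<^bsub>V\<^esub> f (gunit b)"
   using mod_homD(3)[OF f(1) trunc_class_closed[OF paths_closed[of 0 c n]], of "gunit b"]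
    smult_paths[OF C gunit_gspace[OF unit], of 0 c] unit by simp
  then show ?case using N unit N.smult_closed[OF trunc_class_closed[OF paths_closed[of 0 c n]]] by auto
 next
  case (add v w)
  then show ?case using mod_homD(2)[OF f(1), of v w] N.m_closed[of "f v" "f w"] by simp
 qed
 then have "f ` gspace C \<subseteq> N" by (rule image_subsetI)
 moreover have "N \<subseteq> carrier V" using N.subset by simp
 ultimately show "N = carrier V" using f(2) by (intro equalityI) simp_all
qed

lemma realizes_fin_gen:
 assumes "realizes n d V C" shows "fin_gen_module (KZJ n d) V"
proof -
 have "module_isomorphic (KZJ n d) (gmod C) V"
  using module_isomorphic_sym realizesD[OF assms] by blast
 then show ?thesis
  using fin_gen_gmod_image[OF realizesD(2,1)[OF assms]] by (auto simp: module_isomorphic_alt bij_betw_def)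
qed

lemma lookup_basis_mult_single:
 "lookup (basis_mult (path_comp n) (single (i, l) c) f) (j, k)
  = (if l \<le> k \<and> i = (j + (k - l)) mod n then c * lookup f (j, k - l) else (0::'k::field))"
proof -
 have "keys f \<subseteq> UNIV" by simp
 then show ?thesis
 proof (induction f rule: poly_mapping_span_induct)
  case (single x a)
  obtain j' k' where x: "x = (j', k')" by (cases x)
  show ?case by (auto simp: x basis_mult_single path_comp_def lookup_single when_def)
 qed (auto simp: basis_mult_add_right lookup_add algebra_simps)
qed

text \<open>Every element of \<open>KZ\<^sub>n/J\<^sup>d\<close> has exactly one representative of this form, so the regular module is
described by coefficients.\<close>

definition path_poly :: "nat => nat => (nat \<times> nat => 'k::field) => (path \<Rightarrow>\<^sub>0 'k)" where
 "path_poly n d v = (\<Sum>x\<in>{..<n} \<times> {..<d}. single x (v x))"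

lemma lookup_path_poly: "lookup (path_poly n d v) x = (if x \<in> {..<n} \<times> {..<d} then v x else 0)"
proof -
 have "lookup (path_poly n d v) x = (\<Sum>y\<in>{..<n} \<times> {..<d}. if y = x then v x else 0)"
  unfolding path_poly_def lookup_sum by (intro sum.cong) (auto simp: lookup_single when_def)
 then show ?thesis by simp
qed

lemma path_poly_closed: "path_poly n d v \<in> carrier (KZ n)"
 by (auto simp: in_keys_iff lookup_path_poly split: if_splits)

lemma path_poly_add: "path_poly n d (%b. v b + w b) = path_poly n d v + path_poly n d w"
 by (rule poly_mapping_eqI) (simp add: lookup_path_poly lookup_add)

lemma trunc_class_cong:
 assumes a: "a \<in> carrier (KZ n)" "b \<in> carrier (KZ n)"
  and eq: "\<And>i k. i < n ==> k < d ==> lookup a (i, k) = lookup b (i, k)"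
 shows "trunc_class n d a = trunc_class n d b"
proof (rule trunc_class_eqI[OF _ a(2)])
 have "d \<le> snd x" if x: "x \<in> keys (a - b)" for x
 proof (rule ccontr)
  assume "\<not> d \<le> snd x"
  moreover have "fst x < n" using x keys_diff[of a b] a by fastforce
  ultimately show False using eq[of "fst x" "snd x"] x by (auto simp: in_keys_iff lookup_minus)
 qed
 then show "a \<in> trunc_class n d b" using a(1) by (simp add: mem_trunc_class[OF a(2)])
qed

abbreviation regular_blocks :: "nat => nat => (nat \<times> nat) list" where
 "regular_blocks n d \<equiv> map (%j. (d, j)) [0..<n]"

text \<open>An element \<open>x\<close> of a module defines a homomorphism from the free module with one generator. The free
module is the sum of the blocks of length \<open>d\<close>, one for every vertex.\<close>

lemma regular_hom:
 fixes V :: "('k::field trunc, 'v) module"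
 assumes V: "left_module (KZJ n d) V" and x: "x \<in> carrier V" and n: "0 < n"
 shows "mod_hom (KZJ n d) (gmod (std n (regular_blocks n d))) V
   (%v. trunc_class n d (path_poly n d v) \<odot>\<^bsub>V\<^esub> x)" (is "mod_hom _ (gmod ?C) V ?f")
proof -
 interpret V: left_module "KZJ n d" V by (rule V)
 have C: "gvalid n d ?C" by (rule gvalid_std) (use n in auto)
 have idx: "idx ?C = {..<n} \<times> {..<d}" by auto
 have dg: "deg ?C (i, k) = (i + k) mod n" if "i < n" for i k using that by simp
 note T = trunc_class_closed[OF path_poly_closed]
 have key: "?f (cact ?C (single (i, l) c) v) = trunc_class n d (single (i, l) c) \<odot>\<^bsub>V\<^esub> ?f v"
  if i: "i < n" and l: "l = 0 \<or> l = 1" and v: "v \<in> gspace ?C" for i l c and v :: "nat \<times> nat => 'k"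
 proof -
  have s: "single (i, l) c \<in> carrier (KZ n)" using i by simp
  have "(gX ?C ^^ l) (gproj ?C i v) (j, k) = (if l \<le> k \<and> i = (j + (k - l)) mod n then v (j, k - l) else 0)"
   if jk: "j < n" "k < d" for j k
   using jk gX_funpow_std[OF gproj_gspace, of l n "regular_blocks n d" i v j k] by (auto simp: gproj_def)
  then have "trunc_class n d (path_poly n d (cact ?C (single (i, l) c) v))
    = trunc_class n d (basis_mult (path_comp n) (single (i, l) c) (path_poly n d v))"
   by (intro trunc_class_cong path_poly_closed path_algebra_mult_closed s)
     (auto simp: lookup_path_poly lookup_basis_mult_single cact_path[OF C])
  then show ?thesis
   using x by (simp add: trunc_class_mult[OF s path_poly_closed] V.smult_assoc1 T trunc_class_closed[OF s])
 qed
 show ?thesis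
 proof (rule trunc_algebra_hom_criterion[OF left_module_gmod[OF C] V])
  show "?f v \<in> carrier V" for v using T x by (rule V.smult_closed)
  show "?f (v \<oplus>\<^bsub>gmod ?C\<^esub> w) = ?f v \<oplus>\<^bsub>V\<^esub> ?f w" for v w
   using x by (simp add: T path_poly_add trunc_class_add[OF path_poly_closed path_poly_closed] V.smult_l_distr)
 next
  fix i v and c :: 'k assume "i < n" "v \<in> carrier (gmod ?C)"
  then show "?f (trunc_class n d (single (i, 0) c) \<odot>\<^bsub>gmod ?C\<^esub> v) = trunc_class n d (single (i, 0) c) \<odot>\<^bsub>V\<^esub> ?f v"
   using key[of i 0 v c] gmod_smult[OF C, of "single (i, 0) c"] by simp
 next
  fix i v assume "i < n" "v \<in> carrier (gmod ?C)"
  then show "?f (trunc_class n d (single (i, 1) 1) \<odot>\<^bsub>gmod ?C\<^esub> v) = trunc_class n d (single (i, 1) 1) \<odot>\<^bsub>V\<^esub> ?f v"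
   using key[of i 1 v 1] gmod_smult[OF C, of "single (i, 1) 1"] by simp
 qed
qed

lemma mod_hom_dsum:
 fixes C :: "('i, 'k::field) gdata"
 assumes V: "left_module (KZJ n d) V" and C: "gvalid n d C" and D: "gvalid n d D"
  and f: "mod_hom (KZJ n d) (gmod C) V f" and g: "mod_hom (KZJ n d) (gmod D) V g"
 shows "mod_hom (KZJ n d) (gmod (dsum C D)) V (%v. f (%b. v (Inl b)) \<oplus>\<^bsub>V\<^esub> g (%b. v (Inr b)))"
proof (rule mod_homI)
 interpret V: left_module "KZJ n d" V by (rule V)
 note CD = gvalid_dsum[OF C D]
 note fin = gvalid_finite[OF C] gvalid_finite[OF D]
 have l: "(%b. v (Inl b)) \<in> gspace C" and r: "(%b. v (Inr b)) \<in> gspace D" if "v \<in> gspace (dsum C D)" for v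
  using that by (auto simp: gspace_def)
 have fc: "f v \<in> carrier V" if "v \<in> gspace C" for v using mod_homD(1)[OF f] that by simp
 have gc: "g v \<in> carrier V" if "v \<in> gspace D" for v using mod_homD(1)[OF g] that by simp
 { fix x assume "x \<in> carrier (gmod (dsum C D))"
  then show "f (%b. x (Inl b)) \<oplus>\<^bsub>V\<^esub> g (%b. x (Inr b)) \<in> carrier V" using l r fc gc by simp }
 { fix x y assume "x \<in> carrier (gmod (dsum C D))" "y \<in> carrier (gmod (dsum C D))"
  then have *: "x \<in> gspace (dsum C D)" "y \<in> gspace (dsum C D)" by auto
  show "f (%b. (x \<oplus>\<^bsub>gmod (dsum C D)\<^esub> y) (Inl b)) \<oplus>\<^bsub>V\<^esub> g (%b. (x \<oplus>\<^bsub>gmod (dsum C D)\<^esub> y) (Inr b))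
   = f (%b. x (Inl b)) \<oplus>\<^bsub>V\<^esub> g (%b. x (Inr b)) \<oplus>\<^bsub>V\<^esub> (f (%b. y (Inl b)) \<oplus>\<^bsub>V\<^esub> g (%b. y (Inr b)))"
   using mod_homD(2)[OF f, of "%b. x (Inl b)" "%b. y (Inl b)"]
    mod_homD(2)[OF g, of "%b. x (Inr b)" "%b. y (Inr b)"] l[OF *(1)] l[OF *(2)] r[OF *(1)] r[OF *(2)]
   by (simp add: fc gc V.add.m_ac) }
 { fix h :: "'k trunc" and x assume h: "h \<in> carrier (KZJ n d)" and "x \<in> carrier (gmod (dsum C D))"
  then have x: "x \<in> gspace (dsum C D)" by simp
  from h obtain a where a: "a \<in> carrier (KZ n)" "h = trunc_class n d a"
   by (rule trunc_algebra_cases)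
  have "x = case_sum (%b. x (Inl b)) (%b. x (Inr b))" by (auto simp: fun_eq_iff split: sum.splits)
  then have "cact (dsum C D) a x = case_sum (cact C a (%b. x (Inl b))) (cact D a (%b. x (Inr b)))"
   using cact_dsum[OF fin, of a "%b. x (Inl b)" "%b. x (Inr b)"] by simp
  then show "f (%b. (h \<odot>\<^bsub>gmod (dsum C D)\<^esub> x) (Inl b)) \<oplus>\<^bsub>V\<^esub> g (%b. (h \<odot>\<^bsub>gmod (dsum C D)\<^esub> x) (Inr b))
   = h \<odot>\<^bsub>V\<^esub> (f (%b. x (Inl b)) \<oplus>\<^bsub>V\<^esub> g (%b. x (Inr b)))"
   using mod_homD(3)[OF f h, of "%b. x (Inl b)"] mod_homD(3)[OF g h, of "%b. x (Inr b)"] l[OF x] r[OF x] h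
   by (simp add: a(2) gmod_smult[OF CD a(1)] gmod_smult[OF C a(1)] gmod_smult[OF D a(1)] V.smult_r_distr fc gc) }
qed

lemma surjection_from_blocks:
 fixes V :: "('k::field trunc, 'v) module"
 assumes V: "left_module (KZJ n d) V" and n: "0 < n" and S: "finite S" "S \<subseteq> carrier V"
 shows "\<exists>L \<Phi>. (\<forall>x\<in>set L. fst x \<le> d) \<and> mod_hom (KZJ n d) (gmod (std n L)) V \<Phi> \<and>
   S \<subseteq> \<Phi> ` gspace (std n L)"
 using S
proof (induction S rule: finite_induct)
 case empty
 interpret V: left_module "KZJ n d" V by (rule V)
 have "mod_hom (KZJ n d) (gmod (std n [])) V (%_. \<zero>\<^bsub>V\<^esub>)"
  by (rule mod_homI) (auto simp: smult_zero_right[OF V])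
 then show ?case by (intro exI[of _ "[]"] exI) auto
next
 case (insert x S)
 interpret V: left_module "KZJ n d" V by (rule V)
 obtain L \<Phi> where L: "\<forall>x\<in>set L. fst x \<le> d"
  and \<Phi>: "mod_hom (KZJ n d) (gmod (std n L)) V \<Phi>" "S \<subseteq> \<Phi> ` gspace (std n L)"
  using insert by auto
 let ?L = "regular_blocks n d"
 let ?C = "std n L :: 'k gdata2" and ?D = "std n ?L :: 'k gdata2"
 have C: "gvalid n d ?C" and D: "gvalid n d ?D" using L n by (auto intro!: gvalid_std)
 define g where "g v = trunc_class n d (path_poly n d v) \<odot>\<^bsub>V\<^esub> x" for v
 have x: "x \<in> carrier V" using insert by simp
 have g: "mod_hom (KZJ n d) (gmod ?D) V g"
  unfolding g_def using x n by (intro regular_hom[OF V]) auto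
 have zero: "\<Phi> (%_. 0) = \<zero>\<^bsub>V\<^esub>" "g (%_. 0) = \<zero>\<^bsub>V\<^esub>"
  using mod_hom_zero[OF \<Phi>(1) left_module_gmod[OF C] V] mod_hom_zero[OF g left_module_gmod[OF D] V] by auto
 have gx: "g (%y. of_bool (y \<in> {..<n} \<times> {0} \<inter> idx ?D)) = x"
 proof -
  have "trunc_class n d (path_poly n d (%y. of_bool (y \<in> {..<n} \<times> {0} \<inter> idx ?D)))
    = trunc_class n d (\<Sum>i<n. single (i, 0) (1::'k))"
  proof (rule trunc_class_cong[OF path_poly_closed paths_closed])
   fix i k assume "i < n" "k < d"
   moreover from this have "lookup (\<Sum>i<n. single (i, 0::nat) (1::'k)) (i, k)
     = (\<Sum>i'<n. if i' = i then of_bool (k = 0) else 0)"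
    unfolding lookup_sum by (intro sum.cong) (auto simp: lookup_single when_def)
   ultimately show "lookup (path_poly n d (%y. of_bool (y \<in> {..<n} \<times> {0} \<inter> idx ?D))) (i, k)
     = lookup (\<Sum>i<n. single (i, 0::nat) (1::'k)) (i, k)"
    by (simp add: lookup_path_poly)
  qed
  then show ?thesis using x by (simp add: g_def trunc_class_one V.smult_one)
 qed
 have app: "(%y. of_bool (y \<in> {..<n} \<times> {0} \<inter> idx ?D)) \<in> gspace ?D" by (auto simp: gspace_def)
 define \<Psi> where "\<Psi> v = \<Phi> (%b. v (Inl b)) \<oplus>\<^bsub>V\<^esub> g (%b. v (Inr b))" for v :: "nat \<times> nat + nat \<times> nat => 'k"
 have \<Psi>: "mod_hom (KZJ n d) (gmod (dsum ?C ?D)) V \<Psi>"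
  unfolding \<Psi>_def by (rule mod_hom_dsum[OF V C D \<Phi>(1) g])
 have im: "insert x S \<subseteq> \<Psi> ` gspace (dsum ?C ?D)"
 proof
  fix y assume "y \<in> insert x S"
  then consider "y = x" | "y \<in> S" by auto
  then show "y \<in> \<Psi> ` gspace (dsum ?C ?D)"
  proof cases
   case 1
   then show ?thesis using app gx zero x
    by (intro image_eqI[of _ _ "case_sum (%_. 0) (%y. of_bool (y \<in> {..<n} \<times> {0} \<inter> idx ?D))"])
      (auto simp: \<Psi>_def gspace_def split: sum.splits)
  next
   case 2
   then obtain v where v: "v \<in> gspace ?C" "y = \<Phi> v" using \<Phi>(2) by auto
   moreover have "y \<in> carrier V" using 2 insert by auto
   ultimately show ?thesis using zero
    by (intro image_eqI[of _ _ "case_sum v (%_. 0)"]) (auto simp: \<Psi>_def gspace_def split: sum.splits)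
  qed
 qed
 have CD': "gvalid n d (std n (L @ ?L) :: 'k gdata2)" using L n by (auto intro!: gvalid_std)
 have "module_isomorphic (KZJ n d) (gmod (std n (L @ ?L))) (gmod (dsum ?C ?D))"
  using gmod_iso[OF gdata_iso_std_append gvalid_dsum[OF C D]] module_isomorphic_sym
   left_module_gmod[OF gvalid_dsum[OF C D]] by blast
 then obtain h where h: "bij_betw h (gspace (std n (L @ ?L))) (gspace (dsum ?C ?D))"
   "mod_hom (KZJ n d) (gmod (std n (L @ ?L))) (gmod (dsum ?C ?D)) h"
  by (auto simp: module_isomorphic_alt)
 have "insert x S \<subseteq> (%v. \<Psi> (h v)) ` gspace (std n (L @ ?L))"
  using im h(1) by (simp add: bij_betw_def image_image[symmetric])
 then show ?case using mod_hom_comp[OF h(2) \<Psi>] L by (intro exI[of _ "L @ ?L"] exI conjI) auto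
qed

subsection \<open>Shortening a block\<close>

lemma mod_add_left_cancel: "(a + x) mod n = (a + y) mod n \<longleftrightarrow> x mod n = (y::nat) mod n"
 using mod_eq_dvd_iff_nat[of x y n] mod_eq_dvd_iff_nat[of "a + x" "a + y" n]
  mod_eq_dvd_iff_nat[of y x n] mod_eq_dvd_iff_nat[of "a + y" "a + x" n]
 by (cases x y rule: le_cases) auto

lemma gX_sum: "gX C (%b. \<Sum>i\<in>A. c i * f i b) = (%b. \<Sum>i\<in>A. c i * gX C (f i) b)"
 by (induction A rule: infinite_finite_induct) (auto simp: gX_add gX_scale, auto simp: gX_def)

text \<open>The hypothesis \<open>d \<le> n\<close> of the main result enters here: a block of length at most \<open>n\<close> has at most one
basis vector in every degree.\<close>

lemma degree_determines_position:
 assumes "s < l" "s' < l" "l \<le> n" "(j + s) mod n = (j + s') mod (n::nat)" shows "s = s'"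
 using assms by (simp add: mod_add_left_cancel)

context
 fixes n d :: nat and V :: "('k::field trunc, 'v) module" and C :: "('i, 'k) gdata" and f
 assumes V: "left_module (KZJ n d) V" and C: "gvalid n d C"
  and f: "mod_hom (KZJ n d) (gmod C) V f"
begin

lemma ker_scale_X:
 assumes "v \<in> gspace C" "f v = \<zero>\<^bsub>V\<^esub>" shows "f (%b. c * (gX C ^^ k) v b) = \<zero>\<^bsub>V\<^esub>"
 using mod_homD(3)[OF f trunc_class_closed[OF paths_closed[of k c n]], of v] assms
  smult_paths[OF C assms(1), of k c] smult_zero_right[OF V trunc_class_closed[OF paths_closed[of k c n]]]
 by simp

lemma ker_add:
 assumes "v \<in> gspace C" "w \<in> gspace C" "f w = \<zero>\<^bsub>V\<^esub>" shows "f (%b. v b + w b) = f v"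
proof -
 interpret V: left_module "KZJ n d" V by (rule V)
 show ?thesis using mod_homD(2)[OF f, of v w] mod_homD(1)[OF f, of v] assms by simp
qed

lemma ker_sum_X:
 assumes v: "v \<in> gspace C" "f v = \<zero>\<^bsub>V\<^esub>" and A: "finite A"
 shows "f (%b. \<Sum>\<sigma>\<in>A. c \<sigma> * (gX C ^^ k \<sigma>) v b) = \<zero>\<^bsub>V\<^esub>"
 using A
proof (induction A rule: finite_induct)
 case empty
 show ?case using mod_hom_zero[OF f left_module_gmod[OF C] V] by simp
next
 case (insert \<sigma> A)
 have m: "(%b. c \<sigma> * (gX C ^^ k \<sigma>) v b) \<in> gspace C" for \<sigma>
  using v by (intro gspace_scale gX_funpow_gspace)
 have "f (%b. c \<sigma> * (gX C ^^ k \<sigma>) v b + (\<Sum>\<sigma>\<in>A. c \<sigma> * (gX C ^^ k \<sigma>) v b)) = f (%b. c \<sigma> * (gX C ^^ k \<sigma>) v b)"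
  by (rule ker_add) (use insert m in \<open>auto intro: gspace_sum\<close>)
 then show ?case using insert ker_scale_X[OF v, of "c \<sigma>" "k \<sigma>"] by simp
qed

lemma ker_proj:
 assumes "v \<in> gspace C" "f v = \<zero>\<^bsub>V\<^esub>" "i < n" shows "f (gproj C i v) = \<zero>\<^bsub>V\<^esub>"
proof -
 have s: "single (i, 0) (1::'k) \<in> carrier (KZ n)" using assms by simp
 show ?thesis
  using mod_homD(3)[OF f trunc_class_closed[OF s], of v] smult_zero_right[OF V trunc_class_closed[OF s]]
   smult_vertex[OF C assms(3), of v] assms by simp
qed

end

text \<open>A surjection from a standard module that is not injective can be replaced by one from a smaller
standard module. Take a homogeneous vector \<open>w\<close> in the kernel, and a block in which \<open>w\<close> involves
the lowest power \<open>X\<^bsup>s\<^sub>0\<^esup>\<close> of \<open>X\<close> that occurs in it. Then \<open>w = X\<^bsup>s\<^sub>0\<^esup> e\<close>, where \<open>e\<close> is a combination whose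
coefficient at the generator of the chosen block is not zero. In the image, \<open>e\<close> can replace that
generator, and \<open>X\<^bsup>s\<^sub>0\<^esup> e\<close> is zero there; so the block can be cut down to length \<open>s\<^sub>0\<close>.\<close>

lemma shorten_block:
 fixes V :: "('k::field trunc, 'v) module"
 assumes V: "left_module (KZJ n d) V" and n: "0 < n" and dn: "d \<le> n"
  and L: "\<forall>x\<in>set L. fst x \<le> d"
  and \<Phi>: "mod_hom (KZJ n d) (gmod (std n L)) V \<Phi>" "\<Phi> ` gspace (std n L) = carrier V"
  and v: "v \<in> gspace (std n L)" "v b \<noteq> 0" "\<Phi> v = \<zero>\<^bsub>V\<^esub>"
 shows "\<exists>L' \<Phi>'. (\<forall>x\<in>set L'. fst x \<le> d) \<and> mod_hom (KZJ n d) (gmod (std n L')) V \<Phi>' \<and>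
   \<Phi>' ` gspace (std n L') = carrier V \<and> sum_list (map fst L') < sum_list (map fst L)"
proof -
 interpret V: left_module "KZJ n d" V by (rule V)
 let ?C = "std n L :: 'k gdata2"
 have C: "gvalid n d ?C" using n L by (auto intro: gvalid_std)
 \<comment> \<open>Kernels are graded, so a homogeneous component of \<open>v\<close> is again in the kernel.\<close>
 define r where "r = deg ?C b"
 define w where "w = gproj ?C r v"
 have b: "b \<in> idx ?C" using v(2) gspaceD[OF v(1), of b] by blast
 have "w \<in> gspace ?C" by (simp add: w_def)
 moreover have "\<Phi> w = \<zero>\<^bsub>V\<^esub>"
  using ker_proj[OF V C \<Phi>(1) v(1,3), of r] gvalid_deg[OF C b] by (simp add: w_def r_def)
 moreover have "w b \<noteq> 0" using v(2) b by (simp add: w_def r_def gproj_def)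
 ultimately have w: "w \<in> gspace ?C" "\<Phi> w = \<zero>\<^bsub>V\<^esub>" "w b \<noteq> 0" by blast+
 have w_deg: "t < length L" "s < fst (L ! t)" "(snd (L ! t) + s) mod n = r" if "w (t, s) \<noteq> 0" for t s
  using that by (auto simp: w_def gproj_def split: if_splits)
 obtain t0 s0 where ts0: "w (t0, s0) \<noteq> 0" and least: "\<And>t s. w (t, s) \<noteq> 0 ==> s0 \<le> s"
 proof -
  obtain x where "w x \<noteq> 0" "\<forall>y. w y \<noteq> 0 --> snd x \<le> snd y"
   using ex_has_least_nat[of "%x. w x \<noteq> 0" b snd] w(3) by auto
  then show ?thesis using that[of "fst x" "snd x"] by force
 qed
 define l0 j0 where "l0 = fst (L ! t0)" and "j0 = snd (L ! t0)"
 have t0: "t0 < length L" "s0 < l0" "(j0 + s0) mod n = r"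
  using w_deg[OF ts0] by (auto simp: l0_def j0_def)
 have l0: "l0 \<le> d" using L t0(1) by (auto simp: l0_def)
 \<comment> \<open>Division of \<open>w\<close> by the power \<open>s0\<close> of the operator.\<close>
 define e where "e x = w (fst x, snd x + s0)" for x
 have e: "e (t, s) = w (t, s + s0)" for t s by (simp add: e_def)
 have eC: "e \<in> gspace ?C" using w_deg by (fastforce simp: gspace_def e)
 have XC: "(gX ?C ^^ k) e (t, s) = (if t < length L \<and> s < fst (L ! t) \<and> k \<le> s then w (t, s - k + s0) else 0)" for k t s
  using gX_funpow_std[OF eC, of k t s] by (simp add: e)
 have Xs0: "(gX ?C ^^ s0) e = w"
 proof
  fix x :: "nat \<times> nat" obtain t s where x: "x = (t, s)" by (cases x)
  show "(gX ?C ^^ s0) e x = w x"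
   using least[of t s] w_deg[of t s] by (auto simp: x XC)
 qed
 have X_ge: "(gX ?C ^^ k) e = (gX ?C ^^ (k - s0)) w" if "s0 \<le> k" for k
  using that Xs0 funpow_add[of "k - s0" s0 "gX ?C"] by simp
 define c where "c = w (t0, s0)"
 have c: "c \<noteq> 0" using ts0 by (simp add: c_def)
 \<comment> \<open>Within one block a homogeneous vector is a multiple of a single basis vector.\<close>
 have e_t0: "e (t0, s) = (if s = 0 then c else 0)" for s
 proof (cases "w (t0, s + s0) = 0")
  case True then show ?thesis using c by (cases s) (auto simp: e c_def)
 next
  case False
  have "s + s0 < l0" "(j0 + (s + s0)) mod n = (j0 + s0) mod n"
   using w_deg(2,3)[OF False] t0(3) by (simp_all add: l0_def j0_def)
  then have "s + s0 = s0"
   using degree_determines_position[of "s + s0" l0 s0 n j0] t0(2) l0 dn by simp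
  then show ?thesis by (simp add: e c_def)
 qed
 let ?L' = "L[t0 := (s0, j0)]"
 let ?C' = "std n ?L' :: 'k gdata2"
 have L': "\<forall>x\<in>set ?L'. fst x \<le> d"
  using L t0 l0 set_update_subset_insert[of L t0 "(s0, j0)"] by fastforce
 have C': "gvalid n d ?C'" using n L' by (auto intro: gvalid_std)
 have nthL': "?L' ! t = (if t = t0 then (s0, j0) else L ! t)" for t
  using t0(1) by (auto simp: nth_list_update)
 \<comment> \<open>The shortened module maps to the old one by sending the generator of the block \<open>t0\<close> to \<open>e\<close>. This is linear for the operator up to multiples of \<open>w\<close>, which \<open>\<Phi>\<close> kills.\<close>
 define \<Theta> where "\<Theta> u = (%x. (if fst x = t0 then 0 else u x) + (\<Sum>\<sigma><s0. u (t0, \<sigma>) * (gX ?C ^^ \<sigma>) e x))"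
  for u :: "nat \<times> nat => 'k"
 have \<Theta>C: "\<Theta> u \<in> gspace ?C" if "u \<in> gspace ?C'" for u
 proof -
  have "(%x. if fst x = t0 then 0 else u x) \<in> gspace ?C"
   using that t0(1) by (auto simp: gspace_def nthL' split: if_splits)
  moreover have "(%x. \<Sum>\<sigma><s0. u (t0, \<sigma>) * (gX ?C ^^ \<sigma>) e x) \<in> gspace ?C"
   using eC by (intro gspace_sum gspace_scale gX_funpow_gspace)
  ultimately show ?thesis unfolding \<Theta>_def by (rule gspace_add)
 qed
 have \<Theta>_add: "\<Theta> (%x. u x + u' x) = (%x. \<Theta> u x + \<Theta> u' x)" for u u'
  by (auto simp: \<Theta>_def fun_eq_iff sum.distrib algebra_simps)
 have \<Theta>_scale: "\<Theta> (%x. a * u x) = (%x. a * \<Theta> u x)" for a u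
  by (auto simp: \<Theta>_def fun_eq_iff sum_distrib_left algebra_simps)
 have e_homog: "(j0 + \<sigma>) mod n = (snd (L ! t) + s) mod n" if "(gX ?C ^^ \<sigma>) e (t, s) \<noteq> 0" for \<sigma> t s
 proof -
  have *: "\<sigma> \<le> s" "w (t, s - \<sigma> + s0) \<noteq> 0" using that by (auto simp: XC split: if_splits)
  from w_deg(3)[OF *(2)] t0(3) have "(s0 + j0) mod n = (s0 + (snd (L ! t) + (s - \<sigma>))) mod n"
   by (simp add: algebra_simps)
  then have "j0 mod n = (snd (L ! t) + (s - \<sigma>)) mod n" by (simp add: mod_add_left_cancel)
  then have "(\<sigma> + j0) mod n = (\<sigma> + (snd (L ! t) + (s - \<sigma>))) mod n" by (simp add: mod_add_left_cancel)
  then show ?thesis using *(1) by (simp add: add.commute)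
 qed
 have \<Theta>_proj: "\<Theta> (gproj ?C' i u) = gproj ?C i (\<Theta> u)" if u: "u \<in> gspace ?C'" for i u
 proof
  fix x :: "nat \<times> nat" obtain t s where x: "x = (t, s)" by (cases x)
  show "\<Theta> (gproj ?C' i u) x = gproj ?C i (\<Theta> u) x"
  proof (cases "(t, s) \<in> idx ?C")
   case False
   then show ?thesis using gspaceD[OF \<Theta>C[OF gproj_gspace]] by (auto simp: x gproj_def)
  next
   case True
   have "(\<Sum>\<sigma><s0. gproj ?C' i u (t0, \<sigma>) * (gX ?C ^^ \<sigma>) e x)
     = (\<Sum>\<sigma><s0. of_bool ((snd (L ! t) + s) mod n = i) * (u (t0, \<sigma>) * (gX ?C ^^ \<sigma>) e x))"
    by (intro sum.cong) (use t0 e_homog[of _ t s] in \<open>auto simp: gproj_def x nthL'\<close>)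
   then have "(\<Sum>\<sigma><s0. gproj ?C' i u (t0, \<sigma>) * (gX ?C ^^ \<sigma>) e x)
     = of_bool ((snd (L ! t) + s) mod n = i) * (\<Sum>\<sigma><s0. u (t0, \<sigma>) * (gX ?C ^^ \<sigma>) e x)"
    by (simp add: sum_distrib_left)
   then show ?thesis using True by (auto simp: \<Theta>_def gproj_def x nthL')
  qed
 qed
 have \<Theta>_X: "gX ?C (\<Theta> u) = (%x. \<Theta> (gX ?C' u) x + (if s0 = 0 then 0 else u (t0, s0 - 1)) * w x)"
  if u: "u \<in> gspace ?C'" for u
 proof -
  define g where "g x = (if fst x = t0 then 0 else u x)" for x
  have gC: "g \<in> gspace ?C"
   using u t0(1) by (auto simp: g_def gspace_def nthL' split: if_splits)
  have "gX ?C (\<Theta> u) = (%x. gX ?C g x + gX ?C (%x. \<Sum>\<sigma><s0. u (t0, \<sigma>) * (gX ?C ^^ \<sigma>) e x) x)"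
   unfolding \<Theta>_def g_def by (rule gX_add)
  also have "gX ?C (%x. \<Sum>\<sigma><s0. u (t0, \<sigma>) * (gX ?C ^^ \<sigma>) e x)
    = (%x. \<Sum>\<sigma><s0. u (t0, \<sigma>) * (gX ?C ^^ Suc \<sigma>) e x)"
   by (simp add: gX_sum)
  finally have 1: "gX ?C (\<Theta> u) x = gX ?C g x + (\<Sum>\<sigma><s0. u (t0, \<sigma>) * (gX ?C ^^ Suc \<sigma>) e x)" for x
   by simp
  have Xu: "gX ?C' u (t, s) = (if t < length L \<and> s < fst (?L' ! t) \<and> 1 \<le> s then u (t, s - 1) else 0)" for t s
   using gX_funpow_std[OF u, of 1 t s] by simp
  have Xg: "gX ?C g (t, s) = (if t < length L \<and> s < fst (L ! t) \<and> 1 \<le> s then g (t, s - 1) else 0)" for t s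
   using gX_funpow_std[OF gC, of 1 t s] by simp
  have 2: "(if fst x = t0 then 0 else gX ?C' u x) = gX ?C g x" for x
   by (cases x) (auto simp: Xu Xg nthL' g_def)
  have 3: "(\<Sum>\<sigma><s0. u (t0, \<sigma>) * (gX ?C ^^ Suc \<sigma>) e x)
   = (\<Sum>\<sigma><s0. gX ?C' u (t0, \<sigma>) * (gX ?C ^^ \<sigma>) e x) + (if s0 = 0 then 0 else u (t0, s0 - 1)) * w x" for x
  proof (cases s0)
   case (Suc k)
   define F where "F \<sigma> = gX ?C' u (t0, \<sigma>) * (gX ?C ^^ \<sigma>) e x" for \<sigma>
   have F: "F 0 = 0" "\<And>\<sigma>. Suc \<sigma> < s0 ==> F (Suc \<sigma>) = u (t0, \<sigma>) * (gX ?C ^^ Suc \<sigma>) e x"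
    using t0(1) by (auto simp: F_def Xu)
   have "(\<Sum>\<sigma><s0. F \<sigma>) = F 0 + (\<Sum>\<sigma><k. F (Suc \<sigma>))"
    unfolding Suc by (rule sum.lessThan_Suc_shift)
   also have "... = (\<Sum>\<sigma><k. u (t0, \<sigma>) * (gX ?C ^^ Suc \<sigma>) e x)"
    using F Suc by (auto intro!: sum.cong)
   finally have "(\<Sum>\<sigma><s0. F \<sigma>) = (\<Sum>\<sigma><k. u (t0, \<sigma>) * (gX ?C ^^ Suc \<sigma>) e x)" .
   then show ?thesis using Xs0 Suc unfolding F_def by simp
  qed simp
  show ?thesis
  proof
   fix x
   have "\<Theta> (gX ?C' u) x = gX ?C g x + (\<Sum>\<sigma><s0. gX ?C' u (t0, \<sigma>) * (gX ?C ^^ \<sigma>) e x)"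
    unfolding 2[symmetric] by (simp add: \<Theta>_def)
   then show "gX ?C (\<Theta> u) x = \<Theta> (gX ?C' u) x + (if s0 = 0 then 0 else u (t0, s0 - 1)) * w x"
    using 1[of x] 3[of x] by simp
  qed
 qed
 have hom: "mod_hom (KZJ n d) (gmod ?C') V (%u. \<Phi> (\<Theta> u))"
 proof (rule trunc_algebra_hom_criterion[OF left_module_gmod[OF C'] V])
  fix u assume u: "u \<in> carrier (gmod ?C')"
  then show "\<Phi> (\<Theta> u) \<in> carrier V" using mod_homD(1)[OF \<Phi>(1)] \<Theta>C by simp
  fix u' assume u': "u' \<in> carrier (gmod ?C')"
  show "\<Phi> (\<Theta> (u \<oplus>\<^bsub>gmod ?C'\<^esub> u')) = \<Phi> (\<Theta> u) \<oplus>\<^bsub>V\<^esub> \<Phi> (\<Theta> u')"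
   using mod_homD(2)[OF \<Phi>(1), of "\<Theta> u" "\<Theta> u'"] \<Theta>C u u' by (simp add: \<Theta>_add)
 next
  fix i u and a :: 'k assume i: "i < n" and u: "u \<in> carrier (gmod ?C')"
  have s: "single (i, 0) a \<in> carrier (KZ n)" using i by simp
  have "\<Theta> (cact ?C' (single (i, 0) a) u) = cact ?C (single (i, 0) a) (\<Theta> u)"
   using u by (simp add: cact_path[OF C] cact_path[OF C'] \<Theta>_scale \<Theta>_proj)
  then show "\<Phi> (\<Theta> (trunc_class n d (single (i, 0) a) \<odot>\<^bsub>gmod ?C'\<^esub> u)) = trunc_class n d (single (i, 0) a) \<odot>\<^bsub>V\<^esub> \<Phi> (\<Theta> u)"
   using u mod_homD(3)[OF \<Phi>(1) trunc_class_closed[OF s], of "\<Theta> u"] \<Theta>C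
   by (simp add: gmod_smult[OF C s] gmod_smult[OF C' s])
 next
  fix i u assume i: "i < n" and u: "u \<in> carrier (gmod ?C')"
  have s: "single (i, 1) (1::'k) \<in> carrier (KZ n)" using i by simp
  define a where "a = (if s0 = 0 then 0 else gproj ?C' i u (t0, s0 - 1))"
  have m: "(%x. a * w x) \<in> gspace ?C" "\<Theta> (gX ?C' (gproj ?C' i u)) \<in> gspace ?C" using w \<Theta>C by auto
  have "cact ?C (single (i, 1) 1) (\<Theta> u) = gX ?C (\<Theta> (gproj ?C' i u))"
   using u by (simp add: cact_path[OF C] \<Theta>_proj)
  also have "... = (%x. \<Theta> (gX ?C' (gproj ?C' i u)) x + a * w x)"
   unfolding a_def by (rule \<Theta>_X) simp
  finally have "\<Phi> (cact ?C (single (i, 1) 1) (\<Theta> u)) = \<Phi> (\<Theta> (gX ?C' (gproj ?C' i u)))"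
   using ker_add[OF V C \<Phi>(1) m(2,1)] ker_scale_X[OF V C \<Phi>(1) w(1,2), of a 0] by simp
  then show "\<Phi> (\<Theta> (trunc_class n d (single (i, 1) 1) \<odot>\<^bsub>gmod ?C'\<^esub> u)) = trunc_class n d (single (i, 1) 1) \<odot>\<^bsub>V\<^esub> \<Phi> (\<Theta> u)"
   using u mod_homD(3)[OF \<Phi>(1) trunc_class_closed[OF s], of "\<Theta> u"] \<Theta>C
   unfolding gmod_smult[OF C s] gmod_smult[OF C' s] by (simp add: cact_path[OF C'])
 qed
 have "carrier V \<subseteq> (%u. \<Phi> (\<Theta> u)) ` gspace ?C'"
 proof
  fix y assume "y \<in> carrier V"
  then obtain u where u: "u \<in> gspace ?C" "y = \<Phi> u" using \<Phi>(2) by blast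
  \<comment> \<open>Eliminate the block \<open>t0\<close> from \<open>u\<close> by multiples of the powers of the operator at \<open>e\<close>.\<close>
  define g where "g x = u x - (\<Sum>\<sigma><l0. u (t0, \<sigma>) / c * (gX ?C ^^ \<sigma>) e x)" for x
  define u' where "u' = (%x. if fst x = t0 then if snd x < s0 then u x / c else 0 else g x)"
  have XCt0: "(gX ?C ^^ \<sigma>) e (t0, s) = (if s < l0 \<and> \<sigma> = s then c else 0)" for \<sigma> s
   using t0(1) e_t0[of "s - \<sigma>", unfolded e] by (cases "\<sigma> \<le> s") (auto simp: XC l0_def c_def)
  have gt0: "g (t0, s) = 0" for s
  proof (cases "s < l0")
   case True
   have "(\<Sum>\<sigma><l0. u (t0, \<sigma>) / c * (gX ?C ^^ \<sigma>) e (t0, s)) = (\<Sum>\<sigma><l0. if \<sigma> = s then u (t0, s) else 0)"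
    by (intro sum.cong) (use c True in \<open>auto simp: XCt0\<close>)
   then show ?thesis using True by (simp add: g_def)
  next
   case False
   then have "u (t0, s) = 0" using u(1) by (auto simp: gspace_def l0_def)
   then show ?thesis using False by (simp add: g_def XCt0)
  qed
  have gC: "g \<in> gspace ?C"
   using u(1) gspaceD[OF gX_funpow_gspace[OF eC]] by (auto simp: gspace_def g_def intro!: sum.neutral)
  have u'C': "u' \<in> gspace ?C'"
   using gC t0(1) by (auto simp: gspace_def u'_def nthL')
  have "\<Theta> u' x = g x + (\<Sum>\<sigma><s0. u (t0, \<sigma>) / c * (gX ?C ^^ \<sigma>) e x)" for x
   using gt0 by (cases x) (auto simp: \<Theta>_def u'_def intro!: sum.cong)
  then have "u x = \<Theta> u' x + (\<Sum>\<sigma>\<in>{s0..<l0}. u (t0, \<sigma>) / c * (gX ?C ^^ (\<sigma> - s0)) w x)" for x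
  proof -
   have "(\<Sum>\<sigma><l0. u (t0, \<sigma>) / c * (gX ?C ^^ \<sigma>) e x) = (\<Sum>\<sigma><s0. u (t0, \<sigma>) / c * (gX ?C ^^ \<sigma>) e x)
     + (\<Sum>\<sigma>\<in>{s0..<l0}. u (t0, \<sigma>) / c * (gX ?C ^^ \<sigma>) e x)"
    using t0(2) by (simp add: lessThan_atLeast0 sum.atLeastLessThan_concat)
   also have "(\<Sum>\<sigma>\<in>{s0..<l0}. u (t0, \<sigma>) / c * (gX ?C ^^ \<sigma>) e x)
     = (\<Sum>\<sigma>\<in>{s0..<l0}. u (t0, \<sigma>) / c * (gX ?C ^^ (\<sigma> - s0)) w x)"
    by (intro sum.cong) (auto simp: X_ge)
   finally show ?thesis
    using \<open>\<And>x. \<Theta> u' x = g x + (\<Sum>\<sigma><s0. u (t0, \<sigma>) / c * (gX ?C ^^ \<sigma>) e x)\<close>[of x] by (simp add: g_def)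
  qed
  then have "u = (%x. \<Theta> u' x + (\<Sum>\<sigma>\<in>{s0..<l0}. u (t0, \<sigma>) / c * (gX ?C ^^ (\<sigma> - s0)) w x))" by (rule ext)
  moreover have "\<Phi> (%x. \<Theta> u' x + (\<Sum>\<sigma>\<in>{s0..<l0}. u (t0, \<sigma>) / c * (gX ?C ^^ (\<sigma> - s0)) w x)) = \<Phi> (\<Theta> u')"
   using w(1) by (intro ker_add[OF V C \<Phi>(1)] \<Theta>C u'C' ker_sum_X[OF V C \<Phi>(1) w(1,2)] gspace_sum
     gspace_scale gX_funpow_gspace) auto
  ultimately have "y = \<Phi> (\<Theta> u')" using u(2) by simp
  then show "y \<in> (%u. \<Phi> (\<Theta> u)) ` gspace ?C'" using u'C' by (rule image_eqI)
 qed
 moreover have "(%u. \<Phi> (\<Theta> u)) ` gspace ?C' \<subseteq> carrier V" using mod_homD(1)[OF hom] by auto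
 moreover have "sum_list (map fst ?L') < sum_list (map fst L)"
  using t0(1,2) elem_le_sum_list[of t0 "map fst L"] by (simp add: map_update sum_list_update l0_def)
 ultimately show ?thesis using hom L' by (intro exI[of _ ?L'] exI conjI) auto
qed

subsection \<open>Existence of the decomposition\<close>

text \<open>By \<open>shorten_block\<close>, a kernel vector would contradict minimality.\<close>

lemma minimal_surjection_inj:
 fixes V :: "('k::field trunc, 'v) module"
 assumes V: "left_module (KZJ n d) V" and n: "0 < n" and dn: "d \<le> n"
  and L: "\<forall>x\<in>set L. fst x \<le> d"
  and \<Phi>: "mod_hom (KZJ n d) (gmod (std n L)) V \<Phi>" "\<Phi> ` gspace (std n L) = carrier V"
  and min: "\<And>L' \<Phi>'. (\<forall>x\<in>set L'. fst x \<le> d) ==> mod_hom (KZJ n d) (gmod (std n L')) V \<Phi>' ==>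
   \<Phi>' ` gspace (std n L') = carrier V ==> sum_list (map fst L) \<le> sum_list (map fst L')"
 shows "realizes n d V (std n L :: 'k gdata2)"
proof -
 interpret V: left_module "KZJ n d" V by (rule V)
 let ?C = "std n L :: 'k gdata2"
 have C: "gvalid n d ?C" using n L by (auto intro: gvalid_std)
 have inj: "inj_on \<Phi> (gspace ?C)"
 proof (rule inj_onI, rule ccontr)
  fix v w assume vw: "v \<in> gspace ?C" "w \<in> gspace ?C" "\<Phi> v = \<Phi> w" "v \<noteq> w"
  define u where "u = (%b. v b + (-1) * w b)"
  have m: "(%b. (-1) * w b) \<in> gspace ?C" "u \<in> gspace ?C" using vw by (auto simp: u_def gspace_def)
  obtain b where "u b \<noteq> 0" using vw(4) by (auto simp: u_def fun_eq_iff)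
  have "\<Phi> (%b. w b + (-1) * w b) = \<Phi> w \<oplus>\<^bsub>V\<^esub> \<Phi> (%b. (-1) * w b)"
   using mod_homD(2)[OF \<Phi>(1), of w "%b. (-1) * w b"] vw m by simp
  moreover have "\<Phi> u = \<Phi> v \<oplus>\<^bsub>V\<^esub> \<Phi> (%b. (-1) * w b)"
   using mod_homD(2)[OF \<Phi>(1), of v "%b. (-1) * w b"] vw m by (simp add: u_def)
  ultimately have "\<Phi> u = \<zero>\<^bsub>V\<^esub>" using vw(3) mod_hom_zero[OF \<Phi>(1) left_module_gmod[OF C] V] by simp
  from shorten_block[OF V n dn L \<Phi> m(2) \<open>u b \<noteq> 0\<close> this]
  obtain L' \<Phi>' where *: "\<forall>x\<in>set L'. fst x \<le> d" "mod_hom (KZJ n d) (gmod (std n L')) V \<Phi>'"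
   "\<Phi>' ` gspace (std n L') = carrier V" "sum_list (map fst L') < sum_list (map fst L)" by blast
  show False using min[OF *(1-3)] *(4) by simp
 qed
 have "module_isomorphic (KZJ n d) (gmod ?C) V"
  unfolding module_isomorphic_alt using inj \<Phi> by (auto simp: bij_betw_def)
 then have "module_isomorphic (KZJ n d) V (gmod ?C)"
  by (rule module_isomorphic_sym[OF left_module_gmod[OF C]])
 then show ?thesis using V C by (simp add: realizes_def)
qed

text \<open>The index set of the indecomposable modules; length \<open>0\<close>, which gives the zero module, is excluded.\<close>

definition blocks :: "nat => nat => (nat \<times> nat) set" where
 "blocks n d = {1..d} \<times> {..<n}"

lemma gvalid_std_blocks: "0 < n ==> set L \<subseteq> blocks n d ==> gvalid n d (std n L)"
 by (rule gvalid_std) (auto simp: blocks_def)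

lemma realizes_std_normalize:
 fixes V :: "('k::field trunc, 'v) module"
 assumes n: "0 < n" and L: "\<forall>x\<in>set L. fst x \<le> d" and V: "realizes n d V (std n L :: 'k gdata2)"
 shows "\<exists>L'. set L' \<subseteq> blocks n d \<and> realizes n d V (std n L' :: 'k gdata2)"
proof -
 let ?M = "map (%x. (fst x, snd x mod n)) L"
 let ?P = "filter (%x. 0 < fst x) ?M" and ?Z = "filter (%x. \<not> 0 < fst x) ?M"
 have "gdata_iso id (std n L :: 'k gdata2) (std n ?M)"
  by (auto simp: gdata_iso_def bij_betw_def mod_add_left_eq)
 then have 1: "realizes n d V (std n ?M :: 'k gdata2)" using V by (rule realizes_reindex)
 have "mset ?M = mset (?P @ ?Z)" by (simp add: multiset_partition[of "mset ?M" "%x. 0 < fst x"])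
 then obtain h where "gdata_iso h (std n ?M :: 'k gdata2) (std n (?P @ ?Z))"
  using gdata_iso_std_mset by blast
 then have 2: "realizes n d V (std n (?P @ ?Z) :: 'k gdata2)" using 1 by (rule realizes_reindex)
 have Z: "fst (?Z ! t) = 0" if "t < length ?Z" for t
  using nth_mem[OF that] by auto
 have iff: "t < length (?P @ ?Z) \<and> s < fst ((?P @ ?Z) ! t) \<longleftrightarrow> t < length ?P \<and> s < fst (?P ! t)" for t s
  using Z[of "t - length ?P"] by (auto simp: nth_append)
 have "idx (std n (?P @ ?Z) :: 'k gdata2) = idx (std n ?P :: 'k gdata2)"
  using iff unfolding std_sel by (auto simp del: length_append)
 moreover have "deg (std n (?P @ ?Z) :: 'k gdata2) b = deg (std n ?P :: 'k gdata2) b"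
  if "b \<in> idx (std n ?P :: 'k gdata2)" for b
  using that by (cases b) (simp add: nth_append)
 moreover have "mat (std n (?P @ ?Z) :: 'k gdata2) b b' = mat (std n ?P) b b'" for b b'
  by (cases b; cases b') simp
 ultimately have "gdata_iso id (std n (?P @ ?Z) :: 'k gdata2) (std n ?P)"
  by (simp add: gdata_iso_def)
 then have "realizes n d V (std n ?P :: 'k gdata2)" using 2 by (rule realizes_reindex)
 moreover have "set ?P \<subseteq> blocks n d" using L n by (auto simp: blocks_def)
 ultimately show ?thesis by blast
qed

text \<open>A finitely generated module is a quotient of a standard module; among all such surjections one of
least total length exists, and it is an isomorphism.\<close>

theorem block_decomposition:
 fixes V :: "('k::field trunc, 'v) module"
 assumes V: "fin_gen_module (KZJ n d) V" and n: "0 < n" and dn: "d \<le> n"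
 shows "\<exists>L. set L \<subseteq> blocks n d \<and> realizes n d V (std n L :: 'k gdata2)"
proof -
 have V': "left_module (KZJ n d) V" using V by (simp add: fin_gen_module_def)
 obtain S where "finite S \<and> S \<subseteq> carrier V \<and>
   (\<forall>N. submodule N (KZJ n d) V \<and> S \<subseteq> N --> N = carrier V)"
  using V unfolding fin_gen_module_def by (elim conjE exE) (rule that, intro conjI)
 then have S: "finite S" "S \<subseteq> carrier V"
  "\<And>N. submodule N (KZJ n d) V ==> S \<subseteq> N ==> N = carrier V"
  by simp_all
 define good where "good L \<Phi> \<longleftrightarrow> (\<forall>x\<in>set L. fst x \<le> d) \<and> mod_hom (KZJ n d) (gmod (std n L)) V \<Phi> \<and>
   \<Phi> ` gspace (std n L) = carrier V" for L and \<Phi> :: "(nat \<times> nat => 'k) => 'v"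
 obtain L0 \<Phi>0 where L0: "\<forall>x\<in>set L0. fst x \<le> d" "mod_hom (KZJ n d) (gmod (std n L0)) V \<Phi>0"
   "S \<subseteq> \<Phi>0 ` gspace (std n L0)"
  using surjection_from_blocks[OF V' n S(1,2)] by blast
 have "gvalid n d (std n L0 :: 'k gdata2)" using n L0(1) by (auto intro: gvalid_std)
 from submodule_image[OF L0(2) left_module_gmod[OF this] V'] S(3) L0(3)
 have "good L0 \<Phi>0" using L0(1,2) by (simp add: good_def)
 then have "\<exists>L. (\<exists>\<Phi>. good L \<Phi>) \<and> (\<forall>L'. (\<exists>\<Phi>. good L' \<Phi>) --> sum_list (map fst L) \<le> sum_list (map fst L'))"
  using ex_has_least_nat[of "%L. \<exists>\<Phi>. good L \<Phi>" L0 "%L. sum_list (map fst L)"] by blast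
 then obtain L \<Phi> where L: "good L \<Phi>" and min: "\<And>L' \<Phi>'. good L' \<Phi>' ==> sum_list (map fst L) \<le> sum_list (map fst L')"
  by blast
 have "realizes n d V (std n L :: 'k gdata2)"
  by (rule minimal_surjection_inj[OF V' n dn, of L \<Phi>]) (use L min in \<open>auto simp: good_def\<close>)
 then show ?thesis using realizes_std_normalize[OF n] L unfolding good_def by blast
qed

subsection \<open>Uniqueness of the decomposition\<close>

text \<open>A homogeneous linear system with more unknowns than equations has a nontrivial solution. In the form
of \<open>card_le_of_left_inverse\<close> it carries the dimension counts below: the identity does
not factor through a smaller dimension.\<close>

lemma homogeneous_system:
 fixes \<alpha> :: "'a => 'b => 'k::field"
 assumes "finite A" "finite B" "card A < card B"
 shows "\<exists>x. (\<exists>b\<in>B. x b \<noteq> 0) \<and> (\<forall>a\<in>A. (\<Sum>b\<in>B. \<alpha> a b * x b) = 0)"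
 using assms
proof (induction A arbitrary: B \<alpha> rule: finite_induct)
 case empty
 then obtain b where "b \<in> B" by fastforce
 then show ?case by (intro exI[of _ "%_. 1"]) auto
next
 case (insert a A)
 show ?case
 proof (cases "\<forall>b\<in>B. \<alpha> a b = 0")
  case True
  have "card A < card B" using insert by simp
  from insert.IH[OF insert.prems(1) this, of \<alpha>] True show ?thesis by auto
 next
  case False
  then obtain b0 where b0: "b0 \<in> B" "\<alpha> a b0 \<noteq> 0" by blast
  let ?B = "B - {b0}" and ?\<alpha> = "%a' b. \<alpha> a' b - \<alpha> a' b0 * \<alpha> a b / \<alpha> a b0"
  have "finite ?B" "card A < card ?B" using insert b0(1) by auto
  from insert.IH[OF this, of ?\<alpha>] obtain x where x: "\<exists>b\<in>?B. x b \<noteq> 0" "\<forall>a'\<in>A. (\<Sum>b\<in>?B. ?\<alpha> a' b * x b) = 0" by auto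
  define s where "s = (\<Sum>b\<in>?B. \<alpha> a b * x b)"
  define y where "y b = (if b = b0 then - s / \<alpha> a b0 else x b)" for b
  have sum_y: "(\<Sum>b\<in>B. \<alpha> a' b * y b) = \<alpha> a' b0 * (- s / \<alpha> a b0) + (\<Sum>b\<in>?B. \<alpha> a' b * x b)" for a'
  proof -
   have "(\<Sum>b\<in>B. \<alpha> a' b * y b) = \<alpha> a' b0 * y b0 + (\<Sum>b\<in>?B. \<alpha> a' b * y b)"
    using b0(1) insert.prems(1) by (simp add: sum.remove)
   also have "(\<Sum>b\<in>?B. \<alpha> a' b * y b) = (\<Sum>b\<in>?B. \<alpha> a' b * x b)" by (intro sum.cong) (auto simp: y_def)
   finally show ?thesis by (simp add: y_def)
  qed
  have "(\<Sum>b\<in>B. \<alpha> a' b * y b) = 0" if "a' \<in> A" for a'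
  proof -
   have "0 = (\<Sum>b\<in>?B. ?\<alpha> a' b * x b)" using x(2) that by simp
   also have "... = (\<Sum>b\<in>?B. \<alpha> a' b * x b) - \<alpha> a' b0 * s / \<alpha> a b0"
    by (simp add: left_diff_distrib sum_subtractf s_def sum_distrib_left sum_divide_distrib mult.assoc
      times_divide_eq_left[symmetric] del: times_divide_eq_left)
   finally show ?thesis using sum_y[of a'] by simp
  qed
  moreover have "(\<Sum>b\<in>B. \<alpha> a b * y b) = 0" using sum_y[of a] b0(2) by (simp add: s_def)
  moreover have "\<exists>b\<in>B. y b \<noteq> 0" using x(1) by (auto simp: y_def)
  ultimately show ?thesis by blast
 qed
qed

lemma card_le_of_left_inverse:
 fixes \<alpha> :: "'b => 'a => 'k::field"
 assumes fin: "finite A" "finite B"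
  and inv: "\<And>u t. u \<in> A ==> t \<in> A ==> (\<Sum>t'\<in>B. \<beta> u t' * \<alpha> t' t) = of_bool (u = t)"
 shows "card A \<le> card B"
proof (rule ccontr)
 assume "\<not> ?thesis"
 then have "card B < card A" by simp
 then obtain x where x: "\<exists>t\<in>A. x t \<noteq> 0" "\<And>t'. t' \<in> B ==> (\<Sum>t\<in>A. \<alpha> t' t * x t) = 0"
  using homogeneous_system[OF fin(2,1), of \<alpha>] by blast
 have "x u = 0" if u: "u \<in> A" for u
 proof -
  have "x u = (\<Sum>t\<in>A. if t = u then x u else 0)" using fin u by simp
  also have "... = (\<Sum>t\<in>A. (\<Sum>t'\<in>B. \<beta> u t' * \<alpha> t' t) * x t)"
   by (intro sum.cong) (auto simp: inv[OF u])
  also have "... = (\<Sum>t'\<in>B. \<beta> u t' * (\<Sum>t\<in>A. \<alpha> t' t * x t))"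
   unfolding sum_distrib_right sum_distrib_left by (subst sum.swap) (simp add: mult.assoc)
  finally show ?thesis by (simp add: x(2))
 qed
 with x(1) show False by blast
qed

lemma surjection_card_le:
 fixes C :: "('i, 'k::field) gdata" and D :: "('j, 'k) gdata"
 assumes C: "gvalid n d C" and D: "gvalid n d D"
  and f: "mod_hom (KZJ n d) (gmod C) (gmod D) f" "f ` gspace C = gspace D"
 shows "card (idx D) \<le> card (idx C)"
proof -
 have "\<forall>c\<in>idx D. \<exists>v\<in>gspace C. gunit c = f v"
  using f(2) gunit_gspace by (metis imageE)
 then obtain pre where pre: "\<And>c. c \<in> idx D ==> pre c \<in> gspace C \<and> gunit c = f (pre c)" by metis
 show ?thesis
 proof (rule card_le_of_left_inverse[where \<alpha> = "%b c. pre c b" and \<beta> = "%c b. f (gunit b) c"])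
  fix u t assume "u \<in> idx D" "t \<in> idx D"
  have "of_bool (u = t) = f (pre t) u" using pre[OF \<open>t \<in> idx D\<close>] by (metis gunit_def)
  then show "(\<Sum>b\<in>idx C. f (gunit b) u * pre t b) = of_bool (u = t)"
   using gmod_hom_expansion[OF C D f(1), of "pre t"] pre[OF \<open>t \<in> idx D\<close>] by (simp add: mult.commute)
 qed (use gvalid_finite[OF C] gvalid_finite[OF D] in auto)
qed

lemma surjection_dim_iso:
 fixes C :: "('i, 'k::field) gdata"
 assumes n: "0 < n" and dn: "d \<le> n" and L: "\<forall>x\<in>set L. fst x \<le> d" and C: "gvalid n d C"
  and f: "mod_hom (KZJ n d) (gmod (std n L)) (gmod C) f" "f ` gspace (std n L) = gspace C"
  and card: "sum_list (map fst L) = card (idx C)"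
 shows "realizes n d (gmod C) (std n L :: 'k gdata2)"
proof (rule minimal_surjection_inj[OF left_module_gmod[OF C] n dn L f(1)])
 show "f ` gspace (std n L) = carrier (gmod C)" using f(2) by simp
 fix L' \<Phi>' assume L': "\<forall>x\<in>set L'. fst x \<le> d"
  "mod_hom (KZJ n d) (gmod (std n L')) (gmod C) \<Phi>'" "\<Phi>' ` gspace (std n L') = carrier (gmod C)"
 have "gvalid n d (std n L' :: 'k gdata2)" using n L' by (auto intro: gvalid_std)
 from surjection_card_le[OF this C L'(2)] L'(3)
 have "card (idx C) \<le> card (Sigma {..<length L'} (%t. {..<fst (L' ! t)}))" by simp
 also have "... = sum_list (map fst L')" by (simp add: sum_list_sum_nth lessThan_atLeast0)
 finally show "sum_list (map fst L) \<le> sum_list (map fst L')" using card by simp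
qed

lemma gproj_gunit: "b \<in> idx C ==> gproj C i (gunit b) = (if deg C b = i then gunit b else (%_. 0))"
 by (auto simp: gproj_def gunit_def fun_eq_iff)

text \<open>Isomorphisms commute with the projections to degree \<open>r\<close> and so preserve the dimension of every
homogeneous component.\<close>

lemma homogeneous_dim_le:
 fixes C :: "('i, 'k::field) gdata" and D :: "('j, 'k) gdata"
 assumes C: "gvalid n d C" and D: "gvalid n d D" and r: "r < n"
  and iso: "module_isomorphic (KZJ n d) (gmod C) (gmod D)"
 shows "card {b\<in>idx C. deg C b = r} \<le> card {c\<in>idx D. deg D c = r}"
proof -
 obtain f where f: "bij_betw f (gspace C) (gspace D)" "mod_hom (KZJ n d) (gmod C) (gmod D) f"
  using iso by (auto simp: module_isomorphic_alt)
 define g where "g = inv_into (gspace C) f"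
 have g: "mod_hom (KZJ n d) (gmod D) (gmod C) g"
  using mod_hom_inv[OF left_module_gmod[OF C], of f "gmod D"] f by (simp add: g_def)
 have gf: "g (f v) = v" if "v \<in> gspace C" for v using f(1) that by (simp add: g_def bij_betw_def)
 show ?thesis
 proof (rule card_le_of_left_inverse[where \<alpha> = "%c b. f (gunit b) c" and \<beta> = "%b c. g (gunit c) b"])
  fix u t assume u: "u \<in> {b\<in>idx C. deg C b = r}" and t: "t \<in> {b\<in>idx C. deg C b = r}"
  have tC: "gunit t \<in> gspace C" using t by simp
  have ft: "f (gunit t) \<in> gspace D" by (rule gmod_hom_gspace[OF C D f(2) tC])
  have "f (gunit t) = gproj D r (f (gunit t))"
   using gmod_hom_proj[OF C D f(2) r tC] t by (simp add: gproj_gunit)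
  then have z: "f (gunit t) c = 0" if "deg D c \<noteq> r" for c using that by (metis (mono_tags, lifting) gproj_def)
  have "of_bool (u = t) = g (f (gunit t)) u" using gf[OF tC] by (simp add: gunit_def)
  also have "... = (\<Sum>c\<in>idx D. f (gunit t) c * g (gunit c) u)"
   using gmod_hom_expansion[OF D C g ft] by simp
  also have "... = (\<Sum>c\<in>{c\<in>idx D. deg D c = r}. g (gunit c) u * f (gunit t) c)"
   using gvalid_finite[OF D] z by (intro sum.mono_neutral_cong_right) auto
  finally show "(\<Sum>c\<in>{c\<in>idx D. deg D c = r}. g (gunit c) u * f (gunit t) c) = of_bool (u = t)" by simp
 qed (use gvalid_finite[OF C] gvalid_finite[OF D] in auto)
qed

lemma gX_gunit_std:
 assumes "(t, s) \<in> idx (std n L :: 'k::field gdata2)"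
 shows "(gX (std n L) ^^ k) (gunit (t, s)) = (if s + k < fst (L ! t) then gunit (t, s + k) else (%_. 0 :: 'k))"
proof
 fix x :: "nat \<times> nat" obtain t' s' where x: "x = (t', s')" by (cases x)
 show "(gX (std n L) ^^ k) (gunit (t, s)) x = (if s + k < fst (L ! t) then gunit (t, s + k) else (%_. 0 :: 'k)) x"
  using assms unfolding x gX_funpow_std[OF gunit_gspace[OF assms]] by (auto simp: gunit_def)
qed

text \<open>The number of blocks of length at least \<open>i\<close> with generator of degree \<open>j\<close> is an invariant of the
module. Write an isomorphism and its inverse as matrices and keep the rows and columns of the
generators in question only: these submatrices are still inverse to each other. For a basis vector in
the image of \<open>X\<close> stays in the image of \<open>X\<close> and has no generator component, and the generator of a
shorter block is annihilated by \<open>X\<^bsup>i-1\<^esup>\<close>, so its image cannot involve the generator of a long one.\<close>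

lemma tall_blocks_le:
 assumes n: "0 < n" and i: "1 \<le> i" and L: "set L \<subseteq> blocks n d" "set L' \<subseteq> blocks n d"
  and iso: "module_isomorphic (KZJ n d) (gmod (std n L :: 'k::field gdata2)) (gmod (std n L'))"
 shows "card {t. t < length L \<and> snd (L ! t) = j \<and> i \<le> fst (L ! t)}
  \<le> card {t. t < length L' \<and> snd (L' ! t) = j \<and> i \<le> fst (L' ! t)}" (is "card ?B \<le> card ?B'")
proof -
 let ?C = "std n L :: 'k gdata2" and ?D = "std n L' :: 'k gdata2"
 have C: "gvalid n d ?C" and D: "gvalid n d ?D" using n L by (auto intro: gvalid_std_blocks)
 obtain f where f: "bij_betw f (gspace ?C) (gspace ?D)" "mod_hom (KZJ n d) (gmod ?C) (gmod ?D) f"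
  using iso by (auto simp: module_isomorphic_alt)
 define g where "g = inv_into (gspace ?C) f"
 have g: "mod_hom (KZJ n d) (gmod ?D) (gmod ?C) g"
  using mod_hom_inv[OF left_module_gmod[OF C], of f "gmod ?D"] f by (simp add: g_def)
 have gf: "g (f v) = v" if "v \<in> gspace ?C" for v using f(1) that by (simp add: g_def bij_betw_def)
 show ?thesis
 proof (rule card_le_of_left_inverse[where \<alpha> = "%t' t. f (gunit (t, 0)) (t', 0)" and \<beta> = "%t t'. g (gunit (t', 0)) (t, 0)"])
  fix u t assume u: "u \<in> ?B" and t: "t \<in> ?B"
  define y where "y = f (gunit (t, 0))"
  have ti: "(t, 0) \<in> idx ?C" and ui: "(u, 0) \<in> idx ?C" using t u i by auto
  have tC: "gunit (t, 0) \<in> gspace ?C" using ti by (rule gunit_gspace)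
  have yD: "y \<in> gspace ?D" unfolding y_def by (rule gmod_hom_gspace[OF C D f(2) tC])
  have "L ! t \<in> set L" using t by auto
  then have "snd (L ! t) < n" using L(1) by (auto simp: blocks_def)
  then have j: "j < n" using t by simp
  have "y = gproj ?D j y"
   using gmod_hom_proj[OF C D f(2) j tC] t ti j unfolding y_def by (simp add: gproj_gunit)
  then have y0: "deg ?D c = j" if "y c \<noteq> 0" for c using that by (metis (mono_tags, lifting) gproj_def)
  have zero: "y c * g (gunit c) (u, 0) = 0" if c: "c \<in> idx ?D" "c \<notin> (%t'. (t', 0)) ` ?B'" for c
  proof (rule ccontr)
   assume nz: "y c * g (gunit c) (u, 0) \<noteq> 0"
   obtain t' s where ts: "c = (t', s)" "t' < length L'" "s < fst (L' ! t')" using c by auto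
   show False
   proof (cases s)
    case 0
    have "L' ! t' \<in> set L'" using ts by simp
    then have "snd (L' ! t') < n" using L(2) by (auto simp: blocks_def)
    then have "snd (L' ! t') = j" using y0[of c] nz ts 0 by simp
    then have len: "fst (L' ! t') < i" using c ts 0 by auto
    have A: "g ((gX ?D ^^ (i - 1)) (gunit c)) = (gX ?C ^^ (i - 1)) (g (gunit c))"
     using gmod_hom_X[OF D C g, of "gunit c"] c by simp
    have B: "(gX ?D ^^ (i - 1)) (gunit c) = (%_. 0)"
     using len i c(1) unfolding ts 0 by (subst gX_gunit_std) auto
    have "(gX ?C ^^ (i - 1)) (g (gunit c)) = (%_. 0)"
     by (rule trans[OF A[unfolded B, symmetric] gmod_hom_zero[OF D C g]])
    then have "(gX ?C ^^ (i - 1)) (g (gunit c)) (u, i - 1) = 0" by simp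
    then have "g (gunit c) (u, 0) = 0"
    proof -
     have "i - 1 < fst (L ! u)" "u < length L" using u i by auto
     then show ?thesis
      using \<open>(gX ?C ^^ (i - 1)) (g (gunit c)) (u, i - 1) = 0\<close>
       gX_funpow_std[OF gmod_hom_gspace[OF D C g gunit_gspace[OF c(1)]], of "i - 1" u "i - 1"] by simp
    qed
    then show False using nz by simp
   next
    case (Suc s')
    have m: "(t', s') \<in> idx ?D" using ts Suc by auto
    have "gunit c = (gX ?D ^^ 1) (gunit (t', s'))"
     using ts Suc by (subst gX_gunit_std[OF m]) auto
    then have "g (gunit c) = (gX ?C ^^ 1) (g (gunit (t', s')))"
     using gmod_hom_X[OF D C g gunit_gspace[OF m], of 1] by simp
    then have "g (gunit c) (u, 0) = 0"
     using gX_funpow_std[OF gmod_hom_gspace[OF D C g gunit_gspace[OF m]], of 1 u 0] by simp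
    then show False using nz by simp
   qed
  qed
  have "of_bool (u = t) = g y (u, 0)" using gf[OF tC] by (simp add: gunit_def y_def)
  also have "... = (\<Sum>c\<in>idx ?D. y c * g (gunit c) (u, 0))"
   using gmod_hom_expansion[OF D C g yD] by simp
  also have "... = (\<Sum>c\<in>(%t'. (t', 0)) ` ?B'. y c * g (gunit c) (u, 0))"
   using gvalid_finite[OF D] zero i by (intro sum.mono_neutral_right) auto
  also have "... = (\<Sum>t'\<in>?B'. g (gunit (t', 0)) (u, 0) * y (t', 0))"
   by (subst sum.reindex) (auto simp: inj_on_def mult.commute)
  finally show "(\<Sum>t'\<in>?B'. g (gunit (t', 0)) (u, 0) * f (gunit (t, 0)) (t', 0)) = of_bool (u = t)"
   by (simp add: y_def)
 qed auto
qed

lemma card_tall_blocks: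
 "card {t. t < length L \<and> snd (L ! t) = j \<and> i \<le> fst (L ! t)}
  = count (mset L) (i, j) + card {t. t < length L \<and> snd (L ! t) = j \<and> Suc i \<le> fst (L ! t)}"
proof -
 have "{t. t < length L \<and> snd (L ! t) = j \<and> i \<le> fst (L ! t)}
   = {t. t < length L \<and> L ! t = (i, j)} \<union> {t. t < length L \<and> snd (L ! t) = j \<and> Suc i \<le> fst (L ! t)}"
  by (auto simp: prod_eq_iff)
 moreover have "card ({t. t < length L \<and> L ! t = (i, j)} \<union> {t. t < length L \<and> snd (L ! t) = j \<and> Suc i \<le> fst (L ! t)})
   = card {t. t < length L \<and> L ! t = (i, j)} + card {t. t < length L \<and> snd (L ! t) = j \<and> Suc i \<le> fst (L ! t)}"
  by (rule card_Un_disjoint) (auto dest: arg_cong[of _ _ fst])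
 moreover have "card {t. t < length L \<and> L ! t = (i, j)} = count (mset L) (i, j)"
  by (simp add: count_mset count_list_eq_length_filter length_filter_conv_card eq_commute)
 ultimately show ?thesis by simp
qed

theorem block_decomposition_unique:
 assumes n: "0 < n" and L: "set L \<subseteq> blocks n d" "set L' \<subseteq> blocks n d"
  and iso: "module_isomorphic (KZJ n d) (gmod (std n L :: 'k::field gdata2)) (gmod (std n L'))"
 shows "mset L = mset L'"
proof (rule multiset_eqI)
 fix x :: "nat \<times> nat" obtain i j where x: "x = (i, j)" by (cases x)
 have C: "gvalid n d (std n L :: 'k gdata2)" using n L by (auto intro: gvalid_std_blocks)
 note iso' = module_isomorphic_sym[OF left_module_gmod[OF C] iso]
 have eq: "card {t. t < length L \<and> snd (L ! t) = j \<and> i \<le> fst (L ! t)}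
  = card {t. t < length L' \<and> snd (L' ! t) = j \<and> i \<le> fst (L' ! t)}" if "1 \<le> i" for i
  using tall_blocks_le[OF n that L iso] tall_blocks_le[OF n that L(2,1) iso'] by (rule le_antisym)
 show "count (mset L) x = count (mset L') x"
 proof (cases "1 \<le> i")
  case True
  then show ?thesis using eq[of i] eq[of "Suc i"] card_tall_blocks[of L j i] card_tall_blocks[of L' j i] x by simp
 next
  case False
  then have "x \<notin> set L" "x \<notin> set L'" using L x by (auto simp: blocks_def)
  then show ?thesis by (simp add: count_eq_zero_iff[THEN iffD2])
 qed
qed

section \<open>Quotients of free modules\<close>

text \<open>Tensor products and the representation ring are both quotients of a free module by the additive
subgroup that a set of relations generates.\<close>

locale pm_quotient =
 fixes F :: "('a \<Rightarrow>\<^sub>0 'k::comm_ring_1, 'z) ring_scheme" and A :: "'a set" and R :: "('a \<Rightarrow>\<^sub>0 'k) set"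
 assumes carrier_F: "carrier F = {f. keys f \<subseteq> A}" and add_F: "add F = (+)" and zero_F: "zero F = 0"
  and R: "R \<subseteq> {f. keys f \<subseteq> A}"
begin

definition N where "N = generate (add_monoid F) R"

lemma abelian_group_F: "abelian_group F"
proof (rule abelian_groupI)
 fix x assume "x \<in> carrier F"
 then show "\<exists>y\<in>carrier F. y \<oplus>\<^bsub>F\<^esub> x = \<zero>\<^bsub>F\<^esub>"
  by (intro bexI[of _ "- x"]) (auto simp: carrier_F add_F zero_F)
qed (auto simp: carrier_F add_F zero_F add.assoc add.commute dest!: subsetD[OF keys_add])

interpretation F: abelian_group F by (rule abelian_group_F)

lemma minus_F: "x \<in> carrier F ==> inv\<^bsub>add_monoid F\<^esub> x = - x"
 unfolding a_inv_def[symmetric] by (rule F.minus_equality) (auto simp: carrier_F add_F zero_F)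

lemma subgroup_N: "subgroup N (add_monoid F)"
 unfolding N_def using R F.a_group by (intro group.generate_is_subgroup) (auto simp: carrier_F)

lemma abelian_subgroup_N: "abelian_subgroup N F"
 by (intro abelian_subgroupI3 additive_subgroupI subgroup_N abelian_group_F)

lemma N_carrier: "x \<in> N ==> keys x \<subseteq> A"
 using subgroup.subset[OF subgroup_N] by (auto simp: carrier_F)

lemma N_zero: "0 \<in> N" using subgroup.one_closed[OF subgroup_N] by (simp add: zero_F)

lemma N_add: "x \<in> N ==> y \<in> N ==> x + y \<in> N"
 using subgroup.m_closed[OF subgroup_N, of x y] by (simp add: add_F)

lemma N_uminus: assumes x: "x \<in> N" shows "- x \<in> N"
proof -
 have "x \<in> carrier F" using N_carrier[OF x] by (simp add: carrier_F)
 from minus_F[OF this, symmetric] show ?thesis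
  by (rule ssubst) (rule subgroup.m_inv_closed[OF subgroup_N x])
qed

lemma N_diff: "x \<in> N ==> y \<in> N ==> x - y \<in> N"
 using N_add[of x "- y"] N_uminus[of y] by simp

lemma N_gen: "x \<in> R ==> x \<in> N"
 unfolding N_def by (rule generate.incl)

lemma N_sum: "(\<And>i. i \<in> B ==> f i \<in> N) ==> sum f B \<in> N"
 by (induction B rule: infinite_finite_induct) (auto simp: N_zero N_add)

lemma N_vanish:
 fixes \<phi> :: "('a \<Rightarrow>\<^sub>0 'k) => 'g::ab_group_add"
 assumes add: "\<And>x y. \<phi> (x + y) = \<phi> x + \<phi> y" and gen: "\<And>r. r \<in> R ==> \<phi> r = 0" and x: "x \<in> N"
 shows "\<phi> x = 0"
proof -
 have zero: "\<phi> 0 = 0" using add[of 0 0] by simp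
 show ?thesis using x unfolding N_def
 proof induction
  case (inv h)
  then have "inv\<^bsub>add_monoid F\<^esub> h = - h" using R by (intro minus_F) (auto simp: carrier_F)
  moreover have "\<phi> (- h) + \<phi> h = 0" using add[of "- h" h] zero by simp
  ultimately show ?case using gen[OF inv] by simp
 qed (use zero gen add in \<open>auto simp: zero_F add_F\<close>)
qed

lemma coset_eq: "N +>\<^bsub>F\<^esub> t = {s. s - t \<in> N}"
 by (auto simp: a_r_coset_def' add_F intro: exI[of _ "_ - t"])

lemma coset_cong: "t - t' \<in> N ==> N +>\<^bsub>F\<^esub> t = N +>\<^bsub>F\<^esub> t'"
 unfolding coset_eq
proof (intro Collect_cong)
 fix s assume "t - t' \<in> N"
 then show "(s - t \<in> N) = (s - t' \<in> N)"
  using N_add[of "s - t" "t - t'"] N_diff[of "s - t'" "t - t'"] by auto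
qed

lemma coset_self: "t \<in> N +>\<^bsub>F\<^esub> t" by (simp add: coset_eq N_zero)

lemma coset_carrier: "s \<in> N +>\<^bsub>F\<^esub> t ==> keys t \<subseteq> A ==> keys s \<subseteq> A"
 using N_carrier[of "s - t"] keys_add[of "s - t" t] by (auto simp: coset_eq)

lemma coset_add:
 "keys t \<subseteq> A ==> keys t' \<subseteq> A ==> (N +>\<^bsub>F\<^esub> t) <+>\<^bsub>F\<^esub> (N +>\<^bsub>F\<^esub> t') = N +>\<^bsub>F\<^esub> (t + t')"
 using abelian_subgroup.a_rcos_sum[OF abelian_subgroup_N, of t t'] by (simp add: carrier_F add_F)

lemma rcosets_eq: "a_rcosets\<^bsub>F\<^esub> N = {N +>\<^bsub>F\<^esub> t |t. keys t \<subseteq> A}"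
 by (auto simp: A_RCOSETS_def' carrier_F)

end

section \<open>Tensor products\<close>

lemma UN_const2:
 assumes "\<And>a t. a \<in> A ==> t \<in> B ==> G a t = K" "a \<in> A" "t \<in> B"
 shows "(\<Union>a\<in>A. \<Union>t\<in>B. G a t) = K"
proof -
 have "(\<Union>a\<in>A. \<Union>t\<in>B. G a t) = (\<Union>a\<in>A. \<Union>t\<in>B. K)"
  using assms(1) by (intro SUP_cong refl) auto
 then show ?thesis using assms(2,3) by auto
qed

lemma tensor_relations_cases [consumes 1, case_names left right scalar_left scalar_right]:
 assumes "r \<in> tensor_relations n d V W"
 obtains x x' y a where "r = single (x \<oplus>\<^bsub>V\<^esub> x', y) a - single (x, y) a - single (x', y) a"
   "x \<in> carrier V" "x' \<in> carrier V" "y \<in> carrier W"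
 | x y y' a where "r = single (x, y \<oplus>\<^bsub>W\<^esub> y') a - single (x, y) a - single (x, y') a"
   "x \<in> carrier V" "y \<in> carrier W" "y' \<in> carrier W"
 | x y a c where "r = single (scalar n d c \<odot>\<^bsub>V\<^esub> x, y) a - single (x, y) (a * c)"
   "x \<in> carrier V" "y \<in> carrier W"
 | x y a c where "r = single (x, scalar n d c \<odot>\<^bsub>W\<^esub> y) a - single (x, y) (a * c)"
   "x \<in> carrier V" "y \<in> carrier W"
 using assms unfolding tensor_relations_def by blast

lemma tensor_pm_quotient:
 fixes V :: "('k::field trunc, 'v) module" and W :: "('k trunc, 'u) module"
 assumes V: "left_module (KZJ n d) V" and W: "left_module (KZJ n d) W"
 shows "pm_quotient (free_space (carrier V \<times> carrier W)) (carrier V \<times> carrier W) (tensor_relations n d V W)"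
proof
 interpret V: left_module "KZJ n d" V by (rule V)
 interpret W: left_module "KZJ n d" W by (rule W)
 have sc: "scalar n d c \<in> carrier (KZJ n d)" for c
  unfolding scalar_def by (rule trunc_class_closed[OF paths_closed])
 have k: "keys (single x a - single y b) \<subseteq> B" if "x \<in> B" "y \<in> B" for x y and a b :: 'k and B :: "('v \<times> 'u) set"
  using keys_diff[of "single x a" "single y b"] that by (auto split: if_splits)
 have k3: "keys (single x a - single y b - single z c) \<subseteq> B" if "x \<in> B" "y \<in> B" "z \<in> B"
  for x y z and a b c :: 'k and B :: "('v \<times> 'u) set"
  using keys_diff[of "single x a - single y b" "single z c"] k[of x B y a b] that by (auto split: if_splits)
 show "tensor_relations n d V W \<subseteq> {f. keys f \<subseteq> carrier V \<times> carrier W}"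
 proof
  fix r assume "r \<in> tensor_relations n d V W"
  then have "keys r \<subseteq> carrier V \<times> carrier W"
  proof (cases rule: tensor_relations_cases)
   case (left x x' y a)
   then show ?thesis unfolding left(1) by (intro k3) auto
  next
   case (right x y y' a)
   then show ?thesis unfolding right(1) by (intro k3) auto
  next
   case (scalar_left x y a c)
   then show ?thesis unfolding scalar_left(1) by (intro k) (auto simp: V.smult_closed sc)
  next
   case (scalar_right x y a c)
   then show ?thesis unfolding scalar_right(1) by (intro k) (auto simp: W.smult_closed sc)
  qed
  then show "r \<in> {f. keys f \<subseteq> carrier V \<times> carrier W}" by simp
 qed
qed (auto simp: free_space_def)

definition tcoord :: "('v => 'i => 'k::field) => ('u => 'j => 'k) => ('v \<times> 'u \<Rightarrow>\<^sub>0 'k) => 'i \<times> 'j => 'k" where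
 "tcoord f g t = (%(b, c). \<Sum>x\<in>keys t. lookup t x * (f (fst x) b * g (snd x) c))"

lemma tcoord_add: "tcoord f g (t + t') bc = tcoord f g t bc + tcoord f g t' bc"
 unfolding tcoord_def split_def by (rule sum_keys_add) (auto simp: algebra_simps)

lemma tcoord_zero [simp]: "tcoord f g 0 bc = 0"
 by (simp add: tcoord_def split_def)

lemma tcoord_single: "tcoord f g (single (x, y) a) (b, c) = a * (f x b * g y c)"
 unfolding tcoord_def split_def fst_conv snd_conv
 using sum_keys_single[of "%x a. a * (f (fst x) b * g (snd x) c)" "(x, y)" a] by simp

lemma tcoord_diff: "tcoord f g (t - t') bc = tcoord f g t bc - tcoord f g t' bc"
 using tcoord_add[of f g "t - t'" t' bc] by simp

lemma tcoord_sum: "tcoord f g (sum h A) bc = (\<Sum>i\<in>A. tcoord f g (h i) bc)"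
 by (induction A rule: infinite_finite_induct) (auto simp: tcoord_add)

subsection \<open>The comultiplication in matrix form\<close>

definition tensor_path_mat ::
 "('i, 'k::field) gdata => ('j, 'k) gdata => path \<times> path => 'i \<times> 'j => 'i \<times> 'j => 'k" where
 "tensor_path_mat C D x y y' = path_mat C (fst x) (fst y) (fst y') * path_mat D (snd x) (snd y) (snd y')"

abbreviation paths2 :: "nat => (path \<times> path) set" where
 "paths2 n \<equiv> ({..<n} \<times> UNIV) \<times> ({..<n} \<times> UNIV)"

text \<open>Pairs of paths act on pairs of basis vectors compatibly with the product of \<open>KZ\<^sub>n \<otimes> KZ\<^sub>n\<close>.\<close>

lemma tensor_path_mat_mult:
 assumes C: "gvalid n d C" and D: "gvalid n d D"
  and y: "y \<in> idx C \<times> idx D" "y' \<in> idx C \<times> idx D" and x: "x \<in> paths2 n" "x' \<in> paths2 n"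
 shows "(\<Sum>e\<in>idx C \<times> idx D. tensor_path_mat C D x y e * tensor_path_mat C D x' e y')
  = (case path_comp2 n x x' of None => 0 | Some z => tensor_path_mat C D z y y')"
proof -
 have "(\<Sum>e\<in>idx C \<times> idx D. tensor_path_mat C D x y e * tensor_path_mat C D x' e y')
  = (\<Sum>e\<in>idx C. path_mat C (fst x) (fst y) e * path_mat C (fst x') e (fst y'))
   * (\<Sum>f\<in>idx D. path_mat D (snd x) (snd y) f * path_mat D (snd x') f (snd y'))"
  by (simp add: tensor_path_mat_def sum_product sum.cartesian_product split_def mult_ac)
 also have "... = (case path_comp2 n x x' of None => 0 | Some z => tensor_path_mat C D z y y')"
  using y x by (subst path_mat_mult[OF C], simp_all add: mem_Times_iff, subst path_mat_mult[OF D])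
   (auto simp: path_comp2_def tensor_path_mat_def mem_Times_iff split: option.splits)
 finally show ?thesis .
qed

lemma keys_comult_arrow: "keys (comult_arrow n h :: _ \<Rightarrow>\<^sub>0 'k::field) \<subseteq> paths2 n"
proof -
 have "keys (single ((g1, 1), (g2, 0)) 1 + single ((g1, 0), (g2, 1)) (1::'k)) \<subseteq> paths2 n"
  if "g1 < n" "g2 < n" for g1 g2 :: nat
  using that by (intro path_algebra_add_closed) auto
 then show ?thesis
  unfolding comult_arrow_def by (intro order_trans[OF keys_sum] UN_least) (simp only: split_def mem_Collect_eq)
qed

lemma keys_comult_path: "keys (comult_path n i k :: _ \<Rightarrow>\<^sub>0 'k::field) \<subseteq> paths2 n"
proof (induction k)
 case 0
 show ?case unfolding comult_path.simps comult_vertex_def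
  by (intro order_trans[OF keys_sum] UN_least) auto
next
 case (Suc k)
 have "z \<in> paths2 n" if "x \<in> paths2 n" "y \<in> paths2 n" "path_comp2 n x y = Some z" for x y z
  using that by (auto simp: path_comp2_def path_comp_def split: option.splits if_splits)
 then show ?case
  unfolding comult_path.simps using keys_comult_arrow Suc by (intro order_trans[OF keys_basis_mult]) blast
qed

lemma pow_mat_one: "finite (idx C) ==> e \<in> idx C ==> pow_mat C 1 b e = mat C b e"
proof -
 assume "finite (idx C)" "e \<in> idx C"
 moreover have "(\<Sum>c\<in>idx C. mat C b c * of_bool (c = e)) = (\<Sum>c\<in>idx C. if c = e then mat C b e else 0)"
  by (intro sum.cong) auto
 ultimately show ?thesis by simp
qed

lemma sum_degree_pairs:
 fixes F :: "nat => nat => 'k::field"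
 assumes "a < n" "b < n" "\<And>g g'. (g, g') \<noteq> (a, b) ==> F g g' = 0"
 shows "(\<Sum>(g, g')\<in>{(g, g'). g < n \<and> g' < n \<and> (g + g') mod n = h}. F g g')
  = of_bool ((a + b) mod n = h) * F a b"
proof -
 let ?S = "{(g, g'). g < n \<and> g' < n \<and> (g + g') mod n = h}"
 have "finite ?S" by (rule finite_subset[of _ "{..<n} \<times> {..<n}"]) auto
 have "(\<Sum>(g, g')\<in>?S. F g g') = (\<Sum>x\<in>?S. if x = (a, b) then F a b else 0)"
  by (intro sum.cong) (use assms(3) in auto)
 also have "... = of_bool ((a + b) mod n = h) * F a b" using \<open>finite ?S\<close> assms(1,2) by simp
 finally show ?thesis .
qed

text \<open>On \<open>V \<otimes> W\<close> the coproduct of a path acts as the path itself acts in the graded matrix of the tensor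
product. For vertices this says that degrees add, for arrows that \<open>X\<close> acts by the Leibniz rule, and the
general case follows by splitting off the last arrow.\<close>

lemma mat_ext_comult_path:
 assumes C: "gvalid n d C" and D: "gvalid n d D" and T: "gvalid n d (tdata n C D)"
  and y: "y \<in> idx C \<times> idx D" and y': "y' \<in> idx C \<times> idx D"
 shows "mat_ext (tensor_path_mat C D) (comult_path n i k) y y' = path_mat (tdata n C D) (i, k) y y'"
 using y
proof (induction k arbitrary: y)
 case 0
 obtain b c where bc: "y = (b, c)" "b \<in> idx C" "c \<in> idx D" using 0 by auto
 obtain b' c' where bc': "y' = (b', c')" "b' \<in> idx C" "c' \<in> idx D" using y' by auto
 let ?F = "%g g'. tensor_path_mat C D ((g, 0), (g', 0)) y y'"
 have "mat_ext (tensor_path_mat C D) (comult_path n i 0) y y'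
   = (\<Sum>(g, g')\<in>{(g, g'). g < n \<and> g' < n \<and> (g + g') mod n = i}. ?F g g')"
  by (simp add: comult_vertex_def mat_ext_sum split_def)
 also have "... = of_bool ((deg C b' + deg D c') mod n = i) * ?F (deg C b') (deg D c')"
  by (rule sum_degree_pairs) (use gvalid_deg[OF C] gvalid_deg[OF D] bc' in \<open>auto simp: tensor_path_mat_def path_mat_def\<close>)
 also have "... = path_mat (tdata n C D) (i, 0) y y'"
  by (auto simp: bc bc' tensor_path_mat_def path_mat_def)
 finally show ?case .
next
 case (Suc k)
 obtain b' c' where bc': "y' = (b', c')" "b' \<in> idx C" "c' \<in> idx D" using y' by auto
 note fin = gvalid_finite[OF C] gvalid_finite[OF D]
 have arrow: "mat_ext (tensor_path_mat C D) (comult_arrow n h) y e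
   = of_bool (deg (tdata n C D) e = h) * mat (tdata n C D) y e"
  if e: "e \<in> idx C \<times> idx D" for e h
 proof -
  obtain b c where bc: "y = (b, c)" "b \<in> idx C" "c \<in> idx D" using Suc.prems by auto
  obtain b1 c1 where bc1: "e = (b1, c1)" "b1 \<in> idx C" "c1 \<in> idx D" using e by auto
  let ?F = "%g g'. tensor_path_mat C D ((g, 1), (g', 0)) y e + tensor_path_mat C D ((g, 0), (g', 1)) y e"
  have "mat_ext (tensor_path_mat C D) (comult_arrow n h) y e
    = (\<Sum>(g, g')\<in>{(g, g'). g < n \<and> g' < n \<and> (g + g') mod n = h}. ?F g g')"
   by (simp add: comult_arrow_def mat_ext_sum mat_ext_add split_def)
  also have "... = of_bool ((deg C b1 + deg D c1) mod n = h) * ?F (deg C b1) (deg D c1)"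
   by (rule sum_degree_pairs) (use gvalid_deg[OF C] gvalid_deg[OF D] bc1 in \<open>auto simp: tensor_path_mat_def path_mat_def\<close>)
  also have "?F (deg C b1) (deg D c1) = mat (tdata n C D) y e"
   by (simp add: bc bc1 tensor_path_mat_def path_mat_def pow_mat_one[OF fin(1) bc1(2), unfolded One_nat_def]
     pow_mat_one[OF fin(2) bc1(3), unfolded One_nat_def] del: pow_mat.simps(2))
  finally show ?thesis by (simp add: bc1)
 qed
 have y_T: "y \<in> idx (tdata n C D)" "y' \<in> idx (tdata n C D)" using Suc.prems y' by auto
 have "mat_ext (tensor_path_mat C D) (comult_path n i (Suc k)) y y'
  = (\<Sum>e\<in>idx C \<times> idx D. mat_ext (tensor_path_mat C D) (comult_arrow n ((i + k) mod n)) y e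
    * mat_ext (tensor_path_mat C D) (comult_path n i k) e y')"
  unfolding comult_path.simps
  by (rule mat_ext_mult[OF keys_comult_arrow keys_comult_path]) (rule tensor_path_mat_mult[OF C D Suc.prems y'])
 also have "... = (\<Sum>e\<in>idx C \<times> idx D. (mat (tdata n C D) y e * pow_mat (tdata n C D) k e y')
   * of_bool (deg (tdata n C D) y' = i))"
 proof (intro sum.cong refl)
  fix e assume e: "e \<in> idx C \<times> idx D"
  have "deg (tdata n C D) e = (deg (tdata n C D) y' + k) mod n" if "pow_mat (tdata n C D) k e y' \<noteq> 0"
   by (rule pow_mat_deg[OF T]) (use e y_T that in auto)
  then show "mat_ext (tensor_path_mat C D) (comult_arrow n ((i + k) mod n)) y e
    * mat_ext (tensor_path_mat C D) (comult_path n i k) e y'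
   = (mat (tdata n C D) y e * pow_mat (tdata n C D) k e y') * of_bool (deg (tdata n C D) y' = i)"
   unfolding arrow[OF e] Suc.IH[OF e] path_mat_def fst_conv snd_conv by auto
 qed
 also have "... = path_mat (tdata n C D) (i, Suc k) y y'"
  by (simp add: path_mat_def sum_distrib_right)
 finally show ?case .
qed

lemma mat_ext_comult:
 assumes C: "gvalid n d C" and D: "gvalid n d D" and T: "gvalid n d (tdata n C D)"
  and y: "y \<in> idx C \<times> idx D" and y': "y' \<in> idx C \<times> idx D"
 shows "mat_ext (tensor_path_mat C D) (comult n a) y y' = mat_ext (path_mat (tdata n C D)) a y y'"
 unfolding comult_def mat_ext_sum
 by (simp add: mat_ext_def[of "path_mat (tdata n C D)"] split_def mat_ext_scale mat_ext_comult_path[OF C D T y y'])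

lemma keys_comult: "keys (comult n a :: _ \<Rightarrow>\<^sub>0 'k::field) \<subseteq> paths2 n"
proof -
 have "keys (Poly_Mapping.map ((*) c) (comult_path n i k) :: _ \<Rightarrow>\<^sub>0 'k) \<subseteq> paths2 n" for c i k
  using keys_comult_path[of n i k, where 'k = 'k] by (auto simp: in_keys_iff Poly_Mapping.map.rep_eq when_def subset_iff)
 then show ?thesis
  unfolding comult_def by (intro order_trans[OF keys_sum] UN_least) (auto simp: split_def)
qed

subsection \<open>A basis of the tensor product\<close>

context
 fixes n d :: nat and V :: "('k::field trunc, 'v) module" and W :: "('k trunc, 'u) module"
  and C :: "('i, 'k) gdata" and D :: "('j, 'k) gdata" and f :: "'v => 'i => 'k" and g :: "'u => 'j => 'k"
 assumes V: "left_module (KZJ n d) V" and W: "left_module (KZJ n d) W"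
  and C: "gvalid n d C" and D: "gvalid n d D" and T: "gvalid n d (tdata n C D)"
  and f_bij: "bij_betw f (carrier V) (gspace C)" and f: "mod_hom (KZJ n d) V (gmod C) f"
  and g_bij: "bij_betw g (carrier W) (gspace D)" and g: "mod_hom (KZJ n d) W (gmod D) g"
begin

interpretation V: left_module "KZJ n d" V by (rule V)
interpretation W: left_module "KZJ n d" W by (rule W)

abbreviation (input) "FS \<equiv> free_space (carrier V \<times> carrier W)"

interpretation Q: pm_quotient "free_space (carrier V \<times> carrier W) :: ('v \<times> 'u \<Rightarrow>\<^sub>0 'k) ring"
  "carrier V \<times> carrier W" "tensor_relations n d V W"
 by (rule tensor_pm_quotient[OF V W])

lemma tensor_subspace_eq: "tensor_subspace n d V W = Q.N"
 by (simp add: tensor_subspace_def Q.N_def)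

lemma f_gspace: "x \<in> carrier V ==> f x \<in> gspace C" and g_gspace: "y \<in> carrier W ==> g y \<in> gspace D"
 using mod_homD(1)[OF f] mod_homD(1)[OF g] by auto

lemma f_add: "x \<in> carrier V ==> x' \<in> carrier V ==> f (x \<oplus>\<^bsub>V\<^esub> x') b = f x b + f x' b"
 and g_add: "y \<in> carrier W ==> y' \<in> carrier W ==> g (y \<oplus>\<^bsub>W\<^esub> y') c = g y c + g y' c"
 using mod_homD(2)[OF f] mod_homD(2)[OF g] by auto

lemma scalar_closed: "scalar n d (c::'k) \<in> carrier (KZJ n d)"
 unfolding scalar_def by (rule trunc_class_closed[OF paths_closed])

lemma f_scalar: "x \<in> carrier V ==> f (scalar n d a \<odot>\<^bsub>V\<^esub> x) b = a * f x b"
 using mod_homD(3)[OF f scalar_closed, of x a] smult_paths[OF C f_gspace, of x 0 a]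
 by (simp add: scalar_def)

lemma g_scalar: "y \<in> carrier W ==> g (scalar n d a \<odot>\<^bsub>W\<^esub> y) c = a * g y c"
 using mod_homD(3)[OF g scalar_closed, of y a] smult_paths[OF D g_gspace, of y 0 a]
 by (simp add: scalar_def)

lemma tcoord_relations: "t \<in> Q.N ==> tcoord f g t bc = 0"
proof (rule Q.N_vanish[of "%t. tcoord f g t bc"])
 fix r assume r: "r \<in> tensor_relations n d V W"
 obtain b c where bc: "bc = (b, c)" by (cases bc)
 show "tcoord f g r bc = 0"
  using r
 proof (cases rule: tensor_relations_cases)
  case (left x x' y a)
  then show ?thesis unfolding left(1) bc tcoord_diff tcoord_single by (simp add: f_add algebra_simps)
 next
  case (right x y y' a)
  then show ?thesis unfolding right(1) bc tcoord_diff tcoord_single by (simp add: g_add algebra_simps)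
 next
  case (scalar_left x y a c)
  then show ?thesis unfolding scalar_left(1) bc tcoord_diff tcoord_single by (simp add: f_scalar)
 next
  case (scalar_right x y a c)
  then show ?thesis unfolding scalar_right(1) bc tcoord_diff tcoord_single by (simp add: g_scalar)
 qed
qed (auto simp: tcoord_add)

definition e where "e b = inv_into (carrier V) f (gunit b)"
definition e' where "e' c = inv_into (carrier W) g (gunit c)"

lemma e: "b \<in> idx C ==> e b \<in> carrier V" "b \<in> idx C ==> f (e b) = gunit b"
 using f_bij gunit_gspace[of b C] by (auto simp: e_def bij_betw_def inv_into_into f_inv_into_f)

lemma e': "c \<in> idx D ==> e' c \<in> carrier W" "c \<in> idx D ==> g (e' c) = gunit c"
 using g_bij gunit_gspace[of c D] by (auto simp: e'_def bij_betw_def inv_into_into f_inv_into_f)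

lemma f_inj: "x \<in> carrier V ==> x' \<in> carrier V ==> f x = f x' ==> x = x'"
 and g_inj: "y \<in> carrier W ==> y' \<in> carrier W ==> g y = g y' ==> y = y'"
 using f_bij g_bij by (auto simp: bij_betw_def inj_on_def)

lemma rel_left:
 "x \<in> carrier V ==> x' \<in> carrier V ==> y \<in> carrier W ==>
  single (x \<oplus>\<^bsub>V\<^esub> x', y) a - single (x, y) a - single (x', y) a \<in> Q.N"
 by (rule Q.N_gen) (unfold tensor_relations_def, blast)

lemma rel_right:
 "x \<in> carrier V ==> y \<in> carrier W ==> y' \<in> carrier W ==>
  single (x, y \<oplus>\<^bsub>W\<^esub> y') a - single (x, y) a - single (x, y') a \<in> Q.N"
 by (rule Q.N_gen) (unfold tensor_relations_def, blast)

lemma rel_scalar_left: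
 "x \<in> carrier V ==> y \<in> carrier W ==>
  single (scalar n d c \<odot>\<^bsub>V\<^esub> x, y) a - single (x, y) (a * c) \<in> Q.N"
 by (rule Q.N_gen) (unfold tensor_relations_def, blast)

lemma rel_scalar_right:
 "x \<in> carrier V ==> y \<in> carrier W ==>
  single (x, scalar n d c \<odot>\<^bsub>W\<^esub> y) a - single (x, y) (a * c) \<in> Q.N"
 by (rule Q.N_gen) (unfold tensor_relations_def, blast)

text \<open>Modulo the bilinearity relations every pure tensor is a combination of the tensors of basis vectors:
expand the first factor, then the second. With the coordinate map \<open>tcoord\<close>, which vanishes on the
relations, this identifies the quotient with the space of coordinate vectors.\<close>

lemma expand_left:
 assumes y: "y \<in> carrier W" and x: "x \<in> carrier V"
 shows "single (x, y) a - (\<Sum>b\<in>idx C. single (e b, y) (a * f x b)) \<in> Q.N"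
proof -
 note fin = gvalid_finite[OF C]
 have "\<forall>x\<in>carrier V. f x = v --> single (x, y) a - (\<Sum>b\<in>idx C. single (e b, y) (a * f x b)) \<in> Q.N"
  if "v \<in> gspace C" for v
  using fin that
 proof (induction v rule: gspace_induct)
  case zero
  show ?case
  proof (intro ballI impI)
   fix x assume x: "x \<in> carrier V" "f x = (%_. 0)"
   then have "x = \<zero>\<^bsub>V\<^esub>"
    using mod_hom_zero[OF f V left_module_gmod[OF C]] by (intro f_inj) auto
   moreover have "- (single (\<zero>\<^bsub>V\<^esub> \<oplus>\<^bsub>V\<^esub> \<zero>\<^bsub>V\<^esub>, y) a - single (\<zero>\<^bsub>V\<^esub>, y) a - single (\<zero>\<^bsub>V\<^esub>, y) a) \<in> Q.N"
    by (intro Q.N_uminus rel_left) (use y in auto)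
   ultimately show "single (x, y) a - (\<Sum>b\<in>idx C. single (e b, y) (a * f x b)) \<in> Q.N"
    using x by simp
  qed
 next
  case (unit b c)
  show ?case
  proof (intro ballI impI)
   fix x assume x: "x \<in> carrier V" "f x = (%x. c * gunit b x)"
   have "f (scalar n d c \<odot>\<^bsub>V\<^esub> e b) = f x"
    using f_scalar[OF e(1)[OF unit], of c] e(2)[OF unit] x by (simp add: fun_eq_iff)
   then have "x = scalar n d c \<odot>\<^bsub>V\<^esub> e b"
    using x V.smult_closed[OF scalar_closed e(1)[OF unit]] f_inj by metis
   moreover have "(\<Sum>b'\<in>idx C. single (e b', y) (a * f x b')) = (\<Sum>b'\<in>idx C. if b' = b then single (e b, y) (a * c) else 0)"
    by (intro sum.cong) (auto simp: x(2) gunit_def)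
   ultimately show "single (x, y) a - (\<Sum>b\<in>idx C. single (e b, y) (a * f x b)) \<in> Q.N"
    using rel_scalar_left[OF e(1)[OF unit] y, of c a] unit fin by simp
  qed
 next
  case (add v w)
  show ?case
  proof (intro ballI impI)
   fix x assume x: "x \<in> carrier V" "f x = (%b. v b + w b)"
   obtain x1 x2 where x12: "x1 \<in> carrier V" "v = f x1" "x2 \<in> carrier V" "w = f x2"
    using add(1,2) f_bij unfolding bij_betw_def by blast
   have "x = x1 \<oplus>\<^bsub>V\<^esub> x2" using x x12 by (intro f_inj) (auto simp: f_add fun_eq_iff)
   then have eq: "single (x, y) a - (\<Sum>b\<in>idx C. single (e b, y) (a * f x b))
    = (single (x1 \<oplus>\<^bsub>V\<^esub> x2, y) a - single (x1, y) a - single (x2, y) a)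
     + ((single (x1, y) a - (\<Sum>b\<in>idx C. single (e b, y) (a * f x1 b)))
     + (single (x2, y) a - (\<Sum>b\<in>idx C. single (e b, y) (a * f x2 b))))"
    using x(2) x12 by (simp add: distrib_left single_add sum.distrib)
   show "single (x, y) a - (\<Sum>b\<in>idx C. single (e b, y) (a * f x b)) \<in> Q.N"
    unfolding eq using add x12 y by (intro Q.N_add rel_left) auto
  qed
 qed
 then show ?thesis using x f_gspace by blast
qed

lemma expand_right:
 assumes y: "y \<in> carrier W" and x: "x \<in> carrier V"
 shows "single (x, y) a - (\<Sum>c\<in>idx D. single (x, e' c) (a * g y c)) \<in> Q.N"
proof -
 note fin = gvalid_finite[OF D]
 have "\<forall>y\<in>carrier W. g y = v --> single (x, y) a - (\<Sum>c\<in>idx D. single (x, e' c) (a * g y c)) \<in> Q.N"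
  if "v \<in> gspace D" for v
  using fin that
 proof (induction v rule: gspace_induct)
  case zero
  show ?case
  proof (intro ballI impI)
   fix y assume y: "y \<in> carrier W" "g y = (%_. 0)"
   then have "y = \<zero>\<^bsub>W\<^esub>"
    using mod_hom_zero[OF g W left_module_gmod[OF D]] by (intro g_inj) auto
   moreover have "- (single (x, \<zero>\<^bsub>W\<^esub> \<oplus>\<^bsub>W\<^esub> \<zero>\<^bsub>W\<^esub>) a - single (x, \<zero>\<^bsub>W\<^esub>) a - single (x, \<zero>\<^bsub>W\<^esub>) a) \<in> Q.N"
    by (intro Q.N_uminus rel_right) (use x in auto)
   ultimately show "single (x, y) a - (\<Sum>c\<in>idx D. single (x, e' c) (a * g y c)) \<in> Q.N"
    using y by simp
  qed
 next
  case (unit b c)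
  show ?case
  proof (intro ballI impI)
   fix y assume y: "y \<in> carrier W" "g y = (%x. c * gunit b x)"
   have "g (scalar n d c \<odot>\<^bsub>W\<^esub> e' b) = g y"
    using g_scalar[OF e'(1)[OF unit], of c] e'(2)[OF unit] y by (simp add: fun_eq_iff)
   then have "y = scalar n d c \<odot>\<^bsub>W\<^esub> e' b"
    using y W.smult_closed[OF scalar_closed e'(1)[OF unit]] g_inj by metis
   moreover have "(\<Sum>b'\<in>idx D. single (x, e' b') (a * g y b')) = (\<Sum>b'\<in>idx D. if b' = b then single (x, e' b) (a * c) else 0)"
    by (intro sum.cong) (auto simp: y(2) gunit_def)
   ultimately show "single (x, y) a - (\<Sum>c\<in>idx D. single (x, e' c) (a * g y c)) \<in> Q.N"
    using rel_scalar_right[OF x e'(1)[OF unit], of c a] unit fin by simp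
  qed
 next
  case (add v w)
  show ?case
  proof (intro ballI impI)
   fix y assume y: "y \<in> carrier W" "g y = (%b. v b + w b)"
   obtain y1 y2 where y12: "y1 \<in> carrier W" "v = g y1" "y2 \<in> carrier W" "w = g y2"
    using add(1,2) g_bij unfolding bij_betw_def by blast
   have "y = y1 \<oplus>\<^bsub>W\<^esub> y2" using y y12 by (intro g_inj) (auto simp: g_add fun_eq_iff)
   then have eq: "single (x, y) a - (\<Sum>c\<in>idx D. single (x, e' c) (a * g y c))
    = (single (x, y1 \<oplus>\<^bsub>W\<^esub> y2) a - single (x, y1) a - single (x, y2) a)
     + ((single (x, y1) a - (\<Sum>c\<in>idx D. single (x, e' c) (a * g y1 c)))
     + (single (x, y2) a - (\<Sum>c\<in>idx D. single (x, e' c) (a * g y2 c))))"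
    using y(2) y12 by (simp add: distrib_left single_add sum.distrib)
   show "single (x, y) a - (\<Sum>c\<in>idx D. single (x, e' c) (a * g y c)) \<in> Q.N"
    unfolding eq using add y12 x by (intro Q.N_add rel_right) auto
  qed
 qed
 then show ?thesis using y g_gspace by blast
qed

definition tvec where
 "tvec u = (\<Sum>b\<in>idx C. \<Sum>c\<in>idx D. single (e b, e' c) (u (b, c) :: 'k))"

lemma expand_tensor:
 assumes "keys t \<subseteq> carrier V \<times> carrier W"
 shows "t - tvec (tcoord f g t) \<in> Q.N"
 using assms
proof (induction t rule: poly_mapping_span_induct)
 case zero then show ?case by (simp add: tvec_def Q.N_zero)
next
 case (single xy a)
 obtain x y where xy: "xy = (x, y)" "x \<in> carrier V" "y \<in> carrier W" using single by auto
 have eq: "single (x, y) a - tvec (tcoord f g (single (x, y) a))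
  = (single (x, y) a - (\<Sum>b\<in>idx C. single (e b, y) (a * f x b)))
  + (\<Sum>b\<in>idx C. single (e b, y) (a * f x b) - (\<Sum>c\<in>idx D. single (e b, e' c) (a * f x b * g y c)))"
  by (simp add: tvec_def tcoord_single sum_subtractf mult.assoc)
 show ?case
  unfolding xy(1) eq using xy e(1) by (intro Q.N_add expand_left Q.N_sum expand_right) auto
next
 case (add t t')
 have eq: "t + t' - tvec (tcoord f g (t + t')) = (t - tvec (tcoord f g t)) + (t' - tvec (tcoord f g t'))"
  by (simp add: tvec_def tcoord_add single_add sum.distrib)
 show ?case unfolding eq by (rule Q.N_add[OF add(3,4)])
qed

lemma tensor_coset_eqI:
 assumes "keys t \<subseteq> carrier V \<times> carrier W" "keys t' \<subseteq> carrier V \<times> carrier W" "tcoord f g t = tcoord f g t'"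
 shows "t - t' \<in> Q.N"
 using Q.N_diff[OF expand_tensor[OF assms(1)] expand_tensor[OF assms(2)]] assms(3) by simp

lemma keys_tvec: "keys (tvec u) \<subseteq> carrier V \<times> carrier W"
 unfolding tvec_def
 by (intro order_trans[OF keys_sum] UN_least) (auto simp: e e' split: if_splits)

lemma tcoord_tvec:
 assumes "u \<in> gspace (tdata n C D)" shows "tcoord f g (tvec u) = u"
proof
 fix x :: "'i \<times> 'j" obtain b c where x: "x = (b, c)" by (cases x)
 have "tcoord f g (tvec u) x = (\<Sum>b'\<in>idx C. \<Sum>c'\<in>idx D. u (b', c') * (gunit b' b * gunit c' c))"
  by (simp add: x tvec_def tcoord_sum tcoord_single e e')
 also have "... = (\<Sum>b'\<in>idx C. if b' = b then (\<Sum>c'\<in>idx D. if c' = c then u (b, c) else 0) else 0)"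
  by (intro sum.cong) (auto simp: gunit_def intro!: sum.cong)
 also have "... = u (b, c)"
  using assms gvalid_finite[OF C] gvalid_finite[OF D] by (auto simp: gspace_def)
 finally show "tcoord f g (tvec u) x = u x" by (simp add: x)
qed

lemma tcoord_gspace:
 assumes t: "keys t \<subseteq> carrier V \<times> carrier W" shows "tcoord f g t \<in> gspace (tdata n C D)"
proof -
 have "tcoord f g t (b, c) = 0" if "b \<notin> idx C \<or> c \<notin> idx D" for b c
  unfolding tcoord_def split_conv
 proof (intro sum.neutral ballI)
  fix x assume "x \<in> keys t"
  then have "fst x \<in> carrier V" "snd x \<in> carrier W" using t by auto
  then show "lookup t x * (f (fst x) b * g (snd x) c) = 0"
   using that gspaceD[OF f_gspace, of "fst x" b] gspaceD[OF g_gspace, of "snd x" c] by auto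
 qed
 then show ?thesis by (auto simp: gspace_def)
qed

lemma f_path:
 assumes "fst z < n" "x \<in> carrier V" "b \<in> idx C"
 shows "f (trunc_class n d (single z 1) \<odot>\<^bsub>V\<^esub> x) b = (\<Sum>b'\<in>idx C. path_mat C z b b' * f x b')"
proof -
 have s: "single z (1::'k) \<in> carrier (KZ n)" using assms(1) by (cases z) auto
 show ?thesis
  using mod_homD(3)[OF f trunc_class_closed[OF s] assms(2)] gmod_smult[OF C s, of "f x"] assms(3)
  by (simp add: cact_def)
qed

lemma g_path:
 assumes "fst z < n" "y \<in> carrier W" "c \<in> idx D"
 shows "g (trunc_class n d (single z 1) \<odot>\<^bsub>W\<^esub> y) c = (\<Sum>c'\<in>idx D. path_mat D z c c' * g y c')"
proof -
 have s: "single z (1::'k) \<in> carrier (KZ n)" using assms(1) by (cases z) auto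
 show ?thesis
  using mod_homD(3)[OF g trunc_class_closed[OF s] assms(2)] gmod_smult[OF D s, of "g y"] assms(3)
  by (simp add: cact_def)
qed

lemma keys_diagonal_action:
 assumes t: "keys t \<subseteq> carrier V \<times> carrier W"
 shows "keys (diagonal_action n d V W a t) \<subseteq> carrier V \<times> carrier W"
proof -
 have cl: "trunc_class n d (single z (1::'k)) \<in> carrier (KZJ n d)" if "fst z < n" for z
  using that by (intro trunc_class_closed) (cases z, auto)
 have "keys (single (trunc_class n d (single z 1) \<odot>\<^bsub>V\<^esub> x, trunc_class n d (single z' 1) \<odot>\<^bsub>W\<^esub> y) (c::'k))
   \<subseteq> carrier V \<times> carrier W" if "(z, z') \<in> keys (comult n a)" "(x, y) \<in> keys t" for z z' x y c
 proof -
  have "fst z < n" "fst z' < n" using keys_comult[of n a] that(1) by auto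
  moreover have "x \<in> carrier V" "y \<in> carrier W" using t that(2) by auto
  ultimately show ?thesis using V.smult_closed[OF cl] W.smult_closed[OF cl] by (auto split: if_splits)
 qed
 then show ?thesis
  unfolding diagonal_action_def split_def
  by (intro order_trans[OF keys_sum] UN_least) (metis prod.collapse)
qed

lemma tcoord_diagonal_action:
 assumes t: "keys t \<subseteq> carrier V \<times> carrier W"
 shows "tcoord f g (diagonal_action n d V W a t) = cact (tdata n C D) a (tcoord f g t)"
proof
 fix y :: "'i \<times> 'j" obtain b c where y: "y = (b, c)" by (cases y)
 show "tcoord f g (diagonal_action n d V W a t) y = cact (tdata n C D) a (tcoord f g t) y"
 proof (cases "y \<in> idx C \<times> idx D")
  case False
  then show ?thesis
   using gspaceD[OF tcoord_gspace[OF keys_diagonal_action[OF t]], of y a] by (simp add: cact_def)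
 next
  case True
  then have bc: "b \<in> idx C" "c \<in> idx D" by (auto simp: y)
  let ?s = "comult n a"
  have "tcoord f g (diagonal_action n d V W a t) y
   = (\<Sum>z\<in>keys ?s. \<Sum>x\<in>keys t. lookup ?s z * lookup t x *
     ((\<Sum>b'\<in>idx C. path_mat C (fst z) b b' * f (fst x) b') * (\<Sum>c'\<in>idx D. path_mat D (snd z) c c' * g (snd x) c')))"
   unfolding diagonal_action_def split_def y tcoord_sum tcoord_single
  proof (intro sum.cong refl)
   fix z x assume z: "z \<in> keys ?s" and x: "x \<in> keys t"
   have "fst (fst z) < n" "fst (snd z) < n" using keys_comult[of n a] z by auto
   moreover have "fst x \<in> carrier V" "snd x \<in> carrier W" using t x by auto
   ultimately show "lookup ?s (fst z, snd z) * lookup t (fst x, snd x) *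
     (f (trunc_class n d (single (fst z) 1) \<odot>\<^bsub>V\<^esub> fst x) b * g (trunc_class n d (single (snd z) 1) \<odot>\<^bsub>W\<^esub> snd x) c)
    = lookup ?s z * lookup t x *
     ((\<Sum>b'\<in>idx C. path_mat C (fst z) b b' * f (fst x) b') * (\<Sum>c'\<in>idx D. path_mat D (snd z) c c' * g (snd x) c'))"
    using f_path[of "fst z" "fst x" b] g_path[of "snd z" "snd x" c] bc by simp
  qed
  also have "... = (\<Sum>z\<in>keys ?s. \<Sum>x\<in>keys t. \<Sum>e\<in>idx C \<times> idx D.
    (lookup ?s z * tensor_path_mat C D z y e) * (lookup t x * (f (fst x) (fst e) * g (snd x) (snd e))))"
  proof -
   have prod: "(\<Sum>b'\<in>idx C. P b') * (\<Sum>c'\<in>idx D. R c') = (\<Sum>e\<in>idx C \<times> idx D. P (fst e) * R (snd e))"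
    for P :: "'i => 'k" and R
    by (simp add: sum_product sum.cartesian_product split_def)
   show ?thesis
    unfolding prod unfolding sum_distrib_left by (intro sum.cong refl) (simp add: tensor_path_mat_def y mult_ac)
  qed
  also have "... = (\<Sum>e\<in>idx C \<times> idx D. \<Sum>z\<in>keys ?s. \<Sum>x\<in>keys t.
    (lookup ?s z * tensor_path_mat C D z y e) * (lookup t x * (f (fst x) (fst e) * g (snd x) (snd e))))"
   by (subst sum.swap[of _ "idx C \<times> idx D"], subst sum.swap[of _ "idx C \<times> idx D"]) (rule refl)
  also have "... = (\<Sum>e\<in>idx C \<times> idx D. mat_ext (tensor_path_mat C D) ?s y e * tcoord f g t e)"
   by (simp add: mat_ext_def tcoord_def split_def sum_product)
  also have "... = cact (tdata n C D) a (tcoord f g t) y"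
   using True mat_ext_comult[OF C D T True] by (simp add: cact_def)
  finally show ?thesis .
 qed
qed

lemma tensor_smult:
 assumes a: "a \<in> carrier (KZ n)" and t: "keys t \<subseteq> carrier V \<times> carrier W"
 shows "trunc_class n d a \<odot>\<^bsub>tensor_module n d V W\<^esub> (Q.N +>\<^bsub>FS\<^esub> t) = Q.N +>\<^bsub>FS\<^esub> diagonal_action n d V W a t"
proof -
 have same: "Q.N +>\<^bsub>FS\<^esub> diagonal_action n d V W a' t' = Q.N +>\<^bsub>FS\<^esub> diagonal_action n d V W a t"
  if "a' \<in> trunc_class n d a" "t' \<in> Q.N +>\<^bsub>FS\<^esub> t" for a' t'
 proof (rule Q.coset_cong, rule tensor_coset_eqI)
  have t': "keys t' \<subseteq> carrier V \<times> carrier W" using Q.coset_carrier[OF that(2) t] .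
  then show "keys (diagonal_action n d V W a' t') \<subseteq> carrier V \<times> carrier W" by (rule keys_diagonal_action)
  show "keys (diagonal_action n d V W a t) \<subseteq> carrier V \<times> carrier W" using t by (rule keys_diagonal_action)
  have "tcoord f g t' = tcoord f g t"
   using tcoord_relations[of "t' - t"] that(2) by (auto simp: Q.coset_eq tcoord_diff fun_eq_iff)
  then show "tcoord f g (diagonal_action n d V W a' t') = tcoord f g (diagonal_action n d V W a t)"
   using tcoord_diagonal_action[OF t] tcoord_diagonal_action[OF t'] cact_trunc[OF T a that(1)] by simp
 qed
 have "trunc_class n d a \<odot>\<^bsub>tensor_module n d V W\<^esub> (Q.N +>\<^bsub>FS\<^esub> t)
   = (\<Union>a'\<in>trunc_class n d a. \<Union>t'\<in>Q.N +>\<^bsub>FS\<^esub> t. Q.N +>\<^bsub>FS\<^esub> diagonal_action n d V W a' t')"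
  by (simp add: tensor_module_def tensor_subspace_eq Let_def)
 also have "... = Q.N +>\<^bsub>FS\<^esub> diagonal_action n d V W a t"
  by (rule UN_const2, erule (1) same, rule trunc_class_self[OF a], rule Q.coset_self)
 finally show ?thesis .
qed

lemma tensor_module_realizes: "realizes n d (tensor_module n d V W) (tdata n C D)"
proof -
 let ?T = "tensor_module n d V W"
 have carrier: "carrier ?T = {Q.N +>\<^bsub>FS\<^esub> t |t. keys t \<subseteq> carrier V \<times> carrier W}"
  and add: "X \<oplus>\<^bsub>?T\<^esub> Y = X <+>\<^bsub>FS\<^esub> Y" and zero: "\<zero>\<^bsub>?T\<^esub> = Q.N" for X Y
  by (simp_all add: tensor_module_def Let_def tensor_subspace_eq Q.rcosets_eq)
 define \<kappa> where "\<kappa> X = tcoord f g (SOME t. t \<in> X)" for X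
 have \<kappa>: "\<kappa> (Q.N +>\<^bsub>FS\<^esub> t) = tcoord f g t" for t
 proof -
  have "(SOME s. s \<in> Q.N +>\<^bsub>FS\<^esub> t) \<in> Q.N +>\<^bsub>FS\<^esub> t" using Q.coset_self[of t] by (rule someI[of "%s. s \<in> Q.N +>\<^bsub>FS\<^esub> t"])
  then have "tcoord f g ((SOME s. s \<in> Q.N +>\<^bsub>FS\<^esub> t) - t) bc = 0" for bc
   by (intro tcoord_relations) (simp add: Q.coset_eq)
  then show ?thesis by (simp add: \<kappa>_def tcoord_diff fun_eq_iff)
 qed
 have zero_coset: "Q.N = Q.N +>\<^bsub>FS\<^esub> 0" by (auto simp: Q.coset_eq)
 have bij: "bij_betw \<kappa> (carrier ?T) (carrier (gmod (tdata n C D)))"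
 proof (rule bij_betwI')
  fix X Y assume "X \<in> carrier ?T" "Y \<in> carrier ?T"
  then obtain t t' where t: "X = Q.N +>\<^bsub>FS\<^esub> t" "keys t \<subseteq> carrier V \<times> carrier W"
   "Y = Q.N +>\<^bsub>FS\<^esub> t'" "keys t' \<subseteq> carrier V \<times> carrier W" by (auto simp: carrier)
  show "(\<kappa> X = \<kappa> Y) = (X = Y)"
  proof
   assume "\<kappa> X = \<kappa> Y"
   then have "tcoord f g t = tcoord f g t'" by (simp add: t(1,3) \<kappa>)
   then show "X = Y" unfolding t(1,3) by (intro Q.coset_cong tensor_coset_eqI t(2,4))
  qed simp
 next
  fix X assume "X \<in> carrier ?T"
  then show "\<kappa> X \<in> carrier (gmod (tdata n C D))" by (auto simp: carrier \<kappa> tcoord_gspace)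
 next
  fix u assume "u \<in> carrier (gmod (tdata n C D))"
  then show "\<exists>X\<in>carrier ?T. u = \<kappa> X"
   by (intro bexI[of _ "Q.N +>\<^bsub>FS\<^esub> tvec u"]) (auto simp: carrier \<kappa> tcoord_tvec intro!: exI[of _ "tvec u"] subsetD[OF keys_tvec])
 qed
 have hom: "mod_hom (KZJ n d) ?T (gmod (tdata n C D)) \<kappa>"
 proof (rule mod_homI)
  fix X Y assume "X \<in> carrier ?T" "Y \<in> carrier ?T"
  then show "\<kappa> (X \<oplus>\<^bsub>?T\<^esub> Y) = \<kappa> X \<oplus>\<^bsub>gmod (tdata n C D)\<^esub> \<kappa> Y"
   by (auto simp: carrier add Q.coset_add \<kappa> tcoord_add fun_eq_iff)
 next
  fix h :: "'k trunc" and X assume h: "h \<in> carrier (KZJ n d)" and X: "X \<in> carrier ?T"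
  from h obtain a where a: "a \<in> carrier (KZ n)" "h = trunc_class n d a"
   by (rule trunc_algebra_cases)
  obtain t where t: "X = Q.N +>\<^bsub>FS\<^esub> t" "keys t \<subseteq> carrier V \<times> carrier W" using X by (auto simp: carrier)
  show "\<kappa> (h \<odot>\<^bsub>?T\<^esub> X) = h \<odot>\<^bsub>gmod (tdata n C D)\<^esub> \<kappa> X"
   unfolding a(2) t(1) tensor_smult[OF a(1) t(2)] \<kappa> gmod_smult[OF T a(1)] tcoord_diagonal_action[OF t(2)] ..
 qed (use bij in \<open>auto simp: bij_betw_def\<close>)
 have "left_module (KZJ n d) ?T"
 proof (rule left_module_transport[OF left_module_gmod[OF T] bij hom])
  fix X Y assume "X \<in> carrier ?T" "Y \<in> carrier ?T"
  then obtain t t' where t: "X = Q.N +>\<^bsub>FS\<^esub> t" "keys t \<subseteq> carrier V \<times> carrier W"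
   "Y = Q.N +>\<^bsub>FS\<^esub> t'" "keys t' \<subseteq> carrier V \<times> carrier W" by (auto simp: carrier)
  show "X \<oplus>\<^bsub>?T\<^esub> Y \<in> carrier ?T"
   unfolding add t(1,3) Q.coset_add[OF t(2,4)] carrier using path_algebra_add_closed[OF t(2,4)] by blast
 next
  fix h :: "'k trunc" and X assume h: "h \<in> carrier (KZJ n d)" and X: "X \<in> carrier ?T"
  from h obtain a where a: "a \<in> carrier (KZ n)" "h = trunc_class n d a"
   by (rule trunc_algebra_cases)
  obtain t where t: "X = Q.N +>\<^bsub>FS\<^esub> t" "keys t \<subseteq> carrier V \<times> carrier W" using X by (auto simp: carrier)
  show "h \<odot>\<^bsub>?T\<^esub> X \<in> carrier ?T"
   unfolding a(2) t(1) tensor_smult[OF a(1) t(2)] carrier using keys_diagonal_action[OF t(2)] by blast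
 next
  show "\<zero>\<^bsub>?T\<^esub> \<in> carrier ?T" unfolding zero carrier by (subst zero_coset) (auto intro!: exI[of _ 0])
  show "\<kappa> \<zero>\<^bsub>?T\<^esub> = \<zero>\<^bsub>gmod (tdata n C D)\<^esub>" unfolding zero by (subst zero_coset) (simp add: \<kappa> fun_eq_iff)
 qed
 with T bij hom show ?thesis by (auto simp: realizes_def module_isomorphic_alt)
qed

end

theorem realizes_tensor_module:
 fixes C :: "('i, 'k::field) gdata" and D :: "('j, 'k) gdata"
 assumes V: "realizes n d V C" and W: "realizes n d W D" and T: "gvalid n d (tdata n C D)"
 shows "realizes n d (tensor_module n d V W) (tdata n C D)"
proof -
 obtain f where "bij_betw f (carrier V) (gspace C)" "mod_hom (KZJ n d) V (gmod C) f"
  using realizesD(3)[OF V] by (auto simp: module_isomorphic_alt)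
 moreover obtain g where "bij_betw g (carrier W) (gspace D)" "mod_hom (KZJ n d) W (gmod D) g"
  using realizesD(3)[OF W] by (auto simp: module_isomorphic_alt)
 ultimately show ?thesis
  using tensor_module_realizes[OF realizesD(1)[OF V] realizesD(1)[OF W] realizesD(2)[OF V] realizesD(2)[OF W] T] by blast
qed

section \<open>The modules \<open>M(i, j)\<close>\<close>

lemma gX_funpow_block:
 assumes v: "v \<in> gspace (block n x)"
 shows "(gX (block n x) ^^ k) v s = (if s < fst x \<and> k \<le> s then v (s - k) else (0::'k::field))"
proof (cases "s < fst x")
 case True
 let ?C = "block n x :: (nat, 'k) gdata"
 have fin: "finite (idx ?C)" by simp
 have tr: "s \<in> idx ?C" using True by simp
 have mem: "s - k \<in> idx ?C" using tr by auto
 have "pow_mat ?C k s b' * v b' = (if b' = s - k then if k \<le> s then v (s - k) else 0 else 0)" for b'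
  by (auto simp: pow_mat_block[OF True])
 then have "(gX ?C ^^ k) v s = (\<Sum>b'\<in>idx ?C. if b' = s - k then if k \<le> s then v (s - k) else 0 else 0)"
  using gX_funpow[OF fin v tr, of k] by simp
 also have "... = (if k \<le> s then v (s - k) else 0)"
  using mem fin by (simp only: sum.delta if_True)
 finally show ?thesis using True by simp
next
 case False
 then show ?thesis using gspaceD[OF gX_funpow_gspace[OF v], of s] by auto
qed

lemma gX_block:
 "v \<in> gspace (block n x) ==> gX (block n x) v s = (if s < fst x \<and> 1 \<le> s then v (s - 1) else (0::'k::field))"
 using gX_funpow_block[of v n x 1 s] by simp

lemma gproj_block: "gproj (block n x) i v s = (if s < fst x \<and> (snd x + s) mod n = i then v s else (0::'k::field))"
 by (simp add: gproj_def)

lemma shift_hom: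
 assumes n: "0 < n" and l: "i \<le> l" "l \<le> d"
 shows "mod_hom (KZJ n d) (gmod (block n (l - i, j + i) :: (nat, 'k::field) gdata)) (gmod (block n (l, j)))
   (%w s. if i \<le> s then w (s - i) else 0)" (is "mod_hom _ (gmod ?C) (gmod ?D) ?f")
proof (rule gmod_lin_homI)
 show "gvalid n d ?C" "gvalid n d ?D" using n l by (auto intro!: gvalid_block)
 fix v assume v: "v \<in> gspace ?C"
 show fv: "?f v \<in> gspace ?D" using v l by (auto simp: gspace_def)
 show "?f (gX ?C v) = gX ?D (?f v)"
 proof
  fix s show "?f (gX ?C v) s = gX ?D (?f v) s"
   using v l unfolding gX_block[OF v] gX_block[OF fv] by (auto simp: gspace_def diff_diff_add)
 qed
 show "?f (gproj ?C r v) = gproj ?D r (?f v)" for r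
  using l by (auto simp: fun_eq_iff gproj_block)
qed (auto simp: fun_eq_iff)

lemma shift_image:
 assumes "i \<le> l"
 shows "(%w s. if i \<le> s then w (s - i) else 0) ` gspace (block n (l - i, j + i) :: (nat, 'k::field) gdata)
  = {w \<in> gspace (block n (l, j)). \<forall>s<i. w s = 0}"
proof (intro equalityI subsetI)
 fix w assume w: "w \<in> {w \<in> gspace (block n (l, j) :: (nat, 'k) gdata). \<forall>s<i. w s = 0}"
 show "w \<in> (%w s. if i \<le> s then w (s - i) else 0) ` gspace (block n (l - i, j + i) :: (nat, 'k) gdata)"
  by (rule image_eqI[of _ _ "%s. w (s + i)"]) (use w in \<open>auto simp: gspace_def fun_eq_iff\<close>)
qed (use assms in \<open>auto simp: gspace_def\<close>)

lemma truncation_hom: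
 assumes n: "0 < n" and l: "i \<le> l" "l \<le> d"
 shows "mod_hom (KZJ n d) (gmod (block n (l, j) :: (nat, 'k::field) gdata)) (gmod (block n (i, j)))
   (%w s. if s < i then w s else 0)" (is "mod_hom _ (gmod ?C) (gmod ?D) ?f")
proof (rule gmod_lin_homI)
 show "gvalid n d ?C" "gvalid n d ?D" using n l by (auto intro!: gvalid_block)
 fix v assume v: "v \<in> gspace ?C"
 show fv: "?f v \<in> gspace ?D" by (auto simp: gspace_def)
 show "?f (gX ?C v) = gX ?D (?f v)"
 proof
  fix s show "?f (gX ?C v) s = gX ?D (?f v) s"
   using l unfolding gX_block[OF v] gX_block[OF fv] by auto
 qed
 show "?f (gproj ?C r v) = gproj ?D r (?f v)" for r
  using l by (auto simp: fun_eq_iff gproj_block)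
qed (auto simp: fun_eq_iff)

subsection \<open>The radical of a uniserial module\<close>

lemma submodule_subset: "submodule N R V ==> N \<subseteq> carrier V"
 using subgroup.subset[OF submodule.axioms(1)] by force

lemma submodule_add: "submodule N R V ==> x \<in> N ==> y \<in> N ==> x \<oplus>\<^bsub>V\<^esub> y \<in> N"
 using subgroup.m_closed[OF submodule.axioms(1)] by force

lemma submodule_zero: "submodule N R V ==> \<zero>\<^bsub>V\<^esub> \<in> N"
 using subgroup.one_closed[OF submodule.axioms(1)] by force

text \<open>A submodule of a uniserial module that contains a vector with nonzero coefficient at the generator is
everything: the projection to the degree of the generator isolates that coefficient.\<close>

lemma block_submodule:
 assumes n: "0 < n" and l: "l \<le> d" "d \<le> n"
  and V: "left_module (KZJ n d) V"
  and f: "mod_hom (KZJ n d) (gmod (block n (l, j) :: (nat, 'k::field) gdata)) V f"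
   "f ` gspace (block n (l, j)) = carrier V"
  and N: "submodule N (KZJ n d) V"
  and w: "w \<in> gspace (block n (l, j))" "f w \<in> N" "w 0 \<noteq> 0"
 shows "N = carrier V"
proof -
 let ?C = "block n (l, j) :: (nat, 'k) gdata"
 have C: "gvalid n d ?C" using n l by (auto intro: gvalid_block)
 have l0: "0 < l" using w gspaceD[OF w(1), of 0] by (cases "l = 0") auto
 have fin: "finite (idx ?C)" by simp
 have paths: "f (%b. c * (gX ?C ^^ k) v b) \<in> N" if "v \<in> gspace ?C" "f v \<in> N" for c k v
  using mod_homD(3)[OF f(1) trunc_class_closed[OF paths_closed[of k c n]], of v] smult_paths[OF C that(1), of k c]
   submodule.smult_closed[OF N trunc_class_closed[OF paths_closed[of k c n]] that(2)] that(1) by simp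
 have "f (gproj ?C (j mod n) w) \<in> N"
 proof -
  have s: "single (j mod n, 0) (1::'k) \<in> carrier (KZ n)" using n by simp
  show ?thesis
   using mod_homD(3)[OF f(1) trunc_class_closed[OF s], of w] smult_vertex[OF C, of "j mod n" w] n w
    submodule.smult_closed[OF N trunc_class_closed[OF s] w(2)] by simp
 qed
 also have "gproj ?C (j mod n) w = (%s. w 0 * gunit 0 s)"
 proof
  fix s
  have "s = 0" if "s < l" "(j + s) mod n = j mod n"
   using degree_determines_position[of s l 0 n j] that l by simp
  then show "gproj ?C (j mod n) w s = w 0 * gunit 0 s" using l0 by (auto simp: gproj_block gunit_def)
 qed
 finally have "f (%s. (1 / w 0) * (gX ?C ^^ 0) (%s. w 0 * gunit 0 s) s) \<in> N"
  using l0 by (intro paths gspace_scale gunit_gspace) auto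
 then have u0: "f (gunit 0) \<in> N" using w(3) by simp
 have unit: "f (%s. c * gunit b s) \<in> N" if "b \<in> idx ?C" for b c
 proof -
  have "(gX ?C ^^ b) (gunit 0) = gunit b"
  proof
   fix s
   have "(gX ?C ^^ b) (gunit 0) s = (if s < l \<and> b \<le> s then gunit 0 (s - b) else 0)"
    using gX_funpow_block[OF gunit_gspace[of 0 ?C], of b s] l0 by simp
   then show "(gX ?C ^^ b) (gunit 0) s = gunit b s" using that by (auto simp: gunit_def)
  qed
  then show ?thesis using paths[OF gunit_gspace u0, of c b] l0 by simp
 qed
 have "f v \<in> N" if "v \<in> gspace ?C" for v
  using fin that
 proof (induction v rule: gspace_induct)
  case zero
  show ?case using mod_hom_zero[OF f(1) left_module_gmod[OF C] V] submodule_zero[OF N] by simp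
 next
  case (unit b c) then show ?case using \<open>\<And>b c. b \<in> idx ?C ==> f (%s. c * gunit b s) \<in> N\<close> by blast
 next
  case (add v w)
  then show ?case using mod_homD(2)[OF f(1), of v w] submodule_add[OF N, of "f v" "f w"] by simp
 qed
 then have "f ` gspace ?C \<subseteq> N" by (rule image_subsetI)
 then show ?thesis using f(2) submodule_subset[OF N] by simp
qed

text \<open>Consequently the vectors without generator component form the only maximal submodule, and they are
the block of length \<open>l - 1\<close> that starts one degree later.\<close>

lemma module_radical_block:
 assumes n: "0 < n" and l: "0 < l" "l \<le> d" "d \<le> n"
  and V: "left_module (KZJ n d) V"
  and f: "mod_hom (KZJ n d) (gmod (block n (l, j) :: (nat, 'k::field) gdata)) V f"
   "bij_betw f (gspace (block n (l, j))) (carrier V)"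
 shows "module_radical (KZJ n d) V = f ` {w \<in> gspace (block n (l, j)). w 0 = 0}" (is "_ = ?N")
proof -
 let ?C = "block n (l, j) :: (nat, 'k) gdata"
 have C': "gvalid n d (block n (l - 1, j + 1) :: (nat, 'k) gdata)" using n l by (auto intro!: gvalid_block)
 have im: "f ` gspace ?C = carrier V" and inj: "inj_on f (gspace ?C)" using f(2) by (auto simp: bij_betw_def)
 have "submodule ((%w. f (%s. if 1 \<le> s then w (s - 1) else 0)) ` carrier (gmod (block n (l - 1, j + 1)))) (KZJ n d) V"
  by (rule submodule_image[OF mod_hom_comp[OF shift_hom f(1)] left_module_gmod[OF C'] V]) (use n l in auto)
 also have "(%w. f (%s. if 1 \<le> s then w (s - 1) else 0)) ` carrier (gmod (block n (l - 1, j + 1))) = ?N"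
 proof -
  have "f ` (%w s. if 1 \<le> s then w (s - 1) else 0) ` gspace (block n (l - 1, j + 1))
   = (%w. f (%s. if 1 \<le> s then w (s - 1) else 0)) ` carrier (gmod (block n (l - 1, j + 1)))"
   by (simp only: image_image gmod_sel)
  then show ?thesis
   using shift_image[of 1 l n j, where ?'k = 'k] l by (simp add: less_Suc_eq)
 qed
 finally have N: "submodule ?N (KZJ n d) V" .
 have proper: "N' \<subseteq> ?N" if N': "submodule N' (KZJ n d) V" "N' \<noteq> carrier V" for N'
 proof
  fix x assume x: "x \<in> N'"
  then obtain w where w: "w \<in> gspace ?C" "x = f w" using submodule_subset[OF N'(1)] im by blast
  have "w 0 = 0" using block_submodule[OF n l(2,3) V f(1) im N'(1) w(1)] x w(2) N'(2) by blast
  then show "x \<in> ?N" using w by blast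
 qed
 have ne: "?N \<noteq> carrier V"
 proof
  assume "?N = carrier V"
  moreover have "f (gunit 0) \<in> carrier V" using mod_homD(1)[OF f(1), of "gunit 0"] l by simp
  ultimately obtain w where w: "w \<in> gspace ?C" "w 0 = 0" "f (gunit 0) = f w" by auto
  have "gunit 0 = w" using inj_onD[OF inj, of "gunit 0" w] w l by simp
  then show False using w(2) by (auto simp: gunit_def)
 qed
 have "maximal_submodule (KZJ n d) V N' \<longleftrightarrow> N' = ?N" for N'
  unfolding maximal_submodule_def using N ne proper by blast
 then show ?thesis
  unfolding module_radical_def using submodule_subset[OF N] by auto
qed

subsection \<open>Projective modules and their quotients\<close>

lemma left_module_regular:
 assumes "ring R" shows "left_module R (regular_module R)"
proof -
 interpret R: ring R by fact
 show ?thesis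
  by (intro left_module.intro left_module_axioms.intro abelian_groupI R.ring_axioms)
   (auto simp: regular_module_def R.m_assoc R.l_distr R.r_distr R.add.m_assoc R.add.m_comm R.add.m_lcomm
    intro: R.add.l_inv_ex)
qed

lemma realizes_image:
 fixes C :: "('i, 'k::field) gdata"
 assumes C: "gvalid n d C" and R: "left_module (KZJ n d) R"
  and f: "mod_hom (KZJ n d) (gmod C) R f" "inj_on f (gspace C)"
  and M: "M = R\<lparr>carrier := f ` gspace C\<rparr>"
 shows "left_module (KZJ n d) M"
  "mod_hom (KZJ n d) (gmod C) M f" "bij_betw f (gspace C) (carrier M)"
proof -
 have ops: "carrier M = f ` gspace C" "\<And>x y. x \<oplus>\<^bsub>M\<^esub> y = x \<oplus>\<^bsub>R\<^esub> y" "\<And>a x. a \<odot>\<^bsub>M\<^esub> x = a \<odot>\<^bsub>R\<^esub> x" "\<zero>\<^bsub>M\<^esub> = \<zero>\<^bsub>R\<^esub>"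
  by (simp_all add: M)
 show bij: "bij_betw f (gspace C) (carrier M)" using f(2) by (simp add: bij_betw_def ops)
 show hom: "mod_hom (KZJ n d) (gmod C) M f"
  using f(1) by (simp add: mod_hom_def ops)
 interpret G: left_module "KZJ n d" "gmod C" by (rule left_module_gmod[OF C])
 have z: "f (%_. 0) = \<zero>\<^bsub>R\<^esub>" using mod_hom_zero[OF f(1) left_module_gmod[OF C] R] by simp
 have bij': "bij_betw f (carrier (gmod C)) (carrier M)" using bij by simp
 show "left_module (KZJ n d) M"
 proof (rule left_module_transport[OF left_module_gmod[OF C] bij_betw_inv_into[OF bij'] mod_hom_inv[OF left_module_gmod[OF C] bij' hom]])
  fix x y assume "x \<in> carrier M" "y \<in> carrier M"
  then obtain v w where v: "v \<in> gspace C" "x = f v" "w \<in> gspace C" "y = f w" by (auto simp: ops)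
  have "x \<oplus>\<^bsub>M\<^esub> y = f (%b. v b + w b)" using mod_homD(2)[OF f(1), of v w] v by (simp add: ops)
  then show "x \<oplus>\<^bsub>M\<^esub> y \<in> carrier M" using gspace_add[OF v(1,3)] by (simp add: ops)
 next
  fix a :: "'k trunc" and x assume a: "a \<in> carrier (KZJ n d)" and "x \<in> carrier M"
  then obtain v where v: "v \<in> gspace C" "x = f v" by (auto simp: ops)
  then show "a \<odot>\<^bsub>M\<^esub> x \<in> carrier M"
  proof -
   have "a \<odot>\<^bsub>M\<^esub> x = f (a \<odot>\<^bsub>gmod C\<^esub> v)" using mod_homD(3)[OF f(1) a, of v] v by (simp add: ops)
   then show ?thesis using G.smult_closed[OF a, of v] v(1) by (simp add: ops)
  qed
 next
  show "\<zero>\<^bsub>M\<^esub> \<in> carrier M" unfolding ops z[symmetric] by simp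
  have "inv_into (gspace C) f (f (%_. 0)) = (%_. 0)" using f(2) by (rule inv_into_f_f) simp
  then show "inv_into (carrier (gmod C)) f \<zero>\<^bsub>M\<^esub> = \<zero>\<^bsub>gmod C\<^esub>" by (simp add: ops z)
 qed
qed

lemma realizes_quotient:
 fixes D :: "('i, 'k::field) gdata"
 assumes P: "left_module (KZJ n d) P" and D: "gvalid n d D"
  and \<Phi>: "mod_hom (KZJ n d) P (gmod D) \<Phi>" "\<Phi> ` carrier P = gspace D"
  and K: "K = {x \<in> carrier P. \<Phi> x = (%_. 0)}"
 shows "realizes n d (quotient_module P K) D"
proof -
 interpret P: left_module "KZJ n d" P by (rule P)
 interpret G: left_module "KZJ n d" "gmod D" by (rule left_module_gmod[OF D])
 have memK: "x \<in> K \<longleftrightarrow> x \<in> carrier P \<and> \<Phi> x = (%_. 0)" for x by (simp add: K)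
 have "submodule K (KZJ n d) P"
  using submodule_kernel[OF \<Phi>(1) P left_module_gmod[OF D]] by (simp add: K)
 then interpret K: abelian_subgroup K P
  by (intro abelian_subgroupI3 additive_subgroupI submodule.axioms(1) P.abelian_group_axioms)
 let ?Q = "quotient_module P K"
 have \<Phi>c: "\<Phi> x \<in> gspace D" if "x \<in> carrier P" for x using \<Phi> that by blast
 have coset: "y \<in> K +>\<^bsub>P\<^esub> x \<longleftrightarrow> y \<in> carrier P \<and> \<Phi> y = \<Phi> x" if x: "x \<in> carrier P" for x y
 proof
  assume "y \<in> K +>\<^bsub>P\<^esub> x"
  then obtain k where "k \<in> K" and y: "y = k \<oplus>\<^bsub>P\<^esub> x" unfolding a_r_coset_def' by blast
  then have k: "k \<in> carrier P" "\<Phi> k = (%_. 0)" using memK by blast+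
  then show "y \<in> carrier P \<and> \<Phi> y = \<Phi> x" using x y mod_homD(2)[OF \<Phi>(1), of k x] by simp
 next
  assume y: "y \<in> carrier P \<and> \<Phi> y = \<Phi> x"
  define k where "k = y \<ominus>\<^bsub>P\<^esub> x"
  have k: "k \<in> carrier P" using x y by (simp add: k_def)
  have yk: "y = k \<oplus>\<^bsub>P\<^esub> x" using x y by (simp add: k_def P.minus_eq P.add.m_assoc P.l_neg)
  have "(%b. \<Phi> k b + \<Phi> x b) = \<Phi> x" using y mod_homD(2)[OF \<Phi>(1) k x] yk by simp
  then have "\<Phi> k = (%_. 0)" by (simp add: fun_eq_iff)
  then have "k \<in> K" using k memK by blast
  then show "y \<in> K +>\<^bsub>P\<^esub> x" unfolding a_r_coset_def' using yk by blast
 qed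
 have eq: "K +>\<^bsub>P\<^esub> x = K +>\<^bsub>P\<^esub> y \<longleftrightarrow> \<Phi> x = \<Phi> y" if "x \<in> carrier P" "y \<in> carrier P" for x y
 proof
  assume "K +>\<^bsub>P\<^esub> x = K +>\<^bsub>P\<^esub> y"
  then have "x \<in> K +>\<^bsub>P\<^esub> y" using coset[OF that(1), of x] that(1) by simp
  then show "\<Phi> x = \<Phi> y" using coset[OF that(2)] by simp
 next
  assume "\<Phi> x = \<Phi> y"
  then have "z \<in> K +>\<^bsub>P\<^esub> x \<longleftrightarrow> z \<in> K +>\<^bsub>P\<^esub> y" for z using coset[OF that(1)] coset[OF that(2)] by simp
  then show "K +>\<^bsub>P\<^esub> x = K +>\<^bsub>P\<^esub> y" by (rule Set.set_eqI)
 qed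
 have carrier: "carrier ?Q = {K +>\<^bsub>P\<^esub> x |x. x \<in> carrier P}"
  by (auto simp: quotient_module_def A_RCOSETS_def')
 have add: "(K +>\<^bsub>P\<^esub> x) \<oplus>\<^bsub>?Q\<^esub> (K +>\<^bsub>P\<^esub> y) = K +>\<^bsub>P\<^esub> (x \<oplus>\<^bsub>P\<^esub> y)" if "x \<in> carrier P" "y \<in> carrier P" for x y
  using K.a_rcos_sum[OF that] by (simp add: quotient_module_def)
 have zero: "\<zero>\<^bsub>?Q\<^esub> = K +>\<^bsub>P\<^esub> \<zero>\<^bsub>P\<^esub>"
  using P.a_coset_add_zero K.a_subset by (simp add: quotient_module_def)
 have smult: "h \<odot>\<^bsub>?Q\<^esub> (K +>\<^bsub>P\<^esub> x) = K +>\<^bsub>P\<^esub> (h \<odot>\<^bsub>P\<^esub> x)"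
  if h: "h \<in> carrier (KZJ n d)" and x: "x \<in> carrier P" for h x
 proof -
  have "h \<odot>\<^bsub>?Q\<^esub> (K +>\<^bsub>P\<^esub> x) = (\<Union>y\<in>K +>\<^bsub>P\<^esub> x. K +>\<^bsub>P\<^esub> (h \<odot>\<^bsub>P\<^esub> y))" by (simp add: quotient_module_def)
  also have "... = (\<Union>y\<in>K +>\<^bsub>P\<^esub> x. K +>\<^bsub>P\<^esub> (h \<odot>\<^bsub>P\<^esub> x))"
  proof (intro SUP_cong refl)
   fix y assume "y \<in> K +>\<^bsub>P\<^esub> x"
   then have y: "y \<in> carrier P" "\<Phi> y = \<Phi> x" using coset[OF x] by auto
   then show "K +>\<^bsub>P\<^esub> (h \<odot>\<^bsub>P\<^esub> y) = K +>\<^bsub>P\<^esub> (h \<odot>\<^bsub>P\<^esub> x)"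
    using eq[OF P.smult_closed[OF h y(1)] P.smult_closed[OF h x]] mod_homD(3)[OF \<Phi>(1) h] x by simp
  qed
  also have "... = K +>\<^bsub>P\<^esub> (h \<odot>\<^bsub>P\<^esub> x)" using coset[OF x, of x] x by auto
  finally show ?thesis .
 qed
 define \<kappa> where "\<kappa> X = \<Phi> (SOME x. x \<in> X)" for X
 have \<kappa>: "\<kappa> (K +>\<^bsub>P\<^esub> x) = \<Phi> x" if "x \<in> carrier P" for x
 proof -
  have "x \<in> K +>\<^bsub>P\<^esub> x" using coset[OF that] that by simp
  then have "(SOME y. y \<in> K +>\<^bsub>P\<^esub> x) \<in> K +>\<^bsub>P\<^esub> x" by (rule someI[of "%y. y \<in> K +>\<^bsub>P\<^esub> x"])
  then show ?thesis using coset[OF that] by (simp add: \<kappa>_def)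
 qed
 have bij: "bij_betw \<kappa> (carrier ?Q) (carrier (gmod D))"
 proof (rule bij_betwI')
  fix X Y assume "X \<in> carrier ?Q" "Y \<in> carrier ?Q"
  then obtain x y where "x \<in> carrier P" "X = K +>\<^bsub>P\<^esub> x" "y \<in> carrier P" "Y = K +>\<^bsub>P\<^esub> y" by (auto simp: carrier)
  then show "(\<kappa> X = \<kappa> Y) = (X = Y)" using eq by (simp add: \<kappa>)
 next
  fix X assume "X \<in> carrier ?Q"
  then show "\<kappa> X \<in> carrier (gmod D)" using \<Phi>c by (auto simp: carrier \<kappa>)
 next
  fix u assume "u \<in> carrier (gmod D)"
  then have "u \<in> \<Phi> ` carrier P" using \<Phi>(2) by simp
  then obtain x where "x \<in> carrier P" "u = \<Phi> x" by (elim imageE)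
  then show "\<exists>X\<in>carrier ?Q. u = \<kappa> X" by (intro bexI[of _ "K +>\<^bsub>P\<^esub> x"]) (auto simp: carrier \<kappa>)
 qed
 have hom: "mod_hom (KZJ n d) ?Q (gmod D) \<kappa>"
 proof (rule mod_homI)
  fix X Y assume "X \<in> carrier ?Q" "Y \<in> carrier ?Q"
  then obtain x y where "x \<in> carrier P" "X = K +>\<^bsub>P\<^esub> x" "y \<in> carrier P" "Y = K +>\<^bsub>P\<^esub> y" by (auto simp: carrier)
  then show "\<kappa> (X \<oplus>\<^bsub>?Q\<^esub> Y) = \<kappa> X \<oplus>\<^bsub>gmod D\<^esub> \<kappa> Y"
   using mod_homD(2)[OF \<Phi>(1), of x y] by (simp add: add \<kappa>)
 next
  fix h :: "'k trunc" and X assume h: "h \<in> carrier (KZJ n d)" and "X \<in> carrier ?Q"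
  then obtain x where "x \<in> carrier P" "X = K +>\<^bsub>P\<^esub> x" by (auto simp: carrier)
  then show "\<kappa> (h \<odot>\<^bsub>?Q\<^esub> X) = h \<odot>\<^bsub>gmod D\<^esub> \<kappa> X"
   using mod_homD(3)[OF \<Phi>(1) h, of x] P.smult_closed[OF h, of x] h by (simp add: smult \<kappa>)
 qed (use bij in \<open>auto simp: bij_betw_def\<close>)
 have "left_module (KZJ n d) ?Q"
 proof (rule left_module_transport[OF left_module_gmod[OF D] bij hom])
  fix X Y assume "X \<in> carrier ?Q" "Y \<in> carrier ?Q"
  then obtain x y where xy: "x \<in> carrier P" "X = K +>\<^bsub>P\<^esub> x" "y \<in> carrier P" "Y = K +>\<^bsub>P\<^esub> y" by (auto simp: carrier)
  have "x \<oplus>\<^bsub>P\<^esub> y \<in> carrier P" using xy by simp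
  then show "X \<oplus>\<^bsub>?Q\<^esub> Y \<in> carrier ?Q" unfolding xy(2,4) add[OF xy(1,3)] carrier by blast
 next
  fix h :: "'k trunc" and X assume h: "h \<in> carrier (KZJ n d)" and "X \<in> carrier ?Q"
  then obtain x where x: "x \<in> carrier P" "X = K +>\<^bsub>P\<^esub> x" by (auto simp: carrier)
  show "h \<odot>\<^bsub>?Q\<^esub> X \<in> carrier ?Q" unfolding x(2) smult[OF h x(1)] carrier using P.smult_closed[OF h x(1)] by blast
 next
  show "\<zero>\<^bsub>?Q\<^esub> \<in> carrier ?Q" unfolding zero carrier by blast
  show "\<kappa> \<zero>\<^bsub>?Q\<^esub> = \<zero>\<^bsub>gmod D\<^esub>"
   unfolding zero using mod_hom_zero[OF \<Phi>(1) P left_module_gmod[OF D]] by (simp add: \<kappa>)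
 qed
 with D bij hom show ?thesis by (auto simp: realizes_def module_isomorphic_alt)
qed

text \<open>The paths starting at the vertex \<open>j\<close> form a Jordan basis of \<open>P\<^sub>j\<close>.\<close>

definition proj_vec :: "nat => nat => nat => (nat => 'k::field) => 'k trunc" where
 "proj_vec n d j u = trunc_class n d (path_poly n d (%x. if fst x = j then u (snd x) else 0))"

lemma proj_vec_hom:
 assumes n: "0 < n" and j: "j < n"
 shows "mod_hom (KZJ n d) (gmod (block n (d, j) :: (nat, 'k::field) gdata))
  (regular_module (KZJ n d)) (proj_vec n d j)" (is "mod_hom ?H (gmod ?C) ?R ?f")
proof -
 have C: "gvalid n d ?C" using n by (intro gvalid_block) auto
 note R = left_module_regular[OF ring_trunc_algebra]
 let ?p = "%u. path_poly n d (%x. if fst x = j then u (snd x) else (0::'k))"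
 have key: "?f (cact ?C (single (i, l) c) v) = trunc_class n d (single (i, l) c) \<odot>\<^bsub>?R\<^esub> ?f v"
  if i: "i < n" and v: "v \<in> gspace ?C" for i l c and v :: "nat => 'k"
 proof -
  have s: "single (i, l) c \<in> carrier (KZ n)" using i by simp
  have "trunc_class n d (?p (cact ?C (single (i, l) c) v))
    = trunc_class n d (basis_mult (path_comp n) (single (i, l) c) (?p v))"
  proof (intro trunc_class_cong path_poly_closed path_algebra_mult_closed s)
   fix i' k assume ik: "i' < n" "k < d"
   have "cact ?C (single (i, l) c) v k = (if l \<le> k \<and> (j + (k - l)) mod n = i then c * v (k - l) else 0)"
    using ik gX_funpow_block[OF gproj_gspace, of l n "(d, j)" i v k]
    by (auto simp: cact_path[OF C] gproj_block)
   then show "lookup (?p (cact ?C (single (i, l) c) v)) (i', k)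
     = lookup (basis_mult (path_comp n) (single (i, l) c) (?p v)) (i', k)"
    using ik by (auto simp: lookup_path_poly lookup_basis_mult_single)
  qed
  then show ?thesis
   by (simp add: proj_vec_def regular_module_def trunc_class_mult[OF s path_poly_closed])
 qed
 show ?thesis
 proof (rule trunc_algebra_hom_criterion[OF left_module_gmod[OF C] R])
  show "?f v \<in> carrier ?R" for v
   by (simp add: proj_vec_def regular_module_def trunc_class_closed[OF path_poly_closed])
  fix v w :: "nat => 'k"
  have "(%x. if fst x = j then v (snd x) + w (snd x) else 0)
    = (%x. (if fst x = j then v (snd x) else 0) + (if fst x = j then w (snd x) else 0))" by auto
  then show "?f (v \<oplus>\<^bsub>gmod ?C\<^esub> w) = ?f v \<oplus>\<^bsub>?R\<^esub> ?f w"
   by (simp add: proj_vec_def regular_module_def path_poly_add trunc_class_add[OF path_poly_closed path_poly_closed])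
 next
  fix i v and c :: 'k assume "i < n" "v \<in> carrier (gmod ?C)"
  then show "?f (trunc_class n d (single (i, 0) c) \<odot>\<^bsub>gmod ?C\<^esub> v) = trunc_class n d (single (i, 0) c) \<odot>\<^bsub>?R\<^esub> ?f v"
   using key[of i v 0 c] gmod_smult[OF C, of "single (i, 0) c"] by simp
 next
  fix i v assume "i < n" "v \<in> carrier (gmod ?C)"
  then show "?f (trunc_class n d (single (i, 1) 1) \<odot>\<^bsub>gmod ?C\<^esub> v) = trunc_class n d (single (i, 1) 1) \<odot>\<^bsub>?R\<^esub> ?f v"
   using key[of i v 1 1] gmod_smult[OF C, of "single (i, 1) 1"] by simp
 qed
qed

lemma proj_vec_inj: "j < n ==> inj_on (proj_vec n d j) (gspace (block n (d, j) :: (nat, 'k::field) gdata))"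
proof (rule inj_onI)
 fix u w :: "nat => 'k"
 assume j: "j < n" and u: "u \<in> gspace (block n (d, j))" and w: "w \<in> gspace (block n (d, j))"
  and eq: "proj_vec n d j u = proj_vec n d j w"
 let ?p = "%u. path_poly n d (%x. if fst x = j then u (snd x) else (0::'k))"
 have "?p u \<in> trunc_class n d (?p u)" by (rule trunc_class_self[OF path_poly_closed])
 then have "?p u \<in> trunc_class n d (?p w)" using eq by (simp add: proj_vec_def)
 then have k: "\<forall>x\<in>keys (?p u - ?p w). d \<le> snd x" by (simp add: mem_trunc_class[OF path_poly_closed])
 show "u = w"
 proof
  fix s show "u s = w s"
  proof (cases "s < d")
   case True
   then have "(j, s) \<notin> keys (?p u - ?p w)" using k by force
   then show ?thesis using True j by (simp add: in_keys_iff lookup_minus lookup_path_poly)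
  next
   case False
   then show ?thesis using u w by (simp add: gspace_def)
  qed
 qed
qed

lemma lookup_basis_mult_vertex:
 "lookup (basis_mult (path_comp n) a (single (j, 0) 1)) (i, k) = (if i = j \<and> j < n then lookup a ((j::nat), k) else 0)"
 if "j < n" "keys a \<subseteq> {..<n} \<times> UNIV" for a :: "path \<Rightarrow>\<^sub>0 'k::field"
 using that(2)
proof (induction a rule: poly_mapping_span_induct)
 case (single x c)
 obtain i' k' where x: "x = (i', k')" by (cases x)
 show ?case using single \<open>j < n\<close> by (auto simp: x basis_mult_single path_comp_def lookup_single when_def)
qed (auto simp: basis_mult_add_left lookup_add)

lemma carrier_proj_module:
 assumes j: "j < n"
 shows "carrier (proj_module n d j) = proj_vec n d j ` gspace (block n (d, j) :: (nat, 'k::field) gdata)"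
proof -
 have s: "single (j, 0) (1::'k) \<in> carrier (KZ n)" using j by simp
 have eq: "trunc_class n d a \<otimes>\<^bsub>KZJ n d\<^esub> trunc_class n d (single (j, 0) 1)
  = proj_vec n d j (%s. if s < d then lookup a (j, s) else (0::'k))"
  if a: "a \<in> carrier (KZ n)" for a
  unfolding proj_vec_def trunc_class_mult[OF a s, symmetric]
  by (intro trunc_class_cong path_algebra_mult_closed[OF a s] path_poly_closed)
    (use a j in \<open>auto simp: lookup_basis_mult_vertex lookup_path_poly\<close>)
 have "carrier (proj_module n d j) = (%a. proj_vec n d j (%s. if s < d then lookup a (j, s) else (0::'k))) ` carrier (KZ n)"
 proof -
  have "carrier (proj_module n d j) = (%h. h \<otimes>\<^bsub>KZJ n d\<^esub> trunc_class n d (single (j, 0) (1::'k))) ` carrier (KZJ n d)"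
   by (auto simp: proj_module_def)
  then show ?thesis unfolding carrier_trunc_algebra image_image by (simp only: eq cong: image_cong)
 qed
 also have "... = proj_vec n d j ` gspace (block n (d, j))"
 proof (intro equalityI subsetI)
  fix x assume "x \<in> (%a. proj_vec n d j (%s. if s < d then lookup a (j, s) else (0::'k))) ` carrier (KZ n)"
  then show "x \<in> proj_vec n d j ` gspace (block n (d, j))" by (auto simp: gspace_def intro!: imageI)
 next
  fix x assume "x \<in> proj_vec n d j ` gspace (block n (d, j) :: (nat, 'k) gdata)"
  then obtain u where u: "u \<in> gspace (block n (d, j) :: (nat, 'k) gdata)" "x = proj_vec n d j u" by blast
  let ?a = "path_poly n d (%x. if fst x = j then u (snd x) else 0)"
  have "(%s. if s < d then lookup ?a (j, s) else 0) = u"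
   using u(1) j by (auto simp: lookup_path_poly gspace_def fun_eq_iff)
  then show "x \<in> (%a. proj_vec n d j (%s. if s < d then lookup a (j, s) else (0::'k))) ` carrier (KZ n)"
   using u(2) by (intro image_eqI[OF _ path_poly_closed[of n d "%x. if fst x = j then u (snd x) else 0"]]) simp
 qed
 finally show ?thesis .
qed

text \<open>Taking radicals shortens the block step by step, so the \<open>i\<close>-th power of the radical consists of the
multiples of \<open>X\<^sup>i\<close>, and the quotient by it is the block of length \<open>i\<close>.\<close>

lemma radical_power_proj:
 assumes n: "0 < n" and d: "d \<le> n" and j: "j < n" and i: "i \<le> d"
 shows "radical_power (KZJ n d) (proj_module n d j) i
   = proj_vec n d j ` {u \<in> gspace (block n (d, j) :: (nat, 'k::field) gdata). \<forall>s<i. u s = 0}"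
 using i
proof (induction i)
 case 0
 show ?case by (simp add: carrier_proj_module[OF j])
next
 case (Suc i)
 let ?\<sigma> = "%w s. if i \<le> s then w (s - i) else (0::'k)"
 let ?C = "block n (d - i, j + i) :: (nat, 'k) gdata"
 let ?f = "%w. proj_vec n d j (?\<sigma> w)"
 let ?M = "(proj_module n d j)\<lparr>carrier := proj_vec n d j ` {u \<in> gspace (block n (d, j) :: (nat, 'k) gdata). \<forall>s<i. u s = 0}\<rparr>"
 note R = left_module_regular[OF ring_trunc_algebra, of n d]
 have C: "gvalid n d ?C" using n by (intro gvalid_block) auto
 have hom: "mod_hom (KZJ n d) (gmod ?C) (regular_module (KZJ n d)) ?f"
  by (rule mod_hom_comp[OF shift_hom proj_vec_hom]) (use n j Suc.prems in auto)
 have im: "?\<sigma> ` gspace ?C = {u \<in> gspace (block n (d, j) :: (nat, 'k) gdata). \<forall>s<i. u s = 0}"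
  using Suc.prems by (intro shift_image) auto
 have "inj_on ?\<sigma> (gspace ?C)"
 proof (rule inj_onI)
  fix v w assume "?\<sigma> v = ?\<sigma> w"
  then have "?\<sigma> v (s + i) = ?\<sigma> w (s + i)" for s by (rule fun_cong)
  then show "v = w" by (simp add: fun_eq_iff)
 qed
 then have inj: "inj_on ?f (gspace ?C)"
  using comp_inj_on[of ?\<sigma> "gspace ?C" "proj_vec n d j"] im
   inj_on_subset[OF proj_vec_inj[OF j, of d], of "?\<sigma> ` gspace ?C"] by (auto simp: comp_def)
 have "?M = (regular_module (KZJ n d))\<lparr>carrier := ?f ` gspace ?C\<rparr>"
 proof -
  have "?f ` gspace ?C = proj_vec n d j ` ?\<sigma> ` gspace ?C" by (simp only: image_image)
  then show ?thesis unfolding im by (simp add: proj_module_def)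
 qed
 note M = realizes_image[OF C R hom inj this]
 have "module_radical (KZJ n d) ?M = ?f ` {w \<in> gspace ?C. w 0 = 0}"
  by (rule module_radical_block[OF n _ _ d M]) (use Suc.prems in auto)
 also have "... = proj_vec n d j ` ?\<sigma> ` {w \<in> gspace ?C. w 0 = 0}" by (simp add: image_image)
 also have "?\<sigma> ` {w \<in> gspace ?C. w 0 = 0} = {u \<in> gspace (block n (d, j) :: (nat, 'k) gdata). \<forall>s<Suc i. u s = 0}"
 proof (intro equalityI subsetI)
  fix u assume u: "u \<in> {u \<in> gspace (block n (d, j) :: (nat, 'k) gdata). \<forall>s<Suc i. u s = 0}"
  then have "u \<in> ?\<sigma> ` gspace ?C" unfolding im by auto
  then obtain w where "w \<in> gspace ?C" "u = ?\<sigma> w" by blast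
  then show "u \<in> ?\<sigma> ` {w \<in> gspace ?C. w 0 = 0}" using u by auto
 next
  fix u assume "u \<in> ?\<sigma> ` {w \<in> gspace ?C. w 0 = 0}"
  then obtain w where w: "w \<in> gspace ?C" "w 0 = 0" "u = ?\<sigma> w" by blast
  then have "u \<in> ?\<sigma> ` gspace ?C" by blast
  then have "u \<in> gspace (block n (d, j) :: (nat, 'k) gdata)" "\<forall>s<i. u s = 0" unfolding im by auto
  then show "u \<in> {u \<in> gspace (block n (d, j) :: (nat, 'k) gdata). \<forall>s<Suc i. u s = 0}"
   using w by (auto simp: less_Suc_eq)
 qed
 finally show ?case using Suc by simp
qed

theorem realizes_indec_module:
 assumes n: "0 < n" and d: "d \<le> n" and j: "j < n" and i: "i \<le> d"
 shows "realizes n d (indec_module n d i j) (block n (i, j) :: (nat, 'k::field) gdata)"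
proof -
 let ?C = "block n (d, j) :: (nat, 'k) gdata" and ?D = "block n (i, j) :: (nat, 'k) gdata"
 let ?P = "proj_module n d j :: ('k trunc, 'k trunc) module"
 have C: "gvalid n d ?C" and D: "gvalid n d ?D" using n i by (auto intro!: gvalid_block)
 have "?P = (regular_module (KZJ n d))\<lparr>carrier := proj_vec n d j ` gspace ?C\<rparr>"
  using carrier_proj_module[OF j, of d, where ?'k = 'k] by (simp add: proj_module_def)
 note P = realizes_image[OF C left_module_regular[OF ring_trunc_algebra] proj_vec_hom[OF n j] proj_vec_inj[OF j] this]
 define g where "g = inv_into (gspace ?C) (proj_vec n d j :: (nat => 'k) => _)"
 have g: "mod_hom (KZJ n d) ?P (gmod ?C) g"
  using mod_hom_inv[OF left_module_gmod[OF C] _ P(2)] P(3) by (simp add: g_def)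
 have bij: "bij_betw g (carrier ?P) (gspace ?C)" unfolding g_def by (rule bij_betw_inv_into[OF P(3)])
 have gp: "g (proj_vec n d j u) = u" if "u \<in> gspace ?C" for u
  unfolding g_def using that P(3) by (simp add: bij_betw_def)
 let ?\<tau> = "%w s. if s < i then w s else (0::'k)"
 have hom: "mod_hom (KZJ n d) ?P (gmod ?D) (%x. ?\<tau> (g x))"
  by (rule mod_hom_comp[OF g truncation_hom]) (use n i in auto)
 have surj: "(%x. ?\<tau> (g x)) ` carrier ?P = gspace ?D"
 proof -
  have "(%x. ?\<tau> (g x)) ` carrier ?P = ?\<tau> ` gspace ?C"
  proof -
   have "(%x. ?\<tau> (g x)) ` carrier ?P = ?\<tau> ` g ` carrier ?P" by (simp only: image_image)
   then show ?thesis using bij by (simp add: bij_betw_def)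
  qed
  also have "... = gspace ?D"
  proof (intro equalityI subsetI)
   fix w assume w: "w \<in> gspace ?D"
   then show "w \<in> ?\<tau> ` gspace ?C"
    using i by (intro image_eqI[of _ _ w]) (auto simp: gspace_def fun_eq_iff)
  qed (auto simp: gspace_def)
  finally show ?thesis .
 qed
 have "proj_vec n d j ` {u \<in> gspace ?C. \<forall>s<i. u s = 0} = {x \<in> carrier ?P. ?\<tau> (g x) = (%_. 0)}"
 proof (intro equalityI subsetI)
  fix x assume "x \<in> proj_vec n d j ` {u \<in> gspace ?C. \<forall>s<i. u s = 0}"
  then obtain u where u: "u \<in> gspace ?C" "\<forall>s<i. u s = 0" "x = proj_vec n d j u" by blast
  then show "x \<in> {x \<in> carrier ?P. ?\<tau> (g x) = (%_. 0)}"
   using carrier_proj_module[OF j, of d, where ?'k = 'k] by (auto simp: gp)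
 next
  fix x assume x: "x \<in> {x \<in> carrier ?P. ?\<tau> (g x) = (%_. 0)}"
  then obtain u where u: "u \<in> gspace ?C" "x = proj_vec n d j u"
   using carrier_proj_module[OF j, of d, where ?'k = 'k] by blast
  have "u s = 0" if "s < i" for s
  proof -
   have "?\<tau> (g x) = (%_. 0)" using x by simp
   then have "?\<tau> (g x) s = 0" by (rule fun_cong)
   then show ?thesis using that u(2) gp[OF u(1)] by simp
  qed
  then show "x \<in> proj_vec n d j ` {u \<in> gspace ?C. \<forall>s<i. u s = 0}" using u by blast
 qed
 then have "radical_power (KZJ n d) ?P i = {x \<in> carrier ?P. ?\<tau> (g x) = (%_. 0)}"
  using radical_power_proj[OF n d j i, where ?'k = 'k] by simp
 from realizes_quotient[OF P(1) D hom surj this] show ?thesis by (simp add: indec_module_def)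
qed

section \<open>The representation ring\<close>

type_synonym bvec = "nat \<times> nat \<Rightarrow>\<^sub>0 int"

definition vec :: "(nat \<times> nat) list => bvec" where
 "vec L = (\<Sum>x\<leftarrow>L. frag_of x)"

lemma vec_simps [simp]: "vec [] = 0" "vec (x # L) = frag_of x + vec L" "vec (L @ L') = vec L + vec L'"
 by (simp_all add: vec_def)

lemma lookup_vec: "lookup (vec L) x = int (count (mset L) x)"
 by (induction L) (auto simp: lookup_add)

lemma vec_eq_iff: "vec L = vec L' \<longleftrightarrow> mset L = mset L'"
proof
 assume eq: "vec L = vec L'"
 show "mset L = mset L'"
  by (rule multiset_eqI) (use lookup_vec[of L] lookup_vec[of L'] eq in simp)
next
 assume "mset L = mset L'"
 then show "vec L = vec L'" by (intro poly_mapping_eqI) (simp add: lookup_vec)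
qed

lemma keys_vec: "keys (vec L) = set L"
 by (auto simp: in_keys_iff lookup_vec)

lemma basis_mult_diff_left:
 "basis_mult m (f - g) h = basis_mult m f h - basis_mult m g (h :: 'b \<Rightarrow>\<^sub>0 'k::comm_ring_1)"
 using basis_mult_add_left[of m "f - g" g h] by simp

lemma basis_mult_diff_right:
 "basis_mult m h (f - g) = basis_mult m h f - basis_mult m h (g :: 'b \<Rightarrow>\<^sub>0 'k::comm_ring_1)"
 using basis_mult_add_right[of m h "f - g" g] by simp

lemma frag_extend_fun_diff:
 fixes f g :: "'a => 'b \<Rightarrow>\<^sub>0 int"
 shows "frag_extend (%x. f x - g x) c = frag_extend f c - frag_extend g c"
proof -
 have "frag_cmul k (a - b) = frag_cmul k a - frag_cmul k b" for k and a b :: "'b \<Rightarrow>\<^sub>0 int"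
  by (rule poly_mapping_eqI) (simp add: lookup_minus right_diff_distrib)
 then show ?thesis by (simp add: frag_extend_def sum_subtractf)
qed

locale green_ring =
 fixes n p m d :: nat and ty :: "'k::field itself"
 assumes p: "prime p" "CHAR('k) = p" and m: "m \<ge> 1" and d: "d = p ^ m" and dn: "d \<le> n"
begin

lemma d_ge2: "2 \<le> d"
proof -
 have "2 \<le> p" using p(1) by (rule prime_ge_2_nat)
 then show ?thesis using m d self_le_power[of p m] by simp
qed

lemma n_pos: "0 < n" using d_ge2 dn by simp

abbreviation H :: "'k trunc ring" where "H \<equiv> KZJ n d"
abbreviation Bl :: "(nat \<times> nat) set" where "Bl \<equiv> blocks n d"

lemma Bl_iff: "(i, j) \<in> Bl \<longleftrightarrow> 1 \<le> i \<and> i \<le> d \<and> j < n"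
 by (auto simp: blocks_def)

lemma gvalid_tensor: "gvalid n d (C :: ('i, 'k) gdata) ==> gvalid n d (D :: ('j, 'k) gdata) ==> gvalid n d (tdata n C D)"
 by (rule gvalid_tdata[OF p d _ _ n_pos])

definition decomposes :: "('k trunc, 'v) module => (nat \<times> nat) list => bool" where
 "decomposes V L \<longleftrightarrow> set L \<subseteq> Bl \<and> realizes n d V (std n L :: 'k gdata2)"

text \<open>The multiplicities of the indecomposable summands. They do not depend on the decomposition chosen
here, by \<open>block_decomposition_unique\<close>, and they determine the module up to isomorphism.\<close>

definition gvec :: "('k trunc, 'v) module => bvec" where
 "gvec V = vec (SOME L. decomposes V L)"

lemma decomposes_ex: "fin_gen_module H V ==> \<exists>L. decomposes V L"
 using block_decomposition[OF _ n_pos dn] by (auto simp: decomposes_def)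

lemma decomposes_fin_gen: "decomposes V L ==> fin_gen_module H V"
 unfolding decomposes_def using realizes_fin_gen by blast

lemma decomposes_unique: "decomposes V L ==> decomposes V L' ==> mset L = mset L'"
proof -
 assume L: "decomposes V L" and L': "decomposes V L'"
 have "module_isomorphic H (gmod (std n L)) (gmod (std n L'))"
  using L L' module_isomorphic_sym[of H V] module_isomorphic_trans unfolding decomposes_def realizes_def by blast
 then show ?thesis using L L' block_decomposition_unique[OF n_pos] by (auto simp: decomposes_def)
qed

lemma gvec_eq: "decomposes V L ==> gvec V = vec L"
 unfolding gvec_def vec_eq_iff by (metis decomposes_unique someI)

lemma gvec_decomposes: "fin_gen_module H V ==> gvec V = vec L ==> decomposes V L"
proof -
 assume V: "fin_gen_module H V" and eq: "gvec V = vec L"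
 obtain L' where L': "decomposes V L'" using decomposes_ex[OF V] by blast
 then have ms: "mset L' = mset L" using eq gvec_eq[OF L'] by (simp add: vec_eq_iff)
 obtain h where "gdata_iso h (std n L' :: 'k gdata2) (std n L)"
  using gdata_iso_std_mset[OF ms] by blast
 moreover have "set L = set L'" using ms by (metis set_mset_mset)
 ultimately show ?thesis
  using L' realizes_reindex[of h "std n L' :: 'k gdata2" "std n L" n d V] by (simp add: decomposes_def)
qed

lemma keys_gvec: "fin_gen_module H V ==> keys (gvec V) \<subseteq> Bl"
proof -
 assume "fin_gen_module H V"
 then obtain L where L: "decomposes V L" using decomposes_ex by blast
 then have "set L \<subseteq> Bl" by (simp add: decomposes_def)
 then show ?thesis by (simp add: gvec_eq[OF L] keys_vec)
qed

lemma gvec_iso: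
 assumes V: "fin_gen_module H V" and W: "fin_gen_module H W"
 shows "module_isomorphic H V W \<longleftrightarrow> gvec V = gvec W"
proof
 assume iso: "module_isomorphic H V W"
 obtain L where L: "decomposes W L" using decomposes_ex[OF W] by blast
 then have R: "set L \<subseteq> Bl" "realizes n d W (std n L :: 'k gdata2)" by (simp_all add: decomposes_def)
 have "left_module H V" using V by (simp add: fin_gen_module_def)
 then have "decomposes V L"
  unfolding decomposes_def realizes_def
  using R(1) realizesD(2)[OF R(2)] module_isomorphic_trans[OF iso realizesD(3)[OF R(2)]] by simp
 then show "gvec V = gvec W" using gvec_eq[OF L] gvec_eq[of V L] by simp
next
 assume eq: "gvec V = gvec W"
 obtain L where L: "decomposes W L" using decomposes_ex[OF W] by blast
 then have "decomposes V L" using gvec_decomposes[OF V, of L] eq gvec_eq[OF L] by simp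
 then show "module_isomorphic H V W"
  using L realizes_iso[of n d V "std n L :: 'k gdata2" W] by (simp add: decomposes_def)
qed

lemma realizes_gvec_eq:
 assumes "realizes n d V (C :: ('i, 'k) gdata)" "realizes n d W C"
 shows "gvec V = gvec W"
 using gvec_iso[OF realizes_fin_gen[OF assms(1)] realizes_fin_gen[OF assms(2)]] realizes_iso[OF assms] by simp

lemma gvec_cong_data:
 assumes "gdata_iso h C D" "gvalid n d (C :: ('i, 'k) gdata)"
 shows "gvec (gmod C) = gvec (gmod D)"
 using realizes_gvec_eq[OF realizes_reindex[OF assms(1) realizes_gmod[OF assms(2)]]
  realizes_gmod[OF gvalid_iso[OF assms]]] .

lemma gvec_realizes: "realizes n d V (C :: ('i, 'k) gdata) ==> gvec V = gvec (gmod C)"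
 by (rule realizes_gvec_eq[OF _ realizes_gmod]) (auto simp: realizes_def)

lemma gvalid_std_Bl: "set L \<subseteq> Bl ==> gvalid n d (std n L :: 'k gdata2)"
 by (rule gvalid_std_blocks[OF n_pos])

lemma gvec_std: "set L \<subseteq> Bl ==> gvec (gmod (std n L :: 'k gdata2)) = vec L"
 by (rule gvec_eq) (simp add: decomposes_def realizes_gmod gvalid_std_Bl)

lemma gvalid_block_Bl: "x \<in> Bl ==> gvalid n d (block n x :: (nat, 'k) gdata)"
 by (rule gvalid_block[OF n_pos]) (auto simp: blocks_def)

lemma gvec_block: "x \<in> Bl ==> gvec (gmod (block n x :: (nat, 'k) gdata)) = frag_of x"
 using gvec_cong_data[OF gdata_iso_std_singleton gvalid_block_Bl, of x] gvec_std[of "[x]"] by simp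

lemma gvec_dsum:
 assumes C: "gvalid n d (C :: ('i, 'k) gdata)" and D: "gvalid n d (D :: ('j, 'k) gdata)"
 shows "gvec (gmod (dsum C D)) = gvec (gmod C) + gvec (gmod D)"
proof -
 obtain L where L: "decomposes (gmod C) L"
  using decomposes_ex[OF realizes_fin_gen[OF realizes_gmod[OF C]]] by blast
 obtain L' where L': "decomposes (gmod D) L'"
  using decomposes_ex[OF realizes_fin_gen[OF realizes_gmod[OF D]]] by blast
 have s: "gvalid n d (std n L :: 'k gdata2)" "gvalid n d (std n L' :: 'k gdata2)"
  using L L' gvalid_std_Bl by (auto simp: decomposes_def)
 have "realizes n d (direct_sum2 (gmod C) (gmod D)) (dsum C D)"
  by (intro realizes_direct_sum2 realizes_gmod C D)
 moreover have "realizes n d (direct_sum2 (gmod C) (gmod D)) (std n (L @ L') :: 'k gdata2)"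
  using L L' by (intro realizes_reindex[OF gdata_iso_std_append] realizes_direct_sum2) (auto simp: decomposes_def)
 then have "decomposes (direct_sum2 (gmod C) (gmod D)) (L @ L')" using L L' by (simp add: decomposes_def)
 then have "gvec (direct_sum2 (gmod C) (gmod D)) = vec L + vec L'" using gvec_eq by fastforce
 ultimately show ?thesis
  using gvec_realizes[of "direct_sum2 (gmod C) (gmod D)" "dsum C D"] gvec_eq[OF L] gvec_eq[OF L'] by simp
qed

lemma gvec_direct_sum2:
 assumes "fin_gen_module H V" "fin_gen_module H W"
 shows "fin_gen_module H (direct_sum2 V W)" "gvec (direct_sum2 V W) = gvec V + gvec W"
proof -
 obtain L where L: "decomposes V L" using decomposes_ex[OF assms(1)] by blast
 obtain L' where L': "decomposes W L'" using decomposes_ex[OF assms(2)] by blast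
 have R: "realizes n d V (std n L :: 'k gdata2)" "realizes n d W (std n L' :: 'k gdata2)"
  and s: "set L \<subseteq> Bl" "set L' \<subseteq> Bl"
  using L L' by (simp_all add: decomposes_def)
 have "decomposes (direct_sum2 V W) (L @ L')"
  using realizes_reindex[OF gdata_iso_std_append realizes_direct_sum2[OF R]] s by (simp add: decomposes_def)
 from decomposes_fin_gen[OF this] gvec_eq[OF this]
 show "fin_gen_module H (direct_sum2 V W)" "gvec (direct_sum2 V W) = gvec V + gvec W"
  using gvec_eq[OF L] gvec_eq[OF L'] by simp_all
qed

subsection \<open>Products of blocks\<close>

definition tprod :: "nat \<times> nat => nat \<times> nat => bvec" where
 "tprod x y = gvec (gmod (tdata n (block n x :: (nat, 'k) gdata) (block n y :: (nat, 'k) gdata)))"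

definition gmult :: "bvec => bvec => bvec" where
 "gmult g h = frag_extend (%x. frag_extend (tprod x) h) g"

notation gmult (infixl "\<star>" 70)

lemma gmult_zero [simp]: "0 \<star> h = 0" "g \<star> 0 = 0"
 by (simp_all add: gmult_def frag_extend_eq_0)

lemma gmult_diff_left: "(g - g') \<star> h = g \<star> h - g' \<star> h"
 by (simp add: gmult_def frag_extend_diff)

lemma gmult_diff_right: "g \<star> (h - h') = g \<star> h - g \<star> h'"
 by (simp add: gmult_def frag_extend_diff frag_extend_fun_diff)

lemma gmult_frag_of: "frag_of x \<star> frag_of y = tprod x y"
 by (simp add: gmult_def)

text \<open>A module that is realized by two graded matrices has tensor products that are realized by both
tensor products of matrices; so multiplicities of a tensor product depend on the multiplicities of the factors.\<close>

lemma gvec_tdata_cong: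
 assumes C: "gvalid n d (C :: ('i, 'k) gdata)" and C': "gvalid n d (C' :: ('a, 'k) gdata)"
  and D: "gvalid n d (D :: ('j, 'k) gdata)" and eq: "gvec (gmod C) = gvec (gmod C')"
 shows "gvec (gmod (tdata n C D)) = gvec (gmod (tdata n C' D))"
proof -
 have iso: "module_isomorphic H (gmod C) (gmod C')"
  using gvec_iso[OF realizes_fin_gen[OF realizes_gmod[OF C]] realizes_fin_gen[OF realizes_gmod[OF C']]] eq by simp
 have "realizes n d (tensor_module n d (gmod C) (gmod D)) (tdata n C D)"
  by (intro realizes_tensor_module realizes_gmod C D gvalid_tensor)
 moreover have "realizes n d (tensor_module n d (gmod C) (gmod D)) (tdata n C' D)"
  by (intro realizes_tensor_module realizes_trans[OF realizes_gmod[OF C] C' iso] realizes_gmod D gvalid_tensor C')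
 ultimately show ?thesis
  using gvec_realizes[of "tensor_module n d (gmod C) (gmod D)" "tdata n C D"]
   gvec_realizes[of "tensor_module n d (gmod C) (gmod D)" "tdata n C' D"] by simp
qed

lemma gvec_tdata_commute:
 assumes C: "gvalid n d (C :: ('i, 'k) gdata)" and D: "gvalid n d (D :: ('j, 'k) gdata)"
 shows "gvec (gmod (tdata n C D)) = gvec (gmod (tdata n D C))"
 by (rule gvec_cong_data[OF gdata_iso_tdata_commute gvalid_tensor[OF C D]])

lemma gvec_tdata_dsum:
 assumes B: "gvalid n d (B :: ('i, 'k) gdata)" and C: "gvalid n d (C :: ('a, 'k) gdata)"
  and D: "gvalid n d (D :: ('j, 'k) gdata)"
 shows "gvec (gmod (tdata n (dsum B C) D)) = gvec (gmod (tdata n B D)) + gvec (gmod (tdata n C D))"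
 using gvec_cong_data[OF gdata_iso_tdata_dsum gvalid_tensor[OF gvalid_dsum[OF B C] D]]
  gvec_dsum[OF gvalid_tensor[OF B D] gvalid_tensor[OF C D]] by simp

lemma gvec_tdata_std:
 assumes L: "set L \<subseteq> Bl" and D: "gvalid n d (D :: ('j, 'k) gdata)"
 shows "gvec (gmod (tdata n (std n L :: 'k gdata2) D))
  = (\<Sum>x\<leftarrow>L. gvec (gmod (tdata n (block n x :: (nat, 'k) gdata) D)))"
 using L
proof (induction L)
 case Nil
 have "gdata_iso (%_. undefined) (tdata n (std n [] :: 'k gdata2) D) (std n [] :: 'k gdata2)"
  by (auto simp: gdata_iso_def bij_betw_def)
 from gvec_cong_data[OF this gvalid_tensor[OF gvalid_std_Bl D]] gvec_std[of "[]"] show ?case by simp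
next
 case (Cons x L)
 then have x: "x \<in> Bl" and L: "set L \<subseteq> Bl" by auto
 let ?B = "block n x :: (nat, 'k) gdata" and ?L = "std n L :: 'k gdata2"
 have "gvec (gmod (std n (x # L) :: 'k gdata2)) = gvec (gmod (dsum ?B ?L))"
  using gvec_std[of "x # L"] gvec_std[OF L] gvec_block[OF x] gvec_dsum[OF gvalid_block_Bl[OF x] gvalid_std_Bl[OF L]] Cons.prems
  by simp
 from gvec_tdata_cong[OF gvalid_std_Bl gvalid_dsum[OF gvalid_block_Bl[OF x] gvalid_std_Bl[OF L]] D this]
 show ?case
  using Cons.prems gvec_tdata_dsum[OF gvalid_block_Bl[OF x] gvalid_std_Bl[OF L] D] Cons.IH[OF L] by simp
qed

lemma frag_extend_vec: "frag_extend f (vec L) = (\<Sum>x\<leftarrow>L. f x)"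
 by (induction L) (auto simp: frag_extend_add)

lemma gvec_tdata:
 assumes C: "gvalid n d (C :: ('i, 'k) gdata)" and D: "gvalid n d (D :: ('j, 'k) gdata)"
 shows "gvec (gmod (tdata n C D)) = gvec (gmod C) \<star> gvec (gmod D)"
proof -
 obtain L where L: "decomposes (gmod C) L"
  using decomposes_ex[OF realizes_fin_gen[OF realizes_gmod[OF C]]] by blast
 obtain L' where L': "decomposes (gmod D) L'"
  using decomposes_ex[OF realizes_fin_gen[OF realizes_gmod[OF D]]] by blast
 let ?L = "std n L :: 'k gdata2" and ?L' = "std n L' :: 'k gdata2"
 have s: "set L \<subseteq> Bl" "set L' \<subseteq> Bl" using L L' by (auto simp: decomposes_def)
 note g = gvalid_std_Bl[OF s(1)] gvalid_std_Bl[OF s(2)]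
 have "gvec (gmod (tdata n C D)) = gvec (gmod (tdata n ?L D))"
  by (rule gvec_tdata_cong[OF C g(1) D]) (simp add: gvec_eq[OF L] gvec_std[OF s(1)])
 also have "... = gvec (gmod (tdata n D ?L))" by (rule gvec_tdata_commute[OF g(1) D])
 also have "... = gvec (gmod (tdata n ?L' ?L))"
  by (rule gvec_tdata_cong[OF D g(2) g(1)]) (simp add: gvec_eq[OF L'] gvec_std[OF s(2)])
 also have "... = gvec (gmod (tdata n ?L ?L'))" by (rule gvec_tdata_commute[OF g(2,1)])
 also have "... = (\<Sum>x\<leftarrow>L. gvec (gmod (tdata n (block n x :: (nat, 'k) gdata) ?L')))"
  by (rule gvec_tdata_std[OF s(1) g(2)])
 also have "... = (\<Sum>x\<leftarrow>L. \<Sum>y\<leftarrow>L'. tprod x y)"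
 proof (intro arg_cong[of _ _ sum_list] map_cong refl)
  fix x assume "x \<in> set L"
  then have x: "x \<in> Bl" using s(1) by blast
  have "gvec (gmod (tdata n (block n x :: (nat, 'k) gdata) ?L')) = gvec (gmod (tdata n ?L' (block n x :: (nat, 'k) gdata)))"
   by (rule gvec_tdata_commute[OF gvalid_block_Bl[OF x] g(2)])
  also have "... = (\<Sum>y\<leftarrow>L'. gvec (gmod (tdata n (block n y :: (nat, 'k) gdata) (block n x :: (nat, 'k) gdata))))"
   by (rule gvec_tdata_std[OF s(2) gvalid_block_Bl[OF x]])
  also have "... = (\<Sum>y\<leftarrow>L'. tprod x y)"
   using s(2) by (intro arg_cong[of _ _ sum_list] map_cong refl)
    (auto simp: tprod_def intro!: gvec_tdata_commute gvalid_block_Bl x)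
  finally show "gvec (gmod (tdata n (block n x :: (nat, 'k) gdata) ?L')) = (\<Sum>y\<leftarrow>L'. tprod x y)" .
 qed
 also have "... = vec L \<star> vec L'" by (simp add: gmult_def frag_extend_vec)
 finally show ?thesis by (simp add: gvec_eq[OF L] gvec_eq[OF L'])
qed

lemma realizes_std_ex: "fin_gen_module H V ==> \<exists>L. realizes n d V (std n L :: 'k gdata2)"
 using decomposes_ex by (auto simp: decomposes_def)

lemma gvec_tensor:
 assumes V: "fin_gen_module H V" and W: "fin_gen_module H W"
 shows "fin_gen_module H (tensor_module n d V W)" "gvec (tensor_module n d V W) = gvec V \<star> gvec W"
proof -
 obtain L where L: "realizes n d V (std n L :: 'k gdata2)" using realizes_std_ex[OF V] by blast
 obtain L' where L': "realizes n d W (std n L' :: 'k gdata2)" using realizes_std_ex[OF W] by blast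
 note g = realizesD(2)[OF L] realizesD(2)[OF L']
 have T: "realizes n d (tensor_module n d V W) (tdata n (std n L :: 'k gdata2) (std n L' :: 'k gdata2))"
  by (intro realizes_tensor_module L L' gvalid_tensor g)
 then show "fin_gen_module H (tensor_module n d V W)" by (rule realizes_fin_gen)
 show "gvec (tensor_module n d V W) = gvec V \<star> gvec W"
  using gvec_realizes[OF T] gvec_tdata[OF g] gvec_realizes[OF L] gvec_realizes[OF L'] by simp
qed

lemma gmult_commute:
 assumes g: "keys g \<subseteq> Bl" and h: "keys h \<subseteq> Bl" shows "g \<star> h = h \<star> g"
 using g
proof (induction g rule: frag_induction)
 case (one x)
 note x = this
 show ?case using h
 proof (induction h rule: frag_induction)
  case (one y)
  then show ?case using x gvec_tdata_commute[OF gvalid_block_Bl gvalid_block_Bl] by (simp add: gmult_frag_of tprod_def)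
 qed (auto simp: gmult_diff_left gmult_diff_right)
qed (auto simp: gmult_diff_left gmult_diff_right)

lemma gmult_shift:
 assumes "r < n" "(u, s) \<in> Bl"
 shows "frag_of (1, r) \<star> frag_of (u, s) = frag_of (u, (r + s) mod n)"
proof -
 have r: "(1, r) \<in> Bl" using assms(1) d_ge2 by (simp add: Bl_iff)
 have "(u, (r + s) mod n) \<in> Bl" using assms n_pos by (simp add: Bl_iff)
 then show ?thesis
  using gvec_cong_data[OF gdata_iso_tdata_shift gvalid_tensor[OF gvalid_block_Bl[OF r] gvalid_block_Bl[OF assms(2)]]]
  by (simp add: gmult_frag_of tprod_def gvec_block)
qed

subsection \<open>Isomorphism classes\<close>

lemma mem_iso_class: "fin_gen_module H V ==> U \<in> iso_class n d V \<longleftrightarrow> fin_gen_module H U \<and> gvec U = gvec V"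
 unfolding iso_class_def using gvec_iso by auto

lemma umodule_ex:
 assumes "set L \<subseteq> Bl"
 shows "\<exists>U :: 'k umodule. fin_gen_module H U \<and> gvec U = vec L"
proof -
 let ?L = "std n L :: 'k gdata2"
 define C where "C = \<lparr>idx = prod_encode ` idx ?L, deg = (%x. deg ?L (prod_decode x)),
   mat = (%x y. mat ?L (prod_decode x) (prod_decode y))\<rparr>"
 have "gdata_iso prod_encode ?L C"
  by (auto simp: gdata_iso_def C_def bij_betw_def intro: inj_on_subset[OF inj_prod_encode])
 from gvec_cong_data[OF this gvalid_std_Bl[OF assms]] gvalid_iso[OF this gvalid_std_Bl[OF assms]] gvec_std[OF assms]
 show ?thesis using realizes_fin_gen[OF realizes_gmod, of n d C] by (intro exI[of _ "gmod C"]) simp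
qed

lemma umodule_copy:
 assumes V: "fin_gen_module H V"
 obtains U :: "'k umodule" where "fin_gen_module H U" "gvec U = gvec V"
proof -
 obtain L where L: "decomposes V L" using decomposes_ex[OF V] by blast
 then have "set L \<subseteq> Bl" by (simp add: decomposes_def)
 from umodule_ex[OF this] show ?thesis using that gvec_eq[OF L] by auto
qed

lemma iso_class_eq_iff:
 assumes V: "fin_gen_module H V" and W: "fin_gen_module H W"
 shows "iso_class n d V = iso_class n d W \<longleftrightarrow> gvec V = gvec W"
proof
 assume eq: "iso_class n d V = iso_class n d W"
 obtain U :: "'k umodule" where "fin_gen_module H U" "gvec U = gvec V" using umodule_copy[OF V] .
 then have "U \<in> iso_class n d W" using mem_iso_class[OF V] eq by simp
 then show "gvec V = gvec W" using mem_iso_class[OF W] \<open>gvec U = gvec V\<close> by simp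
qed (use mem_iso_class[OF V] mem_iso_class[OF W] in auto)

lemma iso_class_in: "fin_gen_module H V ==> iso_class n d V \<in> iso_classes n d"
proof -
 assume V: "fin_gen_module H V"
 obtain U :: "'k umodule" where U: "fin_gen_module H U" "gvec U = gvec V" using umodule_copy[OF V] .
 then have "iso_class n d V = iso_class n d U" using iso_class_eq_iff[OF V U(1)] by simp
 then show ?thesis using U(1) unfolding iso_classes_def by blast
qed

lemma iso_classes_cases:
 assumes "A \<in> iso_classes n d"
 obtains V :: "'k umodule" where "fin_gen_module H V" "A = iso_class n d V"
 using assms unfolding iso_classes_def by blast

lemma tensor_class_iso_class:
 assumes V: "fin_gen_module H V" and W: "fin_gen_module H W"
 shows "tensor_class n d (iso_class n d V) (iso_class n d W) = iso_class n d (tensor_module n d V W)"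
proof -
 obtain V' :: "'k umodule" where V': "fin_gen_module H V'" "gvec V' = gvec V" using umodule_copy[OF V] .
 obtain W' :: "'k umodule" where W': "fin_gen_module H W'" "gvec W' = gvec W" using umodule_copy[OF W] .
 have "iso_class n d (tensor_module n d X Y) = iso_class n d (tensor_module n d V W)"
  if "X \<in> iso_class n d V" "Y \<in> iso_class n d W" for X Y :: "'k umodule"
 proof -
  have X: "fin_gen_module H X" "gvec X = gvec V" and Y: "fin_gen_module H Y" "gvec Y = gvec W"
   using that mem_iso_class[OF V] mem_iso_class[OF W] by auto
  show ?thesis
   using iso_class_eq_iff[OF gvec_tensor(1)[OF X(1) Y(1)] gvec_tensor(1)[OF V W]]
    gvec_tensor(2)[OF X(1) Y(1)] gvec_tensor(2)[OF V W] X(2) Y(2) by simp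
 qed
 moreover have "V' \<in> iso_class n d V" "W' \<in> iso_class n d W" using mem_iso_class V W V' W' by auto
 ultimately show ?thesis unfolding tensor_class_def by (intro UN_const2)
qed

lemma fin_gen_indec: "i \<le> d ==> j < n ==> fin_gen_module H (indec_module n d i j)"
 using realizes_fin_gen[OF realizes_indec_module[OF n_pos dn]] by blast

lemma gvec_indec: "(i, j) \<in> Bl ==> gvec (indec_module n d i j) = frag_of (i, j)"
 using gvec_realizes[OF realizes_indec_module[OF n_pos dn, of j i]] gvec_block[of "(i, j)"] by (simp add: Bl_iff)

abbreviation one_class :: "'k umodule set" where
 "one_class \<equiv> iso_class n d (indec_module n d 1 0 :: ('k trunc, 'k trunc set) module)"

lemma one_Bl: "(1, 0) \<in> Bl" using d_ge2 n_pos by (simp add: Bl_iff)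

lemma gmult_one:
 assumes "keys g \<subseteq> Bl" shows "frag_of (1, 0) \<star> g = g" "g \<star> frag_of (1, 0) = g"
proof -
 show 1: "frag_of (1, 0) \<star> g = g"
  using assms
 proof (induction g rule: frag_induction)
  case (one x)
  obtain u s where x: "x = (u, s)" by (cases x)
  show ?case using gmult_shift[OF n_pos, of u s] one by (simp add: x Bl_iff)
 qed (auto simp: gmult_diff_right)
 then show "g \<star> frag_of (1, 0) = g" using gmult_commute[OF assms, of "frag_of (1, 0)"] one_Bl by simp
qed

lemma gmult_assoc_gvec:
 assumes U: "fin_gen_module H U" and V: "fin_gen_module H V" and W: "fin_gen_module H W"
 shows "(gvec U \<star> gvec V) \<star> gvec W = gvec U \<star> (gvec V \<star> gvec W)"
proof -
 obtain L1 where L1: "realizes n d U (std n L1 :: 'k gdata2)" using realizes_std_ex[OF U] by blast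
 obtain L2 where L2: "realizes n d V (std n L2 :: 'k gdata2)" using realizes_std_ex[OF V] by blast
 obtain L3 where L3: "realizes n d W (std n L3 :: 'k gdata2)" using realizes_std_ex[OF W] by blast
 note L = L1 L2 L3
 note g = realizesD(2)[OF L(1)] realizesD(2)[OF L(2)] realizesD(2)[OF L(3)]
 show ?thesis
  using gvec_cong_data[OF gdata_iso_tdata_assoc gvalid_tensor[OF gvalid_tensor[OF g(1,2)] g(3)]]
  unfolding gvec_tdata[OF gvalid_tensor[OF g(1,2)] g(3)] gvec_tdata[OF g(1) gvalid_tensor[OF g(2,3)]]
   gvec_tdata[OF g(1,2)] gvec_tdata[OF g(2,3)]
  using gvec_realizes[OF L(1)] gvec_realizes[OF L(2)] gvec_realizes[OF L(3)] by simp
qed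

abbreviation FR :: "('k umodule set \<Rightarrow>\<^sub>0 int) ring" where "FR \<equiv> free_rep_ring n d"

text \<open>The isomorphism classes form a monoid under the tensor product, so the free abelian group on them
is a ring.\<close>

lemma rep_based_algebra:
 "based_algebra (iso_classes n d :: 'k umodule set set) (%A B. Some (tensor_class n d A B)) {one_class}"
proof
 show "{one_class} \<subseteq> iso_classes n d" using iso_class_in[OF fin_gen_indec] n_pos d_ge2 by simp
 fix A B C :: "'k umodule set"
 assume A: "A \<in> iso_classes n d"
 obtain U :: "'k umodule" where U: "fin_gen_module H U" "A = iso_class n d U" using A by (rule iso_classes_cases)
 note one = fin_gen_indec[of 1 0] gvec_indec[OF one_Bl]
 have o: "fin_gen_module H (indec_module n d 1 0)" using one(1) n_pos d_ge2 by simp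
 have "tensor_class n d one_class A = A" "tensor_class n d A one_class = A"
  unfolding U(2) tensor_class_iso_class[OF o U(1)] tensor_class_iso_class[OF U(1) o]
  using iso_class_eq_iff[OF gvec_tensor(1)[OF o U(1)] U(1)] iso_class_eq_iff[OF gvec_tensor(1)[OF U(1) o] U(1)]
   gvec_tensor(2)[OF o U(1)] gvec_tensor(2)[OF U(1) o] gmult_one[OF keys_gvec[OF U(1)]] one(2) by simp_all
 then show "\<exists>e\<in>{one_class}. Some (tensor_class n d e A) = Some A \<and> (\<forall>e'\<in>{one_class}. e' \<noteq> e --> Some (tensor_class n d e' A) = None)"
  "\<exists>e\<in>{one_class}. Some (tensor_class n d A e) = Some A \<and> (\<forall>e'\<in>{one_class}. e' \<noteq> e --> Some (tensor_class n d A e') = None)"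
  by auto
 assume B: "B \<in> iso_classes n d"
 obtain V :: "'k umodule" where V: "fin_gen_module H V" "B = iso_class n d V" using B by (rule iso_classes_cases)
 show "Some (tensor_class n d A B) = Some C ==> C \<in> iso_classes n d"
  unfolding U(2) V(2) tensor_class_iso_class[OF U(1) V(1)] using iso_class_in[OF gvec_tensor(1)[OF U(1) V(1)]] by simp
 assume C: "C \<in> iso_classes n d"
 obtain W :: "'k umodule" where W: "fin_gen_module H W" "C = iso_class n d W" using C by (rule iso_classes_cases)
 note t = gvec_tensor[OF U(1) V(1)] gvec_tensor[OF V(1) W(1)]
 show "Option.bind (Some (tensor_class n d A B)) (%u. Some (tensor_class n d u C))
   = Option.bind (Some (tensor_class n d B C)) (%u. Some (tensor_class n d A u))"
  unfolding U(2) V(2) W(2) bind.bind_lunit tensor_class_iso_class[OF U(1) V(1)] tensor_class_iso_class[OF V(1) W(1)]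
   tensor_class_iso_class[OF t(1) W(1)] tensor_class_iso_class[OF U(1) t(3)]
   option.inject iso_class_eq_iff[OF gvec_tensor(1)[OF t(1) W(1)] gvec_tensor(1)[OF U(1) t(3)]]
  using gvec_tensor(2)[OF t(1) W(1)] gvec_tensor(2)[OF U(1) t(3)] t(2,4) gmult_assoc_gvec[OF U(1) V(1) W(1)] by simp
qed auto

lemma FR_alg: "FR = based_algebra.alg (iso_classes n d) (%A B. Some (tensor_class n d A B)) {one_class}"
 unfolding free_rep_ring_def based_algebra.alg_def[OF rep_based_algebra] by simp

lemma ring_FR: "ring FR"
 unfolding FR_alg by (rule based_algebra.ring_alg[OF rep_based_algebra])

lemma FR_sel:
 "carrier FR = {c. keys c \<subseteq> iso_classes n d}" "mult FR = basis_mult (%A B. Some (tensor_class n d A B))"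
 "one FR = frag_of one_class" "zero FR = 0" "add FR = (+)"
 by (simp_all add: free_rep_ring_def)

abbreviation rep_gens :: "('k umodule set \<Rightarrow>\<^sub>0 int) set" where
 "rep_gens \<equiv> {frag_of (iso_class n d V) + frag_of (iso_class n d W) - frag_of (iso_class n d (direct_sum2 V W))
    |(V :: 'k umodule) (W :: 'k umodule). fin_gen_module H V \<and> fin_gen_module H W}"

lemma rep_pm_quotient: "pm_quotient FR (iso_classes n d) rep_gens"
proof
 show "rep_gens \<subseteq> {f. keys f \<subseteq> iso_classes n d}"
 proof
  fix r assume "r \<in> rep_gens"
  then obtain V W :: "'k umodule" where VW: "fin_gen_module H V" "fin_gen_module H W"
   "r = frag_of (iso_class n d V) + frag_of (iso_class n d W) - frag_of (iso_class n d (direct_sum2 V W))"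
   by blast
  have "keys r \<subseteq> iso_classes n d"
   unfolding VW(3)
   using iso_class_in[OF VW(1)] iso_class_in[OF VW(2)] iso_class_in[OF gvec_direct_sum2(1)[OF VW(1,2)]]
   by (intro order_trans[OF keys_diff] Un_least path_algebra_add_closed) auto
  then show "r \<in> {f. keys f \<subseteq> iso_classes n d}" by simp
 qed
qed (simp_all add: FR_sel)

interpretation Q: pm_quotient FR "iso_classes n d" rep_gens
 by (rule rep_pm_quotient)

lemma rep_relations_eq: "rep_relations n d = Q.N"
 unfolding rep_relations_def Q.N_def ..

definition cvec :: "'k umodule set => bvec" where "cvec A = gvec (SOME U. U \<in> A)"

lemma cvec_iso_class: "fin_gen_module H V ==> cvec (iso_class n d V) = gvec V"
proof -
 assume V: "fin_gen_module H V"
 obtain U :: "'k umodule" where "fin_gen_module H U" "gvec U = gvec V" using umodule_copy[OF V] .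
 then have "U \<in> iso_class n d V" using mem_iso_class[OF V] by simp
 then have "(SOME U. U \<in> iso_class n d V) \<in> iso_class n d V" by (rule someI[of "%U. U \<in> iso_class n d V"])
 then show ?thesis unfolding cvec_def using mem_iso_class[OF V] by simp
qed

definition \<Psi> :: "('k umodule set \<Rightarrow>\<^sub>0 int) => bvec" where "\<Psi> c = frag_extend cvec c"

lemma \<Psi>_simps: "\<Psi> 0 = 0" "\<Psi> (a + b) = \<Psi> a + \<Psi> b" "\<Psi> (a - b) = \<Psi> a - \<Psi> b" "\<Psi> (frag_of A) = cvec A"
 by (simp_all add: \<Psi>_def frag_extend_add frag_extend_diff)

lemma keys_\<Psi>: "keys c \<subseteq> iso_classes n d ==> keys (\<Psi> c) \<subseteq> Bl"
 unfolding \<Psi>_def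
proof (intro order_trans[OF keys_frag_extend] UN_least)
 fix A assume "keys c \<subseteq> iso_classes n d" "A \<in> keys c"
 then have "A \<in> iso_classes n d" by blast
 then obtain V :: "'k umodule" where V: "fin_gen_module H V" "A = iso_class n d V" by (rule iso_classes_cases)
 show "keys (cvec A) \<subseteq> Bl" using keys_gvec[OF V(1)] cvec_iso_class[OF V(1)] V(2) by simp
qed

lemma \<Psi>_N: "c \<in> Q.N ==> \<Psi> c = 0"
proof (rule Q.N_vanish[of \<Psi>])
 fix r assume "r \<in> rep_gens"
 then obtain V W :: "'k umodule" where VW: "fin_gen_module H V" "fin_gen_module H W"
  "r = frag_of (iso_class n d V) + frag_of (iso_class n d W) - frag_of (iso_class n d (direct_sum2 V W))"
  by blast
 then show "\<Psi> r = 0"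
  using gvec_direct_sum2[OF VW(1,2)] by (simp add: \<Psi>_simps cvec_iso_class)
qed (auto simp: \<Psi>_simps)

text \<open>A section of \<open>\<Psi>\<close>, up to the relations. Since every class is congruent to the sum of the classes of its
indecomposable summands, the relations are exactly the kernel of \<open>\<Psi>\<close>.\<close>

definition lift :: "bvec => ('k umodule set \<Rightarrow>\<^sub>0 int)" where
 "lift g = frag_extend (%x. frag_of (iso_class n d (gmod (block n x :: (nat, 'k) gdata)))) g"

lemma lift_simps: "lift 0 = 0" "lift (a + b) = lift a + lift b" "lift (a - b) = lift a - lift b"
 "lift (frag_of x) = frag_of (iso_class n d (gmod (block n x :: (nat, 'k) gdata)))"
 by (simp_all add: lift_def frag_extend_add frag_extend_diff)

lemma fin_gen_block: "x \<in> Bl ==> fin_gen_module H (gmod (block n x :: (nat, 'k) gdata))"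
 by (rule realizes_fin_gen[OF realizes_gmod[OF gvalid_block_Bl]])

lemma rel_in_N:
 "fin_gen_module H (V :: 'k umodule) ==> fin_gen_module H (W :: 'k umodule) ==>
  frag_of (iso_class n d V) + frag_of (iso_class n d W) - frag_of (iso_class n d (direct_sum2 V W)) \<in> Q.N"
 by (rule Q.N_gen) blast

lemma class_lift:
 "set L \<subseteq> Bl ==> fin_gen_module H (V :: 'k umodule) ==> gvec V = vec L ==> frag_of (iso_class n d V) - lift (vec L) \<in> Q.N"
proof (induction L arbitrary: V)
 case Nil
 have "iso_class n d (direct_sum2 V V) = iso_class n d V"
  using iso_class_eq_iff[OF gvec_direct_sum2(1)[OF Nil(2,2)] Nil(2)] gvec_direct_sum2(2)[OF Nil(2,2)] Nil(3) by simp
 then show ?case using rel_in_N[OF Nil(2,2)] by (simp add: lift_simps)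
next
 case (Cons x L)
 then have x: "x \<in> Bl" and L: "set L \<subseteq> Bl" by auto
 obtain U :: "'k umodule" where U: "fin_gen_module H U" "gvec U = vec L" using umodule_ex[OF L] by blast
 let ?B = "gmod (block n x :: (nat, 'k) gdata)"
 have "iso_class n d (direct_sum2 ?B U) = iso_class n d V"
  using iso_class_eq_iff[OF gvec_direct_sum2(1)[OF fin_gen_block[OF x] U(1)] Cons.prems(2)]
   gvec_direct_sum2(2)[OF fin_gen_block[OF x] U(1)] Cons.prems(3) gvec_block[OF x] U(2) by simp
 then have eq: "frag_of (iso_class n d V) - lift (vec (x # L)) = (frag_of (iso_class n d U) - lift (vec L))
   - (frag_of (iso_class n d ?B) + frag_of (iso_class n d U) - frag_of (iso_class n d (direct_sum2 ?B U)))"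
  by (simp add: lift_simps)
 show ?case unfolding eq by (intro Q.N_diff Cons.IH L U rel_in_N fin_gen_block x)
qed

lemma minus_lift: "keys c \<subseteq> iso_classes n d ==> c - lift (\<Psi> c) \<in> Q.N"
proof (induction c rule: frag_induction)
 case zero then show ?case by (simp add: \<Psi>_simps lift_simps Q.N_zero)
next
 case (one A)
 then obtain V :: "'k umodule" where V: "fin_gen_module H V" "A = iso_class n d V" by (rule iso_classes_cases)
 obtain L where L: "decomposes V L" using decomposes_ex[OF V(1)] by blast
 then show ?case using class_lift[of L V] V gvec_eq[OF L] by (simp add: \<Psi>_simps cvec_iso_class decomposes_def)
next
 case (diff a b)
 have eq: "a - b - lift (\<Psi> (a - b)) = (a - lift (\<Psi> a)) - (b - lift (\<Psi> b))" by (simp add: \<Psi>_simps lift_simps)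
 show ?case unfolding eq by (rule Q.N_diff[OF diff])
qed

lemma N_iff: "keys c \<subseteq> iso_classes n d ==> c \<in> Q.N \<longleftrightarrow> \<Psi> c = 0"
 using minus_lift[of c] \<Psi>_N[of c] by (auto simp: lift_simps)

lemma \<Psi>_mult:
 assumes a: "keys a \<subseteq> iso_classes n d" and b: "keys b \<subseteq> iso_classes n d"
 shows "\<Psi> (basis_mult (%A B. Some (tensor_class n d A B)) a b) = \<Psi> a \<star> \<Psi> b"
 using a
proof (induction a rule: frag_induction)
 case (one A)
 note A = this
 show ?case using b
 proof (induction b rule: frag_induction)
  case (one B)
  obtain V :: "'k umodule" where V: "fin_gen_module H V" "A = iso_class n d V" using A by (rule iso_classes_cases)
  obtain W :: "'k umodule" where W: "fin_gen_module H W" "B = iso_class n d W" using one by (rule iso_classes_cases)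
  show ?case
   using gvec_tensor[OF V(1) W(1)]
   by (simp add: basis_mult_single V W tensor_class_iso_class \<Psi>_simps cvec_iso_class)
 qed (auto simp: \<Psi>_simps basis_mult_diff_right gmult_diff_right)
qed (auto simp: \<Psi>_simps basis_mult_diff_left gmult_diff_left)

lemma ideal_N: "ideal Q.N FR"
proof (rule idealI[OF ring_FR Q.subgroup_N])
 fix a x assume a: "a \<in> Q.N" and x: "x \<in> carrier FR"
 interpret ring FR by (rule ring_FR)
 have k: "keys a \<subseteq> iso_classes n d" "keys x \<subseteq> iso_classes n d" using Q.N_carrier[OF a] x by (auto simp: FR_sel)
 have "a \<in> carrier FR" using k by (simp add: FR_sel)
 then have "x \<otimes>\<^bsub>FR\<^esub> a \<in> carrier FR" "a \<otimes>\<^bsub>FR\<^esub> x \<in> carrier FR" using x by simp_all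
 then have c: "keys (x \<otimes>\<^bsub>FR\<^esub> a) \<subseteq> iso_classes n d" "keys (a \<otimes>\<^bsub>FR\<^esub> x) \<subseteq> iso_classes n d"
  by (simp_all add: FR_sel(1))
 show "x \<otimes>\<^bsub>FR\<^esub> a \<in> Q.N" "a \<otimes>\<^bsub>FR\<^esub> x \<in> Q.N"
  using N_iff[OF c(1)] N_iff[OF c(2)] \<Psi>_mult[OF k] \<Psi>_mult[OF k(2,1)] \<Psi>_N[OF a] by (simp_all add: FR_sel(2))
qed

abbreviation RR :: "('k umodule set \<Rightarrow>\<^sub>0 int) set ring" where "RR \<equiv> rep_ring n d"

lemma RR_eq: "RR = FR Quot Q.N"
 by (simp add: rep_ring_def rep_relations_eq)

lemma ring_RR: "ring RR"
 unfolding RR_eq by (rule ideal.quotient_is_ring[OF ideal_N])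

text \<open>The coordinates of an element of the representation ring in the basis of indecomposable modules. On
cosets modulo the relations \<open>\<Psi>\<close> is constant, so any representative may be used.\<close>

definition \<Gamma> :: "('k umodule set \<Rightarrow>\<^sub>0 int) set => bvec" where "\<Gamma> X = \<Psi> (SOME c. c \<in> X)"

lemma \<Gamma>_coset: "\<Gamma> (Q.N +>\<^bsub>FR\<^esub> c) = \<Psi> c"
proof -
 have "(SOME s. s \<in> Q.N +>\<^bsub>FR\<^esub> c) \<in> Q.N +>\<^bsub>FR\<^esub> c"
  using Q.coset_self[of c] by (rule someI[of "%s. s \<in> Q.N +>\<^bsub>FR\<^esub> c"])
 then have "\<Psi> ((SOME s. s \<in> Q.N +>\<^bsub>FR\<^esub> c) - c) = 0" by (intro \<Psi>_N) (simp add: Q.coset_eq)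
 then show ?thesis by (simp add: \<Gamma>_def \<Psi>_simps)
qed

lemma carrier_RR: "carrier RR = {Q.N +>\<^bsub>FR\<^esub> c |c. keys c \<subseteq> iso_classes n d}"
 unfolding RR_eq FactRing_def by (simp add: Q.rcosets_eq)

lemma RR_cases:
 assumes "X \<in> carrier RR"
 obtains c where "keys c \<subseteq> iso_classes n d" "X = Q.N +>\<^bsub>FR\<^esub> c"
 using assms unfolding carrier_RR by blast

lemma RR_ops:
 assumes "keys c \<subseteq> iso_classes n d" "keys c' \<subseteq> iso_classes n d"
 shows "(Q.N +>\<^bsub>FR\<^esub> c) \<oplus>\<^bsub>RR\<^esub> (Q.N +>\<^bsub>FR\<^esub> c') = Q.N +>\<^bsub>FR\<^esub> (c + c')"
  "(Q.N +>\<^bsub>FR\<^esub> c) \<otimes>\<^bsub>RR\<^esub> (Q.N +>\<^bsub>FR\<^esub> c') = Q.N +>\<^bsub>FR\<^esub> (basis_mult (%A B. Some (tensor_class n d A B)) c c')"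
 using ring_hom_add[OF ideal.rcos_ring_hom[OF ideal_N], of c c'] ring_hom_mult[OF ideal.rcos_ring_hom[OF ideal_N], of c c'] assms
 by (simp_all add: RR_eq FR_sel)

lemma \<Gamma>_add: "X \<in> carrier RR ==> Y \<in> carrier RR ==> \<Gamma> (X \<oplus>\<^bsub>RR\<^esub> Y) = \<Gamma> X + \<Gamma> Y"
 by (auto elim!: RR_cases simp: RR_ops \<Gamma>_coset \<Psi>_simps)

lemma \<Gamma>_mult: "X \<in> carrier RR ==> Y \<in> carrier RR ==> \<Gamma> (X \<otimes>\<^bsub>RR\<^esub> Y) = \<Gamma> X \<star> \<Gamma> Y"
 by (auto elim!: RR_cases simp: RR_ops \<Gamma>_coset \<Psi>_mult)

lemma \<Gamma>_one: "\<Gamma> \<one>\<^bsub>RR\<^esub> = frag_of (1, 0)"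
proof -
 have "\<one>\<^bsub>RR\<^esub> = Q.N +>\<^bsub>FR\<^esub> frag_of one_class"
  using ring_hom_one[OF ideal.rcos_ring_hom[OF ideal_N]] by (simp add: RR_eq FR_sel)
 then show ?thesis
  using cvec_iso_class[OF fin_gen_indec[of 1 0]] gvec_indec[OF one_Bl] n_pos d_ge2
  by (simp add: \<Gamma>_coset \<Psi>_simps)
qed

lemma \<Gamma>_inj: "X \<in> carrier RR ==> Y \<in> carrier RR ==> \<Gamma> X = \<Gamma> Y ==> X = Y"
proof -
 assume X: "X \<in> carrier RR" and Y: "Y \<in> carrier RR" and eq: "\<Gamma> X = \<Gamma> Y"
 obtain c where c: "keys c \<subseteq> iso_classes n d" "X = Q.N +>\<^bsub>FR\<^esub> c" using X by (rule RR_cases)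
 obtain c' where c': "keys c' \<subseteq> iso_classes n d" "Y = Q.N +>\<^bsub>FR\<^esub> c'" using Y by (rule RR_cases)
 have "keys (c - c') \<subseteq> iso_classes n d" using keys_diff[of c c'] c(1) c'(1) by blast
 then have "c - c' \<in> Q.N" using eq by (simp add: c c' \<Gamma>_coset N_iff \<Psi>_simps)
 then show "X = Y" unfolding c c' by (rule Q.coset_cong)
qed

lemma keys_\<Gamma>: "X \<in> carrier RR ==> keys (\<Gamma> X) \<subseteq> Bl"
 by (elim RR_cases) (simp add: \<Gamma>_coset keys_\<Psi>)

lemma cring_RR: "cring RR"
proof -
 interpret ring RR by (rule ring_RR)
 show ?thesis
 proof
  fix X Y assume X: "X \<in> carrier RR" and Y: "Y \<in> carrier RR"
  show "X \<otimes>\<^bsub>RR\<^esub> Y = Y \<otimes>\<^bsub>RR\<^esub> X"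
   using X Y gmult_commute[OF keys_\<Gamma>[OF X] keys_\<Gamma>[OF Y]] by (intro \<Gamma>_inj) (auto simp: \<Gamma>_mult)
 qed
qed

lemma rep_class:
 assumes V: "fin_gen_module H V"
 shows "rep_class n d V \<in> carrier RR" "\<Gamma> (rep_class n d V) = gvec V"
proof -
 have "rep_class n d V = Q.N +>\<^bsub>FR\<^esub> frag_of (iso_class n d V)"
  by (simp add: rep_class_def rep_relations_eq)
 moreover have "keys (frag_of (iso_class n d V)) \<subseteq> iso_classes n d" using iso_class_in[OF V] by simp
 ultimately show "rep_class n d V \<in> carrier RR" "\<Gamma> (rep_class n d V) = gvec V"
  unfolding carrier_RR by (auto simp: \<Gamma>_coset \<Psi>_simps cvec_iso_class[OF V])
qed

end

section \<open>Tensor products of indecomposable modules\<close>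

context green_ring
begin

text \<open>The product has one basis vector in degree \<open>0\<close> and one in the top degree \<open>u - 1\<close>. Applying \<open>X\<^bsup>u-1\<^esup>\<close> to
the former gives the latter times a binomial coefficient; if that is not zero, some block must reach
from degree \<open>0\<close> to degree \<open>u - 1\<close>. No block leaves the degrees \<open>0, \<dots>, u - 1\<close>, and the two extreme degrees are
used up by the long block, which confines the others to the degrees \<open>1, \<dots>, u - 2\<close>.\<close>

lemma tensor_top_summand:
 assumes i: "1 \<le> i" and j: "1 \<le> j" and u: "u = i + j - 1" "u \<le> d"
  and binom: "(of_nat ((u - 1) choose (i - 1)) :: 'k) \<noteq> 0"
 shows "\<exists>L. (\<forall>x\<in>set L. 1 \<le> fst x \<and> 1 \<le> snd x \<and> fst x \<le> u - 2 \<and> snd x \<le> u - 2) \<and>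
   tprod (i, 0) (j, 0) = frag_of (u, 0) + vec L"
proof -
 let ?A = "block n (i, 0) :: (nat, 'k) gdata" and ?B = "block n (j, 0) :: (nat, 'k) gdata"
 let ?C = "tdata n ?A ?B"
 have Bl: "(i, 0) \<in> Bl" "(j, 0) \<in> Bl" using i j u n_pos by (auto simp: Bl_iff)
 have C: "gvalid n d ?C" by (intro gvalid_tensor gvalid_block_Bl Bl)
 have un: "u \<le> n" using u dn by simp
 have degC: "deg ?C (s, s') = s + s'" if "s < i" "s' < j" for s s'
  using that u un by simp
 obtain L where L: "decomposes (gmod ?C) L"
  using decomposes_ex[OF realizes_fin_gen[OF realizes_gmod[OF C]]] by blast
 let ?S = "std n L :: 'k gdata2"
 have LBl: "set L \<subseteq> Bl" and R: "realizes n d (gmod ?C) ?S" using L by (auto simp: decomposes_def)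
 have S: "gvalid n d ?S" by (rule gvalid_std_Bl[OF LBl])
 have iso: "module_isomorphic H (gmod ?S) (gmod ?C)"
  by (rule module_isomorphic_sym[OF left_module_gmod[OF C] realizesD(3)[OF R]])
 obtain f where f: "bij_betw f (gspace ?S) (gspace ?C)" "mod_hom H (gmod ?S) (gmod ?C) f"
  using iso by (auto simp: module_isomorphic_alt)
 have LBl': "1 \<le> fst (L ! t)" "snd (L ! t) < n" if "t < length L" for t
  using LBl nth_mem[OF that] by (auto simp: blocks_def)
 have count: "card {b \<in> idx ?S. deg ?S b = r} \<le> card {c \<in> idx ?C. deg ?C c = r}" if "r < n" for r
  by (rule homogeneous_dim_le[OF S C that iso])
 have dim: "b = b'" if "b \<in> idx ?S" "b' \<in> idx ?S" "deg ?S b = r" "deg ?S b' = r" "r < n"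
   "{c \<in> idx ?C. deg ?C c = r} \<subseteq> {c0}" for b b' r c0
 proof -
  have "card {b \<in> idx ?S. deg ?S b = r} \<le> 1"
   using count[OF that(5)] card_mono[OF _ that(6)] by simp
  moreover have "finite {b \<in> idx ?S. deg ?S b = r}" using gvalid_finite[OF S] by (rule rev_finite_subset) blast
  moreover have "b \<in> {b \<in> idx ?S. deg ?S b = r}" "b' \<in> {b \<in> idx ?S. deg ?S b = r}" using that(1-4) by blast+
  ultimately show ?thesis using card_le_Suc0_iff_eq[of "{b \<in> idx ?S. deg ?S b = r}"] by (simp only: One_nat_def)
 qed
 \<comment> \<open>Walking along a block raises the degree by one; it cannot pass the top degree, where the operator vanishes on the product, and so it never wraps around modulo \<open>n\<close>.\<close>
 have fin: "j' + s \<le> u - 1" if "t < length L" "j' = snd (L ! t)" "s < fst (L ! t)" for t s j'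
  using that(3)
 proof (induction s)
  case 0
  have jn: "j' < n" using that(2) LBl'(2)[OF that(1)] by simp
  have "(t, 0) \<in> idx ?S" using that(1) 0 by simp
  moreover have "deg ?S (t, 0) = j'" using that(2) jn by simp
  ultimately have "(t, 0) \<in> {b \<in> idx ?S. deg ?S b = j'}" by blast
  moreover have "finite {b \<in> idx ?S. deg ?S b = j'}" using gvalid_finite[OF S] by (rule rev_finite_subset) blast
  ultimately have "card {b \<in> idx ?S. deg ?S b = j'} \<noteq> 0" by (metis card_0_eq empty_iff)
  then have "card {c \<in> idx ?C. deg ?C c = j'} \<noteq> 0" using count[OF jn] by linarith
  then have "{c \<in> idx ?C. deg ?C c = j'} \<noteq> {}" by (metis card.empty)
  then obtain c where c: "c \<in> idx ?C" "deg ?C c = j'" by blast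
  obtain s s' where ss: "c = (s, s')" by (cases c)
  then have "s < i" "s' < j" using c(1) by simp_all
  then show ?case using degC[of s s'] c(2) u unfolding ss by linarith
 next
  case (Suc s)
  have ts: "(t, s) \<in> idx ?S" using that Suc.prems by simp
  have "j' + s \<noteq> u - 1"
  proof
   assume top: "j' + s = u - 1"
   have un1: "u - 1 < n" using un i j u by simp
   define y where "y = f (gunit (t, s))"
   have "gproj ?S (u - 1) (gunit (t, s)) = gunit (t, s)"
    using gproj_gunit[OF ts] top that un1 by simp
   then have "y = gproj ?C (u - 1) y"
    using gmod_hom_proj[OF S C f(2) un1 gunit_gspace[OF ts]] by (simp add: y_def)
   then have y: "y c = 0" if "\<not> (c \<in> idx ?C \<and> deg ?C c = u - 1)" for c using that by (metis (mono_tags, lifting) gproj_def)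
   have "gX ?C y = (%_. 0)"
   proof
    fix c :: "nat \<times> nat"
    have "mat ?C c c' * y c' = 0" if c: "c \<in> idx ?C" and c': "c' \<in> idx ?C" for c'
    proof (cases "y c' = 0")
     case False
     then have "deg ?C c' = u - 1" using y by blast
     then have "c' = (i - 1, j - 1)" using c' degC[of "fst c'" "snd c'"] u by (cases c') auto
     then show ?thesis using c by (cases c) auto
    qed simp
    then have "(\<Sum>c'\<in>idx ?C. mat ?C c c' * y c') = 0" if "c \<in> idx ?C"
     using that by (intro sum.neutral ballI)
    then show "gX ?C y c = 0" by (cases "c \<in> idx ?C") (simp_all only: gX_def if_True if_False)
   qed
   moreover have "f ((gX ?S ^^ 1) (gunit (t, s))) = (gX ?C ^^ 1) y"
    using gmod_hom_X[OF S C f(2) gunit_gspace[OF ts], of 1] by (simp add: y_def)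
   moreover have "(gX ?S ^^ 1) (gunit (t, s)) = gunit (t, Suc s)"
    using gX_gunit_std[OF ts, of 1] Suc.prems by simp
   ultimately have "f (gunit (t, Suc s)) = f (%_. 0)" using gmod_hom_zero[OF S C f(2)] by simp
   moreover have "(t, Suc s) \<in> idx ?S" using that Suc.prems by simp
   ultimately have "gunit (t, Suc s) = (%_. 0 :: 'k)"
    using f(1) gunit_gspace[of "(t, Suc s)" ?S] by (auto simp: bij_betw_def inj_on_def)
   then show False by (auto simp: gunit_def fun_eq_iff)
  qed
  then show ?case using Suc by simp
 qed
 have bound: "snd (L ! t) + fst (L ! t) \<le> u" if "t < length L" for t
  using fin[OF that refl, of "fst (L ! t) - 1"] LBl'[OF that] i j u by simp
 \<comment> \<open>Only a block of length at least \<open>u\<close> carries a vector on which \<open>u - 1\<close> steps do not vanish.\<close>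
 have "\<exists>t<length L. L ! t = (u, 0)"
 proof -
  have c0: "(0, 0) \<in> idx ?C" using i j by simp
  obtain v where v: "v \<in> gspace ?S" "gunit (0, 0) = f v"
  proof -
   have "gunit (0, 0) \<in> f ` gspace ?S" using f(1) gunit_gspace[OF c0] by (simp add: bij_betw_def)
   then show ?thesis using that by blast
  qed
  have top: "(i - 1, j - 1) \<in> idx ?C" using i j by simp
  have "(gX ?C ^^ (u - 1)) (gunit (0, 0)) (i - 1, j - 1) = (\<Sum>b'\<in>idx ?C. pow_mat ?C (u - 1) (i - 1, j - 1) b' * gunit (0, 0) b')"
   by (rule gX_funpow[OF gvalid_finite[OF C] gunit_gspace[OF c0] top])
  also have "... = (\<Sum>b'\<in>idx ?C. if b' = (0, 0) then pow_mat ?C (u - 1) (i - 1, j - 1) (0, 0) else 0)"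
   by (intro sum.cong) (auto simp: gunit_def)
  also have "... = pow_mat ?C (u - 1) (i - 1, j - 1) (0, 0)"
   using gvalid_finite[OF C] c0 by (simp only: sum.delta if_True)
  also have "... = (\<Sum>k\<le>u - 1. of_nat ((u - 1) choose k) * (pow_mat ?A k (i - 1) 0 * pow_mat ?B (u - 1 - k) (j - 1) 0))"
   by (rule pow_mat_tdata) (use i j in auto)
  also have "... = (\<Sum>k\<le>u - 1. if k = i - 1 then of_nat ((u - 1) choose (i - 1)) else 0)"
   by (intro sum.cong refl) (use i j u in \<open>auto simp: pow_mat_block\<close>)
  also have "... = of_nat ((u - 1) choose (i - 1))" using i j u by simp
  finally have "(gX ?C ^^ (u - 1)) (f v) (i - 1, j - 1) \<noteq> 0" using binom unfolding v(2) by simp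
  then have "(gX ?C ^^ (u - 1)) (f v) \<noteq> (%_. 0)" by metis
  then have "(gX ?S ^^ (u - 1)) v \<noteq> (%_. 0)"
   using gmod_hom_X[OF S C f(2) v(1), of "u - 1"] gmod_hom_zero[OF S C f(2)] by auto
  then obtain b where "(gX ?S ^^ (u - 1)) v b \<noteq> 0" by blast
  then obtain t s where "(gX ?S ^^ (u - 1)) v (t, s) \<noteq> 0" by (cases b) blast
  then have ts: "t < length L" "s < fst (L ! t)" "u - 1 \<le> s"
   using gX_funpow_std[OF v(1), of "u - 1" t s] by (auto split: if_splits)
  then have "fst (L ! t) = u" "snd (L ! t) = 0" using bound[OF ts(1)] by auto
  then show ?thesis using ts(1) by (intro exI[of _ t]) (simp add: prod_eq_iff)
 qed
 then obtain t0 where t0: "t0 < length L" "L ! t0 = (u, 0)" by blast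
 have u1: "1 \<le> u" using i j u by simp
 have others: "1 \<le> fst x \<and> 1 \<le> snd x \<and> fst x \<le> u - 2 \<and> snd x \<le> u - 2"
  if t: "t < length L" "t \<noteq> t0" "x = L ! t" for t x
 proof -
  have "snd x \<noteq> 0"
  proof
   assume z: "snd x = 0"
   have "(t, 0) = (t0, 0::nat)"
   proof (rule dim[of _ _ 0 "(0, 0)"])
    show "{c \<in> idx ?C. deg ?C c = 0} \<subseteq> {(0, 0)}" using degC by auto
   qed (use t z t0 LBl'[of t] u1 n_pos in auto)
   then show False using t by simp
  qed
  moreover have "snd x + fst x \<noteq> u"
  proof
   assume e: "snd x + fst x = u"
   have "(t, fst x - 1) = (t0, u - 1)"
   proof (rule dim[of _ _ "u - 1" "(i - 1, j - 1)"])
    have "c = (i - 1, j - 1)" if "c \<in> idx ?C" "deg ?C c = u - 1" for c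
     using that degC[of "fst c" "snd c"] u by (cases c) auto
    then show "{c \<in> idx ?C. deg ?C c = u - 1} \<subseteq> {(i - 1, j - 1)}" by blast
    show "deg ?S (t, fst x - 1) = u - 1" using t e LBl'[OF t(1)] un u1 by simp
   qed (use t t0 LBl'[of t] u1 un in auto)
   then show False using t by simp
  qed
  ultimately show ?thesis using bound[OF t(1)] LBl'[OF t(1)] t(3) by auto
 qed
 let ?L = "take t0 L @ drop (Suc t0) L"
 have "vec L = frag_of (u, 0) + vec ?L"
  using id_take_nth_drop[OF t0(1)] t0(2) by (metis (no_types, lifting) add.left_commute vec_simps(2,3))
 moreover have "tprod (i, 0) (j, 0) = vec L" unfolding tprod_def by (rule gvec_eq[OF L])
 moreover have "\<forall>x\<in>set ?L. 1 \<le> fst x \<and> 1 \<le> snd x \<and> fst x \<le> u - 2 \<and> snd x \<le> u - 2"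
 proof
  fix x assume "x \<in> set ?L"
  then consider "x \<in> set (take t0 L)" | "x \<in> set (drop (Suc t0) L)" by auto
  then show "1 \<le> fst x \<and> 1 \<le> snd x \<and> fst x \<le> u - 2 \<and> snd x \<le> u - 2"
  proof cases
   case 1
   then obtain t where "t < t0" "t < length L" "x = L ! t" by (auto simp: in_set_conv_nth)
   then show ?thesis using others[of t x] by simp
  next
   case 2
   then obtain t where "Suc t0 + t < length L" "x = L ! (Suc t0 + t)"
    using nth_drop[of "Suc t0" L] by (metis (no_types, lifting) in_set_conv_nth length_drop less_diff_conv add.commute less_imp_le_nat t0(1) Suc_leI)
   then show ?thesis using others[of "Suc t0 + t" x] by simp
  qed
 qed
 ultimately show ?thesis by metis
qed

end

subsection \<open>Homomorphisms given by generators\<close>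

lemma gproj_gX:
 assumes C: "gvalid n d C" and g: "g \<in> gspace C" "gproj C r g = g"
 shows "gproj C i ((gX C ^^ s) g) = (if i = (r + s) mod n then (gX C ^^ s) g else (%_. 0))"
proof -
 have "deg C b = (r + s) mod n" if "b \<in> idx C" "(gX C ^^ s) g b \<noteq> 0" for b
 proof -
  have "(\<Sum>b'\<in>idx C. pow_mat C s b b' * g b') \<noteq> 0"
   using that gX_funpow[OF gvalid_finite[OF C] g(1) that(1), of s] by simp
  then obtain b' where b': "b' \<in> idx C" "pow_mat C s b b' \<noteq> 0" "g b' \<noteq> 0"
   by (auto elim!: sum.not_neutral_contains_not_neutral)
  have "deg C b' = r" using g(2) b'(3) by (metis (mono_tags, lifting) gproj_def)
  then show ?thesis using pow_mat_deg[OF C that(1) b'(1,2)] by simp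
 qed
 then show ?thesis
  using gspaceD[OF gX_funpow_gspace[OF g(1)]] by (auto simp: gproj_def fun_eq_iff)
qed

text \<open>The linear map from a standard module that sends the generator of block \<open>t\<close> to \<open>g t\<close>. It is a
homomorphism if \<open>g t\<close> has the right degree and is annihilated by the right power of the operator.\<close>

definition std_map :: "nat => (nat \<times> nat) list => ('i, 'k::field) gdata => (nat => 'i => 'k) => (nat \<times> nat => 'k) => 'i => 'k" where
 "std_map n L C g v = (%x. \<Sum>b\<in>idx (std n L :: 'k gdata2). v b * (gX C ^^ snd b) (g (fst b)) x)"

lemma std_map_add: "std_map n L C g (%b. v b + w b) = (%x. std_map n L C g v x + std_map n L C g w x)"
 by (simp add: std_map_def algebra_simps sum.distrib)

lemma std_map_scale: "std_map n L C g (%b. c * v b) = (%x. c * std_map n L C g v x)"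
 by (simp add: std_map_def sum_distrib_left algebra_simps)

lemma finite_idx_std: "finite (idx (std n L :: 'k::field gdata2))"
 by simp

lemma std_map_gunit:
 assumes "(t, s) \<in> idx (std n L :: 'k::field gdata2)"
 shows "std_map n L C g (gunit (t, s)) = (gX C ^^ s) (g t :: 'i => 'k)"
proof
 fix x
 have "std_map n L C g (gunit (t, s)) x = (\<Sum>b\<in>idx (std n L :: 'k gdata2).
   if b = (t, s) then (gX C ^^ s) (g t) x else 0)"
  unfolding std_map_def by (intro sum.cong) (auto simp: gunit_def)
 then show "std_map n L C g (gunit (t, s)) x = (gX C ^^ s) (g t) x"
  using assms finite_idx_std[of n L, where ?'k = 'k] by (simp only: sum.delta if_True)
qed

lemma std_map_hom:
 fixes C :: "('i, 'k::field) gdata"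
 assumes n: "0 < n" and L: "\<forall>x\<in>set L. fst x \<le> d" and C: "gvalid n d C"
  and g: "\<And>t. t < length L ==> g t \<in> gspace C"
   "\<And>t. t < length L ==> gproj C (snd (L ! t) mod n) (g t) = g t"
   "\<And>t. t < length L ==> (gX C ^^ fst (L ! t)) (g t) = (%_. 0)"
 shows "mod_hom (KZJ n d) (gmod (std n L)) (gmod C) (std_map n L C g)"
proof -
 let ?S = "std n L :: 'k gdata2" and ?f = "std_map n L C g"
 have S: "gvalid n d ?S" using n L by (auto intro: gvalid_std)
 note fin = gvalid_finite[OF S]
 have gt: "g t \<in> gspace C" if "(t, s) \<in> idx ?S" for t s using that g(1) by simp
 have f: "?f v \<in> gspace C" if "v \<in> gspace ?S" for v
  unfolding std_map_def
 proof (rule gspace_sum)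
  fix b assume "b \<in> idx ?S"
  then show "(%x. v b * (gX C ^^ snd b) (g (fst b)) x) \<in> gspace C"
   using gt[of "fst b" "snd b"] by (intro gspace_scale gX_funpow_gspace) simp
 qed
 have zero: "?f (%_. 0) = (%_. 0)" by (simp add: std_map_def)
 have zX: "gX D (%_. 0) = (%_. 0)" for D :: "('a, 'k) gdata" by (simp add: gX_def fun_eq_iff)
 have zp: "gproj D i (%_. 0) = (%_. 0)" for D :: "('a, 'k) gdata" and i by (simp add: gproj_def fun_eq_iff)
 have addp: "gproj D i (%b. v b + w b) = (%b. gproj D i v b + gproj D i w b)" for D :: "('a, 'k) gdata" and i v w
  by (auto simp: gproj_def fun_eq_iff)
 have scalep: "gproj D i (%b. c * v b) = (%b. c * gproj D i v b)" for D :: "('a, 'k) gdata" and i v c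
  by (auto simp: gproj_def fun_eq_iff)
 show ?thesis
 proof (rule gmod_lin_homI[OF S C f])
  fix v assume v: "v \<in> gspace ?S"
  show "?f (gX ?S v) = gX C (?f v)"
   using fin v
  proof (induction v rule: gspace_induct)
   case zero then show ?case using zX[of ?S] zX[of C] \<open>?f (%_. 0) = (%_. 0)\<close> by simp
  next
   case (unit b c)
   obtain t s where b: "b = (t, s)" by (cases b)
   have ts: "(t, s) \<in> idx ?S" using unit by (simp only: b)
   have Xg: "gX ?S (gunit (t, s)) = (if Suc s < fst (L ! t) then gunit (t, Suc s) else (%_. 0))"
    using gX_gunit_std[OF ts, of 1] by simp
   have "?f (gX ?S (gunit (t, s))) = gX C (?f (gunit (t, s)))"
   proof (cases "Suc s < fst (L ! t)")
    case True
    then have "(t, Suc s) \<in> idx ?S" using ts by simp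
    then show ?thesis unfolding Xg std_map_gunit[OF ts] using True std_map_gunit[of t "Suc s" n L C g] by simp
   next
    case False
    then have "Suc s = fst (L ! t)" using ts by simp
    then have "gX C ((gX C ^^ s) (g t)) = (%_. 0)" using g(3)[of t] ts by (metis funpow.simps(2) comp_apply mem_Sigma_iff std_sel(1) lessThan_iff)
    then show ?thesis unfolding Xg std_map_gunit[OF ts] using False \<open>?f (%_. 0) = (%_. 0)\<close> by simp
   qed
   then show ?case by (simp only: gX_scale std_map_scale b)
  next
   case (add v w) then show ?case by (simp only: gX_add std_map_add)
  qed
  fix i
  show "?f (gproj ?S i v) = gproj C i (?f v)"
   using fin v
  proof (induction v rule: gspace_induct)
   case zero then show ?case using zp[of ?S] zp[of C] \<open>?f (%_. 0) = (%_. 0)\<close> by simp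
  next
   case (unit b c)
   obtain t s where b: "b = (t, s)" by (cases b)
   have ts: "(t, s) \<in> idx ?S" using unit by (simp only: b)
   have t: "t < length L" using ts by simp
   have "?f (gproj ?S i (gunit (t, s))) = gproj C i (?f (gunit (t, s)))"
    unfolding gproj_gunit[OF ts] std_map_gunit[OF ts] gproj_gX[OF C g(1)[OF t] g(2)[OF t]]
    using std_map_gunit[OF ts, of C g] \<open>?f (%_. 0) = (%_. 0)\<close> by (simp add: mod_add_left_eq)
   then show ?case by (simp only: scalep std_map_scale b)
  next
   case (add v w) then show ?case by (simp only: addp std_map_add)
  qed
 qed (simp_all add: std_map_add std_map_scale)
qed

subsection \<open>Truncated polynomials in two variables\<close>

text \<open>The product of two blocks of degree \<open>0\<close> consists of the polynomials in two variables \<open>a\<close> and \<open>b\<close> modulo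
powers of \<open>a\<close> and \<open>b\<close>, and the operator is multiplication by \<open>x = a + b\<close>. Polynomials in \<open>a\<close> over
polynomials in \<open>b\<close> serve as the polynomial ring; \<open>pev\<close> is the reduction modulo \<open>a\<^sup>q\<close> and \<open>b\<^sup>N\<close> to the
coefficient vector, and \<open>phom r\<close> says that a polynomial is homogeneous of degree \<open>r\<close>.\<close>

definition pa :: "'k::field poly poly" where "pa = [:0, 1:]"
definition pb :: "'k::field poly poly" where "pb = [:[:0, 1:]:]"
abbreviation px :: "'k::field poly poly" where "px \<equiv> pa + pb"
abbreviation pconst :: "'k::field => 'k poly poly" where "pconst c \<equiv> [:[:c:]:]"

definition pev :: "nat => nat => 'k::field poly poly => nat \<times> nat => 'k" where
 "pev q N F = (%(s, s'). if s < q \<and> s' < N then coeff (coeff F s) s' else 0)"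

definition phom :: "nat => 'k::field poly poly => bool" where
 "phom r F \<longleftrightarrow> (\<forall>s s'. coeff (coeff F s) s' \<noteq> 0 --> s + s' = r)"

lemma coeff_pa: "coeff (pa * F) s = (if s = 0 then 0 else coeff F (s - 1))"
 by (simp add: pa_def coeff_pCons split: nat.splits)

lemma coeff_pb: "coeff (coeff (pb * F) s) s' = (if s' = 0 then 0 else coeff (coeff F s) (s' - 1))"
 by (simp add: pb_def coeff_pCons split: nat.splits)

lemma pev_add: "pev q N (F + G) = (%x. pev q N F x + pev q N G x)"
 and pev_diff: "pev q N (F - G) = (%x. pev q N F x - pev q N G x)"
 and pev_const: "pev q N (pconst c * F) = (%x. c * pev q N F x)"
 by (auto simp: pev_def fun_eq_iff)

lemma pev_zero_mult:
 assumes "pev q N F = (%_. 0)" shows "pev q N (G * F) = (%_. 0)"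
proof -
 have F: "coeff (coeff F s) s' = 0" if "s < q" "s' < N" for s s'
  using fun_cong[OF assms, of "(s, s')"] that by (simp add: pev_def)
 have "coeff (coeff (G * F) s) s' = 0" if "s < q" "s' < N" for s s'
  unfolding coeff_mult coeff_sum using that by (intro sum.neutral ballI) (auto simp: F)
 then show ?thesis by (auto simp: pev_def fun_eq_iff)
qed

lemma pev_pa_power: "pev q N (pa ^ q :: 'k::field poly poly) = (%_. 0)"
proof -
 have "coeff (pa ^ k :: 'k poly poly) s = 0" if "s < k" for k s :: nat
  using that by (induction k arbitrary: s) (auto simp: coeff_pa)
 then show ?thesis by (auto simp: pev_def fun_eq_iff)
qed

lemma pev_pb_power: "pev q N (pb ^ N :: 'k::field poly poly) = (%_. 0)"
proof -
 have "coeff (coeff (pb ^ k :: 'k poly poly) s) s' = 0" if "s' < k" for k s s' :: nat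
  using that by (induction k arbitrary: s') (auto simp: coeff_pb)
 then show ?thesis by (auto simp: pev_def fun_eq_iff)
qed

lemma pev_monomial:
 assumes "s < q" "s' < N" shows "pev q N (pa ^ s * pb ^ s' :: 'k::field poly poly) = gunit (s, s')"
proof -
 have b: "coeff (coeff (pb ^ k :: 'k poly poly) t) t' = of_bool (t = 0 \<and> t' = k)" for k t t' :: nat
  by (induction k arbitrary: t') (auto simp: coeff_pb)
 have "coeff (coeff (pa ^ k * pb ^ s' :: 'k poly poly) t) t' = of_bool (t = k \<and> t' = s')" for k t t' :: nat
  by (induction k arbitrary: t) (auto simp: coeff_pa mult.assoc b)
 then show ?thesis using assms by (auto simp: pev_def gunit_def fun_eq_iff)
qed

lemma phom_add: "phom r F ==> phom r G ==> phom r (F + G)"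
 and phom_diff: "phom r F ==> phom r G ==> phom r (F - G)"
 unfolding phom_def by (metis add.right_neutral coeff_add) (metis coeff_diff diff_zero diff_0 neg_equal_0_iff_equal)

lemma phom_mult: assumes "phom r F" "phom r' G" shows "phom (r + r') (F * G)"
 unfolding phom_def
proof (intro allI impI)
 fix s s' assume "coeff (coeff (F * G) s) s' \<noteq> 0"
 then have "(\<Sum>i\<le>s. \<Sum>j\<le>s'. coeff (coeff F i) j * coeff (coeff G (s - i)) (s' - j)) \<noteq> 0"
  by (simp add: coeff_mult coeff_sum)
 then obtain i where i: "i \<le> s" "(\<Sum>j\<le>s'. coeff (coeff F i) j * coeff (coeff G (s - i)) (s' - j)) \<noteq> 0"
  by (rule sum.not_neutral_contains_not_neutral) simp
 from i(2) obtain j where j: "j \<le> s'" "coeff (coeff F i) j * coeff (coeff G (s - i)) (s' - j) \<noteq> 0"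
  by (rule sum.not_neutral_contains_not_neutral) simp
 then have "i + j = r" "(s - i) + (s' - j) = r'" using assms by (auto simp: phom_def)
 then show "s + s' = r + r'" using i(1) j(1) by simp
qed

lemma phom_const: "phom 0 (pconst c)"
 by (auto simp: phom_def coeff_pCons split: nat.splits)

lemma phom_one: "phom 0 1"
 using phom_const[of 1] by (simp add: one_pCons)

lemma phom_pa: "phom 1 pa" and phom_pb: "phom 1 pb"
 by (auto simp: phom_def pa_def pb_def coeff_pCons split: nat.splits if_splits)

lemma phom_px: "phom 1 px" by (rule phom_add[OF phom_pa phom_pb])

lemma phom_power: "phom r F ==> phom (k * r) (F ^ k)"
proof (induction k)
 case 0 show ?case using phom_one by simp
next
 case (Suc k) then show ?case using phom_mult[of r F "k * r" "F ^ k"] by simp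
qed

context green_ring
begin

lemma gX_pev:
 assumes "1 \<le> q" "q \<le> d" "1 \<le> N" "N \<le> d"
 shows "gX (tdata n (block n (q, 0)) (block n (N, 0))) (pev q N F) = (pev q N (px * F) :: nat \<times> nat => 'k)"
proof
 let ?C = "tdata n (block n (q, 0)) (block n (N, 0)) :: 'k gdata2"
 fix x :: "nat \<times> nat" obtain s s' where x: "x = (s, s')" by (cases x)
 show "gX ?C (pev q N F) x = pev q N (px * F) x"
 proof (cases "s < q \<and> s' < N")
  case True
  have "gX ?C (pev q N F) x = (\<Sum>e<q. \<Sum>e'<N. (if e' = s' then of_bool (s = Suc e) * pev q N F (e, s') else 0)
    + (if e = s then of_bool (s' = Suc e') * pev q N F (s, e') else 0))"
  proof -
   have "gX ?C (pev q N F) x = (\<Sum>e<q. \<Sum>e'<N. mat ?C (s, s') (e, e') * pev q N F (e, e'))"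
    using True by (simp add: gX_def x sum.cartesian_product split_def del: tdata_sel(3))
   also have "... = (\<Sum>e<q. \<Sum>e'<N. (if e' = s' then of_bool (s = Suc e) * pev q N F (e, s') else 0)
    + (if e = s then of_bool (s' = Suc e') * pev q N F (s, e') else 0))"
    by (intro sum.cong refl) auto
   finally show ?thesis .
  qed
  also have "... = (\<Sum>e<q. of_bool (s = Suc e) * pev q N F (e, s')) + (\<Sum>e'<N. of_bool (s' = Suc e') * pev q N F (s, e'))"
  proof -
   have "(\<Sum>e<q. \<Sum>e'<N. if e = s then of_bool (s' = Suc e') * pev q N F (s, e') else 0)
    = (\<Sum>e<q. if e = s then \<Sum>e'<N. of_bool (s' = Suc e') * pev q N F (s, e') else 0)"
    by (intro sum.cong) auto
   then show ?thesis using True by (simp add: sum.distrib)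
  qed
  also have "(\<Sum>e<q. of_bool (s = Suc e) * pev q N F (e, s')) = (if s = 0 then 0 else pev q N F (s - 1, s'))"
  proof -
   have "(\<Sum>e<q. of_bool (s = Suc e) * pev q N F (e, s')) = (\<Sum>e<q. if e = s - 1 then (if s = 0 then 0 else pev q N F (s - 1, s')) else 0)"
    by (intro sum.cong) auto
   then show ?thesis using True by auto
  qed
  also have "(\<Sum>e'<N. of_bool (s' = Suc e') * pev q N F (s, e')) = (if s' = 0 then 0 else pev q N F (s, s' - 1))"
  proof -
   have "(\<Sum>e'<N. of_bool (s' = Suc e') * pev q N F (s, e')) = (\<Sum>e'<N. if e' = s' - 1 then (if s' = 0 then 0 else pev q N F (s, s' - 1)) else 0)"
    by (intro sum.cong) auto
   then show ?thesis using True by auto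
  qed
  also have "(if s = 0 then 0 else pev q N F (s - 1, s')) + (if s' = 0 then 0 else pev q N F (s, s' - 1)) = pev q N (px * F) x"
   using True by (auto simp: x pev_def distrib_right coeff_pa coeff_pb)
  finally show ?thesis .
 qed (auto simp: gX_def pev_def x)
qed

lemma gX_pev_power:
 assumes "1 \<le> q" "q \<le> d" "1 \<le> N" "N \<le> d"
 shows "(gX (tdata n (block n (q, 0)) (block n (N, 0))) ^^ k) (pev q N F) = (pev q N (px ^ k * F) :: nat \<times> nat => 'k)"
 by (induction k) (simp_all add: gX_pev[OF assms] mult.assoc)

text \<open>Homogeneous polynomials whose annihilators allow the prescribed block lengths define a homomorphism
from the standard module. If the powers of \<open>a\<close> are in its image, so is everything, as \<open>b = x - a\<close>; and
if the dimensions agree, a surjection is an isomorphism.\<close>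

lemma two_variable_decomposition:
 fixes G :: "((nat \<times> nat) \<times> 'k poly poly) list"
 assumes q: "1 \<le> q" "q \<le> d" and N: "1 \<le> N" "N \<le> d"
  and G: "\<And>y F. (y, F) \<in> set G ==> y \<in> Bl \<and> phom (snd y) F \<and> pev q N (px ^ fst y * F) = (%_. 0)"
  and dim: "(\<Sum>y\<leftarrow>G. fst (fst y)) = q * N"
  and gen: "\<And>P j. (\<And>y F. (y, F) \<in> set G ==> P F) ==> (\<And>F F'. P F ==> P F' ==> P (F + F')) ==>
    (\<And>c F. P F ==> P (pconst c * F)) ==> (\<And>F. P F ==> P (px * F)) ==> j < q ==> P (pa ^ j)"
 shows "tprod (q, 0) (N, 0) = vec (map fst G)"
proof -
 let ?C = "tdata n (block n (q, 0)) (block n (N, 0)) :: 'k gdata2"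
 let ?L = "map fst G" and ?g = "%t. pev q N (snd (G ! t))"
 let ?S = "std n ?L :: 'k gdata2"
 have Bl: "(q, 0) \<in> Bl" "(N, 0) \<in> Bl" using q N n_pos by (auto simp: Bl_iff)
 have C: "gvalid n d ?C" by (intro gvalid_tensor gvalid_block_Bl Bl)
 have LBl: "set ?L \<subseteq> Bl" using G by auto
 have L: "\<forall>x\<in>set ?L. fst x \<le> d" using LBl by (auto simp: blocks_def)
 have S: "gvalid n d ?S" by (rule gvalid_std_Bl[OF LBl])
 have mem: "(?L ! t, snd (G ! t)) \<in> set G" if "t < length ?L" for t
  using nth_mem[of t G] that by simp
 have pevC: "pev q N F \<in> gspace ?C" for F by (auto simp: pev_def gspace_def)
 have hom: "mod_hom H (gmod ?S) (gmod ?C) (std_map n ?L ?C ?g)"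
 proof (rule std_map_hom[OF n_pos L C])
  fix t assume t: "t < length ?L"
  show "?g t \<in> gspace ?C" by (rule pevC)
  show "(gX ?C ^^ fst (?L ! t)) (?g t) = (%_. 0)"
   using G[OF mem[OF t]] by (simp only: gX_pev_power[OF q N])
  have h: "phom (snd (?L ! t)) (snd (G ! t))" using G[OF mem[OF t]] by blast
  show "gproj ?C (snd (?L ! t) mod n) (?g t) = ?g t"
  proof
   fix x :: "nat \<times> nat" obtain s s' where x: "x = (s, s')" by (cases x)
   show "gproj ?C (snd (?L ! t) mod n) (?g t) x = ?g t x"
   proof (cases "coeff (coeff (snd (G ! t)) s) s' = 0")
    case False
    then have "s + s' = snd (?L ! t)" using h by (simp add: phom_def)
    then show ?thesis by (auto simp: x gproj_def pev_def mod_add_eq)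
   qed (auto simp: x gproj_def pev_def)
  qed
 qed
 let ?I = "std_map n ?L ?C ?g ` gspace ?S"
 define P where "P F \<longleftrightarrow> pev q N F \<in> ?I" for F
 have I_add: "(%x. v x + w x) \<in> ?I" if "v \<in> ?I" "w \<in> ?I" for v w
 proof -
  from that(1) obtain v' where v': "v = std_map n ?L ?C ?g v'" "v' \<in> gspace ?S" by (rule imageE)
  from that(2) obtain w' where w': "w = std_map n ?L ?C ?g w'" "w' \<in> gspace ?S" by (rule imageE)
  show ?thesis
   by (rule image_eqI[of _ _ "%b. v' b + w' b"]) (simp_all only: std_map_add v'(1) w'(1) gspace_add[OF v'(2) w'(2)])
 qed
 have I_scale: "(%x. c * (gX ?C ^^ k) v x) \<in> ?I" if "v \<in> ?I" for v c k
 proof -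
  from that obtain v' where v': "v = std_map n ?L ?C ?g v'" "v' \<in> gspace ?S" by (rule imageE)
  show ?thesis
   by (rule image_eqI[of _ _ "%b. c * (gX ?S ^^ k) v' b"])
    (simp_all only: gmod_hom_scale_X[OF S C hom v'(2)] v'(1) gspace_scale gX_funpow_gspace v'(2))
 qed
 have P_add: "P (F + F')" if "P F" "P F'" for F F'
  unfolding P_def pev_add by (rule I_add[OF that[unfolded P_def]])
 have P_const: "P (pconst c * F)" if "P F" for c F
  unfolding P_def pev_const using I_scale[OF that[unfolded P_def], of c 0] by (simp only: funpow_0)
 have P_px: "P (px * F)" if "P F" for F
  unfolding P_def using I_scale[OF that[unfolded P_def], of 1 1] by (simp only: funpow_simps_right funpow_0 comp_apply One_nat_def mult_1 id_apply gX_pev[OF q N])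
 have P_diff: "P (F - F')" if "P F" "P F'" for F F'
 proof -
  have "[:-1:] = (- 1 :: 'k poly)" by (simp add: one_pCons)
  then have "F + pconst (-1) * F' = F - F'" by simp
  then show ?thesis using P_add[OF that(1) P_const[OF that(2), of "-1"]] by (simp only:)
 qed
 have P_gen: "P F" if "(y, F) \<in> set G" for y F
 proof -
  obtain t where t: "t < length G" "G ! t = (y, F)" using \<open>(y, F) \<in> set G\<close> by (auto simp: in_set_conv_nth)
  have "y \<in> Bl" using G that by blast
  then have ts: "(t, 0) \<in> idx ?S" using t by (auto simp: blocks_def)
  have "std_map n ?L ?C ?g (gunit (t, 0)) = pev q N F"
   unfolding std_map_gunit[OF ts] t(2) by simp
  moreover have "std_map n ?L ?C ?g (gunit (t, 0)) \<in> ?I" by (rule imageI[OF gunit_gspace[OF ts]])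
  ultimately show ?thesis unfolding P_def by (simp only:)
 qed
 have I_zero: "(%_. 0) \<in> ?I"
 proof -
  have "std_map n ?L ?C ?g (%_. 0) \<in> ?I" by (rule imageI[OF gspace_zero])
  then show ?thesis by (simp only: gmod_hom_zero[OF S C hom])
 qed
 have P_zero: "P F" if "pev q N F = (%_. 0)" for F
  unfolding P_def that by (rule I_zero)
 have P_pa: "P (pa ^ j)" for j
 proof (cases "j < q")
  case True show ?thesis by (rule gen[OF P_gen P_add P_const P_px True])
 next
  case False
  then have "pa ^ j = pa ^ (j - q) * (pa ^ q :: 'k poly poly)" by (simp add: power_add[symmetric])
  then show ?thesis using P_zero pev_zero_mult[OF pev_pa_power, of q N "pa ^ (j - q)"] by simp
 qed
 have P_mono: "P (pa ^ j * pb ^ s)" for j s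
 proof (induction s arbitrary: j)
  case (Suc s)
  have "pa ^ j * pb ^ Suc s = px * (pa ^ j * pb ^ s) - (pa ^ Suc j * pb ^ s :: 'k poly poly)"
   by (simp add: algebra_simps)
  then show ?case using P_diff[OF P_px[OF Suc[of j]] Suc[of "Suc j"]] by simp
 qed (use P_pa in simp)
 have surj: "v \<in> ?I" if "v \<in> gspace ?C" for v
  using gvalid_finite[OF C] that
 proof (induction v rule: gspace_induct)
  case zero
  show ?case by (rule I_zero)
 next
  case (unit b c)
  then obtain s s' where b: "b = (s, s')" "s < q" "s' < N" by auto
  have "gunit b \<in> ?I"
   using P_mono[of s s'] unfolding P_def pev_monomial[OF b(2,3)] b(1) .
  from I_scale[OF this, of c 0] show ?case by (simp only: funpow_0)
 next
  case (add v w) then show ?case using I_add by blast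
 qed
 have "std_map n ?L ?C ?g ` gspace ?S = gspace ?C"
  using surj gmod_hom_gspace[OF S C hom] by blast
 moreover have "sum_list (map fst ?L) = card (idx ?C)" using dim by (simp add: comp_def card_cartesian_product)
 ultimately have "realizes n d (gmod ?C) ?S"
  using surjection_dim_iso[OF n_pos dn L C hom] by simp
 then show ?thesis
  unfolding tprod_def using gvec_realizes[of "gmod ?C" ?S] gvec_std[OF LBl] by simp
qed

end

section \<open>Products with a module of length \<open>p\<^sup>l + 1\<close>\<close>

lemma power_diff_expansion:
 fixes X Y :: "'r::comm_ring_1"
 shows "\<exists>W. (X - Y) ^ k = X ^ k - of_nat k * X ^ (k - 1) * Y + Y ^ 2 * W"
proof (induction k)
 case 0 show ?case by (rule exI[of _ 0]) simp
next
 case (Suc k)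
 then obtain W where W: "(X - Y) ^ k = X ^ k - of_nat k * X ^ (k - 1) * Y + Y ^ 2 * W" by blast
 have X: "of_nat k * (X * X ^ (k - 1)) = of_nat k * X ^ k" by (cases k) auto
 have "(X - Y) ^ Suc k = X * X ^ k - (of_nat k * (X * X ^ (k - 1)) + X ^ k) * Y
   + Y ^ 2 * (of_nat k * X ^ (k - 1) + (X - Y) * W)"
  by (simp only: power_Suc W) (simp add: algebra_simps power2_eq_square)
 also have "X * X ^ k - (of_nat k * (X * X ^ (k - 1)) + X ^ k) * Y = X ^ Suc k - of_nat (Suc k) * X ^ (Suc k - 1) * Y"
  unfolding X by (simp add: algebra_simps)
 finally show ?case by (rule exI)
qed

text \<open>Modulo the ideal \<open>Z\<close>, the expansion of \<open>(x - a)\<^bsup>kq+1\<^esup> = (x - a)(x\<^sup>q - a\<^sup>q)\<^sup>k\<close> gives the relation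
\<open>x\<^bsup>kq+1\<^esup> = x\<^bsup>kq\<^esup> a + k x\<^bsup>(k-1)q+1\<^esup> a\<^sup>q\<close>, which is the second conclusion up to sign. Its products with \<open>a\<^bsup>j-1\<^esup>\<close>
give the first one, since \<open>a\<^bsup>q+1\<^esup>\<close> is in \<open>Z\<close>. The third one follows by eliminating \<open>a\<^sup>q\<close> from the second, using that
\<open>a\<^sup>q - x\<^bsup>q-1\<^esup> a\<close> is a telescoping combination of the elements \<open>a\<^sup>j - x a\<^bsup>j-1\<^esup>\<close>.\<close>

lemma ideal_relations:
 fixes a x :: "'r::comm_ring_1" and Z :: "'r => bool"
 assumes Z_add: "\<And>F G. Z F ==> Z G ==> Z (F + G)" and Z_mult: "\<And>F G. Z F ==> Z (G * F)"
  and Za: "Z (a ^ (q + 1))" and Zb: "Z ((x - a) ^ (k * q + 1))" and fd: "(x - a) ^ q = x ^ q - a ^ q"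
  and q: "2 \<le> q" and k: "1 \<le> k"
 shows "2 \<le> j ==> Z (x ^ (k * q) * (a ^ j - x * a ^ (j - 1)))"
  and "Z (x ^ ((k - 1) * q + 1) * (of_nat k * a ^ q + x ^ (q - 1) * a - x ^ q))"
  and "Z (x ^ ((k + 1) * q - 1) * (of_nat (k + 1) * a - x))"
proof -
 have Z_uminus: "Z (- F)" if "Z F" for F using Z_mult[OF that, of "-1"] by simp
 have Z_diff: "Z (F - G)" if "Z F" "Z G" for F G using Z_add[OF that(1) Z_uminus[OF that(2)]] by simp
 have Z_a: "Z (G * a ^ i)" if "q + 1 \<le> i" for G i
 proof -
  have "G * a ^ i = (G * a ^ (i - (q + 1))) * a ^ (q + 1)"
   using that by (simp only: mult.assoc power_add[symmetric]) simp
  then show ?thesis using Z_mult[OF Za] by simp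
 qed
 have kq: "k * q = (k - 1) * q + q" using k by (cases k) auto
 let ?R = "x ^ (k * q + 1) - x ^ (k * q) * a - of_nat k * x ^ ((k - 1) * q + 1) * a ^ q"
 obtain W where W: "(x ^ q - a ^ q) ^ k = (x ^ q) ^ k - of_nat k * (x ^ q) ^ (k - 1) * a ^ q + (a ^ q) ^ 2 * W"
  using power_diff_expansion by blast
 have "(x - a) ^ (k * q + 1) = (x - a) * (x ^ q - a ^ q) ^ k"
  by (simp add: fd[symmetric] power_mult[symmetric] mult.commute)
 also have "... = (x - a) * (x ^ (k * q) - of_nat k * x ^ ((k - 1) * q) * a ^ q + a ^ (2 * q) * W)"
  unfolding W by (simp add: power_mult[symmetric] mult.commute)
 also have "... = ?R + (of_nat k * x ^ ((k - 1) * q)) * a ^ (q + 1) + ((x - a) * W) * a ^ (2 * q)"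
  by (simp add: algebra_simps)
 finally have R_eq: "?R = (x - a) ^ (k * q + 1) - (of_nat k * x ^ ((k - 1) * q)) * a ^ (q + 1) - ((x - a) * W) * a ^ (2 * q)"
  by simp
 have R: "Z ?R" unfolding R_eq using q by (intro Z_diff Zb Z_a) simp_all
 have f: "Z (x ^ (k * q) * (a ^ j - x * a ^ (j - 1)))" if j: "2 \<le> j" for j
 proof -
  have aj: "a * a ^ (j - 1) = a ^ j" using j by (cases j) auto
  have aq: "a ^ (j - 1) * a ^ q = a ^ (q + j - 1)" using j by (simp add: power_add[symmetric] add.commute)
  have "x ^ (k * q) * (a ^ j - x * a ^ (j - 1))
    = - (a ^ (j - 1) * ?R) - (of_nat k * x ^ ((k - 1) * q + 1)) * (a ^ (j - 1) * a ^ q)"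
   unfolding aj[symmetric] by (simp add: algebra_simps)
  also have "... = - (a ^ (j - 1) * ?R) - (of_nat k * x ^ ((k - 1) * q + 1)) * a ^ (q + j - 1)"
   unfolding aq ..
  finally show ?thesis using j by (simp only:) (intro Z_diff Z_uminus Z_mult R Z_a, simp)
 qed
 then show "2 \<le> j ==> Z (x ^ (k * q) * (a ^ j - x * a ^ (j - 1)))" .
 let ?G = "of_nat k * a ^ q + x ^ (q - 1) * a - x ^ q"
 have e: "x ^ ((k - 1) * q + 1) * x ^ (q - 1) = x ^ (k * q)" "x ^ ((k - 1) * q + 1) * x ^ q = x ^ (k * q + 1)"
  unfolding power_add[symmetric] using q kq by (simp_all del: power_Suc add.commute)
 have "x ^ ((k - 1) * q + 1) * ?G = of_nat k * (x ^ ((k - 1) * q + 1) * a ^ q)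
   + (x ^ ((k - 1) * q + 1) * x ^ (q - 1)) * a - x ^ ((k - 1) * q + 1) * x ^ q"
  by (simp only: algebra_simps)
 also have "... = - ?R" unfolding e by (simp add: algebra_simps)
 finally show G: "Z (x ^ ((k - 1) * q + 1) * ?G)" using Z_uminus[OF R] by (simp only:)
 have tel: "(\<Sum>j = 2..r. x ^ (r - j) * (a ^ j - x * a ^ (j - 1))) = a ^ r - x ^ (r - 1) * a" if "1 \<le> r" for r
  using that
 proof (induction r rule: nat_induct_at_least)
  case (Suc r)
  have "(\<Sum>j = 2..Suc r. x ^ (Suc r - j) * (a ^ j - x * a ^ (j - 1)))
    = (\<Sum>j = 2..r. x * (x ^ (r - j) * (a ^ j - x * a ^ (j - 1)))) + (a ^ Suc r - x * a ^ r)"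
   using Suc.hyps by (simp add: Suc_diff_le mult.assoc)
  also have "... = x * (a ^ r - x ^ (r - 1) * a) + (a ^ Suc r - x * a ^ r)"
   unfolding sum_distrib_left[symmetric] Suc.IH ..
  also have "... = a ^ Suc r - (x * x ^ (r - 1)) * a" by (simp add: algebra_simps)
  also have "x * x ^ (r - 1) = x ^ r" using Suc.hyps by (cases r) auto
  finally show ?case by simp
 qed simp
 have F: "Z (x ^ (k * q) * (a ^ q - x ^ (q - 1) * a))"
 proof -
  have sum: "Z (\<Sum>i\<in>A. h i)" if "finite A" "\<And>i. i \<in> A ==> Z (h i)" for A :: "nat set" and h
   using that by (induction A rule: finite_induct) (use Z_mult[OF Za, of 0] Z_add in auto)
  have "x ^ (k * q) * (a ^ q - x ^ (q - 1) * a) = (\<Sum>j = 2..q. x ^ (q - j) * (x ^ (k * q) * (a ^ j - x * a ^ (j - 1))))"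
   unfolding mult.left_commute[of "x ^ (q - _)"] sum_distrib_left[symmetric] using tel[of q] q by simp
  moreover have "Z (\<Sum>j = 2..q. x ^ (q - j) * (x ^ (k * q) * (a ^ j - x * a ^ (j - 1))))"
   by (intro sum Z_mult f) auto
  ultimately show ?thesis by simp
 qed
 have e1: "x ^ ((k + 1) * q - 1) = x ^ (k * q) * x ^ (q - 1)" using q by (simp add: power_add[symmetric] add.commute)
 have e2: "x ^ q = x * x ^ (q - 1)" using q by (cases q) auto
 have e3: "x ^ (k * q) = x ^ (q - 1) * x ^ ((k - 1) * q + 1)" using e(1) by (simp add: mult.commute)
 have "x ^ (k * q) * x ^ (q - 1) * (of_nat (k + 1) * a - x)
   = x ^ (k * q) * ?G - of_nat k * (x ^ (k * q) * (a ^ q - x ^ (q - 1) * a))"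
  unfolding e2 by (simp add: algebra_simps)
 moreover have "Z (x ^ (k * q) * ?G)" unfolding e3 mult.assoc by (intro Z_mult G)
 ultimately show "Z (x ^ ((k + 1) * q - 1) * (of_nat (k + 1) * a - x))"
  unfolding e1 using Z_diff[OF _ Z_mult[OF F]] by simp
qed

lemma pev_phom:
 assumes "phom r F" "q + N < r" shows "pev (q + 1) (N + 1) F = (%_. 0)"
proof
 fix y :: "nat \<times> nat" obtain s s' where y: "y = (s, s')" by (cases y)
 show "pev (q + 1) (N + 1) F y = 0"
 proof (cases "coeff (coeff F s) s' = 0")
  case False
  then have "s + s' = r" using assms(1) by (simp add: phom_def)
  then show ?thesis using assms(2) by (auto simp: pev_def y)
 qed (simp add: pev_def y)
qed

lemma of_nat_pconst: "of_nat k = (pconst (of_nat k) :: 'k::field poly poly)"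
 by (simp add: of_nat_poly)

lemma phom_of_nat: "phom 0 (of_nat k)"
 unfolding of_nat_pconst by (rule phom_const)

context green_ring
begin

lemma freshman: "(px - pa) ^ p ^ l = px ^ p ^ l - (pa ^ p ^ l :: 'k poly poly)"
proof -
 have "(pa + pb) ^ p ^ l = pa ^ p ^ l + (pb ^ p ^ l :: 'k poly poly)"
  by (rule freshmans_dream'[where n = l]) (simp_all add: p)
 then show ?thesis by simp
qed

lemma of_nat_char: "(of_nat k :: 'k) = 0 \<longleftrightarrow> p dvd k"
 using p(2) of_nat_eq_0_iff_char_dvd[where ?'a = 'k] by simp

text \<open>The generators are \<open>1\<close>, a homogeneous element \<open>E\<close> of degree \<open>1\<close> that together with \<open>x\<close> spans \<open>a\<close>, the elements
\<open>a\<^sup>j - x a\<^bsup>j-1\<^esup>\<close>, and one element of degree \<open>q\<close> that involves \<open>k a\<^sup>q\<close>, where \<open>k\<close> is invertible. They generate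
all powers of \<open>a\<close> up to \<open>a\<^sup>q\<close>. Only \<open>E\<close> and the two lengths \<open>e1\<close> and \<open>e2\<close> depend on whether \<open>k + 1\<close> vanishes in \<open>K\<close>.\<close>

lemma product_decomposition_aux:
 fixes E :: "'k poly poly" and e1 e2 :: nat
 assumes l: "1 \<le> l" "l < m" and q: "q = p ^ l" and k: "1 \<le> k" "k < p"
  and e: "1 \<le> e1" "1 \<le> e2" "e1 \<le> d" "e2 \<le> d" "e1 + e2 = 2 * (k + 1) * q"
  and E: "phom 1 E" "pev (q + 1) (k * q + 1) (px ^ e1 :: 'k poly poly) = (%_. 0)" "pev (q + 1) (k * q + 1) (px ^ e2 * E) = (%_. 0)"
  and gen: "\<exists>c c'. pa = pconst c * E + pconst c' * px"
 shows "tprod (q + 1, 0) (k * q + 1, 0)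
  = frag_of (e1, 0) + frag_of (e2, 1) + (\<Sum>j = 2..q - 1. frag_of (k * q, j)) + frag_of ((k - 1) * q + 1, q)"
proof -
 let ?f = "%j. pa ^ j - px * pa ^ (j - 1) :: 'k poly poly"
 let ?Gq = "of_nat k * pa ^ q + px ^ (q - 1) * pa - px ^ q :: 'k poly poly"
 have one: "phom 0 (1 :: 'k poly poly)" by (rule phom_one)
 let ?G = "[((e1, 0), 1), ((e2, 1), E)] @ map (%j. ((k * q, j), ?f j)) [2..<q] @ [(((k - 1) * q + 1, q), ?Gq)]"
 have p2: "2 \<le> p" using p(1) by (rule prime_ge_2_nat)
 have q2: "2 \<le> q" unfolding q using l p2 self_le_power[of p l] by simp
 have pq: "p * q \<le> d" unfolding q d using l p2 power_increasing[of "Suc l" m p] by simp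
 have "(k + 1) * q \<le> p * q" using k by (intro mult_right_mono) auto
 then have kq: "(k + 1) * q \<le> d" using pq by simp
 then have kq': "k * q + 1 \<le> d" "q + 1 \<le> d" "q < n" "(k - 1) * q + 1 \<le> d" "k * q \<le> d" "1 \<le> k * q"
 proof -
  obtain i where i: "k = Suc i" using k(1) by (cases k) auto
  show "k * q + 1 \<le> d" "q + 1 \<le> d" "q < n" "(k - 1) * q + 1 \<le> d" "k * q \<le> d" "1 \<le> k * q" using kq q2 dn by (simp_all add: i)
 qed
 define Z where "Z F \<longleftrightarrow> pev (q + 1) (k * q + 1) F = (%_. 0)" for F :: "'k poly poly"
 have Z_add: "Z (F + F')" if "Z F" "Z F'" for F F' using that by (simp add: Z_def pev_add)
 have Z_mult: "Z (F' * F)" if "Z F" for F F' using that unfolding Z_def by (rule pev_zero_mult)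
 have Za: "Z (pa ^ (q + 1))" unfolding Z_def by (rule pev_pa_power)
 have Zb: "Z ((px - pa) ^ (k * q + 1))" using pev_pb_power[of "q + 1" "k * q + 1"] by (simp add: Z_def)
 have fd: "(px - pa) ^ q = px ^ q - (pa ^ q :: 'k poly poly)" unfolding q by (rule freshman)
 note rel = ideal_relations[of Z pa q px k, OF Z_add Z_mult Za Zb fd q2 k(1)]
 have hf: "phom j (?f j)" if "2 \<le> j" for j
 proof -
  have "phom (1 + (j - 1) * 1) (px * pa ^ (j - 1) :: 'k poly poly)"
   by (intro phom_mult[OF phom_px] phom_power phom_pa)
  then show ?thesis using that phom_power[OF phom_pa, of j] by (intro phom_diff) simp_all
 qed
 have hG: "phom q ?Gq"
 proof -
  have "phom (0 + q * 1) (of_nat k * pa ^ q :: 'k poly poly)" by (intro phom_mult[OF phom_of_nat] phom_power phom_pa)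
  moreover have "phom ((q - 1) * 1 + 1) (px ^ (q - 1) * pa :: 'k poly poly)" by (intro phom_mult phom_power phom_px phom_pa)
  moreover have "phom (q * 1) (px ^ q :: 'k poly poly)" by (intro phom_power phom_px)
  ultimately show ?thesis using q2 by (intro phom_diff phom_add) simp_all
 qed
 have "tprod (q + 1, 0) (k * q + 1, 0) = vec (map fst ?G)"
 proof (rule two_variable_decomposition)
  fix y F assume "(y, F) \<in> set ?G"
  then consider "y = (e1, 0)" "F = 1" | "y = (e2, 1)" "F = E" | j where "y = (k * q, j)" "F = ?f j" "2 \<le> j" "j < q"
   | "y = ((k - 1) * q + 1, q)" "F = ?Gq" by auto
  then show "y \<in> Bl \<and> phom (snd y) F \<and> pev (q + 1) (k * q + 1) (px ^ fst y * F) = (%_. 0)"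
  proof cases
   case 1 then show ?thesis using E(2) e n_pos one by (simp add: Bl_iff)
  next
   case 2 then show ?thesis using E(1,3) e d_ge2 dn by (simp add: Bl_iff)
  next
   case (3 j) show ?thesis
    unfolding 3(1,2) fst_conv snd_conv Bl_iff by (intro conjI hf rel(1)[unfolded Z_def] 3(3)) (use kq' 3 in simp_all)
  next
   case 4 show ?thesis
    unfolding 4 fst_conv snd_conv Bl_iff by (intro conjI hG rel(2)[unfolded Z_def]) (use kq' in simp_all)
  qed
 next
  have s: "(\<Sum>y\<leftarrow>?G. fst (fst y)) = e1 + e2 + (q - 2) * (k * q) + ((k - 1) * q + 1)"
   by (simp add: comp_def sum_list_triv)
  obtain q' where q': "q = q' + 2" using q2 le_Suc_ex by (metis add.commute)
  obtain k' where k': "k = k' + 1" using k(1) le_Suc_ex by (metis add.commute)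
  show "(\<Sum>y\<leftarrow>?G. fst (fst y)) = (q + 1) * (k * q + 1)"
   unfolding s unfolding e(5) unfolding q' k' by (simp add: algebra_simps)
 next
  fix P :: "'k poly poly => bool" and j :: nat
  assume PG: "\<And>y F. (y, F) \<in> set ?G ==> P F" and Padd: "\<And>F F'. P F ==> P F' ==> P (F + F')"
   and Pc: "\<And>c F. P F ==> P (pconst c * F)" and Px: "\<And>F. P F ==> P (px * F)" and j: "j < q + 1"
  have Pxk: "P (px ^ i * F)" if "P F" for i F using that by (induction i) (auto simp: mult.assoc intro: Px)
  have Pm: "P (F - F')" if "P F" "P F'" for F F'
  proof -
   have "[:-1:] = (- 1 :: 'k poly)" by (simp add: one_pCons)
   then have "F + pconst (-1) * F' = F - F'" by simp
   then show ?thesis using Padd[OF that(1) Pc[OF that(2), of "-1"]] by (simp only:)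
  qed
  have P1: "P 1" by (rule PG[of "(e1, 0)"]) simp
  have PE: "P E" by (rule PG[of "(e2, 1)"]) simp
  have Pf: "P (?f j)" if "2 \<le> j" "j < q" for j by (rule PG[of "(k * q, j)"]) (use that in simp)
  have PGq: "P ?Gq" by (rule PG[of "((k - 1) * q + 1, q)"]) simp
  have Pa: "P pa"
  proof -
   obtain c c' where c: "pa = pconst c * E + pconst c' * px" using gen by blast
   have "P (pconst c * E + pconst c' * (px * 1))" by (rule Padd[OF Pc[OF PE] Pc[OF Px[OF P1]]])
   then show ?thesis unfolding mult_1_right c[symmetric] .
  qed
  have Pj: "P (pa ^ j)" if "j < q" for j
   using that
  proof (induction j)
   case (Suc j)
   show ?case
   proof (cases "j = 0")
    case True then show ?thesis using Pa by simp
   next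
    case False
    have e: "pa ^ Suc j = ?f (Suc j) + px * pa ^ j" by simp
    have "P (pa ^ j)" using Suc by simp
    then show ?thesis by (subst e) (rule Padd[OF Pf Px], use Suc.prems False in simp_all)
   qed
  qed (use P1 in simp)
  show "P (pa ^ j)"
  proof (cases "j < q")
   case False
   then have jq: "j = q" using j by simp
   have k0: "(of_nat k :: 'k) \<noteq> 0" using k by (auto simp: of_nat_char dest: dvd_imp_le)
   have "pconst (inverse (of_nat k)) * of_nat k = (1 :: 'k poly poly)"
    using k0 by (simp add: of_nat_pconst one_pCons)
   then have "pa ^ q = pconst (inverse (of_nat k)) * (of_nat k * pa ^ q :: 'k poly poly)" by (simp only: mult.assoc[symmetric]) simp
   also have "of_nat k * pa ^ q = ?Gq - px ^ (q - 1) * pa + (px ^ q * 1 :: 'k poly poly)" by simp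
   finally have e: "pa ^ q = pconst (inverse (of_nat k)) * (?Gq - px ^ (q - 1) * pa + px ^ q * 1)" .
   show ?thesis unfolding jq by (subst e) (rule Pc[OF Padd[OF Pm[OF PGq Pxk[OF Pa]] Pxk[OF P1]]])
  qed (rule Pj)
 qed (use kq' in simp_all)
 also have "... = frag_of (e1, 0) + frag_of (e2, 1) + vec (map (%j. (k * q, j)) [2..<q]) + frag_of ((k - 1) * q + 1, q)"
  by (simp add: comp_def)
 also have "vec (map (%j. (k * q, j)) [2..<q]) = (\<Sum>j = 2..q - 1. frag_of (k * q, j))"
 proof -
  have "{2..<q} = {2..q - 1}" using q2 by auto
  then show ?thesis by (simp add: vec_def comp_def interv_sum_list_conv_sum_set_nat)
 qed
 finally show ?thesis .
qed

lemma inverse_of_nat_mult: "(of_nat k :: 'k) \<noteq> 0 ==> pconst (inverse (of_nat k)) * (of_nat k * F) = (F :: 'k poly poly)"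
proof -
 assume "(of_nat k :: 'k) \<noteq> 0"
 then have "pconst (inverse (of_nat k)) * of_nat k = (1 :: 'k poly poly)"
  by (simp add: of_nat_pconst one_pCons)
 then show ?thesis by (simp only: mult.assoc[symmetric]) simp
qed

lemma gen_E:
 assumes "1 \<le> k" "k + 1 < p" "E = of_nat (k + 1) * pa - px"
 shows "\<exists>c c'. (pa :: 'k poly poly) = pconst c * E + pconst c' * px"
proof -
 have k0: "(of_nat (k + 1) :: 'k) \<noteq> 0" unfolding of_nat_char using assms by (auto dest: dvd_imp_le)
 have "pa = pconst (inverse (of_nat (k + 1))) * (of_nat (k + 1) * (pa :: 'k poly poly))"
  by (rule inverse_of_nat_mult[OF k0, symmetric])
 also have "of_nat (k + 1) * pa = E + px" using assms(3) by simp
 finally show ?thesis by (metis distrib_left)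
qed

lemma phom_E: "phom 1 (of_nat k * pa - px :: 'k poly poly)"
 using phom_mult[OF phom_of_nat phom_pa] by (intro phom_diff phom_px) simp

lemma E_relation:
 assumes q: "q = p ^ l" "2 \<le> q" and k: "1 \<le> k"
 shows "pev (q + 1) (k * q + 1) (px ^ ((k + 1) * q - 1) * (of_nat (k + 1) * pa - px)) = (%_. 0 :: 'k)"
proof (rule ideal_relations(3)[of "%F. pev (q + 1) (k * q + 1) F = (%_. 0)", OF _ pev_zero_mult pev_pa_power _ _ q(2) k])
 show "pev (q + 1) (k * q + 1) ((px - pa) ^ (k * q + 1)) = (%_. 0 :: 'k)"
  using pev_pb_power[of "q + 1" "k * q + 1"] by simp
 show "(px - pa) ^ q = px ^ q - (pa ^ q :: 'k poly poly)" unfolding q by (rule freshman)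
qed (simp add: pev_add)

text \<open>As \<open>k + 1\<close> is invertible in \<open>K\<close>, the element \<open>(k + 1) a - x\<close> generates a block, which is two shorter than
the maximal one.\<close>

lemma product_decomposition:
 assumes l: "1 \<le> l" "l < m" and q: "q = p ^ l" and k: "1 \<le> k" "k + 1 < p"
 shows "tprod (q + 1, 0) (k * q + 1, 0) = frag_of ((k + 1) * q + 1, 0) + frag_of ((k + 1) * q - 1, 1)
   + (\<Sum>j = 2..q - 1. frag_of (k * q, j)) + frag_of ((k - 1) * q + 1, q)"
proof -
 define E :: "'k poly poly" where "E = of_nat (k + 1) * pa - px"
 have p2: "2 \<le> p" using p(1) by (rule prime_ge_2_nat)
 have q2: "2 \<le> q" unfolding q using l p2 self_le_power[of p l] by simp
 have pq: "p * q \<le> d" unfolding q d using l p2 power_increasing[of "Suc l" m p] by simp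
 have "((k + 1) + 1) * q \<le> p * q" using k by (intro mult_right_mono) auto
 then have kq: "(k + 1) * q + 1 \<le> d" using pq q2 by simp
 show ?thesis
 proof (rule product_decomposition_aux[OF l q])
  show "phom 1 E" unfolding E_def by (rule phom_E)
  have "phom (((k + 1) * q + 1) * 1) (px ^ ((k + 1) * q + 1) :: 'k poly poly)" by (intro phom_power phom_px)
  then show "pev (q + 1) (k * q + 1) (px ^ ((k + 1) * q + 1) :: 'k poly poly) = (%_. 0)"
   by (rule pev_phom) simp
  show "\<exists>c c'. pa = pconst c * E + pconst c' * px" using gen_E[OF k E_def] .
  show "pev (q + 1) (k * q + 1) (px ^ ((k + 1) * q - 1) * E) = (%_. 0)"
   unfolding E_def by (rule E_relation[OF q q2 k(1)])
 qed (use k kq q2 in \<open>simp_all add: algebra_simps\<close>)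
qed

text \<open>For \<open>k = p - 1\<close> the element \<open>(k + 1) a - x\<close> degenerates to \<open>- x\<close>; the relation that it satisfied now says that
\<open>x\<^bsup>pq\<^esup>\<close> vanishes, and \<open>1\<close> and \<open>a\<close> generate two blocks of equal length \<open>pq\<close>.\<close>

lemma product_decomposition_last:
 assumes l: "1 \<le> l" "l < m" and q: "q = p ^ l"
 shows "tprod (q + 1, 0) ((p - 1) * q + 1, 0) = frag_of (p * q, 0) + frag_of (p * q, 1)
   + (\<Sum>j = 2..q - 1. frag_of ((p - 1) * q, j)) + frag_of ((p - 2) * q + 1, q)"
proof -
 have p2: "2 \<le> p" using p(1) by (rule prime_ge_2_nat)
 define k where "k = p - 1"
 have k: "1 \<le> k" "k < p" "p = k + 1" "p - 2 = k - 1" using p2 by (auto simp: k_def)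
 have q2: "2 \<le> q" unfolding q using l p2 self_le_power[of p l] by simp
 have pq: "p * q \<le> d" unfolding q d using l p2 power_increasing[of "Suc l" m p] by simp
 show ?thesis unfolding k_def[symmetric] k(4)
 proof (rule product_decomposition_aux[OF l q k(1,2)])
  show "phom 1 (pa :: 'k poly poly)" by (rule phom_pa)
  have "phom ((p * q) * 1 + 1) (px ^ (p * q) * pa :: 'k poly poly)" by (intro phom_mult phom_power phom_px phom_pa)
  then show "pev (q + 1) (k * q + 1) (px ^ (p * q) * pa :: 'k poly poly) = (%_. 0)"
   by (rule pev_phom) (simp add: k(3))
  have "pa = pconst 1 * pa + pconst 0 * (px :: 'k poly poly)" by (simp add: one_pCons[symmetric])
  then show "\<exists>c c'. pa = pconst c * pa + pconst c' * (px :: 'k poly poly)" by blast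
  have "pev (q + 1) (k * q + 1) (px ^ ((k + 1) * q - 1) * (of_nat (k + 1) * pa - px)) = (%_. 0 :: 'k)"
   by (rule E_relation[OF q q2 k(1)])
  moreover have "(of_nat (k + 1) :: 'k poly poly) = 0"
   using of_nat_char[of p] unfolding k(3)[symmetric] by (simp add: of_nat_pconst)
  then have "px ^ ((k + 1) * q - 1) * (of_nat (k + 1) * pa - px) = pconst (-1) * (px ^ (p * q) :: 'k poly poly)"
  proof -
   assume z: "(of_nat (k + 1) :: 'k poly poly) = 0"
   have c: "pconst (-1) = (- 1 :: 'k poly poly)" by (simp add: one_pCons)
   have "p * q = Suc ((k + 1) * q - 1)" using q2 k(3) by simp
   then have e: "px ^ (p * q) = px * (px :: 'k poly poly) ^ ((k + 1) * q - 1)" by (simp only: power_Suc)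
   show ?thesis unfolding z c e
    by (simp only: mult_zero_left diff_0 mult_minus_right mult_minus_left mult_1_left mult.commute)
  qed
  ultimately have "pev (q + 1) (k * q + 1) (pconst (-1) * (px ^ (p * q) :: 'k poly poly)) = (%_. 0)" by (simp only:)
  then show "pev (q + 1) (k * q + 1) (px ^ (p * q) :: 'k poly poly) = (%_. 0)"
   unfolding pev_const by (simp add: fun_eq_iff)
 qed (use k q2 pq in \<open>simp_all add: algebra_simps\<close>)
qed

lemma product_decomposition_two_aux:
 fixes E :: "'k poly poly" and e1 e2 :: nat
 assumes k: "1 \<le> k" "k < p" and e: "1 \<le> e1" "1 \<le> e2" "e1 \<le> d" "e2 \<le> d" "e1 + e2 = 2 * (k + 1)"
  and E: "phom 1 E" "pev 2 (k + 1) (px ^ e1 :: 'k poly poly) = (%_. 0)" "pev 2 (k + 1) (px ^ e2 * E) = (%_. 0)"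
  and gen: "\<exists>c c'. pa = pconst c * E + pconst c' * px"
 shows "tprod (2, 0) (k + 1, 0) = frag_of (e1, 0) + frag_of (e2, 1)"
proof -
 let ?G = "[((e1, 0 :: nat), 1), ((e2, 1), E)]"
 have one: "phom 0 (1 :: 'k poly poly)" by (rule phom_one)
 have "p \<le> d" unfolding d using m prime_gt_1_nat[OF p(1)] self_le_power[of p m] by simp
 then have kd: "k + 1 \<le> d" using k by simp
 have "tprod (2, 0) (k + 1, 0) = vec (map fst ?G)"
 proof (rule two_variable_decomposition)
  fix y F assume "(y, F) \<in> set ?G"
  then consider "y = (e1, 0)" "F = 1" | "y = (e2, 1)" "F = E" by auto
  then show "y \<in> Bl \<and> phom (snd y) F \<and> pev 2 (k + 1) (px ^ fst y * F) = (%_. 0)"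
  proof cases
   case 1 then show ?thesis using E(2) e n_pos one by (simp add: Bl_iff)
  next
   case 2 then show ?thesis using E(1,3) e d_ge2 dn by (simp add: Bl_iff)
  qed
 next
  fix P :: "'k poly poly => bool" and j :: nat
  assume PG: "\<And>y F. (y, F) \<in> set ?G ==> P F" and Padd: "\<And>F F'. P F ==> P F' ==> P (F + F')"
   and Pc: "\<And>c F. P F ==> P (pconst c * F)" and Px: "\<And>F. P F ==> P (px * F)" and j: "j < 2"
  have P1: "P 1" by (rule PG[of "(e1, 0)"]) simp
  have PE: "P E" by (rule PG[of "(e2, 1)"]) simp
  obtain c c' where c: "pa = pconst c * E + pconst c' * px" using gen by blast
  have "P (pconst c * E + pconst c' * (px * 1))" by (rule Padd[OF Pc[OF PE] Pc[OF Px[OF P1]]])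
  then have "P pa" unfolding mult_1_right c[symmetric] .
  then show "P (pa ^ j)" using j P1 by (cases j) (auto simp: less_Suc_eq)
 qed (use kd d_ge2 e in simp_all)
 then show ?thesis by simp
qed

lemma two_relation: "pev 2 (k + 1) (px ^ k * (of_nat (k + 1) * pa - px)) = (%_. 0 :: 'k)"
proof -
 obtain W where W: "(px - pa) ^ (k + 1) = px ^ (k + 1) - of_nat (k + 1) * px ^ (k + 1 - 1) * pa + pa ^ 2 * (W :: 'k poly poly)"
  using power_diff_expansion by blast
 have "px ^ k * (of_nat (k + 1) * pa - px) = W * pa ^ 2 + pconst (-1) * ((px - pa) ^ (k + 1) :: 'k poly poly)"
 proof -
  have c: "pconst (-1) = (- 1 :: 'k poly poly)" by (simp add: one_pCons)
  show ?thesis unfolding W c by (simp add: algebra_simps)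
 qed
 moreover have "pev 2 (k + 1) (W * pa ^ 2) = (%_. 0)" by (rule pev_zero_mult[OF pev_pa_power])
 moreover have "pev 2 (k + 1) ((px - pa) ^ (k + 1)) = (%_. 0 :: 'k)" using pev_pb_power[of 2 "k + 1"] by simp
 ultimately show ?thesis by (simp only: pev_add pev_const) simp
qed

lemma product_two:
 assumes k: "2 \<le> k" "k < p"
 shows "tprod (2, 0) (k, 0) = frag_of (k + 1, 0) + frag_of (k - 1, 1)"
proof -
 have pd: "p \<le> d" unfolding d using m prime_gt_1_nat[OF p(1)] self_le_power[of p m] by simp
 define i where "i = k - 1"
 have i: "k = i + 1" "k + 1 = i + 2" "k - 1 = i" "1 \<le> i" using k by (auto simp: i_def)
 define E :: "'k poly poly" where "E = of_nat (i + 1) * pa - px"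
 have "phom ((i + 2) * 1) (px ^ (i + 2) :: 'k poly poly)" by (intro phom_power phom_px)
 then have "pev 2 (i + 1) (px ^ (i + 2) :: 'k poly poly) = (%_. 0)"
  using pev_phom[of "i + 2" "px ^ (i + 2)" 1 i] by (simp add: numeral_2_eq_2)
 then show ?thesis
  unfolding i(2,3) unfolding i(1)
  using product_decomposition_two_aux[of i "i + 2" i E] two_relation[of i] gen_E[of i E] k i pd phom_E[of "i + 1"]
  by (simp add: E_def)
qed

lemma product_two_last: "tprod (2, 0) (p, 0) = frag_of (p, 0) + frag_of (p, 1)"
proof -
 have pd: "p \<le> d" unfolding d using m prime_gt_1_nat[OF p(1)] self_le_power[of p m] by simp
 have p2: "2 \<le> p" using p(1) by (rule prime_ge_2_nat)
 define i where "i = p - 1"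
 have i: "p = i + 1" "1 \<le> i" using p2 by (auto simp: i_def)
 have "phom ((i + 1) * 1 + 1) (px ^ (i + 1) * pa :: 'k poly poly)" by (intro phom_mult phom_power phom_px phom_pa)
 then have 1: "pev 2 (i + 1) (px ^ (i + 1) * pa :: 'k poly poly) = (%_. 0)"
  using pev_phom[of "i + 2" "px ^ (i + 1) * pa" 1 i] by (simp add: numeral_2_eq_2)
 have "(of_nat (i + 1) :: 'k poly poly) = 0"
  using of_nat_char[of p] unfolding i(1)[symmetric] by (simp add: of_nat_pconst)
 then have "px ^ i * (of_nat (i + 1) * pa - px) = pconst (-1) * (px ^ (i + 1) :: 'k poly poly)"
 proof -
  assume z: "(of_nat (i + 1) :: 'k poly poly) = 0"
  have c: "pconst (-1) = (- 1 :: 'k poly poly)" by (simp add: one_pCons)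
  show ?thesis unfolding z c unfolding Suc_eq_plus1[symmetric] power_Suc
   by (simp only: mult_zero_left diff_0 mult_minus_right mult_minus_left mult_1_left mult.commute)
 qed
 then have "pev 2 (i + 1) (pconst (-1) * (px ^ (i + 1) :: 'k poly poly)) = (%_. 0)"
  using two_relation[of i] by (simp only:)
 then have 2: "pev 2 (i + 1) (px ^ (i + 1) :: 'k poly poly) = (%_. 0)"
  unfolding pev_const by (simp add: fun_eq_iff)
 have "pa = pconst 1 * pa + pconst 0 * (px :: 'k poly poly)" by (simp add: one_pCons[symmetric])
 then have 3: "\<exists>c c'. pa = pconst c * pa + pconst c' * (px :: 'k poly poly)" by blast
 show ?thesis
  using product_decomposition_two_aux[of i "i + 1" "i + 1" pa] 1 2 3 i pd phom_pa[where ?'a = 'k] by (simp del: power_Suc)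
qed

end

section \<open>Integral polynomials\<close>

abbreviation zp :: "nat => zpoly set" where "zp m \<equiv> carrier (zpoly_ring m)"

lemma zpoly_ring_sel:
 "zp m = {P. \<forall>\<mu>\<in>keys P. keys \<mu> \<subseteq> {..m}}" "P \<otimes>\<^bsub>zpoly_ring m\<^esub> Q = P * Q" "\<one>\<^bsub>zpoly_ring m\<^esub> = 1"
 "\<zero>\<^bsub>zpoly_ring m\<^esub> = 0" "P \<oplus>\<^bsub>zpoly_ring m\<^esub> Q = P + Q"
 by (simp_all add: zpoly_ring_def)

lemma keys_add_nat: "keys (\<mu> + \<nu>) = keys \<mu> \<union> keys (\<nu> :: 'a \<Rightarrow>\<^sub>0 nat)"
 by (auto simp: in_keys_iff lookup_add)

lemma zp_zero: "0 \<in> zp m" and zp_one: "1 \<in> zp m"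
 by (auto simp: zpoly_ring_sel)

lemma zp_add: "P \<in> zp m ==> Q \<in> zp m ==> P + Q \<in> zp m"
 using keys_add[of P Q] unfolding zpoly_ring_sel(1) by blast

lemma zp_diff: "P \<in> zp m ==> Q \<in> zp m ==> P - Q \<in> zp m"
 using keys_diff[of P Q] unfolding zpoly_ring_sel(1) by blast

lemma zp_mult: assumes "P \<in> zp m" "Q \<in> zp m" shows "P * Q \<in> zp m"
 unfolding zpoly_ring_sel(1) mem_Collect_eq
proof
 fix \<kappa> assume "\<kappa> \<in> keys (P * Q)"
 then obtain \<mu> \<nu> where "\<kappa> = \<mu> + \<nu>" "\<mu> \<in> keys P" "\<nu> \<in> keys Q" using keys_mult[of P Q] by blast
 then show "keys \<kappa> \<subseteq> {..m}" using assms by (simp add: zpoly_ring_sel keys_add_nat)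
qed

lemma zp_indet: "i \<le> m ==> indet i \<in> zp m"
 by (simp add: zpoly_ring_sel indet_def)

lemma zp_power: "P \<in> zp m ==> P ^ k \<in> zp m"
 by (induction k) (simp_all add: zp_one zp_mult)

lemma zp_sum: "(\<And>i. i \<in> A ==> g i \<in> zp m) ==> sum g A \<in> zp m"
 by (induction A rule: infinite_finite_induct) (simp_all add: zp_zero zp_add)

lemma zp_sum_list: "(\<And>x. x \<in> set L ==> g x \<in> zp m) ==> (\<Sum>x\<leftarrow>L. g x) \<in> zp m"
 by (induction L) (simp_all add: zp_zero zp_add)

lemma frag_of_in_zp: "keys \<mu> \<subseteq> {..m} ==> frag_of \<mu> \<in> zp m"
 by (simp add: zpoly_ring_sel)

lemma cring_zpoly_ring: "cring (zpoly_ring m)"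
proof (rule cringI)
 show "abelian_group (zpoly_ring m)"
 proof (rule abelian_groupI)
  fix P assume "P \<in> zp m"
  then have "- P \<in> zp m" using zp_diff[OF zp_zero, of P m] by simp
  then show "\<exists>Q\<in>zp m. Q \<oplus>\<^bsub>zpoly_ring m\<^esub> P = \<zero>\<^bsub>zpoly_ring m\<^esub>"
   by (intro bexI[of _ "- P"]) (simp_all add: zpoly_ring_sel(4,5))
 qed (simp_all add: zpoly_ring_sel(4,5) zp_zero zp_add algebra_simps)
 show "comm_monoid (zpoly_ring m)"
  by (rule comm_monoidI) (simp_all add: zpoly_ring_sel(2,3) zp_one zp_mult algebra_simps)
qed (simp add: zpoly_ring_sel(2,5) algebra_simps)

lemma indet_power: "indet i ^ k = frag_of (Poly_Mapping.single i k)"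
 by (induction k) (simp_all add: indet_def mult_single single_add[symmetric])

lemma varY_power: "varY ^ k = frag_of (Poly_Mapping.single 0 k)"
 by (simp add: varY_def indet_power)

subsection \<open>Weights\<close>

text \<open>The weight of an indeterminate is chosen such that \<open>f\<^bsub>u,0\<^esub>\<close> has weight at most \<open>u - 1\<close>, while \<open>y\<close> has
weight \<open>0\<close> and does not count.\<close>

definition weight :: "nat => nat => (nat \<Rightarrow>\<^sub>0 nat) => nat" where
 "weight p m \<mu> = (\<Sum>i\<in>{1..m}. lookup \<mu> i * p ^ (i - 1))"

definition wle :: "nat => nat => nat => zpoly => bool" where
 "wle p m V P \<longleftrightarrow> (\<forall>\<mu>\<in>keys P. weight p m \<mu> \<le> V)"

lemma weight_add: "weight p m (\<mu> + \<nu>) = weight p m \<mu> + weight p m \<nu>"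
 by (simp add: weight_def lookup_add distrib_right sum.distrib)

lemma weight_single: "weight p m (Poly_Mapping.single i k) = (if i \<in> {1..m} then k * p ^ (i - 1) else 0)"
proof -
 have "weight p m (Poly_Mapping.single i k) = (\<Sum>j\<in>{1..m}. if j = i then k * p ^ (i - 1) else 0)"
  unfolding weight_def by (intro sum.cong) (auto simp: lookup_single)
 then show ?thesis by (simp only: sum.delta[OF finite_atLeastAtMost])
qed

lemma wle_mono: "wle p m V P ==> V \<le> V' ==> wle p m V' P"
 unfolding wle_def by fastforce

lemma wle_zero: "wle p m V 0" and wle_one: "wle p m V 1"
 by (simp_all add: wle_def weight_def)

lemma wle_add: "wle p m V P ==> wle p m V Q ==> wle p m V (P + Q)"
 using keys_add[of P Q] unfolding wle_def by blast

lemma wle_diff: "wle p m V P ==> wle p m V Q ==> wle p m V (P - Q)"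
 using keys_diff[of P Q] unfolding wle_def by blast

lemma wle_mult: assumes "wle p m V P" "wle p m V' Q" shows "wle p m (V + V') (P * Q)"
 unfolding wle_def
proof
 fix \<kappa> assume "\<kappa> \<in> keys (P * Q)"
 then obtain \<mu> \<nu> where k: "\<kappa> = \<mu> + \<nu>" "\<mu> \<in> keys P" "\<nu> \<in> keys Q" using keys_mult[of P Q] by blast
 have "weight p m \<mu> \<le> V" "weight p m \<nu> \<le> V'" using assms k by (auto simp: wle_def)
 then show "weight p m \<kappa> \<le> V + V'" by (simp add: k(1) weight_add)
qed

lemma wle_frag_of: "weight p m \<mu> \<le> V ==> wle p m V (frag_of \<mu>)"
 by (simp add: wle_def)

lemma wle_sum: "(\<And>i. i \<in> A ==> wle p m V (g i)) ==> wle p m V (sum g A)"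
 by (induction A rule: infinite_finite_induct) (simp_all add: wle_zero wle_add)

lemma wle_sum_list: "(\<And>x. x \<in> set L ==> wle p m V (g x)) ==> wle p m V (\<Sum>x\<leftarrow>L. g x)"
 by (induction L) (simp_all add: wle_zero wle_add)

lemma wle_Y_power: "wle p m V (varY ^ r)"
 unfolding varY_power by (rule wle_frag_of) (simp add: weight_single)

lemma wle_Y: "wle p m V varY"
 using wle_Y_power[of p m V 1] by simp

lemma wle_Z: "wle p m 1 varZ"
 unfolding varZ_def indet_def by (rule wle_frag_of) (simp add: weight_single)

lemma wle_W: "wle p m (p ^ l) (varW l)"
 unfolding varW_def indet_def by (rule wle_frag_of) (simp add: weight_single)

subsection \<open>Reduction modulo monic relations\<close>

definition reduced :: "nat => nat => nat => (nat \<Rightarrow>\<^sub>0 nat) set" where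
 "reduced n p m = {\<mu>. keys \<mu> \<subseteq> {..m} \<and> lookup \<mu> 0 < n \<and> (\<forall>i\<in>{1..m}. lookup \<mu> i < p)}"

lemma reduced_card: "finite (reduced n p m)" "card (reduced n p m) \<le> n * p ^ m"
proof -
 let ?B = "%i. if i = 0 then {..<n} else {..<p}"
 let ?r = "%\<mu> :: nat \<Rightarrow>\<^sub>0 nat. restrict (lookup \<mu>) {..m}"
 have fin: "finite (PiE {..m} ?B)" by (intro finite_PiE) auto
 have inj: "inj_on ?r (reduced n p m)"
 proof (rule inj_onI, rule poly_mapping_eqI)
  fix \<mu> \<nu> i assume h: "\<mu> \<in> reduced n p m" "\<nu> \<in> reduced n p m" "?r \<mu> = ?r \<nu>"
  show "lookup \<mu> i = lookup \<nu> i"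
  proof (cases "i \<le> m")
   case True then show ?thesis using fun_cong[OF h(3), of i] by simp
  next
   case False
   then have "i \<notin> keys \<mu>" "i \<notin> keys \<nu>" using h(1,2) by (auto simp: reduced_def)
   then show ?thesis by (simp add: in_keys_iff)
  qed
 qed
 have sub: "?r ` reduced n p m \<subseteq> PiE {..m} ?B" by (intro image_subsetI restrict_PiE_iff[THEN iffD2]) (auto simp: reduced_def)
 show "finite (reduced n p m)" using inj_on_finite[OF inj sub fin] .
 have "card (PiE {..m} ?B) = (\<Prod>i\<in>{..m}. card (?B i))" by (rule card_PiE) simp
 also have "... = (\<Prod>i\<in>insert 0 {1..m}. card (?B i))" by (rule prod.cong) auto
 also have "(\<Prod>i\<in>insert 0 {1..m}. card (?B i)) = n * (\<Prod>i\<in>{1..m}. p)"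
  by (subst prod.insert) (auto intro!: prod.cong)
 finally show "card (reduced n p m) \<le> n * p ^ m"
  using card_inj_on_le[OF inj sub fin] by simp
qed

text \<open>Replacing \<open>x\<^sub>i\<^sup>p\<close> by \<open>x\<^sub>i\<^sup>p - g\<^sub>i\<close> lowers the weight, so the process stops; then the exponents of \<open>y\<close> are reduced
modulo \<open>n\<close>, which does not change the weight.\<close>

lemma reduction:
 assumes p: "0 < p" and n: "0 < n"
  and g: "\<And>i. i \<in> {1..m} ==> g i \<in> zp m \<and> wle p m (p ^ i - 1) (g i - indet i ^ p)" and g0: "g 0 = varY ^ n - 1"
  and I0: "0 \<in> I" and I_add: "\<And>a b. a \<in> I ==> b \<in> I ==> a + b \<in> I" and I_diff: "\<And>a b. a \<in> I ==> b \<in> I ==> a - b \<in> I"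
  and I_mult: "\<And>a P. P \<in> zp m ==> a \<in> I ==> P * a \<in> I" and I_g: "\<And>i. i \<le> m ==> g i \<in> I"
  and P: "P \<in> zp m"
 shows "\<exists>Q. keys Q \<subseteq> reduced n p m \<and> P - Q \<in> I"
proof -
 define S where "S = {P. \<exists>Q. keys Q \<subseteq> reduced n p m \<and> P - Q \<in> I}"
 have S_I: "a \<in> S" if "a \<in> I" for a using that by (auto simp: S_def intro!: exI[of _ 0])
 have S_red: "frag_of \<mu> \<in> S" if "\<mu> \<in> reduced n p m" for \<mu>
  using that I0 by (auto simp: S_def intro!: exI[of _ "frag_of \<mu>"])
 have S_diff: "a - b \<in> S" if "a \<in> S" "b \<in> S" for a b
 proof -
  from that(1) obtain Q where Q: "keys Q \<subseteq> reduced n p m" "a - Q \<in> I" by (auto simp: S_def)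
  from that(2) obtain Q' where Q': "keys Q' \<subseteq> reduced n p m" "b - Q' \<in> I" by (auto simp: S_def)
  have "keys (Q - Q') \<subseteq> reduced n p m" using keys_diff[of Q Q'] Q(1) Q'(1) by blast
  moreover have "(a - b) - (Q - Q') \<in> I" using I_diff[OF Q(2) Q'(2)] by (simp add: algebra_simps)
  ultimately show ?thesis unfolding S_def by blast
 qed
 have S_0: "0 \<in> S" by (rule S_I[OF I0])
 have S_add: "a + b \<in> S" if "a \<in> S" "b \<in> S" for a b using S_diff[OF that(1) S_diff[OF S_0 that(2)]] by simp
 have Y: "frag_of \<mu> \<in> S" if "keys \<mu> \<subseteq> {..m}" "\<forall>i\<in>{1..m}. lookup \<mu> i < p" for \<mu>
  using that
 proof (induction "lookup \<mu> 0" arbitrary: \<mu> rule: less_induct)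
  case less
  show ?case
  proof (cases "lookup \<mu> 0 < n")
   case True then show ?thesis using less.prems by (intro S_red) (simp add: reduced_def)
  next
   case False
   define \<nu> where "\<nu> = \<mu> - Poly_Mapping.single 0 n"
   have \<mu>: "\<mu> = \<nu> + Poly_Mapping.single 0 n"
    using False by (intro poly_mapping_eqI) (auto simp: \<nu>_def lookup_add lookup_minus lookup_single when_def)
   have \<nu>: "keys \<nu> \<subseteq> {..m}" "\<forall>i\<in>{1..m}. lookup \<nu> i < p" "lookup \<nu> 0 < lookup \<mu> 0"
    using less.prems False n unfolding \<mu> by (auto simp: keys_add_nat lookup_add lookup_single)
   have "frag_of \<mu> = frag_of \<nu> * g 0 + frag_of \<nu>"
    unfolding g0 varY_power right_diff_distrib mult_single \<mu> by simp
   moreover have "frag_of \<nu> * g 0 \<in> S" by (intro S_I I_mult frag_of_in_zp I_g \<nu>(1)) simp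
   ultimately show ?thesis using S_add less.hyps[OF \<nu>(3,1,2)] by simp
  qed
 qed
 have "P \<in> S" if "P \<in> zp m" "wle p m V P" for V P
  using that
 proof (induction V arbitrary: P rule: less_induct)
  case (less V)
  have "keys P \<subseteq> {\<mu>. keys \<mu> \<subseteq> {..m} \<and> weight p m \<mu> \<le> V}"
   using less.prems by (auto simp: zpoly_ring_sel wle_def)
  then show ?case
  proof (induction P rule: frag_induction)
   case (one \<mu>)
   show ?case
   proof (cases "\<forall>i\<in>{1..m}. lookup \<mu> i < p")
    case True then show ?thesis using Y one by simp
   next
    case False
    then obtain i where i: "i \<in> {1..m}" "p \<le> lookup \<mu> i" by (auto simp: not_less)
    define \<nu> where "\<nu> = \<mu> - Poly_Mapping.single i p"
    have \<mu>: "\<mu> = \<nu> + Poly_Mapping.single i p"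
     using i by (intro poly_mapping_eqI) (auto simp: \<nu>_def lookup_add lookup_minus lookup_single when_def)
    have \<nu>: "keys \<nu> \<subseteq> {..m}" using one unfolding \<mu> by (simp add: keys_add_nat)
    have pp: "p * p ^ (i - 1) = p ^ i" using i(1) by (cases i) auto
    have w: "weight p m \<nu> + p ^ i \<le> V"
     using one i(1) pp unfolding \<mu> by (simp add: weight_add weight_single)
    have "0 < p ^ i" using p by simp
    then have lt: "weight p m \<nu> + (p ^ i - 1) < V" using w by linarith
    have "frag_of \<mu> = frag_of \<nu> * g i - frag_of \<nu> * (g i - indet i ^ p)"
     unfolding right_diff_distrib indet_power mult_single \<mu> by simp
    moreover have "frag_of \<nu> * g i \<in> S" using i by (intro S_I I_mult frag_of_in_zp I_g \<nu>) simp
    moreover have "frag_of \<nu> * (g i - indet i ^ p) \<in> S"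
    proof (rule less.IH[OF lt])
     show "frag_of \<nu> * (g i - indet i ^ p) \<in> zp m"
      using g[OF i(1)] i(1) by (intro zp_mult zp_diff zp_power zp_indet frag_of_in_zp \<nu>) simp_all
     show "wle p m (weight p m \<nu> + (p ^ i - 1)) (frag_of \<nu> * (g i - indet i ^ p))"
      using g[OF i(1)] by (intro wle_mult wle_frag_of) simp_all
    qed
    ultimately show ?thesis using S_diff by simp
   qed
  qed (use S_0 S_diff in simp_all)
 qed
 moreover have "\<exists>V. wle p m V P"
  unfolding wle_def by (rule exI[of _ "\<Sum>\<mu>\<in>keys P. weight p m \<mu>"]) (simp add: member_le_sum)
 ultimately show ?thesis using P unfolding S_def by blast
qed

text \<open>If \<open>c a \<noteq> 0\<close> in a relation, then over the rational numbers the vector \<open>v a\<close> could be eliminated, and fewer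
than \<open>card B\<close> vectors would span a space of dimension \<open>card B\<close>.\<close>

lemma spanning_family_independent:
 fixes v :: "'a => 'b => int" and c :: "'a => int"
 assumes A: "finite A" and B: "finite B" and card: "card A \<le> card B"
  and span: "\<And>b. b \<in> B ==> \<exists>e. \<forall>b'\<in>B. (\<Sum>a\<in>A. e a * v a b') = of_bool (b = b')"
  and rel: "\<And>b. b \<in> B ==> (\<Sum>a\<in>A. c a * v a b) = 0" and a: "a \<in> A"
 shows "c a = 0"
proof (rule ccontr)
 assume ca: "c a \<noteq> 0"
 obtain e where e: "\<And>b b'. b \<in> B ==> b' \<in> B ==> (\<Sum>x\<in>A. e b x * v x b') = of_bool (b = b')"
  using span by metis
 let ?\<beta> = "%b x. of_int (e b x) - of_int (e b a) * of_int (c x) / of_int (c a) :: rat"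
 have "card B \<le> card (A - {a})"
 proof (rule card_le_of_left_inverse)
  fix b b' assume b: "b \<in> B" "b' \<in> B"
  have "(\<Sum>x\<in>A - {a}. ?\<beta> b x * of_int (v x b')) = (\<Sum>x\<in>A. ?\<beta> b x * of_int (v x b'))"
   using A ca a by (simp add: sum.remove)
  also have "... = of_int (\<Sum>x\<in>A. e b x * v x b') - of_int (e b a) / of_int (c a) * of_int (\<Sum>x\<in>A. c x * v x b')"
   by (simp add: left_diff_distrib sum_subtractf sum_distrib_left mult.assoc)
  finally show "(\<Sum>x\<in>A - {a}. ?\<beta> b x * of_int (v x b')) = of_bool (b = b')"
   using e[OF b] rel[OF b(2)] by simp
 qed (use A B in simp_all)
 moreover have "card (A - {a}) < card A" using A a by (rule card_Diff1_less)
 ultimately show False using card by simp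
qed

section \<open>The polynomials \<open>f\<^bsub>u,0\<^esub>\<close>\<close>

context green_ring
begin

lemma p_ge2: "2 \<le> p"
 using p(1) by (rule prime_ge_2_nat)

lemma varY_zp: "varY ^ r \<in> zp m" and varY_zp': "varY \<in> zp m" and varZ_zp: "varZ \<in> zp m"
 and varW_zp: "l \<in> {1..m - 1} ==> varW l \<in> zp m"
 using m by (auto simp: varY_def varZ_def varW_def intro!: zp_power zp_indet)

lemma index_cases:
 assumes "1 \<le> u" "u \<le> d"
 obtains "u = 1" | "u = 2" | l where "l \<in> {1..m - 1}" "u = p ^ l + 1" | "recursive_index p m u"
proof -
 consider "u = 1" | "u = 2" | "3 \<le> u" using assms by linarith
 then show ?thesis
 proof cases
  case 3
  show ?thesis
  proof (cases "\<exists>l. u - 1 = p ^ l")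
   case True
   then obtain l where l: "u - 1 = p ^ l" by blast
   have "l \<noteq> 0"
   proof
    assume "l = 0" then have "u - 1 = 1" using l by simp
    then show False using 3 by simp
   qed
   moreover have "p ^ l < p ^ m" using l 3 assms(2) unfolding d by linarith
   then have "l < m" using p_ge2 by (simp add: power_strict_increasing_iff)
   ultimately show ?thesis using that(3)[of l] l 3 by simp
  next
   case False then show ?thesis using 3 assms(2) that(4) by (simp add: recursive_index_def d)
  qed
 qed (use that in blast)+
qed

lemma Bl_bound: "1 \<le> i ==> i \<le> u - 2 ==> j \<le> u - 2 ==> u \<le> d ==> 3 \<le> u ==> (i, j) \<in> Bl"
 using dn unfolding Bl_iff by linarith

lemma direct_sum_indec:
 assumes L: "set L \<subseteq> Bl"
 shows "fin_gen_module H (direct_sum {..<length L} (%s. indec_module n d (fst (L ! s)) (snd (L ! s))))" (is "fin_gen_module H ?V")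
  and "gvec (direct_sum {..<length L} (%s. indec_module n d (fst (L ! s)) (snd (L ! s)))) = vec L"
proof -
 have "realizes n d ?V (famsum (length L) (%s. block n (L ! s)) :: 'k gdata2)"
 proof (rule realizes_direct_sum)
  fix s assume "s < length L"
  then have "L ! s \<in> Bl" using L by auto
  then have "fst (L ! s) \<le> d" "snd (L ! s) < n" by (auto simp: blocks_def)
  from realizes_indec_module[OF n_pos dn this(2,1), where ?'k = 'k]
  show "realizes n d (indec_module n d (fst (L ! s)) (snd (L ! s))) (block n (L ! s) :: (nat, 'k) gdata)" by simp
 qed
 then have R: "realizes n d ?V (std n L :: 'k gdata2)" by (simp only: std_def)
 show "fin_gen_module H ?V" by (rule realizes_fin_gen[OF R])
 show "gvec ?V = vec L" using gvec_realizes[OF R] gvec_std[OF L] by simp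
qed

text \<open>The isomorphisms in the recursion for \<open>f\<^bsub>u,0\<^esub>\<close> are equations between coordinate vectors.\<close>

lemma recursion_iso_iff:
 assumes a: "1 \<le> a" "a \<le> d" and b: "1 \<le> b" "b \<le> d" and u: "1 \<le> u" "u \<le> d" and L: "set L \<subseteq> Bl"
 shows "module_isomorphic H
   (tensor_module n d (indec_module n d a 0 :: ('k trunc, 'k trunc set) module) (indec_module n d b 0))
   (direct_sum2 (indec_module n d u 0) (direct_sum {..<length L} (%s. indec_module n d (fst (L ! s)) (snd (L ! s)))))
  \<longleftrightarrow> tprod (a, 0) (b, 0) = frag_of (u, 0) + vec L"
proof -
 have Bl: "(a, 0) \<in> Bl" "(b, 0) \<in> Bl" "(u, 0) \<in> Bl" using assms n_pos by (simp_all add: Bl_iff)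
 note f = fin_gen_indec[OF a(2) n_pos] fin_gen_indec[OF b(2) n_pos] fin_gen_indec[OF u(2) n_pos]
 show ?thesis
  unfolding gvec_iso[OF gvec_tensor(1)[OF f(1,2)] gvec_direct_sum2(1)[OF f(3) direct_sum_indec(1)[OF L]]]
   gvec_tensor(2)[OF f(1,2)] gvec_direct_sum2(2)[OF f(3) direct_sum_indec(1)[OF L]]
   direct_sum_indec(2)[OF L] gvec_indec[OF Bl(1)] gvec_indec[OF Bl(2)] gvec_indec[OF Bl(3)] gmult_frag_of ..
qed

lemma recursive_indexD:
 assumes "admissible_choice TYPE('k) p m w" "recursive_index p m u"
 shows "1 \<le> w u" "w u \<le> u - 2" "(of_nat ((u - 1) choose (w u)) :: 'k) \<noteq> 0" "3 \<le> u" "u \<le> d"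
  "1 \<le> u - w u" "u - w u < u" "w u + 1 < u" "u - w u \<le> d" "w u + 1 \<le> d"
 using assms by (auto simp: admissible_choice_def recursive_index_def d)

text \<open>The recursion refers to smaller indices only: \<open>u - w u\<close> and \<open>w u + 1\<close> are less than \<open>u\<close>, and so are the
lengths of the complementary summands.\<close>

lemma f_family_exists:
 assumes adm: "admissible_choice TYPE('k) p m w"
 shows "\<exists>f. f_family TYPE('k) n p m w f"
proof -
 have "\<exists>L. recursive_index p m u --> (\<forall>x\<in>set L. 1 \<le> fst x \<and> 1 \<le> snd x \<and> fst x \<le> u - 2 \<and> snd x \<le> u - 2) \<and>
   tprod (u - w u, 0) (w u + 1, 0) = frag_of (u, 0) + vec L" for u
 proof (cases "recursive_index p m u")
  case True
  note r = recursive_indexD[OF adm True]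
  have "(u - 1) choose (u - w u - 1) = (u - 1) choose (w u)"
   using binomial_symmetric[of "w u" "u - 1"] r(2,4) by (simp add: diff_commute)
  then have "(of_nat ((u - 1) choose (u - w u - 1)) :: 'k) \<noteq> 0" using r(3) by simp
  from tensor_top_summand[OF r(6) _ _ r(5) this, of "w u + 1"] show ?thesis using r by simp
 qed blast
 then obtain L where L: "\<And>u. recursive_index p m u ==> \<forall>x\<in>set (L u). 1 \<le> fst x \<and> 1 \<le> snd x \<and> fst x \<le> u - 2 \<and> snd x \<le> u - 2"
  "\<And>u. recursive_index p m u ==> tprod (u - w u, 0) (w u + 1, 0) = frag_of (u, 0) + vec (L u)"
  by metis
 define F where "F g u = (if u = 1 then 1 else if u = 2 then varZ
   else if \<exists>l. u = p ^ l + 1 then varW (THE l. u = p ^ l + 1)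
   else g (u - w u) * g (w u + 1) - (\<Sum>(i, j)\<leftarrow>L u. varY ^ j * g i))" for g :: "nat => zpoly" and u
 define f where "f = wfrec less_than F"
 have f: "f u = F (cut f less_than u) u" for u
  unfolding f_def by (rule wfrec[OF wf_less_than])
 have "f (p ^ l + 1) = varW l" if l: "l \<in> {1..m - 1}" for l
 proof -
  have "2 \<le> p ^ l" using p_ge2 l self_le_power[of p l] by simp
  moreover have "(THE l'. p ^ l + 1 = p ^ l' + 1) = l"
   using p_ge2 by (intro the_equality) (auto simp: power_inject_exp)
  moreover have "\<exists>l'. p ^ l + 1 = p ^ l' + 1" by blast
  ultimately show ?thesis unfolding f[of "p ^ l + 1"] F_def using p_ge2 by auto
 qed
 moreover have "\<exists>L :: (nat \<times> nat) list. (\<forall>(i, j)\<in>set L. 1 \<le> i \<and> i \<le> u - 2 \<and> 1 \<le> j \<and> j \<le> u - 2) \<and>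
   module_isomorphic H
    (tensor_module n d (indec_module n d (u - w u) 0 :: ('k trunc, 'k trunc set) module) (indec_module n d (w u + 1) 0))
    (direct_sum2 (indec_module n d u 0) (direct_sum {..<length L} (%s. indec_module n d (fst (L ! s)) (snd (L ! s))))) \<and>
   f u = f (u - w u) * f (w u + 1) - (\<Sum>(i, j)\<leftarrow>L. varY ^ j * f i)" if u: "recursive_index p m u" for u
 proof (intro exI[of _ "L u"] conjI)
  note r = recursive_indexD[OF adm u]
  show "\<forall>(i, j)\<in>set (L u). 1 \<le> i \<and> i \<le> u - 2 \<and> 1 \<le> j \<and> j \<le> u - 2" using L(1)[OF u] by auto
  have "set (L u) \<subseteq> Bl" using L(1)[OF u] r(4,5) Bl_bound by auto
  then show "module_isomorphic H
    (tensor_module n d (indec_module n d (u - w u) 0 :: ('k trunc, 'k trunc set) module) (indec_module n d (w u + 1) 0))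
    (direct_sum2 (indec_module n d u 0) (direct_sum {..<length (L u)} (%s. indec_module n d (fst (L u ! s)) (snd (L u ! s)))))"
   using r L(2)[OF u] by (subst recursion_iso_iff) simp_all
  have "(\<nexists>l. u = p ^ l + 1)" using u by (auto simp: recursive_index_def)
  then have "f u = cut f less_than u (u - w u) * cut f less_than u (w u + 1)
    - (\<Sum>(i, j)\<leftarrow>L u. varY ^ j * cut f less_than u i)"
   unfolding f[of u] F_def using r(4) by simp
  also have "(\<Sum>(i, j)\<leftarrow>L u. varY ^ j * cut f less_than u i) = (\<Sum>(i, j)\<leftarrow>L u. varY ^ j * f i)"
  proof (rule arg_cong[of _ _ sum_list], rule map_cong[OF refl])
   fix x assume "x \<in> set (L u)"
   then have "fst x < u" using L(1)[OF u] r(4) by fastforce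
   then show "(case x of (i, j) => varY ^ j * cut f less_than u i) = (case x of (i, j) => varY ^ j * f i)"
    by (simp add: split_def cut_apply)
  qed
  finally show "f u = f (u - w u) * f (w u + 1) - (\<Sum>(i, j)\<leftarrow>L u. varY ^ j * f i)"
   using r(7,8) by (simp add: cut_apply)
 qed
 moreover have "f 1 = 1" "f 2 = varZ" unfolding f[of 1] f[of 2] F_def by simp_all
 ultimately show ?thesis unfolding f_family_def d by blast
qed

lemma f_family_cases:
 assumes fam: "f_family TYPE('k) n p m w f" and adm: "admissible_choice TYPE('k) p m w" and u: "1 \<le> u" "u \<le> d"
 obtains "u = 1" "f u = 1" | "u = 2" "f u = varZ" | l where "l \<in> {1..m - 1}" "u = p ^ l + 1" "f u = varW l"
  | L where "recursive_index p m u" "\<And>i j. (i, j) \<in> set L ==> 1 \<le> i \<and> i \<le> u - 2 \<and> (i, j) \<in> Bl"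
   "tprod (u - w u, 0) (w u + 1, 0) = frag_of (u, 0) + vec L"
   "f u = f (u - w u) * f (w u + 1) - (\<Sum>(i, j)\<leftarrow>L. varY ^ j * f i)"
 using u
proof (cases rule: index_cases)
 case 4
 note r = recursive_indexD[OF adm 4]
 obtain L :: "(nat \<times> nat) list" where L: "\<forall>(i, j)\<in>set L. 1 \<le> i \<and> i \<le> u - 2 \<and> 1 \<le> j \<and> j \<le> u - 2"
  "module_isomorphic H
    (tensor_module n d (indec_module n d (u - w u) 0 :: ('k trunc, 'k trunc set) module) (indec_module n d (w u + 1) 0))
    (direct_sum2 (indec_module n d u 0) (direct_sum {..<length L} (%s. indec_module n d (fst (L ! s)) (snd (L ! s)))))"
  "f u = f (u - w u) * f (w u + 1) - (\<Sum>(i, j)\<leftarrow>L. varY ^ j * f i)"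
  using fam 4 unfolding f_family_def d[symmetric] by blast
 have LBl: "1 \<le> i \<and> i \<le> u - 2 \<and> (i, j) \<in> Bl" if "(i, j) \<in> set L" for i j
  using L(1) that Bl_bound[of i u j] r(4,5) by blast
 then have "set L \<subseteq> Bl" by auto
 then have "tprod (u - w u, 0) (w u + 1, 0) = frag_of (u, 0) + vec L"
  using L(2) recursion_iso_iff[of "u - w u" "w u + 1" u L] r by simp
 then show ?thesis using that(4)[OF 4 LBl] L(3) by blast
qed (use fam that in \<open>auto simp: f_family_def\<close>)

lemma f_family_bounds:
 assumes fam: "f_family TYPE('k) n p m w f" and adm: "admissible_choice TYPE('k) p m w" and u: "1 \<le> u" "u \<le> d"
 shows "f u \<in> zp m \<and> wle p m (u - 1) (f u)"
 using u
proof (induction u rule: less_induct)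
 case (less u)
 from fam adm less.prems show ?case
 proof (cases rule: f_family_cases)
  case 1 then show ?thesis by (simp add: zp_one wle_one)
 next
  case 2 then show ?thesis using wle_Z[of p m] zp_indet[of 1 m] m by (simp add: varZ_def)
 next
  case (3 l) then show ?thesis using wle_W[of p m l] zp_indet[of "l + 1" m] m by (auto simp: varW_def)
 next
  case (4 L)
  note r = recursive_indexD[OF adm 4(1)]
  have 1: "f (u - w u) \<in> zp m \<and> wle p m (u - w u - 1) (f (u - w u))" using less.IH[OF r(7,6,9)] .
  have 2: "f (w u + 1) \<in> zp m \<and> wle p m (w u) (f (w u + 1))" using less.IH[OF r(8) _ r(10)] by simp
  have 3: "f i \<in> zp m \<and> wle p m (u - 1) (f i)" if "(i, j) \<in> set L" for i j
  proof -
   have i: "1 \<le> i" "i \<le> u - 2" using 4(2)[OF that] by auto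
   then have "i < u" "i \<le> d" using r(4,5) by auto
   then have "f i \<in> zp m \<and> wle p m (i - 1) (f i)" using less.IH[of i] i by simp
   then show ?thesis using wle_mono[of p m "i - 1" "f i" "u - 1"] i by auto
  qed
  have "(u - w u - 1) + w u = u - 1" using r(6,7) by simp
  then have "wle p m (u - 1) (f (u - w u) * f (w u + 1))" using wle_mult[of p m "u - w u - 1" "f (u - w u)" "w u"] 1 2 by metis
  moreover have "wle p m (u - 1) (\<Sum>(i, j)\<leftarrow>L. varY ^ j * f i)"
  proof (rule wle_sum_list)
   fix x assume x: "x \<in> set L"
   show "wle p m (u - 1) (case x of (i, j) => varY ^ j * f i)"
    using wle_mult[OF wle_Y_power[of p m 0], of "u - 1" "f (fst x)" "snd x"] 3[of "fst x" "snd x"] x by (simp add: split_def)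
  qed
  moreover have "(\<Sum>(i, j)\<leftarrow>L. varY ^ j * f i) \<in> zp m"
  proof (rule zp_sum_list)
   fix x assume x: "x \<in> set L"
   then show "(case x of (i, j) => varY ^ j * f i) \<in> zp m"
    using 3[of "fst x" "snd x"] by (simp add: split_def zp_mult zp_power varY_def zp_indet)
  qed
  ultimately show ?thesis unfolding 4(4) using 1 2 by (simp add: wle_diff zp_diff zp_mult)
 qed
qed

end

section \<open>Evaluation in the representation ring\<close>

text \<open>The composite of an epimorphism with \<open>\<Gamma>\<close>. Only the values on polynomials in the given
indeterminates are constrained.\<close>

locale rep_evaluation = green_ring n p m d ty for n p m d and ty :: "'k::field itself" +
 fixes \<psi> :: "zpoly => bvec"
 assumes \<psi>_add: "P \<in> zp m ==> Q \<in> zp m ==> \<psi> (P + Q) = \<psi> P + \<psi> Q"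
  and \<psi>_mult: "P \<in> zp m ==> Q \<in> zp m ==> \<psi> (P * Q) = gmult (\<psi> P) (\<psi> Q)"
  and \<psi>_one: "\<psi> 1 = frag_of (1, 0)" and \<psi>_Y: "\<psi> varY = frag_of (1, 1)" and \<psi>_Z: "\<psi> varZ = frag_of (2, 0)"
  and \<psi>_W: "l \<in> {1..m - 1} ==> \<psi> (varW l) = frag_of (p ^ l + 1, 0)"
begin

lemma \<psi>_zero: "\<psi> 0 = 0"
 using \<psi>_add[OF zp_zero zp_zero] by simp

lemma \<psi>_diff: "P \<in> zp m ==> Q \<in> zp m ==> \<psi> (P - Q) = \<psi> P - \<psi> Q"
 using \<psi>_add[OF zp_diff, of P Q Q] by simp

lemma \<psi>_sum: "(\<And>i. i \<in> A ==> g i \<in> zp m) ==> \<psi> (sum g A) = (\<Sum>i\<in>A. \<psi> (g i))"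
 by (induction A rule: infinite_finite_induct) (simp_all add: \<psi>_zero \<psi>_add zp_sum)

lemma \<psi>_sum_list: "(\<And>x. x \<in> set L ==> g x \<in> zp m) ==> \<psi> (\<Sum>x\<leftarrow>L. g x) = (\<Sum>x\<leftarrow>L. \<psi> (g x))"
 by (induction L) (simp_all add: \<psi>_zero \<psi>_add zp_sum_list)

lemma \<psi>_Y_power: "\<psi> (varY ^ r) = frag_of (1, r mod n)"
proof (induction r)
 case 0 then show ?case using \<psi>_one n_pos by simp
next
 case (Suc r)
 have "(1, r mod n) \<in> Bl" "1 < n" using n_pos d_ge2 dn by (simp_all add: Bl_iff)
 then show ?case
  using \<psi>_mult[OF varY_zp[of 1] varY_zp[of r]] gmult_shift[of 1 1 "r mod n"] Suc \<psi>_Y by (simp add: mod_Suc_eq)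
qed

lemma \<psi>_Y_mult:
 assumes "P \<in> zp m" "\<psi> P = frag_of (u, 0)" "1 \<le> u" "u \<le> d"
 shows "\<psi> (varY ^ r * P) = frag_of (u, r mod n)"
 using \<psi>_mult[OF varY_zp assms(1), of r] gmult_shift[of "r mod n" u 0] assms n_pos by (simp add: \<psi>_Y_power Bl_iff)

lemma \<psi>_f:
 assumes fam: "f_family TYPE('k) n p m w f" and adm: "admissible_choice TYPE('k) p m w" and u: "1 \<le> u" "u \<le> d"
 shows "\<psi> (f u) = frag_of (u, 0)"
 using u
proof (induction u rule: less_induct)
 case (less u)
 note zp = f_family_bounds[OF fam adm, THEN conjunct1]
 from fam adm less.prems show ?case
 proof (cases rule: f_family_cases)
  case (4 L)
  note r = recursive_indexD[OF adm 4(1)]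
  have i: "1 \<le> i" "i \<le> d" "i < u" "j < n" if "(i, j) \<in> set L" for i j
   using 4(2)[OF that] r(4) by (auto simp: Bl_iff)
  have 1: "\<psi> (f (u - w u) * f (w u + 1)) = tprod (u - w u, 0) (w u + 1, 0)"
   using \<psi>_mult[OF zp[OF r(6,9)] zp[OF _ r(10)]] less.IH[OF r(7,6,9)] less.IH[OF r(8) _ r(10)] by (simp add: gmult_frag_of)
  have z: "varY ^ snd x * f (fst x) \<in> zp m" if "x \<in> set L" for x
   using zp[of "fst x"] i[of "fst x" "snd x"] that by (simp add: zp_mult varY_zp)
  have "(\<Sum>x\<leftarrow>L. \<psi> (varY ^ snd x * f (fst x))) = (\<Sum>x\<leftarrow>L. frag_of x)"
  proof (rule arg_cong[of _ _ sum_list], rule map_cong[OF refl])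
   fix x assume "x \<in> set L"
   then have x: "1 \<le> fst x" "fst x \<le> d" "fst x < u" "snd x < n" using i[of "fst x" "snd x"] by simp_all
   show "\<psi> (varY ^ snd x * f (fst x)) = frag_of x"
    using \<psi>_Y_mult[OF zp[OF x(1,2)] less.IH[OF x(3,1,2)] x(1,2), of "snd x"] x(4) by simp
  qed
  then have 2: "\<psi> (\<Sum>x\<leftarrow>L. varY ^ snd x * f (fst x)) = vec L"
   using \<psi>_sum_list[of L "%x. varY ^ snd x * f (fst x)"] z by (simp add: vec_def)
  show ?thesis
   unfolding 4(4) split_def
   using \<psi>_diff[OF zp_mult[OF zp[OF r(6,9)] zp[OF _ r(10)]] zp_sum_list[of L "%x. varY ^ snd x * f (fst x)", OF z]] 1 2 4(3)
   by simp
 qed (use \<psi>_one \<psi>_Z \<psi>_W in simp_all)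
qed

lemma \<psi>_f_shift:
 assumes fam: "f_family TYPE('k) n p m w f" and adm: "admissible_choice TYPE('k) p m w" and u: "1 \<le> u" "u \<le> d"
 shows "f_shift f u r \<in> zp m" "\<psi> (f_shift f u r) = frag_of (u, r mod n)"
 using \<psi>_Y_mult[OF f_family_bounds[OF fam adm u, THEN conjunct1] \<psi>_f[OF fam adm u] u]
  f_family_bounds[OF fam adm u] by (simp_all add: f_shift_def zp_mult varY_zp)

lemma \<psi>_surjective:
 assumes fam: "f_family TYPE('k) n p m w f" and adm: "admissible_choice TYPE('k) p m w" and g: "keys g \<subseteq> Bl"
 shows "\<exists>P\<in>zp m. \<psi> P = g"
 using g
proof (induction g rule: frag_induction)
 case zero show ?case using zp_zero \<psi>_zero by blast
next
 case (one x)
 then have "1 \<le> fst x" "fst x \<le> d" "snd x < n" by (auto simp: blocks_def)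
 then show ?case using \<psi>_f_shift[OF fam adm, of "fst x" "snd x"] by (intro bexI[of _ "f_shift f (fst x) (snd x)"]) simp_all
next
 case (diff a b)
 then obtain P Q where "P \<in> zp m" "\<psi> P = a" "Q \<in> zp m" "\<psi> Q = b" by blast
 then show ?case using zp_diff \<psi>_diff by (intro bexI[of _ "P - Q"]) simp_all
qed

end

subsection \<open>The relations\<close>

lemma h_poly_Suc:
 "1 \<le> k ==> h_poly p f l (Suc k) = varW l * h_poly p f l k - f_shift f ((k + 1) * p ^ l - 1) 1
   - (\<Sum>j = 2..p ^ l - 1. f_shift f (k * p ^ l) j) - f_shift f ((k - 1) * p ^ l + 1) (p ^ l)"
 by (cases k) (simp_all add: Let_def)

lemma g_poly_Suc:
 "1 \<le> l ==> g_poly n p f (Suc l) = varW l * h_poly p f l (p - 1) - f_shift f (p * p ^ l) 0 - f_shift f (p * p ^ l) 1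
   - (\<Sum>j = 2..p ^ l - 1. f_shift f ((p - 1) * p ^ l) j) - f_shift f ((p - 2) * p ^ l + 1) (p ^ l)"
 by (cases l) (simp_all add: Let_def)

context green_ring
begin

lemma f_shift_bounds:
 assumes "f_family TYPE('k) n p m w f" "admissible_choice TYPE('k) p m w" "1 \<le> u" "u \<le> d" "u - 1 \<le> V"
 shows "f_shift f u r \<in> zp m" "wle p m V (f_shift f u r)"
proof -
 note b = f_family_bounds[OF assms(1-4)]
 show "f_shift f u r \<in> zp m" using b by (simp add: f_shift_def zp_mult varY_zp)
 have "wle p m (0 + (u - 1)) (f_shift f u r)" unfolding f_shift_def using b by (intro wle_mult wle_Y_power) simp
 then show "wle p m V (f_shift f u r)" using wle_mono assms(5) by simp
qed

lemma a_poly_bounds: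
 "1 \<le> k ==> a_poly k \<in> zp m \<and> wle p m (k - 1) (a_poly k) \<and> (2 \<le> k --> wle p m (k - 2) (a_poly k - varZ ^ (k - 1)))"
proof (induction k rule: a_poly.induct)
 case 2 show ?case by (simp add: zp_one wle_one)
next
 case 3 show ?case using wle_Z by (simp add: varZ_zp wle_zero)
next
 case (4 k)
 have 1: "a_poly (Suc (Suc k)) \<in> zp m" "wle p m (k + 1) (a_poly (Suc (Suc k)))"
  "wle p m k (a_poly (Suc (Suc k)) - varZ ^ (k + 1))" using 4(1) by simp_all
 have 2: "a_poly (Suc k) \<in> zp m" "wle p m k (a_poly (Suc k))" using 4(2) by simp_all
 have Y: "wle p m (0 + k) (varY * a_poly (Suc k))" by (rule wle_mult[OF wle_Y 2(2)])
 have "wle p m (1 + (k + 1)) (varZ * a_poly (Suc (Suc k)))" by (rule wle_mult[OF wle_Z 1(2)])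
 then have "wle p m (k + 2) (a_poly (Suc (Suc (Suc k))))"
  using wle_diff[of p m "k + 2" "varZ * a_poly (Suc (Suc k))"] wle_mono[OF Y, of "k + 2"] by simp
 moreover have "wle p m (1 + k) (varZ * (a_poly (Suc (Suc k)) - varZ ^ (k + 1)))" by (rule wle_mult[OF wle_Z 1(3)])
 then have "wle p m (k + 1) (varZ * (a_poly (Suc (Suc k)) - varZ ^ (k + 1)) - varY * a_poly (Suc k))"
  using wle_diff[of p m "k + 1"] wle_mono[OF Y, of "k + 1"] by simp
 moreover have "varZ * (a_poly (Suc (Suc k)) - varZ ^ (k + 1)) - varY * a_poly (Suc k) = a_poly (Suc (Suc (Suc k))) - varZ ^ (k + 2)"
  by (simp add: algebra_simps)
 moreover have "a_poly (Suc (Suc (Suc k))) \<in> zp m"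
  using 1(1) 2(1) by (simp add: zp_diff zp_mult varZ_zp varY_zp')
 ultimately show ?case by (simp del: a_poly.simps)
qed simp

lemma q_bounds:
 assumes "l \<in> {1..m - 1}" shows "2 \<le> p ^ l" "p * p ^ l \<le> d" "p ^ l < n" "1 \<le> l" "l < m"
proof -
 show l: "1 \<le> l" "l < m" using assms m by auto
 show "2 \<le> p ^ l" using l p_ge2 self_le_power[of p l] by simp
 show pq: "p * p ^ l \<le> d" unfolding d using l p_ge2 power_increasing[of "Suc l" m p] by simp
 have "1 * p ^ l < p * p ^ l" using p_ge2 by (intro mult_strict_right_mono) auto
 then show "p ^ l < n" using pq dn by linarith
qed

text \<open>The polynomial \<open>h\<^sub>k\<close> is \<open>w\<^sub>l\<^sup>k\<close> up to smaller weight; hence the relation \<open>g\<^bsub>l+1\<^esub>\<close> has leading term \<open>w\<^sub>l\<^sup>p\<close>.\<close>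

lemma h_poly_bounds:
 assumes fam: "f_family TYPE('k) n p m w f" and adm: "admissible_choice TYPE('k) p m w"
  and l: "l \<in> {1..m - 1}" and k: "1 \<le> k" "k < p"
 shows "h_poly p f l k \<in> zp m \<and> wle p m (k * p ^ l - 1) (h_poly p f l k - varW l ^ k)"
 using k
proof (induction k rule: nat_induct_at_least)
 case base show ?case using varW_zp[OF l] by (simp add: wle_zero)
next
 case (Suc k)
 let ?q = "p ^ l" and ?V = "Suc k * p ^ l - 1"
 have "(k + 1) * ?q \<le> p * ?q" using Suc.prems by (intro mult_right_mono) auto
 then have kq: "(k + 1) * ?q \<le> d" using q_bounds(2)[OF l] by simp
 obtain i where i: "k = Suc i" using Suc.hyps by (cases k) auto
 have b: "1 \<le> (k + 1) * ?q - 1" "(k + 1) * ?q - 1 \<le> d" "1 \<le> k * ?q" "k * ?q \<le> d" "1 \<le> (k - 1) * ?q + 1" "(k - 1) * ?q + 1 \<le> d"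
  "(k + 1) * ?q - 1 - 1 \<le> ?V" "k * ?q - 1 \<le> ?V" "(k - 1) * ?q + 1 - 1 \<le> ?V"
  using kq q_bounds(1)[OF l] by (simp_all add: i)
 note F = f_shift_bounds[OF fam adm]
 note Fz = f_shift_bounds(1)[OF fam adm _ _ order_refl]
 have IH: "h_poly p f l k \<in> zp m" "wle p m (k * ?q - 1) (h_poly p f l k - varW l ^ k)" using Suc by simp_all
 have "wle p m (?q + (k * ?q - 1)) (varW l * (h_poly p f l k - varW l ^ k))" by (rule wle_mult[OF wle_W IH(2)])
 moreover have "?q + (k * ?q - 1) = ?V" using b(3) by simp
 ultimately have W: "wle p m ?V (varW l * (h_poly p f l k - varW l ^ k))" by simp
 have "wle p m ?V (varW l * (h_poly p f l k - varW l ^ k) - f_shift f ((k + 1) * ?q - 1) 1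
   - (\<Sum>j = 2..?q - 1. f_shift f (k * ?q) j) - f_shift f ((k - 1) * ?q + 1) ?q)"
  by (intro wle_diff W wle_sum F(2) b)
 moreover have "varW l * (h_poly p f l k - varW l ^ k) - f_shift f ((k + 1) * ?q - 1) 1
   - (\<Sum>j = 2..?q - 1. f_shift f (k * ?q) j) - f_shift f ((k - 1) * ?q + 1) ?q = h_poly p f l (Suc k) - varW l ^ Suc k"
  unfolding h_poly_Suc[OF Suc.hyps] by (simp add: right_diff_distrib)
 moreover have "h_poly p f l (Suc k) \<in> zp m"
  unfolding h_poly_Suc[OF Suc.hyps] by (intro zp_diff zp_mult zp_sum varW_zp l IH Fz b)
 ultimately show ?case by simp
qed

lemma g_poly_bounds:
 assumes fam: "f_family TYPE('k) n p m w f" and adm: "admissible_choice TYPE('k) p m w" and i: "i \<in> {1..m}"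
 shows "g_poly n p f i \<in> zp m \<and> wle p m (p ^ i - 1) (g_poly n p f i - indet i ^ p)"
proof (cases "i = 1")
 case True
 have a: "a_poly p \<in> zp m" "wle p m (p - 1) (a_poly p)" "wle p m (p - 2) (a_poly p - varZ ^ (p - 1))"
  using a_poly_bounds[of p] p_ge2 by simp_all
 have "wle p m (1 + (p - 2)) (varZ * (a_poly p - varZ ^ (p - 1)))" by (rule wle_mult[OF wle_Z a(3)])
 moreover have "1 + (p - 2) = p - 1" using p_ge2 by simp
 moreover have "wle p m (0 + (p - 1)) ((varY + 1) * a_poly p)" by (intro wle_mult wle_add wle_Y wle_one a(2))
 ultimately have "wle p m (p - 1) (varZ * (a_poly p - varZ ^ (p - 1)) - (varY + 1) * a_poly p)"
  by (intro wle_diff) simp_all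
 moreover have "varZ * varZ ^ (p - 1) = varZ ^ p" using p_ge2 by (cases p) auto
 then have "varZ * (a_poly p - varZ ^ (p - 1)) - (varY + 1) * a_poly p = g_poly n p f 1 - indet 1 ^ p"
  by (simp add: algebra_simps varZ_def)
 moreover have "g_poly n p f 1 \<in> zp m" using a(1) by (simp add: zp_diff zp_mult zp_one varZ_zp varY_zp')
 ultimately show ?thesis using True by simp
next
 case False
 then obtain l where il: "i = Suc l" and l: "l \<in> {1..m - 1}" using i by (cases i) auto
 let ?q = "p ^ l" and ?V = "p * p ^ l - 1"
 note qb = q_bounds[OF l]
 obtain t where t: "p = Suc (Suc t)" using p_ge2 by (metis Suc_le_D numeral_2_eq_2 Suc_le_mono)
 have b: "1 \<le> p * ?q" "1 \<le> (p - 1) * ?q" "(p - 1) * ?q \<le> d" "1 \<le> (p - 2) * ?q + 1" "(p - 2) * ?q + 1 \<le> d"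
  "p * ?q - 1 \<le> ?V" "(p - 1) * ?q - 1 \<le> ?V" "(p - 2) * ?q + 1 - 1 \<le> ?V"
  using qb(1,2) unfolding t by simp_all
 note F = f_shift_bounds[OF fam adm]
 note Fz = f_shift_bounds(1)[OF fam adm _ _ order_refl]
 have h: "h_poly p f l (p - 1) \<in> zp m" "wle p m ((p - 1) * ?q - 1) (h_poly p f l (p - 1) - varW l ^ (p - 1))"
  using h_poly_bounds[OF fam adm l, of "p - 1"] p_ge2 by simp_all
 have "wle p m (?q + ((p - 1) * ?q - 1)) (varW l * (h_poly p f l (p - 1) - varW l ^ (p - 1)))" by (rule wle_mult[OF wle_W h(2)])
 moreover have "?q + ((p - 1) * ?q - 1) = ?V" using qb(1) unfolding t by simp
 ultimately have W: "wle p m ?V (varW l * (h_poly p f l (p - 1) - varW l ^ (p - 1)))" by simp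
 have "wle p m ?V (varW l * (h_poly p f l (p - 1) - varW l ^ (p - 1)) - f_shift f (p * ?q) 0 - f_shift f (p * ?q) 1
   - (\<Sum>j = 2..?q - 1. f_shift f ((p - 1) * ?q) j) - f_shift f ((p - 2) * ?q + 1) ?q)"
  by (intro wle_diff W wle_sum F(2) b qb(2))
 moreover have "varW l * varW l ^ (p - 1) = indet i ^ p" using p_ge2 by (cases p) (auto simp: varW_def il)
 then have "varW l * (h_poly p f l (p - 1) - varW l ^ (p - 1)) - f_shift f (p * ?q) 0 - f_shift f (p * ?q) 1
   - (\<Sum>j = 2..?q - 1. f_shift f ((p - 1) * ?q) j) - f_shift f ((p - 2) * ?q + 1) ?q = g_poly n p f i - indet i ^ p"
  unfolding il g_poly_Suc[OF qb(4)] by (simp add: right_diff_distrib)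
 moreover have "g_poly n p f i \<in> zp m"
  unfolding il g_poly_Suc[OF qb(4)] by (intro zp_diff zp_mult zp_sum varW_zp l h Fz b qb(2))
 ultimately show ?thesis by (simp add: il)
qed

end

context rep_evaluation
begin

text \<open>The recursion for \<open>a\<^sub>k\<close> is the decomposition of \<open>M(2, 0) \<otimes> M(k, 0)\<close>, solved for the longest summand;
that for \<open>h\<^sub>k\<close> below is the decomposition of \<open>M(q + 1, 0) \<otimes> M(kq + 1, 0)\<close>.\<close>

lemma \<psi>_a_poly: "1 \<le> k ==> k \<le> p ==> \<psi> (a_poly k) = frag_of (k, 0)"
proof (induction k rule: a_poly.induct)
 case (4 k)
 have zp: "a_poly (Suc (Suc k)) \<in> zp m" "a_poly (Suc k) \<in> zp m" using a_poly_bounds by simp_all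
 have pd: "p \<le> d" unfolding d using m p_ge2 self_le_power[of p m] by simp
 have n2: "1 < n" using d_ge2 dn by simp
 have 1: "\<psi> (a_poly (Suc (Suc k))) = frag_of (Suc (Suc k), 0)" using 4(1,4) by simp
 have 2: "\<psi> (a_poly (Suc k)) = frag_of (Suc k, 0)" using 4(2,4) by simp
 have "\<psi> (varY * a_poly (Suc k)) = frag_of (Suc k, 1)"
  using \<psi>_Y_mult[OF zp(2) 2, of 1] 4(4) pd n2 by simp
 moreover have "\<psi> (varZ * a_poly (Suc (Suc k))) = frag_of (Suc (Suc (Suc k)), 0) + frag_of (Suc k, 1)"
  using \<psi>_mult[OF varZ_zp zp(1)] 1 \<psi>_Z product_two[of "Suc (Suc k)"] 4(4) by (simp add: gmult_frag_of)
 ultimately show ?case using \<psi>_diff[OF zp_mult[OF varZ_zp zp(1)] zp_mult[OF varY_zp' zp(2)]] by simp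
qed (use \<psi>_one \<psi>_Z in \<open>simp_all add: numeral_2_eq_2\<close>)

context
 fixes w f
 assumes fam: "f_family TYPE('k) n p m w f" and adm: "admissible_choice TYPE('k) p m w"
begin

lemma \<psi>_f_shift_sum:
 assumes "1 \<le> u" "u \<le> d" "q \<le> n"
 shows "\<psi> (\<Sum>j = 2..q - 1. f_shift f u j) = (\<Sum>j = 2..q - 1. frag_of (u, j))"
proof -
 have "\<psi> (\<Sum>j = 2..q - 1. f_shift f u j) = (\<Sum>j = 2..q - 1. \<psi> (f_shift f u j))"
  by (rule \<psi>_sum) (rule \<psi>_f_shift(1)[OF fam adm assms(1,2)])
 also have "... = (\<Sum>j = 2..q - 1. frag_of (u, j))"
  using \<psi>_f_shift(2)[OF fam adm assms(1,2)] assms(3) by (intro sum.cong) auto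
 finally show ?thesis .
qed

lemma \<psi>_h_poly:
 assumes l: "l \<in> {1..m - 1}" and k: "1 \<le> k" "k < p"
 shows "\<psi> (h_poly p f l k) = frag_of (k * p ^ l + 1, 0)"
 using k
proof (induction k rule: nat_induct_at_least)
 case base show ?case using \<psi>_W[OF l] by simp
next
 case (Suc k)
 let ?q = "p ^ l"
 note qb = q_bounds[OF l]
 have "(k + 1) * ?q \<le> p * ?q" using Suc.prems by (intro mult_right_mono) auto
 then have kq: "(k + 1) * ?q \<le> d" using qb(2) by simp
 obtain i where i: "k = Suc i" using Suc.hyps by (cases k) auto
 have b: "1 \<le> (k + 1) * ?q - 1" "(k + 1) * ?q - 1 \<le> d" "1 \<le> k * ?q" "k * ?q \<le> d" "1 \<le> (k - 1) * ?q + 1" "(k - 1) * ?q + 1 \<le> d"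
  using kq qb(1) by (simp_all add: i)
 have h: "h_poly p f l k \<in> zp m" using h_poly_bounds[OF fam adm l Suc.hyps] Suc.prems by simp
 note F = \<psi>_f_shift[OF fam adm]
 have n2: "1 mod n = 1" "?q mod n = ?q" using d_ge2 dn qb(3) by simp_all
 have k1: "k + 1 < p" using Suc.prems by simp
 have W: "\<psi> (varW l * h_poly p f l k) = tprod (?q + 1, 0) (k * ?q + 1, 0)"
  using \<psi>_mult[OF varW_zp[OF l] h] Suc \<psi>_W[OF l] by (simp add: gmult_frag_of)
 have "\<psi> (h_poly p f l (Suc k)) = tprod (?q + 1, 0) (k * ?q + 1, 0) - frag_of ((k + 1) * ?q - 1, 1)
   - (\<Sum>j = 2..?q - 1. frag_of (k * ?q, j)) - frag_of ((k - 1) * ?q + 1, ?q)"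
  unfolding h_poly_Suc[OF Suc.hyps]
  using W F(2)[OF b(1,2), of 1] F(2)[OF b(5,6), of ?q] \<psi>_f_shift_sum[OF b(3,4) less_imp_le[OF qb(3)]] n2
  by (simp only: \<psi>_diff zp_diff zp_mult zp_sum varW_zp l h F(1) b)
 also have "... = frag_of ((k + 1) * ?q + 1, 0)"
  unfolding product_decomposition[OF qb(4,5) refl Suc.hyps k1] by simp
 finally show ?case by simp
qed

lemma \<psi>_g_poly:
 assumes i: "i \<le> m" shows "g_poly n p f i \<in> zp m" "\<psi> (g_poly n p f i) = 0"
proof -
 have "g_poly n p f i \<in> zp m \<and> \<psi> (g_poly n p f i) = 0"
 proof -
  consider "i = 0" | "i = 1" | l where "i = Suc l" "l \<in> {1..m - 1}" using i by (cases i; cases "i - 1") auto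
  then show ?thesis
  proof cases
   case 1 then show ?thesis using \<psi>_diff[OF varY_zp zp_one] \<psi>_Y_power[of n] by (simp add: \<psi>_one zp_diff varY_zp zp_one)
  next
   case 2
   have a: "a_poly p \<in> zp m" "\<psi> (a_poly p) = frag_of (p, 0)" using a_poly_bounds[of p] \<psi>_a_poly[of p] p_ge2 by simp_all
   have pd: "p \<le> d" unfolding d using m p_ge2 self_le_power[of p m] by simp
   have n2: "1 mod n = 1" using d_ge2 dn by simp
   have eq: "g_poly n p f 1 = varZ * a_poly p - varY ^ 1 * a_poly p - a_poly p" by (simp add: left_diff_distrib)
   have "\<psi> (varZ * a_poly p) = frag_of (p, 0) + frag_of (p, 1)"
    using \<psi>_mult[OF varZ_zp a(1)] a(2) \<psi>_Z product_two_last by (simp add: gmult_frag_of)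
   moreover have "\<psi> (varY ^ 1 * a_poly p) = frag_of (p, 1)"
    using \<psi>_Y_mult[OF a, of 1] p_ge2 pd n2 by simp
   ultimately have "\<psi> (g_poly n p f 1) = 0"
    unfolding eq using a by (simp only: \<psi>_diff zp_diff zp_mult varZ_zp varY_zp) simp
   then show ?thesis using g_poly_bounds[OF fam adm, of 1] m 2 by simp
  next
   case (3 l)
   let ?q = "p ^ l"
   note qb = q_bounds[OF 3(2)]
   obtain t where t: "p = Suc (Suc t)" using p_ge2 by (metis Suc_le_D numeral_2_eq_2 Suc_le_mono)
   have b: "1 \<le> p * ?q" "1 \<le> (p - 1) * ?q" "(p - 1) * ?q \<le> d" "1 \<le> (p - 2) * ?q + 1" "(p - 2) * ?q + 1 \<le> d"
    using qb(1,2) unfolding t by simp_all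
   have p1: "1 \<le> p - 1" "p - 1 < p" using p_ge2 by simp_all
   have h: "h_poly p f l (p - 1) \<in> zp m" using h_poly_bounds[OF fam adm 3(2) p1] by simp
   note F = \<psi>_f_shift[OF fam adm]
   have n2: "0 mod n = 0" "1 mod n = 1" "?q mod n = ?q" using d_ge2 dn qb(3) by simp_all
   have W: "\<psi> (varW l * h_poly p f l (p - 1)) = tprod (?q + 1, 0) ((p - 1) * ?q + 1, 0)"
    using \<psi>_mult[OF varW_zp[OF 3(2)] h] \<psi>_h_poly[OF 3(2) p1] \<psi>_W[OF 3(2)] by (simp add: gmult_frag_of)
   have "\<psi> (g_poly n p f (Suc l)) = tprod (?q + 1, 0) ((p - 1) * ?q + 1, 0) - frag_of (p * ?q, 0) - frag_of (p * ?q, 1)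
     - (\<Sum>j = 2..?q - 1. frag_of ((p - 1) * ?q, j)) - frag_of ((p - 2) * ?q + 1, ?q)"
    unfolding g_poly_Suc[OF qb(4)]
    using W F(2)[OF b(1) qb(2), of 0] F(2)[OF b(1) qb(2), of 1] F(2)[OF b(4,5), of ?q]
     \<psi>_f_shift_sum[OF b(2,3) less_imp_le[OF qb(3)]] n2
    by (simp only: \<psi>_diff zp_diff zp_mult zp_sum varW_zp 3(2) h F(1) b qb(2))
   also have "... = 0" unfolding product_decomposition_last[OF qb(4,5) refl] by simp
   finally show ?thesis using g_poly_bounds[OF fam adm, of i] i 3 by simp
  qed
 qed
 then show "g_poly n p f i \<in> zp m" "\<psi> (g_poly n p f i) = 0" by simp_all
qed

lemma lookup_\<psi>_reduced:
 assumes "keys Q \<subseteq> reduced n p m"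
 shows "Q \<in> zp m \<and> lookup (\<psi> Q) b = (\<Sum>\<mu>\<in>reduced n p m. lookup Q \<mu> * lookup (\<psi> (frag_of \<mu>)) b)"
 using assms
proof (induction Q rule: frag_induction)
 case zero show ?case by (simp add: zp_zero \<psi>_zero)
next
 case (one \<nu>)
 have "(\<Sum>\<mu>\<in>reduced n p m. lookup (frag_of \<nu>) \<mu> * lookup (\<psi> (frag_of \<mu>)) b)
  = (\<Sum>\<mu>\<in>reduced n p m. if \<mu> = \<nu> then lookup (\<psi> (frag_of \<nu>)) b else 0)"
  by (intro sum.cong) (auto simp: lookup_single)
 then show ?case using one reduced_card(1)[of n p m] by (auto simp: reduced_def intro!: frag_of_in_zp)
next
 case (diff P Q)
 then show ?case by (simp add: zp_diff \<psi>_diff lookup_minus left_diff_distrib sum_subtractf)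
qed

text \<open>An element of the kernel is congruent to a combination of reduced monomials that is in the kernel too.
The images of the reduced monomials span the coordinate vectors, and there are at most as many of them
as there are indecomposable modules; so the combination is trivial.\<close>

lemma kernel_eq:
 assumes K: "ideal {P \<in> zp m. \<psi> P = 0} (zpoly_ring m)"
 shows "rep_ideal n p m f = {P \<in> zp m. \<psi> P = 0}"
proof
 interpret cring "zpoly_ring m" by (rule cring_zpoly_ring)
 let ?I = "rep_ideal n p m f" and ?K = "{P \<in> zp m. \<psi> P = 0}"
 have gens: "g_poly n p f ` {0..m} \<subseteq> zp m" using \<psi>_g_poly(1) by auto
 have I: "ideal ?I (zpoly_ring m)" unfolding rep_ideal_def by (rule genideal_ideal[OF gens])
 show sub: "?I \<subseteq> ?K"
  unfolding rep_ideal_def by (rule genideal_minimal[OF K]) (use \<psi>_g_poly in auto)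
 have I0: "0 \<in> ?I"
  using additive_subgroup.zero_closed[OF ideal.axioms(1)[OF I]] by (simp add: zpoly_ring_sel(4))
 have I_add: "a + b \<in> ?I" if "a \<in> ?I" "b \<in> ?I" for a b
  using additive_subgroup.a_closed[OF ideal.axioms(1)[OF I], of a b] that by (simp add: zpoly_ring_sel(5))
 have I_mult: "P * a \<in> ?I" if "P \<in> zp m" "a \<in> ?I" for P a
  using ideal.I_l_closed[OF I that(2,1)] by (simp add: zpoly_ring_sel(2))
 have "- 1 \<in> zp m" using zp_diff[OF zp_zero zp_one] by simp
 then have I_diff: "a - b \<in> ?I" if "a \<in> ?I" "b \<in> ?I" for a b using I_add[OF that(1) I_mult[of "-1" b]] that by simp
 have I_g: "g_poly n p f i \<in> ?I" if "i \<le> m" for i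
  using genideal_self[OF gens] that unfolding rep_ideal_def by auto
 have red: "\<exists>Q. keys Q \<subseteq> reduced n p m \<and> P - Q \<in> ?I" if "P \<in> zp m" for P
 proof (rule reduction[OF _ n_pos, of p m "g_poly n p f"])
  show "0 < p" using p_ge2 by simp
 qed (use g_poly_bounds[OF fam adm] I0 I_add I_diff I_mult I_g that in simp_all)
 have red': "\<exists>Q. keys Q \<subseteq> reduced n p m \<and> P - Q \<in> ?I \<and> \<psi> Q = \<psi> P" if P: "P \<in> zp m" for P
 proof -
  obtain Q where Q: "keys Q \<subseteq> reduced n p m" "P - Q \<in> ?I" using red[OF P] by blast
  have "\<psi> (P - Q) = 0" using sub Q(2) by blast
  then have "\<psi> Q = \<psi> P" using \<psi>_diff[OF P, of Q] lookup_\<psi>_reduced[OF Q(1)] by simp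
  then show ?thesis using Q by blast
 qed
 show "?K \<subseteq> ?I"
 proof
  fix P assume P: "P \<in> ?K"
  then have "P \<in> zp m" by simp
  from red'[OF this] obtain Q where Q: "keys Q \<subseteq> reduced n p m" "P - Q \<in> ?I" "\<psi> Q = \<psi> P" by blast
  have Bl: "finite Bl" "card Bl = d * n" by (simp_all add: blocks_def card_cartesian_product)
  have "lookup Q \<mu> = 0" if \<mu>: "\<mu> \<in> reduced n p m" for \<mu>
  proof (rule spanning_family_independent[of "reduced n p m" Bl "%\<mu>. lookup (\<psi> (frag_of \<mu>))"])
   show "card (reduced n p m) \<le> card Bl" using reduced_card(2)[of n p m] Bl(2) by (simp add: d mult.commute)
   fix b assume b: "b \<in> Bl"
   show "(\<Sum>a\<in>reduced n p m. lookup Q a * lookup (\<psi> (frag_of a)) b) = 0"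
    using lookup_\<psi>_reduced[OF Q(1), of b] Q(3) P by simp
   obtain P' where P': "P' \<in> zp m" "\<psi> P' = frag_of b" using \<psi>_surjective[OF fam adm, of "frag_of b"] b by auto
   from red'[OF P'(1)] obtain Q' where Q': "keys Q' \<subseteq> reduced n p m" "\<psi> Q' = frag_of b" using P'(2) by auto
   have "(\<Sum>a\<in>reduced n p m. lookup Q' a * lookup (\<psi> (frag_of a)) b') = of_bool (b = b')" for b'
    using lookup_\<psi>_reduced[OF Q'(1), of b'] Q'(2) by (auto simp: lookup_single when_def split: if_splits)
   then show "\<exists>e. \<forall>b'\<in>Bl. (\<Sum>a\<in>reduced n p m. e a * lookup (\<psi> (frag_of a)) b') = of_bool (b = b')" by blast
  qed (use reduced_card(1) Bl \<mu> in simp_all)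
  then have "Q = 0" using Q(1) by (intro poly_mapping_eqI) (auto simp: in_keys_iff)
  then show "P \<in> ?I" using Q(2) by simp
 qed
qed

end

end

section \<open>The epimorphism\<close>

context green_ring
begin

lemma \<Gamma>_zero: "\<Gamma> \<zero>\<^bsub>RR\<^esub> = 0"
proof -
 interpret cring RR by (rule cring_RR)
 show ?thesis using \<Gamma>_add[of "\<zero>\<^bsub>RR\<^esub>" "\<zero>\<^bsub>RR\<^esub>"] by simp
qed

lemma \<Gamma>_surjective: assumes "keys g \<subseteq> Bl" shows "\<exists>X\<in>carrier RR. \<Gamma> X = g"
 using assms
proof (induction g rule: frag_induction)
 case zero
 interpret cring RR by (rule cring_RR)
 show ?case using \<Gamma>_zero by (intro bexI[of _ "\<zero>\<^bsub>RR\<^esub>"]) simp_all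
next
 case (one x)
 then have x: "(fst x, snd x) \<in> Bl" by simp
 have fg: "fin_gen_module H (indec_module n d (fst x) (snd x))" by (rule fin_gen_indec) (use x[unfolded Bl_iff] in simp_all)
 show ?case using rep_class[OF fg] gvec_indec[OF x] by (intro bexI[of _ "rep_class n d (indec_module n d (fst x) (snd x))"]) simp_all
next
 case (diff a b)
 interpret cring RR by (rule cring_RR)
 from diff obtain X Y where XY: "X \<in> carrier RR" "\<Gamma> X = a" "Y \<in> carrier RR" "\<Gamma> Y = b" by blast
 have "(X \<ominus>\<^bsub>RR\<^esub> Y) \<oplus>\<^bsub>RR\<^esub> Y = X" using XY(1,3) by (simp add: minus_eq a_assoc l_neg)
 then have "\<Gamma> (X \<ominus>\<^bsub>RR\<^esub> Y) = a - b" using \<Gamma>_add[of "X \<ominus>\<^bsub>RR\<^esub> Y" Y] XY by simp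
 then show ?case using XY by (intro bexI[of _ "X \<ominus>\<^bsub>RR\<^esub> Y"]) simp_all
qed

lemma epimorphism_evaluation:
 assumes "rep_epimorphism n p m (\<phi> :: zpoly => ('k umodule set \<Rightarrow>\<^sub>0 int) set)"
 shows "rep_evaluation TYPE('k) n p m d (%P. \<Gamma> (\<phi> P))"
proof -
 have h: "ring_hom_ring (zpoly_ring m) RR \<phi>"
  and v: "\<phi> 1 = rep_class n d (indec_module n d 1 0)" "\<phi> varY = rep_class n d (indec_module n d 1 1)"
   "\<phi> varZ = rep_class n d (indec_module n d 2 0)"
   "\<And>l. l \<in> {1..m - 1} ==> \<phi> (varW l) = rep_class n d (indec_module n d (p ^ l + 1) 0)"
  using assms by (auto simp: rep_epimorphism_def Let_def d)
 interpret h: ring_hom_ring "zpoly_ring m" RR \<phi> by (rule h)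
 have ind: "\<Gamma> (rep_class n d (indec_module n d i j)) = frag_of (i, j)" if "(i, j) \<in> Bl" for i j
  using rep_class(2)[OF fin_gen_indec[of i j]] gvec_indec[OF that] that by (simp add: Bl_iff)
 have pl: "(p ^ l + 1, 0) \<in> Bl" if "l \<in> {1..m - 1}" for l
 proof -
  have "2 * p ^ l \<le> p * p ^ l" using p_ge2 by (rule mult_right_mono) simp
  then have "p ^ l + 1 \<le> d" using q_bounds(1,2)[OF that] by linarith
  then show ?thesis using n_pos by (simp add: Bl_iff)
 qed
 have "1 < n" using d_ge2 dn by simp
 show ?thesis
 proof
  fix P Q assume PQ: "P \<in> zp m" "Q \<in> zp m"
  show "\<Gamma> (\<phi> (P + Q)) = \<Gamma> (\<phi> P) + \<Gamma> (\<phi> Q)"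
   using h.hom_add[OF PQ] \<Gamma>_add[OF h.hom_closed[OF PQ(1)] h.hom_closed[OF PQ(2)]] by (simp add: zpoly_ring_sel(5))
  show "\<Gamma> (\<phi> (P * Q)) = \<Gamma> (\<phi> P) \<star> \<Gamma> (\<phi> Q)"
   using h.hom_mult[OF PQ] \<Gamma>_mult[OF h.hom_closed[OF PQ(1)] h.hom_closed[OF PQ(2)]] by (simp add: zpoly_ring_sel(2))
 qed (use v ind pl d_ge2 n_pos \<open>1 < n\<close> in \<open>simp_all add: Bl_iff\<close>)
qed

text \<open>A monomial is sent to the product of the prescribed values, computed in the representation ring.
Expanding linearly in coordinates avoids integer multiples in that ring; the result is lifted along
the bijection \<open>\<Gamma>\<close>.\<close>

lemma epimorphism_exists:
 assumes adm: "admissible_choice TYPE('k) p m w"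
 shows "\<exists>\<phi> :: zpoly => ('k umodule set \<Rightarrow>\<^sub>0 int) set. rep_epimorphism n p m \<phi>"
proof -
 interpret R: cring RR by (rule cring_RR)
 define ix where "ix i = (if i = 0 then (1, 1) else (p ^ (i - 1) + 1, 0 :: nat))" for i :: nat
 have n2: "1 < n" using d_ge2 dn by simp
 have ixBl: "ix i \<in> Bl" if "i \<le> m" for i
 proof (cases "i = 0")
  case False
  have "p ^ (i - 1) < p ^ m" using that False p_ge2 by (intro power_strict_increasing) auto
  then show ?thesis using False n_pos unfolding ix_def d by (simp add: blocks_def d)
 qed (use n2 d_ge2 in \<open>simp add: ix_def blocks_def\<close>)
 define X :: "nat => ('k umodule set \<Rightarrow>\<^sub>0 int) set" where "X i = rep_class n d (indec_module n d (fst (ix i)) (snd (ix i)))" for i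
 have X: "X i \<in> carrier RR" "\<Gamma> (X i) = frag_of (ix i)" if "i \<le> m" for i
 proof -
  have b: "(fst (ix i), snd (ix i)) \<in> Bl" using ixBl[OF that] by simp
  have fg: "fin_gen_module H (indec_module n d (fst (ix i)) (snd (ix i)))" by (rule fin_gen_indec) (use b[unfolded Bl_iff] in simp_all)
  show "X i \<in> carrier RR" "\<Gamma> (X i) = frag_of (ix i)" using rep_class[OF fg] gvec_indec[OF b] by (simp_all add: X_def)
 qed
 define mon where "mon \<mu> = finprod RR (%i. X i [^]\<^bsub>RR\<^esub> lookup \<mu> i) {..m}" for \<mu> :: "nat \<Rightarrow>\<^sub>0 nat"
 have mon_closed: "mon \<mu> \<in> carrier RR" for \<mu> unfolding mon_def using X by (intro R.finprod_closed) auto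
 have mon_add: "mon (\<mu> + \<nu>) = mon \<mu> \<otimes>\<^bsub>RR\<^esub> mon \<nu>" for \<mu> \<nu>
 proof -
  have "mon (\<mu> + \<nu>) = finprod RR (%i. X i [^]\<^bsub>RR\<^esub> lookup \<mu> i \<otimes>\<^bsub>RR\<^esub> X i [^]\<^bsub>RR\<^esub> lookup \<nu> i) {..m}"
   unfolding mon_def by (rule R.finprod_cong') (use X in \<open>auto simp: lookup_add R.nat_pow_mult\<close>)
  then show ?thesis unfolding mon_def using X by (subst (asm) R.finprod_multf) auto
 qed
 have mon_zero: "mon 0 = \<one>\<^bsub>RR\<^esub>" unfolding mon_def by (rule R.finprod_one_eqI) simp
 have mon_single: "mon (Poly_Mapping.single i 1) = X i" if i: "i \<le> m" for i
 proof -
  have "mon (Poly_Mapping.single i 1) = finprod RR (%j. if i = j then X j else \<one>\<^bsub>RR\<^esub>) {..m}"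
   unfolding mon_def by (rule R.finprod_cong') (use X in \<open>auto simp: lookup_single\<close>)
  also have "... = X i" using i X by (intro R.finprod_singleton) auto
  finally show ?thesis .
 qed
 define \<psi> where "\<psi> = frag_extend (%\<mu>. \<Gamma> (mon \<mu>))"
 have \<psi>_of: "\<psi> (frag_of \<mu>) = \<Gamma> (mon \<mu>)" for \<mu> by (simp add: \<psi>_def)
 have \<psi>_diff: "\<psi> (a - b) = \<psi> a - \<psi> b" and \<psi>_add: "\<psi> (a + b) = \<psi> a + \<psi> b" for a b
  by (simp_all add: \<psi>_def frag_extend_diff frag_extend_add)
 have \<psi>_0: "\<psi> 0 = 0" by (simp add: \<psi>_def)
 have \<psi>_mult: "\<psi> (P * Q) = \<psi> P \<star> \<psi> Q" for P Q
  using subset_UNIV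
 proof (induction P rule: frag_induction)
  case (one \<mu>)
  show ?case using subset_UNIV
  proof (induction Q rule: frag_induction)
   case (one \<nu>) show ?case by (simp add: mult_single \<psi>_of mon_add \<Gamma>_mult mon_closed)
  qed (simp_all add: \<psi>_0 \<psi>_diff right_diff_distrib gmult_diff_right)
 qed (simp_all add: \<psi>_0 \<psi>_diff left_diff_distrib gmult_diff_left)
 have \<psi>_keys: "keys (\<psi> P) \<subseteq> Bl" for P
  using subset_UNIV
 proof (induction P rule: frag_induction)
  case (one \<mu>) show ?case unfolding \<psi>_of by (rule keys_\<Gamma>[OF mon_closed])
 next
  case (diff a b) then show ?case using keys_diff[of "\<psi> a" "\<psi> b"] by (auto simp: \<psi>_diff)
 qed (simp add: \<psi>_0)
 have \<psi>_one: "\<psi> 1 = frag_of (1, 0)" using \<psi>_of[of 0] by (simp add: mon_zero \<Gamma>_one)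
 have \<psi>_indet: "\<psi> (indet i) = frag_of (ix i)" if "i \<le> m" for i
  using \<psi>_of[of "Poly_Mapping.single i 1"] mon_single[OF that] X(2)[OF that] by (simp add: indet_def)
 have vars: "\<psi> varY = frag_of (1, 1)" "\<psi> varZ = frag_of (2, 0)" "\<And>l. l \<in> {1..m - 1} ==> \<psi> (varW l) = frag_of (p ^ l + 1, 0)"
  using \<psi>_indet m by (auto simp: varY_def varZ_def varW_def ix_def numeral_2_eq_2)
 interpret E: rep_evaluation n p m d ty \<psi>
  by unfold_locales (simp_all only: \<psi>_add \<psi>_mult \<psi>_one vars)
 define \<phi> where "\<phi> P = inv_into (carrier RR) \<Gamma> (\<psi> P)" for P
 have img: "\<psi> P \<in> \<Gamma> ` carrier RR" for P
 proof -
  from \<Gamma>_surjective[OF \<psi>_keys[of P]] obtain Y where Y: "Y \<in> carrier RR" "\<Gamma> Y = \<psi> P" by (elim bexE)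
  show ?thesis using imageI[OF Y(1), of \<Gamma>] unfolding Y(2) .
 qed
 have \<phi>: "\<phi> P \<in> carrier RR" "\<Gamma> (\<phi> P) = \<psi> P" for P
  unfolding \<phi>_def using inv_into_into[OF img] f_inv_into_f[OF img] by simp_all
 have eq: "\<phi> P = Y" if "Y \<in> carrier RR" "\<Gamma> Y = \<psi> P" for P Y
  using \<Gamma>_inj[OF \<phi>(1) that(1)] \<phi>(2) that(2) by simp
 have hom: "ring_hom_ring (zpoly_ring m) RR \<phi>"
 proof (rule ring_hom_ringI2[OF cring.axioms(1)[OF cring_zpoly_ring] ring_RR], rule ring_hom_memI)
  fix P Q
  show "\<phi> (P \<otimes>\<^bsub>zpoly_ring m\<^esub> Q) = \<phi> P \<otimes>\<^bsub>RR\<^esub> \<phi> Q"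
   by (rule eq) (simp_all add: \<phi> \<Gamma>_mult \<psi>_mult zpoly_ring_sel(2))
  show "\<phi> (P \<oplus>\<^bsub>zpoly_ring m\<^esub> Q) = \<phi> P \<oplus>\<^bsub>RR\<^esub> \<phi> Q"
   by (rule eq) (simp_all add: \<phi> \<Gamma>_add \<psi>_add zpoly_ring_sel(5))
  show "\<phi> \<one>\<^bsub>zpoly_ring m\<^esub> = \<one>\<^bsub>RR\<^esub>"
   by (rule eq) (simp_all add: \<Gamma>_one \<psi>_one zpoly_ring_sel(3))
 qed (rule \<phi>(1))
 obtain f where f: "f_family TYPE('k) n p m w f" using f_family_exists[OF adm] by blast
 have "\<phi> ` zp m = carrier RR"
 proof
  show "carrier RR \<subseteq> \<phi> ` zp m"
  proof
   fix Y assume Y: "Y \<in> carrier RR"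
   from E.\<psi>_surjective[OF f adm keys_\<Gamma>[OF Y]] obtain P where "P \<in> zp m" "\<psi> P = \<Gamma> Y" by blast
   then have "\<phi> P = Y" "\<phi> P \<in> \<phi> ` zp m" using eq[OF Y, of P] imageI[of P "zp m" \<phi>] by simp_all
   then show "Y \<in> \<phi> ` zp m" by simp
  qed
 qed (use \<phi>(1) in blast)
 moreover have val: "\<phi> P = rep_class n d (indec_module n d i j)" if "(i, j) \<in> Bl" "\<psi> P = frag_of (i, j)" for P i j
 proof (rule eq)
  have fg: "fin_gen_module H (indec_module n d i j)" using that(1) by (intro fin_gen_indec) (simp_all add: Bl_iff)
  show "rep_class n d (indec_module n d i j) \<in> carrier RR" "\<Gamma> (rep_class n d (indec_module n d i j)) = \<psi> P"
   using rep_class[OF fg] gvec_indec[OF that(1)] that(2) by simp_all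
 qed
 moreover have "(p ^ l + 1, 0) \<in> Bl" if "l \<in> {1..m - 1}" for l
  using ixBl[of "l + 1"] that m by (auto simp: ix_def)
 ultimately have "rep_epimorphism n p m \<phi>"
  using hom vars \<psi>_one d_ge2 n2 n_pos unfolding rep_epimorphism_def Let_def d[symmetric]
  by (intro conjI ballI val) (simp_all add: Bl_iff)
 then show ?thesis by blast
qed

lemma induced_isomorphism:
 assumes adm: "admissible_choice TYPE('k) p m w" and fam: "f_family TYPE('k) n p m w f"
  and epi: "rep_epimorphism n p m (\<phi> :: zpoly => ('k umodule set \<Rightarrow>\<^sub>0 int) set)"
 shows "(%X. the_elem (\<phi> ` X)) \<in> ring_iso (zpoly_ring m Quot rep_ideal n p m f) RR"
proof -
 have h: "ring_hom_ring (zpoly_ring m) RR \<phi>" and surj: "\<phi> ` zp m = carrier RR"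
  using epi by (auto simp: rep_epimorphism_def Let_def d)
 interpret h: ring_hom_ring "zpoly_ring m" RR \<phi> by (rule h)
 interpret E: rep_evaluation n p m d ty "%P. \<Gamma> (\<phi> P)" by (rule epimorphism_evaluation[OF epi])
 have z: "\<phi> P = \<zero>\<^bsub>RR\<^esub> \<longleftrightarrow> \<Gamma> (\<phi> P) = 0" if "P \<in> zp m" for P
  using \<Gamma>_inj[OF h.hom_closed[OF that], of "\<zero>\<^bsub>RR\<^esub>"] \<Gamma>_zero by auto
 have K: "a_kernel (zpoly_ring m) RR \<phi> = {P \<in> zp m. \<Gamma> (\<phi> P) = 0}"
  unfolding a_kernel_def' by (intro Collect_cong conj_cong refl z)
 have "rep_ideal n p m f = a_kernel (zpoly_ring m) RR \<phi>"
  unfolding K by (rule E.kernel_eq[OF fam adm]) (use h.kernel_is_ideal K in simp)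
 then show ?thesis using h.FactRing_iso_set[OF surj] by simp
qed

end

theorem theorem7p6:
 fixes p m n d :: nat
  and w :: "nat \<Rightarrow> nat"
 assumes "prime p"
  and "CHAR('k::alg_closed_field) = p"
  and "m \<ge> 1"
  and "d = p ^ m"
  and "n \<ge> d"
  and "admissible_choice TYPE('k) p m w"
 shows "(\<exists>f. f_family TYPE('k) n p m w f) \<and>
  (\<exists>\<phi> :: zpoly \<Rightarrow> ('k umodule set \<Rightarrow>\<^sub>0 int) set. rep_epimorphism n p m \<phi>) \<and>
  (\<forall>f (\<phi> :: zpoly \<Rightarrow> ('k umodule set \<Rightarrow>\<^sub>0 int) set).
    f_family TYPE('k) n p m w f \<longrightarrow> rep_epimorphism n p m \<phi> \<longrightarrow>
     (\<lambda>X. the_elem (\<phi> ` X))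
      \<in> ring_iso (zpoly_ring m Quot rep_ideal n p m f) (rep_ring n d))"
proof -
 interpret green_ring n p m d "TYPE('k)"
  by unfold_locales (use assms in auto)
 show ?thesis
  using f_family_exists[OF assms(6)] epimorphism_exists[OF assms(6)] induced_isomorphism[OF assms(6)] by blast
qed

end
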